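(* Let $\gamma\in(1,5/3]$. Let $L_1,L_2,U_1,U_2,k_1,k_2,\alpha,\delta_1,\delta_2$ be positive constants with $\delta_1\le\delta_2$, and let $\bar a\in C^1_b(\mathbf R_+)\cap L^1(\mathbf R_+)$. Then there is $M_0>0$ such that the following holds for every $M\ge M_0$. Let $A\in C^2(\mathbf R_+)$, $A>0$, and put $a=A'/A$. Assume: (1) $a\in C^1_b(\mathbf R_+)$ with $(a(x))^2\le k_1(1+Mx)^{-2-\alpha}$ and $|a'(x)|\le k_2(1+Mx)^{-2-\alpha}$ for all $x\ge0$; $|a(x)|<l\,\bar a(x)$ for all $x\ge 0$; and $$L_1\ge U_1e^{2\int_0^\infty\bar a(x)dx},\quad L_2\ge U_2e^{2\int_0^\infty\bar a(x)dx},\quad U_1>L_2,\quad \frac{L_1}{U_2e^{2\int_0^\infty\bar a(x)dx}}\le\sigma_2 .$$ (2) $(z_0,w_0)\in C^1(\mathbf R_+)$ satisfies $(z_0(x),w_0(x))\in\Delta_{l,x}$ for all $x\ge0$, and for all $x\ge0$ $$-\delta_1(1+Mx)^{-1-\alpha}\le\Phi(x,0;z_0,w_0)\le\delta_2,\qquad -\delta_1(1+Mx)^{-1-\alpha}\le\Psi(x,0;z_0,w_0)\le\delta_2 .$$ Then the problem (P3) has a time global classical solution, i.e. a solution $(z,w)\in C^1(\mathbf R_+\times[0,\infty))$.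
   Context: Notation: $\mathbf R_+=[0,\infty)$; $C^1_b$ denotes $C^1$ functions that are bounded together with their first derivative. $\gamma\in(1,5/3]$, $\theta=(\gamma-1)/2$, $\beta=\frac{\gamma-3}{2(\gamma-1)}$ (so $\beta=-1$ iff $\gamma=5/3$). The problem comes from the isentropic nozzle flow equations $\rho_t+m_x=-a(x)m$, $m_t+(m^2/\rho+p(\rho))_x=-a(x)m^2/\rho$, $p(\rho)=\rho^\gamma/\gamma$, $v=m/\rho$, via the Riemann invariants $w=v+\rho^\theta/\theta$, $z=v-\rho^\theta/\theta$, so that $v=(w+z)/2$ and $\rho=(\theta(w-z)/2)^{1/\theta}$. The characteristic speeds are $\lambda_1=v-\rho^\theta=\frac{\gamma+1}{4}z+\frac{3-\gamma}{4}w$ and $\lambda_2=v+\rho^\theta=\frac{3-\gamma}{4}z+\frac{\gamma+1}{4}w$. Problem (P3): on $x\ge0$, $t\ge0$, $$z_t+\lambda_1z_x=\tfrac{\gamma-1}{8}a(x)(w^2-z^2),\qquad w_t+\lambda_2w_x=-\tfrac{\gamma-1}{8}a(x)(w^2-z^2),$$ with initial data $(z,w)|_{t=0}=(z_0,w_0)$ (the Riemann invariants of the initial density and momentum $(\rho_0,m_0)$) and no boundary condition at $x=0$. Constants $l,\sigma_2$: let $f(r)=\frac{2}{\gamma-1}\,\frac{\gamma+1+(3-\gamma)r}{|r^2-1|}$ (with $f(\pm1)=+\infty$). $l>0$ is the minimum of $f$ on $[-1,1]$; $\sigma_2>1$ is the solution of $f(r)=l$ in $r>1$. Region: $$\Delta_{l,x}=\Big\{(z,w):-L_1e^{-\int_0^x\bar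 a(y)dy}\le z\le-U_1e^{\int_0^x\bar a(y)dy},\ -L_2e^{-\int_0^x\bar a(y)dy}\le w\le-U_2e^{\int_0^x\bar a(y)dy},\ w\ge z\Big\}.$$ (The subscript $l$ in $\Delta_{l,x}$ is only a label and is unrelated to the constant $l$.) Functionals: if $\beta\ne-1$, $$\Phi(x,t;z,w)=(w-z)^\beta z_x+\frac{a(x)z}{2\beta}(w-z)^\beta+\frac{a(x)}{2(\beta+1)}(w-z)^{\beta+1},$$ $$\Psi(x,t;z,w)=(w-z)^\beta w_x+\frac{a(x)w}{2\beta}(w-z)^\beta-\frac{a(x)}{2(\beta+1)}(w-z)^{\beta+1};$$ if $\beta=-1$, $$\Phi(x,t;z,w)=\frac{z_x}{w-z}-\frac{a(x)z}{2(w-z)}+\frac{a(x)}2\log(w-z),\qquad \Psi(x,t;z,w)=\frac{w_x}{w-z}-\frac{a(x)w}{2(w-z)}-\frac{a(x)}2\log(w-z).$$ $\Phi(x,0;z_0,w_0)$ and $\Psi(x,0;z_0,w_0)$ are these expressions with $z,w,z_x,w_x$ replaced by $z_0(x),w_0(x),z_0'(x),w_0'(x)$. *)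

theory Defs
  imports "HOL-Analysis.Analysis"
begin

text \<open>Functions on the closed half line \<open>[0,\<infinity>)\<close> are represented by total functions; only their
  values on \<open>{0..}\<close> matter, and derivatives at \<open>0\<close> are one-sided.\<close>

definition hderiv :: "(real \<Rightarrow> real) \<Rightarrow> real \<Rightarrow> real" where
  "hderiv f x = vector_derivative f (at x within {0..})"

definition C1_halfline :: "(real \<Rightarrow> real) \<Rightarrow> bool" where
  "C1_halfline f \<longleftrightarrow> f differentiable_on {0..} \<and> continuous_on {0..} (hderiv f)"

definition C2_halfline :: "(real \<Rightarrow> real) \<Rightarrow> bool" where
  "C2_halfline f \<longleftrightarrow> C1_halfline f \<and> C1_halfline (hderiv f)"

definition C1b_halfline :: "(real \<Rightarrow> real) \<Rightarrow> bool" where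
  "C1b_halfline f \<longleftrightarrow> C1_halfline f \<and> bounded (f ` {0..}) \<and> bounded (hderiv f ` {0..})"

text \<open>\<open>C\<^sup>1\<close> up to the boundary on the closed quadrant of points \<open>(x,t)\<close>.\<close>

definition C1_quadrant :: "(real \<Rightarrow> real \<Rightarrow> real) \<Rightarrow> bool" where
  "C1_quadrant u \<longleftrightarrow> (\<exists>ux ut.
     continuous_on ({0..} \<times> {0..}) (\<lambda>(x, t). ux x t) \<and>
     continuous_on ({0..} \<times> {0..}) (\<lambda>(x, t). ut x t) \<and>
     (\<forall>x\<ge>0. \<forall>t\<ge>0.
        ((\<lambda>(y, s). u y s) has_derivative (\<lambda>(h, k). ux x t * h + ut x t * k))
          (at (x, t) within {0..} \<times> {0..})))"

definition lambda1 :: "real \<Rightarrow> real \<Rightarrow> real \<Rightarrow> real" where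
  "lambda1 \<gamma> z w = (\<gamma> + 1) / 4 * z + (3 - \<gamma>) / 4 * w"

definition lambda2 :: "real \<Rightarrow> real \<Rightarrow> real \<Rightarrow> real" where
  "lambda2 \<gamma> z w = (3 - \<gamma>) / 4 * z + (\<gamma> + 1) / 4 * w"

definition P3_classical_solution ::
  "real \<Rightarrow> (real \<Rightarrow> real) \<Rightarrow> (real \<Rightarrow> real) \<Rightarrow> (real \<Rightarrow> real) \<Rightarrow>
   (real \<Rightarrow> real \<Rightarrow> real) \<Rightarrow> (real \<Rightarrow> real \<Rightarrow> real) \<Rightarrow> bool" where
  "P3_classical_solution \<gamma> a z0 w0 z w \<longleftrightarrow>
     C1_quadrant z \<and> C1_quadrant w \<and>
     (\<forall>x\<ge>0. \<forall>t\<ge>0.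
        hderiv (\<lambda>s. z x s) t + lambda1 \<gamma> (z x t) (w x t) * hderiv (\<lambda>y. z y t) x
          = (\<gamma> - 1) / 8 * a x * ((w x t)\<^sup>2 - (z x t)\<^sup>2) \<and>
        hderiv (\<lambda>s. w x s) t + lambda2 \<gamma> (z x t) (w x t) * hderiv (\<lambda>y. w y t) x
          = - ((\<gamma> - 1) / 8) * a x * ((w x t)\<^sup>2 - (z x t)\<^sup>2)) \<and>
     (\<forall>x\<ge>0. z x 0 = z0 x \<and> w x 0 = w0 x)"

definition nozzle_f :: "real \<Rightarrow> real \<Rightarrow> ereal" where
  "nozzle_f \<gamma> r = (if \<bar>r\<bar> = 1 then \<infinity>
     else ereal (2 / (\<gamma> - 1) * ((\<gamma> + 1 + (3 - \<gamma>) * r) / \<bar>r\<^sup>2 - 1\<bar>)))"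

definition nozzle_l :: "real \<Rightarrow> real" where
  "nozzle_l \<gamma> = (THE m. (\<exists>r\<in>{-1..1}. nozzle_f \<gamma> r = ereal m) \<and>
                        (\<forall>r\<in>{-1..1}. ereal m \<le> nozzle_f \<gamma> r))"

definition nozzle_sigma2 :: "real \<Rightarrow> real" where
  "nozzle_sigma2 \<gamma> = (THE r. r > 1 \<and> nozzle_f \<gamma> r = ereal (nozzle_l \<gamma>))"

text \<open>The two definite descriptions above are well defined, and \<open>nozzle_l \<gamma> > 0\<close>.\<close>

lemma nozzle_l_aux:
  fixes \<gamma> :: real assumes "1 < \<gamma>" "\<gamma> < 3"
  obtains K where "K > (3 - \<gamma>) / 2" "(3 - \<gamma>)\<^sup>2 = 4 * K * (\<gamma> + 1 - K)"
proof
  define s where "s = sqrt (8 * (\<gamma> - 1))"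
  have s: "s * s = 8 * (\<gamma> - 1)" using assms by (simp add: s_def)
  have s0: "s > 0" using assms by (simp add: s_def)
  show "(\<gamma> + 1 + s) / 2 > (3 - \<gamma>) / 2" using assms s0 by simp
  have "4 * ((\<gamma> + 1 + s) / 2) * (\<gamma> + 1 - (\<gamma> + 1 + s) / 2) = (\<gamma> + 1) * (\<gamma> + 1) - s * s"
    by (simp add: field_simps)
  moreover have c: "(\<gamma> + 1) * (\<gamma> + 1) - 8 * (\<gamma> - 1) = (3 - \<gamma>)\<^sup>2"
    by (simp add: power2_eq_square algebra_simps)
  ultimately show "(3 - \<gamma>)\<^sup>2 = 4 * ((\<gamma> + 1 + s) / 2) * (\<gamma> + 1 - (\<gamma> + 1 + s) / 2)"
    unfolding s c by (simp only:)
qed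

lemma nozzle_l_min:
  assumes "1 < \<gamma>" "\<gamma> < 3"
  shows "nozzle_l \<gamma> > (3 - \<gamma>) / (\<gamma> - 1)"
    and "\<exists>r\<in>{-1..1}. nozzle_f \<gamma> r = ereal (nozzle_l \<gamma>)"
    and "\<forall>r\<in>{-1..1}. ereal (nozzle_l \<gamma>) \<le> nozzle_f \<gamma> r"
proof -
  obtain K where K: "K > (3 - \<gamma>) / 2" "(3 - \<gamma>)\<^sup>2 = 4 * K * (\<gamma> + 1 - K)"
    using nozzle_l_aux assms by blast
  have K0: "K > 0" using K(1) assms by simp
  let ?l = "2 / (\<gamma> - 1) * K"
  let ?r = "- (3 - \<gamma>) / (2 * K)"
  let ?P = "\<lambda>m. (\<exists>r\<in>{-1..1}. nozzle_f \<gamma> r = ereal m) \<and> (\<forall>r\<in>{-1..1}. ereal m \<le> nozzle_f \<gamma> r)"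
  have key: "K * (\<gamma> + 1 + (3 - \<gamma>) * r - K * (1 - r\<^sup>2)) = (K * r + (3 - \<gamma>) / 2)\<^sup>2" for r
  proof -
    have 1: "(K * r + (3 - \<gamma>) / 2)\<^sup>2 = K * K * r\<^sup>2 + K * r * (3 - \<gamma>) + (3 - \<gamma>)\<^sup>2 / 4"
      by (simp add: power2_sum power_mult_distrib power_divide) (simp add: power2_eq_square)
    have 2: "(3 - \<gamma>)\<^sup>2 / 4 = K * (\<gamma> + 1 - K)" using K(2) by simp
    show ?thesis unfolding 1 2 by (simp add: algebra_simps)
  qed
  have r: "-1 < ?r" "?r < 1" using K(1) K0 assms by (auto simp: field_simps)
  have r2: "?r\<^sup>2 < 1" using r by (simp add: abs_square_less_1 abs_less_iff)
  have "K * ?r + (3 - \<gamma>) / 2 = 0" using K0 by (simp add: field_simps)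
  then have eq: "\<gamma> + 1 + (3 - \<gamma>) * ?r = K * (1 - ?r\<^sup>2)" using key[of ?r] K0 by (simp del: minus_divide_left)
  have ab: "\<bar>?r\<^sup>2 - 1\<bar> = 1 - ?r\<^sup>2" using r2 by simp
  have "nozzle_f \<gamma> ?r = ereal ?l"
  proof -
    have "\<bar>?r\<bar> \<noteq> 1" "1 - ?r\<^sup>2 \<noteq> 0" using r r2 by linarith+
    then show ?thesis unfolding nozzle_f_def eq ab by (simp only: if_False simp_thms not_False_eq_True nonzero_mult_div_cancel_right)
  qed
  moreover have "ereal ?l \<le> nozzle_f \<gamma> q" if "q \<in> {-1..1}" for q
  proof (cases "\<bar>q\<bar> = 1")
    case False
    then have "\<bar>q\<bar> < 1" using that by auto
    then have q2: "q\<^sup>2 < 1" by (simp add: abs_square_less_1)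
    have "K * (\<gamma> + 1 + (3 - \<gamma>) * q - K * (1 - q\<^sup>2)) \<ge> 0" unfolding key by simp
    then have "K * (1 - q\<^sup>2) \<le> \<gamma> + 1 + (3 - \<gamma>) * q" using K0 by (simp add: zero_le_mult_iff)
    then have "K \<le> (\<gamma> + 1 + (3 - \<gamma>) * q) / \<bar>q\<^sup>2 - 1\<bar>" using q2 by (simp add: pos_le_divide_eq)
    then have "?l \<le> 2 / (\<gamma> - 1) * ((\<gamma> + 1 + (3 - \<gamma>) * q) / \<bar>q\<^sup>2 - 1\<bar>)"
      using assms by (intro mult_left_mono) auto
    then show ?thesis using False by (simp add: nozzle_f_def)
  qed (simp add: nozzle_f_def)
  ultimately have P: "?P ?l" using r by (intro conjI bexI[of _ ?r]) auto
  have l: "nozzle_l \<gamma> = ?l" unfolding nozzle_l_def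
  proof (rule the_equality[where P = ?P])
    fix m assume "?P m" then show "m = ?l" using P by (metis ereal_less_eq(3) order_antisym)
  qed (rule P)
  show "nozzle_l \<gamma> > (3 - \<gamma>) / (\<gamma> - 1)"
    unfolding l using divide_strict_right_mono[of "3 - \<gamma>" "2 * K" "\<gamma> - 1"] K(1) assms by simp
  show "\<exists>r\<in>{-1..1}. nozzle_f \<gamma> r = ereal (nozzle_l \<gamma>)"
    "\<forall>r\<in>{-1..1}. ereal (nozzle_l \<gamma>) \<le> nozzle_f \<gamma> r" using P unfolding l by blast+
qed

lemma nozzle_sigma2_unique:
  assumes "1 < \<gamma>" "\<gamma> < 3"
  shows "\<exists>!r. r > 1 \<and> nozzle_f \<gamma> r = ereal (nozzle_l \<gamma>)"
proof -
  define K where "K = nozzle_l \<gamma> * (\<gamma> - 1) / 2"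
  let ?d = "3 - \<gamma>" let ?c = "\<gamma> + 1"
  have K: "2 * K > ?d" using nozzle_l_min(1)[OF assms] assms by (simp add: K_def field_simps)
  then have K0: "K > 0" using assms by simp
  have f: "nozzle_f \<gamma> r = ereal (nozzle_l \<gamma>) \<longleftrightarrow> ?c + ?d * r = K * (r\<^sup>2 - 1)" if "r > 1" for r
  proof -
    have "r\<^sup>2 > 1" using that by (simp add: one_less_power)
    then have "r\<^sup>2 - 1 > 0" "\<bar>r\<^sup>2 - 1\<bar> = r\<^sup>2 - 1" by auto
    moreover have "\<bar>r\<bar> \<noteq> 1" using that by simp
    ultimately show ?thesis using assms unfolding nozzle_f_def K_def
      by (simp add: divide_eq_eq) (simp add: field_simps)
  qed
  define D where "D = sqrt (?d\<^sup>2 + 4 * K * (?c + K))"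
  have nn: "?d\<^sup>2 + 4 * K * (?c + K) \<ge> 0" using K0 assms by simp
  have D2: "D * D = ?d * ?d + 4 * K * (?c + K)" using nn by (simp add: D_def power2_eq_square)
  have "D > 2 * K" unfolding D_def
  proof (rule real_less_rsqrt)
    have "4 * K * ?c > 0" using K0 assms by simp
    moreover have "?d\<^sup>2 \<ge> 0" by simp
    ultimately show "(2 * K)\<^sup>2 < ?d\<^sup>2 + 4 * K * (?c + K)"
      unfolding power2_eq_square distrib_left by linarith
  qed
  then have r1: "(?d + D) / (2 * K) > 1" using K0 assms by (simp add: field_simps)
  have e: "?c + ?d * ((?d + D) / (2 * K)) = K * (((?d + D) / (2 * K))\<^sup>2 - 1)"
  proof -
    define r where "r = (?d + D) / (2 * K)"
    have "D = 2 * K * r - ?d" using K0 by (simp add: r_def)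
    with D2 have "4 * K * (?c + ?d * r) = 4 * K * (K * (r\<^sup>2 - 1))"
      by (simp add: power2_eq_square algebra_simps)
    then show ?thesis using K0 unfolding r_def[symmetric] by simp
  qed
  show ?thesis
  proof (rule ex1I[of _ "(?d + D) / (2 * K)"])
    show "(?d + D) / (2 * K) > 1 \<and> nozzle_f \<gamma> ((?d + D) / (2 * K)) = ereal (nozzle_l \<gamma>)"
      using r1 e f[OF r1] by blast
    fix s assume "s > 1 \<and> nozzle_f \<gamma> s = ereal (nozzle_l \<gamma>)"
    then have s: "s > 1" "?c + ?d * s = K * (s\<^sup>2 - 1)" using f by auto
    let ?r = "(?d + D) / (2 * K)"
    have "(s - ?r) * (K * (s + ?r) - ?d) = 0"
      using s(2) e by (simp only: power2_eq_square algebra_simps)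
    moreover have "K * (s + ?r) > K * 2" using s(1) r1 K0 by (intro mult_strict_left_mono) linarith+
    ultimately show "s = ?r" using K by simp
  qed
qed

definition Delta_region ::
  "real \<Rightarrow> real \<Rightarrow> real \<Rightarrow> real \<Rightarrow> (real \<Rightarrow> real) \<Rightarrow> real \<Rightarrow> (real \<times> real) set" where
  "Delta_region L1 L2 U1 U2 abar x =
     {(z, w). - L1 * exp (- integral {0..x} abar) \<le> z \<and> z \<le> - U1 * exp (integral {0..x} abar) \<and>
              - L2 * exp (- integral {0..x} abar) \<le> w \<and> w \<le> - U2 * exp (integral {0..x} abar) \<and>
              w \<ge> z}"

definition beta :: "real \<Rightarrow> real" where
  "beta \<gamma> = (\<gamma> - 3) / (2 * (\<gamma> - 1))"

text \<open>The functionals are pointwise expressions: the last four arguments are the values at one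
  point of \<open>a\<close>, \<open>z\<close>, \<open>w\<close> and of \<open>z\<^sub>x\<close> (for \<open>Phi\<close>), respectively \<open>w\<^sub>x\<close> (for \<open>Psi\<close>).\<close>

definition Phi :: "real \<Rightarrow> real \<Rightarrow> real \<Rightarrow> real \<Rightarrow> real \<Rightarrow> real" where
  "Phi \<gamma> a z w zx = (let \<beta> = beta \<gamma> in
     if \<beta> \<noteq> -1 then
       (w - z) powr \<beta> * zx + a * z / (2 * \<beta>) * (w - z) powr \<beta>
         + a / (2 * (\<beta> + 1)) * (w - z) powr (\<beta> + 1)
     else zx / (w - z) - a * z / (2 * (w - z)) + a / 2 * ln (w - z))"

definition Psi :: "real \<Rightarrow> real \<Rightarrow> real \<Rightarrow> real \<Rightarrow> real \<Rightarrow> real" where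
  "Psi \<gamma> a z w wx = (let \<beta> = beta \<gamma> in
     if \<beta> \<noteq> -1 then
       (w - z) powr \<beta> * wx + a * w / (2 * \<beta>) * (w - z) powr \<beta>
         - a / (2 * (\<beta> + 1)) * (w - z) powr (\<beta> + 1)
     else wx / (w - z) - a * w / (2 * (w - z)) - a / 2 * ln (w - z))"

end

theory Submission imports Defs begin

text \<open>All characteristic speeds are negative, so no boundary condition at \<open>x = 0\<close> is needed, and along a
  characteristic \<open>\<bar>a\<bar>\<close> integrates to \<open>O(1/M)\<close>: for large \<open>M\<close> a solution stays in a slight enlargement of
  the box containing the data, where \<open>w - z\<close> and both speeds are bounded away from \<open>0\<close>. Along the
  1-characteristics \<open>Phi\<close> solves a Riccati equation from which \<open>w\<^sub>x\<close> has dropped out. Its quadratic term has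
  the good sign and its forcing is \<open>O((1+Mx) powr (-2-\<alpha>))\<close>, so \<open>-2\<delta>\<^sub>1 (1+Mx) powr (-1-\<alpha>)\<close> is a lower barrier once
  \<open>M\<close> is large; the symmetry \<open>(z,w,a) \<mapsto> (-w,-z,-a)\<close> gives the same for \<open>Psi\<close>. Hence \<open>z\<^sub>x\<close> and \<open>w\<^sub>x\<close> stay bounded.

  Existence is obtained globally at once, in characteristic coordinates \<open>(p,q)\<close>: each point of the quadrant
  lies on the 1-characteristic with label \<open>p\<close> and the 2-characteristic with label \<open>q\<close>. There the system becomes
  a pair of families of ordinary differential equations for \<open>x, z, w\<close>, the derivatives of \<open>x\<close> and multiples of
  \<open>z\<^sub>t, w\<^sub>t\<close>. With the right-hand sides clamped to bounded sets it has a solution on the whole plane by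
  Picard iteration. The a priori bounds show that the clamps are never active where \<open>x \<ge> 0\<close>, and
  \<open>(p,q) \<mapsto> (x,t)\<close> maps that region bijectively onto the quadrant.\<close>

text \<open>The data are only C1, so z_x and w_x are merely continuous and cannot be differentiated
  as functions of (x, t). With \<open>ze\<close> and \<open>om\<close> as unknowns, each is
  differentiable along its own family by construction, and the Riccati equation for
  \<open>Phi\<close> follows from these equations. The price: the derivatives across the families
  (x_p, z_p, w_p, t_p) have to be identified afterwards, by an error estimate that rests on
  continuity.

  The clamped solution is meaningful only where no clamp acts. Since t is itself an unknown function
  of (p, q), this is not shown by continuation in time: one takes a failing point with smallest p -
  q. The triangle between it and the diagonal is its domain of dependence, and the legs are the two
  characteristics on which the estimates are run.

  M enters through one integral: (1 + M x)^(-1-b) has integral 1/(b M) over the half line. This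
  makes three quantities small: the drift of z and w along their characteristics, the growth of the
  functionals, and the forcing compared with the descent of the barrier at a first contact.\<close>

section \<open>Integral equations along two families of lines\<close>

text \<open>The integral from \<open>q\<close> to \<open>p\<close>, with the sign changed if \<open>p < q\<close>.\<close>

definition oint :: "(real \<Rightarrow> 'a::banach) \<Rightarrow> real \<Rightarrow> real \<Rightarrow> 'a" where
  "oint h q p = (p - q) *\<^sub>R integral {0..1} (\<lambda>\<sigma>. h (q + \<sigma> * (p - q)))"

lemma oint_refl [simp]: "oint h q q = 0"
  by (simp add: oint_def)

lemma oint_eq_antiderivative:
  fixes h F :: "real \<Rightarrow> 'a::banach"
  assumes F: "\<And>r. r \<in> closed_segment q p \<Longrightarrow> (F has_vector_derivative h r) (at r within closed_segment q p)"
  shows "oint h q p = F p - F q"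
proof -
  have seg: "q + \<sigma> * (p - q) \<in> closed_segment q p" if "\<sigma> \<in> {0..1}" for \<sigma>
    using that by (auto simp: closed_segment_def algebra_simps intro!: exI[of _ \<sigma>])
  have "((\<lambda>\<sigma>. F (q + \<sigma> * (p - q))) has_vector_derivative (p - q) *\<^sub>R h (q + \<sigma> * (p - q)))
      (at \<sigma> within {0..1})" if "\<sigma> \<in> {0..1}" for \<sigma>
  proof -
    have "((\<lambda>\<sigma>. q + \<sigma> * (p - q)) has_vector_derivative (p - q)) (at \<sigma> within {0..1})"
      by (auto intro!: derivative_eq_intros)
    moreover have "(F has_vector_derivative h (q + \<sigma> * (p - q)))
        (at (q + \<sigma> * (p - q)) within (\<lambda>\<sigma>. q + \<sigma> * (p - q)) ` {0..1})"
      by (rule has_vector_derivative_within_subset[OF F]) (use seg that in auto)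
    ultimately show ?thesis
      using vector_diff_chain_within by (fastforce simp: o_def)
  qed
  then have "((\<lambda>\<sigma>. (p - q) *\<^sub>R h (q + \<sigma> * (p - q))) has_integral (F (q + 1 * (p - q)) - F (q + 0 * (p - q)))) {0..1}"
    by (intro fundamental_theorem_of_calculus) auto
  then have "integral {0..1} (\<lambda>\<sigma>. (p - q) *\<^sub>R h (q + \<sigma> * (p - q))) = F p - F q"
    by (metis (no_types, lifting) add.right_neutral add_diff_cancel_left' diff_add_cancel integral_unique mult_1 mult_zero_left add.commute)
  then show ?thesis by (simp add: oint_def del: integral_mult_right)
qed

lemma antiderivative_interval:
  fixes h :: "real \<Rightarrow> 'a::banach"
  assumes "continuous_on UNIV h"
  obtains F where "\<And>r. r \<in> {a<..<b} \<Longrightarrow> (F has_vector_derivative h r) (at r)"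
proof -
  obtain F where F: "\<And>r. r \<in> {a..b} \<Longrightarrow> (F has_vector_derivative h r) (at r within {a..b})"
    using antiderivative_continuous[of a b h] assms continuous_on_subset by blast
  have "(F has_vector_derivative h r) (at r)" if "r \<in> {a<..<b}" for r
    using F[of r] that by (metis at_within_Icc_at greaterThanLessThan_iff atLeastAtMost_iff less_imp_le)
  then show ?thesis using that by blast
qed

lemma oint_has_vector_derivative:
  fixes h :: "real \<Rightarrow> 'a::banach"
  assumes h: "continuous_on UNIV h"
  shows "((\<lambda>q. oint h q p) has_vector_derivative - h q) (at q)"
    and "((\<lambda>p. oint h q p) has_vector_derivative h p) (at p)"
proof -
  define a b where "a = min p q - 1" and "b = max p q + 1"
  obtain F where F: "\<And>r. r \<in> {a<..<b} \<Longrightarrow> (F has_vector_derivative h r) (at r)"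
    using antiderivative_interval[OF h] by blast
  have eq: "oint h q' p' = F p' - F q'" if "q' \<in> {a<..<b}" "p' \<in> {a<..<b}" for p' q'
  proof (rule oint_eq_antiderivative)
    fix r assume "r \<in> closed_segment q' p'"
    then have "r \<in> {a<..<b}" using that by (auto simp: closed_segment_eq_real_ivl split: if_splits)
    then show "(F has_vector_derivative h r) (at r within closed_segment q' p')"
      using F has_vector_derivative_at_within by blast
  qed
  have pq: "p \<in> {a<..<b}" "q \<in> {a<..<b}" by (auto simp: a_def b_def)
  have "((\<lambda>q. F p - F q) has_vector_derivative - h q) (at q)"
    using F[OF pq(2)] by (auto intro!: derivative_eq_intros)
  then show "((\<lambda>q. oint h q p) has_vector_derivative - h q) (at q)"
    by (rule has_vector_derivative_transform_within_open[of _ _ _ "{a<..<b}"]) (use pq eq in auto)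
  have "((\<lambda>p. F p - F q) has_vector_derivative h p) (at p)"
    using F[OF pq(1)] by (auto intro!: derivative_eq_intros)
  then show "((\<lambda>p. oint h q p) has_vector_derivative h p) (at p)"
    by (rule has_vector_derivative_transform_within_open[of _ _ _ "{a<..<b}"]) (use pq eq in auto)
qed

text \<open>Normalising the integral to \<open>{0..1}\<close> pays off here: integrand and both
  endpoints vary with \<open>y\<close>, yet the domain of integration is fixed, so the theorem on
  integrals with a parameter applies.\<close>

lemma continuous_on_oint:
  fixes h :: "'b::topological_space \<Rightarrow> real \<Rightarrow> 'a::banach"
  assumes h: "continuous_on UNIV (\<lambda>(y, r). h y r)"
    and "continuous_on UNIV f" "continuous_on UNIV g"
  shows "continuous_on UNIV (\<lambda>y. oint (h y) (f y) (g y))"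
proof -
  have "continuous_on (UNIV \<times> cbox 0 1) (\<lambda>(y, \<sigma>). h y (f y + \<sigma> * (g y - f y)))"
    unfolding split_beta
    by (intro continuous_on_compose2[OF h[unfolded split_beta], of _ "\<lambda>z. (fst z, f (fst z) + snd z * (g (fst z) - f (fst z)))", simplified]
        continuous_intros continuous_on_compose2[OF assms(2)] continuous_on_compose2[OF assms(3)]) auto
  then have "continuous_on UNIV (\<lambda>y. integral (cbox 0 1) (\<lambda>\<sigma>. h y (f y + \<sigma> * (g y - f y))))"
    by (rule integral_continuous_on_param)
  then show ?thesis unfolding oint_def
    by (intro continuous_intros assms(2,3)) auto
qed

lemma norm_oint_le:
  fixes h :: "real \<Rightarrow> 'a::banach"
  assumes h: "continuous_on UNIV h" and B: "\<And>r. r \<in> closed_segment q p \<Longrightarrow> norm (h r) \<le> B"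
  shows "norm (oint h q p) \<le> B * \<bar>p - q\<bar>"
proof -
  have "norm (integral {0..1} (\<lambda>\<sigma>. h (q + \<sigma> * (p - q)))) \<le> B * (1 - 0)"
  proof (rule integral_bound)
    show "continuous_on {0..1} (\<lambda>\<sigma>. h (q + \<sigma> * (p - q)))"
      by (rule continuous_on_compose2[OF h]) (auto intro!: continuous_intros)
    fix \<sigma> :: real assume "\<sigma> \<in> {0..1}"
    then have "q + \<sigma> * (p - q) \<in> closed_segment q p"
      by (auto simp: closed_segment_def algebra_simps intro!: exI[of _ \<sigma>])
    then show "norm (h (q + \<sigma> * (p - q))) \<le> B" by (rule B)
  qed auto
  then have "\<bar>p - q\<bar> * norm (integral {0..1} (\<lambda>\<sigma>. h (q + \<sigma> * (p - q)))) \<le> \<bar>p - q\<bar> * B"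
    by (intro mult_left_mono) auto
  then show ?thesis by (simp add: oint_def mult.commute)
qed

lemma oint_diff:
  fixes h :: "real \<Rightarrow> 'a::banach"
  assumes "continuous_on UNIV h" "continuous_on UNIV h'"
  shows "oint (\<lambda>r. h r - h' r) q p = oint h q p - oint h' q p"
proof -
  have "(\<lambda>\<sigma>. k (q + \<sigma> * (p - q))) integrable_on {0..1}" if "continuous_on UNIV k" for k :: "real \<Rightarrow> 'a"
    by (intro integrable_continuous_real continuous_on_compose2[OF that]) (auto intro!: continuous_intros)
  then show ?thesis using assms by (simp add: oint_def integral_diff scaleR_diff_right)
qed

lemma norm_oint_exp_le:
  fixes h :: "real \<Rightarrow> 'a::banach"
  assumes h: "continuous_on UNIV h" and "k > 0" "B \<ge> 0" and e: "e \<in> {q, p}"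
    and B: "\<And>r. norm (h r) \<le> B * exp (k * \<bar>r - e\<bar>)"
  shows "norm (oint h q p) \<le> B * exp (k * \<bar>p - q\<bar>) / k"
proof -
  define d where "d = \<bar>p - q\<bar>"
  have int: "(\<lambda>\<sigma>. h (q + \<sigma> * (p - q))) integrable_on {0..1}"
    by (intro integrable_continuous_real continuous_on_compose2[OF h]) (auto intro!: continuous_intros)
  have mult: "d * norm (integral {0..1} (\<lambda>\<sigma>. h (q + \<sigma> * (p - q)))) \<le> B * (exp (k * d) - 1) / k" (is "d * norm ?I \<le> _")
  proof (cases "d = 0")
    case False
    then have d: "d > 0" by (simp add: d_def)
    \<comment> \<open>The distance from \<open>e\<close> in units of \<open>d\<close>: the parameter
      itself if \<open>e\<close> is the lower limit, its reflection otherwise.\<close>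
    define s :: "real \<Rightarrow> real" where "s = (if e = q then (\<lambda>\<sigma>. \<sigma>) else (\<lambda>\<sigma>. 1 - \<sigma>))"
    have es: "\<bar>q + \<sigma> * (p - q) - e\<bar> = s \<sigma> * d" if "\<sigma> \<in> {0..1}" for \<sigma>
    proof (cases "e = q")
      case True then show ?thesis using that by (simp add: s_def d_def abs_mult)
    next
      case False
      then have "q + \<sigma> * (p - q) - e = - ((1 - \<sigma>) * (p - q))" using e by (simp add: algebra_simps)
      then show ?thesis using that False by (simp only: s_def d_def abs_mult abs_minus_cancel if_False) auto
    qed
    define F where "F \<sigma> = (if e = q then 1 else -1) * (B / (k * d)) * exp (k * (s \<sigma> * d))" for \<sigma>
    have "((\<lambda>\<sigma>. B * exp (k * (s \<sigma> * d))) has_integral F 1 - F 0) {0..1}"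
      unfolding F_def s_def using d \<open>k > 0\<close>
      by (intro fundamental_theorem_of_calculus)
        (auto intro!: derivative_eq_intros simp: has_real_derivative_iff_has_vector_derivative[symmetric] field_simps)
    moreover have "norm (h (q + \<sigma> * (p - q))) \<le> B * exp (k * (s \<sigma> * d))" if "\<sigma> \<in> {0..1}" for \<sigma>
      using B[of "q + \<sigma> * (p - q)"] es[OF that] by simp
    ultimately have "norm ?I \<le> F 1 - F 0"
      using integral_norm_bound_integral[OF int, of "\<lambda>\<sigma>. B * exp (k * (s \<sigma> * d))"]
      by (metis has_integral_iff)
    then have "d * norm ?I \<le> d * (F 1 - F 0)" using d by simp
    also have "\<dots> = B * (exp (k * d) - 1) / k"
      using d \<open>k > 0\<close> by (simp add: F_def s_def field_simps)
    finally show ?thesis .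
  qed simp
  also have "\<dots> \<le> B * exp (k * d) / k"
    using assms(2,3) by (intro divide_right_mono mult_left_mono) auto
  finally show ?thesis by (simp add: oint_def d_def)
qed

lemma picard_two_families:
  fixes u0 :: "real \<Rightarrow> 'u::banach" and v0 :: "real \<Rightarrow> 'v::banach"
    and f :: "'u \<times> 'v \<Rightarrow> 'u" and g :: "'u \<times> 'v \<Rightarrow> 'v"
  assumes f: "L-lipschitz_on UNIV f" and g: "L-lipschitz_on UNIV g"
    and u0: "continuous_on UNIV u0" and v0: "continuous_on UNIV v0"
    and C: "\<And>p q. norm (f (u0 p, v0 q)) \<le> C" "\<And>p q. norm (g (u0 p, v0 q)) \<le> C"
  obtains u v where "continuous_on UNIV (\<lambda>(p, q). u p q)" "continuous_on UNIV (\<lambda>(p, q). v p q)"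
    "\<And>p. u p p = u0 p" "\<And>q. v q q = v0 q"
    "\<And>p q. ((\<lambda>q. u p q) has_vector_derivative f (u p q, v p q)) (at q)"
    "\<And>p q. ((\<lambda>p. v p q) has_vector_derivative g (u p q, v p q)) (at p)"
proof -
  define K where "K = max L 1"
  have K: "K \<ge> 1" "K \<ge> L" by (auto simp: K_def)
  have fK: "norm (f s - f s') \<le> K * norm (s - s')" and gK: "norm (g s - g s') \<le> K * norm (s - s')" for s s'
    using lipschitz_onD[OF f, of s s'] lipschitz_onD[OF g, of s s'] K mult_right_mono[of L K "norm (s - s')"]
    by (auto simp: dist_norm)
  have cf: "continuous_on UNIV f" and cg: "continuous_on UNIV g"
    using f g lipschitz_on_continuous_on by blast+
  have C0: "C \<ge> 0" using C(1) norm_ge_zero order_trans by blast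
  \<comment> \<open>Each of the two integrals contributes \<open>K / k = 1 / 4\<close>, so one
    iteration contracts by 1/2; \<open>K \<ge> 1\<close> excludes a zero divisor.\<close>
  define k where "k = 4 * K"
  have k: "k > 0" using K by (simp add: k_def)
  define T :: "(real \<times> real \<Rightarrow> 'u \<times> 'v) \<Rightarrow> real \<times> real \<Rightarrow> 'u \<times> 'v" where
    "T s = (\<lambda>(p, q). (u0 p - oint (\<lambda>r. f (s (p, r))) q p, v0 q + oint (\<lambda>r. g (s (r, q))) q p))" for s
  define S where "S n = (T ^^ n) (\<lambda>(p, q). (u0 p, v0 q))" for n
  have S_Suc: "S (Suc n) = T (S n)" for n by (simp add: S_def)
  have row: "continuous_on UNIV (\<lambda>r. s (p, r))" and col: "continuous_on UNIV (\<lambda>r. s (r, q))"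
    if "continuous_on UNIV s" for s :: "real \<times> real \<Rightarrow> 'u \<times> 'v" and p q
    by (rule continuous_on_compose2[OF that]; auto intro!: continuous_intros)+
  have rowf: "continuous_on UNIV (\<lambda>r. f (s (p, r)))" and colg: "continuous_on UNIV (\<lambda>r. g (s (r, q)))"
    if "continuous_on UNIV s" for s :: "real \<times> real \<Rightarrow> 'u \<times> 'v" and p q
    by (rule continuous_on_compose2[OF cf row[OF that]] continuous_on_compose2[OF cg col[OF that]]; simp)+
  have T_cont: "continuous_on UNIV (T s)" if s: "continuous_on UNIV s" for s
  proof -
    have "continuous_on UNIV (\<lambda>(y, r). f (s (fst y, r)))" "continuous_on UNIV (\<lambda>(y, r). g (s (r, snd y)))"
      unfolding split_beta
      by (rule continuous_on_compose2[OF cf continuous_on_compose2[OF s]]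
            continuous_on_compose2[OF cg continuous_on_compose2[OF s]]; auto intro!: continuous_intros)+
    then show ?thesis unfolding T_def split_beta
      by (intro continuous_intros continuous_on_oint continuous_on_compose2[OF u0] continuous_on_compose2[OF v0])
        (auto simp: split_beta)
  qed
  have S_cont: "continuous_on UNIV (S n)" for n
  proof (induction n)
    case 0 then show ?case unfolding S_def split_beta
      by (auto intro!: continuous_intros continuous_on_compose2[OF u0] continuous_on_compose2[OF v0])
  qed (simp add: S_Suc T_cont)
  have norm_pair: "norm (x :: 'u \<times> 'v) \<le> norm (fst x) + norm (snd x)" for x
    by (metis norm_Pair_le prod.collapse)
  define M where "M = 2 * C / k"
  have M: "M \<ge> 0" using C0 k by (simp add: M_def)
  have step: "norm (S (Suc n) (p, q) - S n (p, q)) \<le> M * (1 / 2) ^ n * exp (k * \<bar>p - q\<bar>)" for n p q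
  proof (induction n arbitrary: p q)
    case 0
    have e1: "C \<le> C * exp (k * \<bar>r\<bar>)" for r using C0 k mult_left_mono[of 1 "exp (k * \<bar>r\<bar>)" C] by simp
    have "norm (oint (\<lambda>r. f (u0 p, v0 r)) q p) \<le> C * exp (k * \<bar>p - q\<bar>) / k"
      using C(1) e1 rowf[OF S_cont[of 0]] k C0
      by (intro norm_oint_exp_le[where e = q]) (auto simp: S_def intro: order_trans)
    moreover have "norm (oint (\<lambda>r. g (u0 r, v0 q)) q p) \<le> C * exp (k * \<bar>p - q\<bar>) / k"
      using C(2) e1 colg[OF S_cont[of 0]] k C0
      by (intro norm_oint_exp_le[where e = q]) (auto simp: S_def intro: order_trans)
    ultimately have "norm (S (Suc 0) (p, q) - S 0 (p, q)) \<le> 2 * (C * exp (k * \<bar>p - q\<bar>) / k)"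
      using norm_pair[of "S (Suc 0) (p, q) - S 0 (p, q)"] by (simp add: S_def T_def)
    also have "\<dots> = M * (1 / 2) ^ 0 * exp (k * \<bar>p - q\<bar>)" by (simp add: M_def)
    finally show ?case .
  next
    case (Suc n)
    let ?B = "K * (M * (1 / 2) ^ n)"
    have B0: "?B \<ge> 0" using K M by simp
    have "norm (oint (\<lambda>r. f (S (Suc n) (p, r)) - f (S n (p, r))) q p) \<le> ?B * exp (k * \<bar>p - q\<bar>) / k"
    proof (rule norm_oint_exp_le[where e = p])
      fix r
      have "norm (f (S (Suc n) (p, r)) - f (S n (p, r))) \<le> K * (M * (1 / 2) ^ n * exp (k * \<bar>p - r\<bar>))"
        by (rule order_trans[OF fK mult_left_mono[OF Suc[of p r]]]) (use K in simp)
      then show "norm (f (S (Suc n) (p, r)) - f (S n (p, r))) \<le> ?B * exp (k * \<bar>r - p\<bar>)"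
        by (simp only: mult.assoc abs_minus_commute)
    qed (use k B0 in \<open>auto intro!: continuous_intros rowf S_cont\<close>)
    moreover have "norm (oint (\<lambda>r. g (S (Suc n) (r, q)) - g (S n (r, q))) q p) \<le> ?B * exp (k * \<bar>p - q\<bar>) / k"
    proof (rule norm_oint_exp_le[where e = q])
      fix r
      have "norm (g (S (Suc n) (r, q)) - g (S n (r, q))) \<le> K * (M * (1 / 2) ^ n * exp (k * \<bar>r - q\<bar>))"
        by (rule order_trans[OF gK mult_left_mono[OF Suc[of r q]]]) (use K in simp)
      then show "norm (g (S (Suc n) (r, q)) - g (S n (r, q))) \<le> ?B * exp (k * \<bar>r - q\<bar>)"
        by (simp only: mult.assoc)
    qed (use k B0 in \<open>auto intro!: continuous_intros colg S_cont\<close>)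
    moreover have "S (Suc (Suc n)) (p, q) - S (Suc n) (p, q) =
        (- oint (\<lambda>r. f (S (Suc n) (p, r)) - f (S n (p, r))) q p, oint (\<lambda>r. g (S (Suc n) (r, q)) - g (S n (r, q))) q p)"
      unfolding S_Suc[of "Suc n"] oint_diff[OF rowf[OF S_cont] rowf[OF S_cont]] oint_diff[OF colg[OF S_cont] colg[OF S_cont]]
      using S_Suc[of n] by (simp add: T_def)
    ultimately have "norm (S (Suc (Suc n)) (p, q) - S (Suc n) (p, q)) \<le> 2 * (?B * exp (k * \<bar>p - q\<bar>) / k)"
      using norm_pair[of "S (Suc (Suc n)) (p, q) - S (Suc n) (p, q)"] by simp
    also have "\<dots> = M * (1 / 2) ^ Suc n * exp (k * \<bar>p - q\<bar>)"
      using K by (simp add: k_def)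
    finally show ?case .
  qed
  define s where "s x = S 0 x + (\<Sum>i. S (Suc i) x - S i x)" for x
  \<comment> \<open>The weight is bounded on a strip around the diagonal, so convergence is uniform
    there. The strips are open and exhaust the plane, which gives continuity of the limit
    everywhere.\<close>
  define W where "W R = {x :: real \<times> real. \<bar>fst x - snd x\<bar> < R}" for R
  have lim: "uniform_limit (W R) S s sequentially" for R
  proof -
    have "uniform_limit (W R) (\<lambda>n x. \<Sum>i<n. S (Suc i) x - S i x) (\<lambda>x. \<Sum>i. S (Suc i) x - S i x) sequentially"
    proof (rule Weierstrass_m_test)
      fix n x assume "x \<in> W R"
      then have "exp (k * \<bar>fst x - snd x\<bar>) \<le> exp (k * R)" using k by (simp add: W_def)
      then have "M * (1 / 2) ^ n * exp (k * \<bar>fst x - snd x\<bar>) \<le> M * (1 / 2) ^ n * exp (k * R)"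
        using M by (intro mult_left_mono) auto
      then show "norm (S (Suc n) x - S n x) \<le> M * (1 / 2) ^ n * exp (k * R)"
        using step[of n "fst x" "snd x"] by simp
    qed (intro summable_mult summable_mult2 summable_geometric; simp)
    then have "uniform_limit (W R) (\<lambda>n x. S 0 x + (\<Sum>i<n. S (Suc i) x - S i x)) s sequentially"
      unfolding s_def by (intro uniform_limit_intros)
    moreover have "S 0 x + (\<Sum>i<n. S (Suc i) x - S i x) = S n x" for n x
      by (simp add: sum_lessThan_telescope[of "\<lambda>i. S i x"])
    ultimately show ?thesis by simp
  qed
  have W_open: "open (W R)" for R
    unfolding W_def by (intro open_Collect_less continuous_intros)
  have inW: "x \<in> W (\<bar>fst x - snd x\<bar> + 1)" for x by (simp add: W_def)
  have s_cont: "continuous_on UNIV s"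
  proof -
    have c: "continuous_on (W R) s" for R
      by (rule uniform_limit_theorem[OF _ lim])
        (auto intro!: always_eventually continuous_on_subset[OF S_cont])
    have "isCont s x" for x
      using c W_open inW[of x] continuous_on_eq_continuous_at by blast
    then show ?thesis by (simp add: continuous_at_imp_continuous_on)
  qed
  have fix_s: "T s (p, q) = s (p, q)" for p q
  proof -
    have Slim: "(\<lambda>n. S n (p, q)) \<longlonglongrightarrow> s (p, q)"
      using tendsto_uniform_limitI[OF lim inW[of "(p, q)"]] .
    have "(\<lambda>n. T (S n) (p, q)) \<longlonglongrightarrow> T s (p, q)"
    proof -
      \<comment> \<open>The two integrals belonging to (p, q) see only points of this strip, so
        uniform convergence carries over to them.\<close>
      define R where "R = \<bar>p - q\<bar> + 1"
      have inR: "(p, r) \<in> W R" "(r, q) \<in> W R" if "r \<in> closed_segment q p" for r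
        using that by (auto simp: W_def R_def closed_segment_eq_real_ivl split: if_splits)
      have conv: "(\<lambda>n. oint (h n) q p) \<longlonglongrightarrow> oint h0 q p"
        if "\<And>n. continuous_on UNIV (h n)" "continuous_on UNIV h0"
          "\<And>n r e. r \<in> closed_segment q p \<Longrightarrow> (\<forall>x\<in>W R. norm (S n x - s x) \<le> e) \<Longrightarrow> norm (h n r - h0 r) \<le> K * e"
        for h :: "nat \<Rightarrow> real \<Rightarrow> 'c::banach" and h0
      proof (rule tendstoI)
        fix e :: real assume e: "e > 0"
        define e' where "e' = e / (2 * K * R)"
        have R: "R \<ge> 1" by (simp add: R_def)
        have e': "e' > 0" using e K R by (simp add: e'_def)
        show "\<forall>\<^sub>F n in sequentially. dist (oint (h n) q p) (oint h0 q p) < e"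
          using uniform_limitD[OF lim[of R] e']
        proof eventually_elim
          case (elim n)
          then have "\<forall>x\<in>W R. norm (S n x - s x) \<le> e'" by (auto simp: dist_norm less_imp_le)
          then have "norm (oint (\<lambda>r. h n r - h0 r) q p) \<le> (K * e') * \<bar>p - q\<bar>"
            using that by (intro norm_oint_le continuous_intros) auto
          also have "\<dots> \<le> (K * e') * R" using e' K by (intro mult_left_mono) (auto simp: R_def)
          also have "\<dots> < e" using K R e by (simp add: e'_def)
          finally show ?case using oint_diff[OF that(1,2)] by (simp add: dist_norm)
        qed
      qed
      have "(\<lambda>n. oint (\<lambda>r. f (S n (p, r))) q p) \<longlonglongrightarrow> oint (\<lambda>r. f (s (p, r))) q p"
        by (rule conv) (use K in \<open>auto intro!: rowf S_cont s_cont order_trans[OF fK] mult_left_mono dest: inR\<close>)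
      moreover have "(\<lambda>n. oint (\<lambda>r. g (S n (r, q))) q p) \<longlonglongrightarrow> oint (\<lambda>r. g (s (r, q))) q p"
        by (rule conv) (use K in \<open>auto intro!: colg S_cont s_cont order_trans[OF gK] mult_left_mono dest: inR\<close>)
      ultimately show ?thesis unfolding T_def by (auto intro!: tendsto_intros)
    qed
    then have "(\<lambda>n. S (Suc n) (p, q)) \<longlonglongrightarrow> T s (p, q)" by (simp add: S_Suc)
    then show ?thesis using LIMSEQ_Suc[OF Slim] LIMSEQ_unique by blast
  qed
  define u v where "u p q = fst (s (p, q))" and "v p q = snd (s (p, q))" for p q
  have s_eq: "s (p, q) = (u p q, v p q)" for p q by (simp add: u_def v_def)
  have u: "u p q = u0 p - oint (\<lambda>r. f (u p r, v p r)) q p" and v: "v p q = v0 q + oint (\<lambda>r. g (u r q, v r q)) q p" for p q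
    using fix_s[of p q] by (simp_all add: T_def s_eq)
  show ?thesis
  proof
    show "continuous_on UNIV (\<lambda>(p, q). u p q)" "continuous_on UNIV (\<lambda>(p, q). v p q)"
      unfolding u_def v_def split_beta using s_cont by (auto intro!: continuous_intros)
    show "u p p = u0 p" "v p p = v0 p" for p by (subst u v, simp)+
    have "((\<lambda>q. u0 p - oint (\<lambda>r. f (u p r, v p r)) q p) has_vector_derivative f (u p q, v p q)) (at q)" for p q
      using oint_has_vector_derivative(1)[OF rowf[OF s_cont], of p p q]
      by (auto intro!: derivative_eq_intros simp: s_eq)
    then show "((\<lambda>q. u p q) has_vector_derivative f (u p q, v p q)) (at q)" for p q
      by (simp flip: u)
    have "((\<lambda>p. v0 q + oint (\<lambda>r. g (u r q, v r q)) q p) has_vector_derivative g (u p q, v p q)) (at p)" for p q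
      using oint_has_vector_derivative(2)[OF colg[OF s_cont], of q q p]
      by (auto intro!: derivative_eq_intros simp: s_eq)
    then show "((\<lambda>p. v p q) has_vector_derivative g (u p q, v p q)) (at p)" for p q
      by (simp flip: v)
  qed
qed

section \<open>Differentiability in a parameter\<close>

text \<open>The mean value inequality for \<open>f s - s *\<^sub>R c\<close>: replacing
  \<open>f\<close> by a linear function costs no more than the oscillation of its derivative around
  \<open>c\<close>.\<close>

lemma mean_value_linearization:
  fixes f :: "real \<Rightarrow> 'a::real_normed_vector"
  assumes "a \<le> b" and f: "\<And>s. s \<in> {a..b} \<Longrightarrow> (f has_vector_derivative f' s) (at s within {a..b})"
    and e: "\<And>s. s \<in> {a..b} \<Longrightarrow> norm (f' s - c) \<le> e"
  shows "norm (f b - f a - (b - a) *\<^sub>R c) \<le> e * (b - a)"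
proof (cases "a < b")
  case True
  have "norm ((f b - b *\<^sub>R c) - (f a - a *\<^sub>R c)) \<le> e * b - e * a"
  proof (rule differentiable_bound_general[where f = "\<lambda>s. f s - s *\<^sub>R c" and \<phi> = "\<lambda>s. e * s" and f' = "\<lambda>s. f' s - c" and \<phi>' = "\<lambda>s. e"])
    have "continuous_on {a..b} f"
      using f has_vector_derivative_continuous continuous_on_eq_continuous_within by blast
    then show "continuous_on {a..b} (\<lambda>s. f s - s *\<^sub>R c)" by (intro continuous_intros)
    fix x assume x: "a < x" "x < b"
    then have "(f has_vector_derivative f' x) (at x)"
      using f[of x] by (simp add: at_within_Icc_at)
    then show "((\<lambda>s. f s - s *\<^sub>R c) has_vector_derivative f' x - c) (at x)"
      by (auto intro!: derivative_eq_intros)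
    show "norm (f' x - c) \<le> e" using e x by simp
  qed (use True in \<open>auto intro!: derivative_eq_intros continuous_intros\<close>)
  then show ?thesis by (simp add: algebra_simps)
next
  case False
  then have "a = b" using assms(1) by simp
  then show ?thesis by simp
qed

text \<open>The value is known at the right end \<open>b\<close>, as on the diagonal. At the point
  \<open>m\<close> where the weighted norm is largest, the term with \<open>L\<close> integrates to
  at most half of \<open>norm (e m)\<close> and is absorbed; this explains the factor 2 and the rate
  \<open>2 * L + 1\<close>. Arguing at a maximum avoids integrating \<open>e'\<close>, which is not
  assumed continuous.\<close>

lemma backward_gronwall:
  fixes e :: "real \<Rightarrow> 'a::real_normed_vector"
  assumes e: "\<And>q. q \<in> {a..b} \<Longrightarrow> (e has_vector_derivative e' q) (at q within {a..b})"
    and b: "\<And>q. q \<in> {a..b} \<Longrightarrow> norm (e' q) \<le> L * norm (e q) + \<eta>"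
    and L: "L \<ge> 0" "\<eta> \<ge> 0" and q: "q \<in> {a..b}"
  shows "norm (e q) \<le> 2 * (norm (e b) + \<eta> * (b - a)) * exp ((2 * L + 1) * (b - a))"
proof -
  define k where "k = 2 * L + 1"
  have k: "k > 0" "L / k \<le> 1 / 2" using L by (auto simp: k_def field_simps)
  have cont: "continuous_on {a..b} e"
    using e has_vector_derivative_continuous continuous_on_eq_continuous_within by blast
  have "continuous_on {a..b} (\<lambda>q. norm (e q) * exp (- k * (b - q)))"
    by (intro continuous_intros cont)
  moreover have "{a..b} \<noteq> {}" using q by blast
  ultimately obtain m where m: "m \<in> {a..b}"
    and max: "\<forall>q\<in>{a..b}. norm (e q) * exp (- k * (b - q)) \<le> norm (e m) * exp (- k * (b - m))"
    using continuous_attains_sup[OF compact_Icc] by meson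
  define M where "M = norm (e m) * exp (- k * (b - m))"
  have M0: "M \<ge> 0" by (simp add: M_def)
  have le: "norm (e q) \<le> M * exp (k * (b - q))" if "q \<in> {a..b}" for q
  proof -
    have "norm (e q) * exp (- k * (b - q)) \<le> M" using max that by (simp add: M_def)
    then have "norm (e q) * exp (- k * (b - q)) * exp (k * (b - q)) \<le> M * exp (k * (b - q))"
      by (rule mult_right_mono) simp
    then show ?thesis by (simp add: mult.assoc flip: exp_add)
  qed
  have em: "norm (e m) = M * exp (k * (b - m))" by (simp add: M_def mult.assoc flip: exp_add)
  have "norm (e b - e m) \<le> L * M / k * (exp (k * (b - m)) - 1) + \<eta> * (b - m)"
  proof (cases "m < b")
    case True
    have "norm (e b - e m) \<le> (- (L * M / k) * exp (k * (b - b)) + \<eta> * b) - (- (L * M / k) * exp (k * (b - m)) + \<eta> * m)"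
    proof (rule differentiable_bound_general[where f' = e' and \<phi>' = "\<lambda>q. L * M * exp (k * (b - q)) + \<eta>"])
      show "continuous_on {m..b} e" using cont m by (auto elim: continuous_on_subset)
      fix x assume x: "m < x" "x < b"
      then have ab: "x \<in> {a..b}" "a < x" using m by auto
      then show "(e has_vector_derivative e' x) (at x)" using e[of x] x by (simp add: at_within_Icc_at)
      show "((\<lambda>q. - (L * M / k) * exp (k * (b - q)) + \<eta> * q) has_vector_derivative L * M * exp (k * (b - x)) + \<eta>) (at x)"
        using k by (auto intro!: derivative_eq_intros simp: has_real_derivative_iff_has_vector_derivative[symmetric])
      have "L * norm (e x) \<le> L * (M * exp (k * (b - x)))" using le[OF ab(1)] L by (intro mult_left_mono)
      then show "norm (e' x) \<le> L * M * exp (k * (b - x)) + \<eta>" using b[OF ab(1)] by simp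
    qed (use True k in \<open>auto intro!: continuous_intros\<close>)
    then show ?thesis by (simp add: algebra_simps)
  qed (use m in auto)
  also have "\<dots> \<le> 1 / 2 * norm (e m) + \<eta> * (b - a)"
  proof (rule add_mono)
    have "L * M / k * (exp (k * (b - m)) - 1) = (L / k) * (M * (exp (k * (b - m)) - 1))" by simp
    also have "\<dots> \<le> 1 / 2 * (M * (exp (k * (b - m)) - 1))"
      using k M0 m by (intro mult_right_mono mult_nonneg_nonneg) auto
    also have "\<dots> \<le> 1 / 2 * (M * exp (k * (b - m)))"
      using M0 by (intro mult_left_mono) auto
    finally show "L * M / k * (exp (k * (b - m)) - 1) \<le> 1 / 2 * norm (e m)"
      by (simp only: em)
    show "\<eta> * (b - m) \<le> \<eta> * (b - a)" using m L by (intro mult_left_mono) auto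
  qed
  finally have "norm (e m) \<le> 2 * (norm (e b) + \<eta> * (b - a))"
    using norm_triangle_ineq2[of "e m" "e b"] by (simp add: norm_minus_commute)
  moreover have "M \<le> norm (e m)"
    unfolding M_def using k m by (intro mult_left_le) auto
  ultimately have "M \<le> 2 * (norm (e b) + \<eta> * (b - a))" by simp
  moreover have "exp (k * (b - q)) \<le> exp (k * (b - a))" using k q by simp
  ultimately have "M * exp (k * (b - q)) \<le> 2 * (norm (e b) + \<eta> * (b - a)) * exp (k * (b - a))"
    using M0 by (intro mult_mono) auto
  then show ?thesis using le[OF q] by (simp add: k_def)
qed

text \<open>The domain of dependence of the apex \<open>(P, Q)\<close>: the hypotenuse lies on the
  initial line p = q, and the legs are the two characteristics through the apex.\<close>

definition triangle :: "real \<Rightarrow> real \<Rightarrow> (real \<times> real) set" where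
  "triangle Q P = {(p, q). Q \<le> q \<and> q \<le> p \<and> p \<le> P}"

lemma in_triangle [simp]: "(p, q) \<in> triangle Q P \<longleftrightarrow> Q \<le> q \<and> q \<le> p \<and> p \<le> P"
  by (simp add: triangle_def)

lemma compact_triangle: "compact (triangle Q P)"
proof -
  have "closed (triangle Q P)"
    unfolding triangle_def split_beta
    by (intro closed_Collect_conj closed_Collect_le continuous_intros)
  moreover have "triangle Q P \<subseteq> cbox (Q, Q) (P, P)"
    by (auto simp: triangle_def cbox_Pair_eq)
  ultimately show ?thesis
    by (metis bounded_cbox bounded_subset compact_eq_bounded_closed)
qed

lemma triangle_uniformly_continuous:
  fixes f :: "real \<Rightarrow> real \<Rightarrow> 'a::metric_space"
  assumes "continuous_on (triangle Q P) (\<lambda>(p, q). f p q)" "\<epsilon> > 0"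
  obtains \<delta> where "\<delta> > 0"
    "\<And>p q p' q'. (p, q) \<in> triangle Q P \<Longrightarrow> (p', q') \<in> triangle Q P \<Longrightarrow> \<bar>p - p'\<bar> < \<delta> \<Longrightarrow> \<bar>q - q'\<bar> < \<delta> \<Longrightarrow>
      dist (f p q) (f p' q') < \<epsilon>"
proof -
  obtain d where d: "d > 0" "\<And>x x'. x \<in> triangle Q P \<Longrightarrow> x' \<in> triangle Q P \<Longrightarrow> dist x' x < d \<Longrightarrow>
      dist ((\<lambda>(p, q). f p q) x') ((\<lambda>(p, q). f p q) x) < \<epsilon>"
    using compact_uniformly_continuous[OF assms(1) compact_triangle] assms(2)
    unfolding uniformly_continuous_on_def by metis
  show ?thesis
  proof (rule that[of "d / 2"])
    fix p q p' q' assume *: "(p, q) \<in> triangle Q P" "(p', q') \<in> triangle Q P" "\<bar>p - p'\<bar> < d / 2" "\<bar>q - q'\<bar> < d / 2"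
    have "dist (p, q) (p', q') \<le> \<bar>p - p'\<bar> + \<bar>q - q'\<bar>"
      unfolding dist_Pair_Pair dist_real_def using sqrt_sum_squares_le_sum_abs[of "p - p'" "q - q'"] by simp
    then have "dist (p, q) (p', q') < d" using * by linarith
    then show "dist (f p q) (f p' q') < \<epsilon>" using d(2)[OF *(2,1)] by simp
  qed (use d in auto)
qed

text \<open>If \<open>U\<^sub>q = \<alpha>\<close> and \<open>\<beta>\<^sub>q = \<sigma>\<close>, where \<open>\<sigma>\<close> is what \<open>\<alpha>\<^sub>p\<close> would be if \<open>U\<^sub>p\<close> were \<open>\<beta>\<close>, then \<open>U\<^sub>p = \<beta>\<close>:
  by Gronwall, the error \<open>U(p\<^sub>2,q) - U(p\<^sub>1,q) - (p\<^sub>2-p\<^sub>1) \<beta>(p\<^sub>1,q)\<close> is \<open>o(p\<^sub>2-p\<^sub>1)\<close> because it is so on the diagonal.\<close>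

lemma parameter_derivative:
  fixes U \<alpha> \<beta> \<sigma> :: "real \<Rightarrow> real \<Rightarrow> 'a::real_normed_vector"
  assumes U: "\<And>p q. (p, q) \<in> triangle Q P \<Longrightarrow> ((\<lambda>q. U p q) has_vector_derivative \<alpha> p q) (at q within {Q..p})"
    and \<beta>: "\<And>p q. (p, q) \<in> triangle Q P \<Longrightarrow> ((\<lambda>q. \<beta> p q) has_vector_derivative \<sigma> p q) (at q within {Q..p})"
    and U0: "\<And>p. p \<in> {Q..P} \<Longrightarrow> ((\<lambda>p. U p p) has_vector_derivative \<alpha> p p + \<beta> p p) (at p within {Q..P})"
    and c\<alpha>: "continuous_on (triangle Q P) (\<lambda>(p, q). \<alpha> p q)" and c\<beta>: "continuous_on (triangle Q P) (\<lambda>(p, q). \<beta> p q)"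
    and L: "L \<ge> 0"
    and key: "\<And>\<epsilon>. \<epsilon> > 0 \<Longrightarrow> \<exists>\<delta>>0. \<forall>p1 p2 q. Q \<le> q \<and> q \<le> p1 \<and> p1 \<le> p2 \<and> p2 \<le> P \<and> p2 - p1 < \<delta> \<longrightarrow>
      norm (\<alpha> p2 q - \<alpha> p1 q - (p2 - p1) *\<^sub>R \<sigma> p1 q) \<le>
        L * norm (U p2 q - U p1 q - (p2 - p1) *\<^sub>R \<beta> p1 q) + \<epsilon> * (p2 - p1)"
    and pq: "(p, q) \<in> triangle Q P"
  shows "((\<lambda>p. U p q) has_vector_derivative \<beta> p q) (at p within {q..P})"
proof -
  have QP: "Q \<le> P" using pq by simp
  have unif: "\<exists>\<delta>>0. \<forall>p1 p2 q. Q \<le> q \<and> q \<le> p1 \<and> p1 \<le> p2 \<and> p2 \<le> P \<and> p2 - p1 < \<delta> \<longrightarrow>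
      norm (U p2 q - U p1 q - (p2 - p1) *\<^sub>R \<beta> p1 q) \<le> \<epsilon> * (p2 - p1)" if \<epsilon>: "\<epsilon> > 0" for \<epsilon>
  proof -
    \<comment> \<open>The Gronwall bound for initial error \<open>3 * \<eta>\<close> and defect
      \<open>\<eta>\<close>, both per unit of \<open>p2 - p1\<close>; \<open>\<eta>\<close> is then
      chosen to turn it into \<open>\<epsilon>\<close>.\<close>
    define D where "D = 2 * (3 + (P - Q)) * exp ((2 * L + 1) * (P - Q))"
    have D: "D > 0" using QP by (simp add: D_def)
    define \<eta> where "\<eta> = \<epsilon> / D"
    have \<eta>: "\<eta> > 0" using D \<epsilon> by (simp add: \<eta>_def)
    obtain d1 where d1: "d1 > 0" "\<And>p q p' q'. (p, q) \<in> triangle Q P \<Longrightarrow> (p', q') \<in> triangle Q P \<Longrightarrow>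
        \<bar>p - p'\<bar> < d1 \<Longrightarrow> \<bar>q - q'\<bar> < d1 \<Longrightarrow> dist (\<alpha> p q) (\<alpha> p' q') < \<eta>"
      by (rule triangle_uniformly_continuous[OF c\<alpha> \<eta>]) (rule that)
    obtain d2 where d2: "d2 > 0" "\<And>p q p' q'. (p, q) \<in> triangle Q P \<Longrightarrow> (p', q') \<in> triangle Q P \<Longrightarrow>
        \<bar>p - p'\<bar> < d2 \<Longrightarrow> \<bar>q - q'\<bar> < d2 \<Longrightarrow> dist (\<beta> p q) (\<beta> p' q') < \<eta>"
      by (rule triangle_uniformly_continuous[OF c\<beta> \<eta>]) (rule that)
    obtain d3 where d3: "d3 > 0" "\<And>p1 p2 q. Q \<le> q \<Longrightarrow> q \<le> p1 \<Longrightarrow> p1 \<le> p2 \<Longrightarrow> p2 \<le> P \<Longrightarrow> p2 - p1 < d3 \<Longrightarrow>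
      norm (\<alpha> p2 q - \<alpha> p1 q - (p2 - p1) *\<^sub>R \<sigma> p1 q) \<le> L * norm (U p2 q - U p1 q - (p2 - p1) *\<^sub>R \<beta> p1 q) + \<eta> * (p2 - p1)"
      using key[OF \<eta>] by (elim exE conjE, intro that) auto
    define \<delta> where "\<delta> = min d1 (min d2 d3)"
    have "norm (U p2 q - U p1 q - (p2 - p1) *\<^sub>R \<beta> p1 q) \<le> \<epsilon> * (p2 - p1)"
      if *: "Q \<le> q" "q \<le> p1" "p1 \<le> p2" "p2 \<le> P" "p2 - p1 < \<delta>" for p1 p2 q
    proof -
      define e where "e = (\<lambda>q. U p2 q - U p1 q - (p2 - p1) *\<^sub>R \<beta> p1 q)"
      have "norm (U p2 p2 - U p1 p1 - (p2 - p1) *\<^sub>R (\<alpha> p1 p1 + \<beta> p1 p1)) \<le> (2 * \<eta>) * (p2 - p1)"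
      proof (rule mean_value_linearization[where f = "\<lambda>p. U p p"])
        fix s assume s: "s \<in> {p1..p2}"
        then have "s \<in> {Q..P}" using * by auto
        then show "((\<lambda>p. U p p) has_vector_derivative \<alpha> s s + \<beta> s s) (at s within {p1..p2})"
          by (rule has_vector_derivative_within_subset[OF U0]) (use * in auto)
        have "norm (\<alpha> s s - \<alpha> p1 p1) < \<eta>" "norm (\<beta> s s - \<beta> p1 p1) < \<eta>"
          using d1(2)[of s s p1 p1] d2(2)[of s s p1 p1] s * by (auto simp: \<delta>_def dist_norm)
        then show "norm (\<alpha> s s + \<beta> s s - (\<alpha> p1 p1 + \<beta> p1 p1)) \<le> 2 * \<eta>"
          using norm_triangle_ineq[of "\<alpha> s s - \<alpha> p1 p1" "\<beta> s s - \<beta> p1 p1"]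
          by (simp add: algebra_simps)
      qed (use * in auto)
      moreover have "norm (U p2 p2 - U p2 p1 - (p2 - p1) *\<^sub>R \<alpha> p1 p1) \<le> \<eta> * (p2 - p1)"
      proof (rule mean_value_linearization[where f = "\<lambda>q. U p2 q"])
        fix s assume s: "s \<in> {p1..p2}"
        then show "((\<lambda>q. U p2 q) has_vector_derivative \<alpha> p2 s) (at s within {p1..p2})"
          by (intro has_vector_derivative_within_subset[OF U]) (use * in auto)
        show "norm (\<alpha> p2 s - \<alpha> p1 p1) \<le> \<eta>"
          using d1(2)[of p2 s p1 p1] s * by (auto simp: \<delta>_def dist_norm intro!: less_imp_le)
      qed (use * in auto)
      \<comment> \<open>The increment of \<open>U\<close> along the diagonal minus the increment
        along the short vertical piece at \<open>p2\<close>: the \<open>\<alpha>\<close> parts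
        cancel and the \<open>\<beta>\<close> part is left.\<close>
      moreover have "e p1 = (U p2 p2 - U p1 p1 - (p2 - p1) *\<^sub>R (\<alpha> p1 p1 + \<beta> p1 p1)) - (U p2 p2 - U p2 p1 - (p2 - p1) *\<^sub>R \<alpha> p1 p1)"
        by (simp add: e_def algebra_simps)
      ultimately have e0: "norm (e p1) \<le> 3 * (\<eta> * (p2 - p1))"
        using norm_triangle_ineq4[of "U p2 p2 - U p1 p1 - (p2 - p1) *\<^sub>R (\<alpha> p1 p1 + \<beta> p1 p1)" "U p2 p2 - U p2 p1 - (p2 - p1) *\<^sub>R \<alpha> p1 p1"]
        by simp
      have "norm (e q) \<le> 2 * (norm (e p1) + \<eta> * (p2 - p1) * (p1 - Q)) * exp ((2 * L + 1) * (p1 - Q))"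
      proof (rule backward_gronwall)
        fix s assume s: "s \<in> {Q..p1}"
        have "((\<lambda>q. U p2 q) has_vector_derivative \<alpha> p2 s) (at s within {Q..p1})"
          by (rule has_vector_derivative_within_subset[OF U]) (use s * in auto)
        then show "(e has_vector_derivative (\<alpha> p2 s - \<alpha> p1 s - (p2 - p1) *\<^sub>R \<sigma> p1 s)) (at s within {Q..p1})"
          unfolding e_def
          by (intro has_vector_derivative_diff U bounded_linear.has_vector_derivative[OF bounded_linear_scaleR_right] \<beta>
              has_vector_derivative_within_subset[OF U, of p1 s] has_vector_derivative_within_subset[OF \<beta>, of p1 s])
            (use s * in auto)
        show "norm (\<alpha> p2 s - \<alpha> p1 s - (p2 - p1) *\<^sub>R \<sigma> p1 s) \<le> L * norm (e s) + \<eta> * (p2 - p1)"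
          unfolding e_def by (rule d3(2)) (use s * in \<open>auto simp: \<delta>_def\<close>)
      qed (use * L \<eta> in auto)
      also have "\<dots> \<le> 2 * (3 * (\<eta> * (p2 - p1)) + \<eta> * (p2 - p1) * (P - Q)) * exp ((2 * L + 1) * (P - Q))"
      proof (rule mult_mono)
        have "\<eta> * (p2 - p1) * (p1 - Q) \<le> \<eta> * (p2 - p1) * (P - Q)"
          using * \<eta> by (intro mult_left_mono) auto
        from add_mono[OF e0 this]
        show "2 * (norm (e p1) + \<eta> * (p2 - p1) * (p1 - Q)) \<le> 2 * (3 * (\<eta> * (p2 - p1)) + \<eta> * (p2 - p1) * (P - Q))"
          by (rule mult_left_mono) simp
        have "(2 * L + 1) * (p1 - Q) \<le> (2 * L + 1) * (P - Q)"
          using * L by (intro mult_left_mono) auto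
        then show "exp ((2 * L + 1) * (p1 - Q)) \<le> exp ((2 * L + 1) * (P - Q))" by simp
        show "0 \<le> 2 * (3 * (\<eta> * (p2 - p1)) + \<eta> * (p2 - p1) * (P - Q))"
          using * \<eta> by (intro mult_nonneg_nonneg add_nonneg_nonneg) auto
      qed auto
      also have "\<dots> = (\<eta> * D) * (p2 - p1)" unfolding D_def by (simp only: algebra_simps)
      also have "\<eta> * D = \<epsilon>" using D by (simp add: \<eta>_def)
      finally show ?thesis by (simp add: e_def)
    qed
    moreover have "\<delta> > 0" using d1 d2 d3 by (simp add: \<delta>_def)
    ultimately show ?thesis by blast
  qed
  show ?thesis
    unfolding has_vector_derivative_def has_derivative_within_alt
  proof (intro conjI allI impI bounded_linear_scaleR_left)
    fix e :: real assume e: "e > 0"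
    obtain d1 where d1_pos: "d1 > 0" and d1_all: "\<forall>p1 p2 q. Q \<le> q \<and> q \<le> p1 \<and> p1 \<le> p2 \<and> p2 \<le> P \<and> p2 - p1 < d1 \<longrightarrow>
      norm (U p2 q - U p1 q - (p2 - p1) *\<^sub>R \<beta> p1 q) \<le> e / 2 * (p2 - p1)"
      using unif[OF half_gt_zero[OF e]] by (elim exE conjE)
    note d1 = d1_pos d1_all[rule_format, OF conjI, OF _ conjI, OF _ _ conjI, OF _ _ _ conjI]
    obtain d2 where d2: "d2 > 0" "\<And>p q p' q'. (p, q) \<in> triangle Q P \<Longrightarrow> (p', q') \<in> triangle Q P \<Longrightarrow>
        \<bar>p - p'\<bar> < d2 \<Longrightarrow> \<bar>q - q'\<bar> < d2 \<Longrightarrow> dist (\<beta> p q) (\<beta> p' q') < e / 2"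
      by (rule triangle_uniformly_continuous[OF c\<beta> half_gt_zero[OF e]]) (rule that)
    show "\<exists>d>0. \<forall>y\<in>{q..P}. norm (y - p) < d \<longrightarrow> norm (U y q - U p q - (y - p) *\<^sub>R \<beta> p q) \<le> e * norm (y - p)"
    proof (intro exI[of _ "min d1 d2"] conjI ballI impI)
      fix y assume y: "y \<in> {q..P}" "norm (y - p) < min d1 d2"
      show "norm (U y q - U p q - (y - p) *\<^sub>R \<beta> p q) \<le> e * norm (y - p)"
      proof (cases "p \<le> y")
        case True
        then have "norm (U y q - U p q - (y - p) *\<^sub>R \<beta> p q) \<le> e / 2 * (y - p)"
          using d1(2)[of q p y] y pq by auto
        also have "\<dots> \<le> e * (y - p)" using e True by (intro mult_right_mono) auto
        finally show ?thesis using True by simp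
      next
        case False
        \<comment> \<open>For \<open>y < p\<close> the uniform estimate is anchored at
          \<open>y\<close> instead of \<open>p\<close>; continuity of \<open>\<beta>\<close> moves
          the anchor.\<close>
        have 1: "norm (U p q - U y q - (p - y) *\<^sub>R \<beta> y q) \<le> e / 2 * (p - y)"
          using d1(2)[of q y p] y pq False by auto
        have "norm (\<beta> y q - \<beta> p q) \<le> e / 2"
          using d2(2)[of y q p q] y pq d2(1) by (auto simp: dist_norm)
        then have "(p - y) * norm (\<beta> y q - \<beta> p q) \<le> (p - y) * (e / 2)"
          using False by (intro mult_left_mono) auto
        then have 2: "norm ((p - y) *\<^sub>R (\<beta> y q - \<beta> p q)) \<le> e / 2 * (p - y)"
          using False by (simp add: mult.commute)
        have "U y q - U p q - (y - p) *\<^sub>R \<beta> p q = - ((U p q - U y q - (p - y) *\<^sub>R \<beta> y q) + (p - y) *\<^sub>R (\<beta> y q - \<beta> p q))"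
          by (simp add: algebra_simps)
        then have "norm (U y q - U p q - (y - p) *\<^sub>R \<beta> p q) =
            norm ((U p q - U y q - (p - y) *\<^sub>R \<beta> y q) + (p - y) *\<^sub>R (\<beta> y q - \<beta> p q))"
          by (simp only: norm_minus_cancel)
        also have "\<dots> \<le> e / 2 * (p - y) + e / 2 * (p - y)" by (rule norm_triangle_mono[OF 1 2])
        also have "e / 2 * (p - y) + e / 2 * (p - y) = e * norm (y - p)"
          using False by (simp add: field_simps)
        finally show ?thesis .
      qed
    qed (use d1 d2 in auto)
  qed
qed

section \<open>C1 coefficients on a closed rectangle and their expansion along the solution\<close>

definition C1_box ::
  "real set \<Rightarrow> real set \<Rightarrow> (real \<Rightarrow> real \<Rightarrow> real) \<Rightarrow> (real \<Rightarrow> real \<Rightarrow> real) \<Rightarrow> (real \<Rightarrow> real \<Rightarrow> real) \<Rightarrow> bool" where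
  "C1_box Z W k kz kw \<longleftrightarrow>
     (\<forall>z\<in>Z. \<forall>w\<in>W. ((\<lambda>z. k z w) has_real_derivative kz z w) (at z within Z) \<and>
                    ((\<lambda>w. k z w) has_real_derivative kw z w) (at w within W)) \<and>
     continuous_on (Z \<times> W) (\<lambda>(z, w). kz z w) \<and> continuous_on (Z \<times> W) (\<lambda>(z, w). kw z w)"

lemma mean_value_linearization_real:
  fixes f :: "real \<Rightarrow> real"
  assumes f: "\<And>s. s \<in> {a..b} \<Longrightarrow> (f has_real_derivative f' s) (at s within {a..b})"
    and xy: "x \<in> {a..b}" "y \<in> {a..b}"
    and e: "\<And>s. s \<in> {a..b} \<Longrightarrow> \<bar>s - x\<bar> \<le> \<bar>y - x\<bar> \<Longrightarrow> \<bar>f' s - c\<bar> \<le> e"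
  shows "\<bar>f y - f x - (y - x) * c\<bar> \<le> e * \<bar>y - x\<bar>"
proof -
  have *: "\<bar>f v - f u - (v - u) * c\<bar> \<le> e * (v - u)"
    if "u \<le> v" "{u..v} \<subseteq> {a..b}" "\<And>s. s \<in> {u..v} \<Longrightarrow> \<bar>s - x\<bar> \<le> \<bar>y - x\<bar>" for u v
  proof -
    have "norm (f v - f u - (v - u) *\<^sub>R c) \<le> e * (v - u)"
    proof (rule mean_value_linearization[OF that(1), where f' = f'])
      fix s assume s: "s \<in> {u..v}"
      show "(f has_vector_derivative f' s) (at s within {u..v})"
        using DERIV_subset[OF f that(2)] s that(2) by (auto simp: has_real_derivative_iff_has_vector_derivative)
      show "norm (f' s - c) \<le> e" using e[of s] s that by auto
    qed
    then show ?thesis by simp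
  qed
  show ?thesis
  proof (cases "x \<le> y")
    case True
    then show ?thesis using *[of x y] xy by auto
  next
    case False
    then have "\<bar>f x - f y - (x - y) * c\<bar> \<le> e * (x - y)" using *[of y x] xy by auto
    moreover have "f y - f x - (y - x) * c = - (f x - f y - (x - y) * c)" by (simp add: algebra_simps)
    ultimately show ?thesis using False by (simp only: abs_minus_cancel) simp
  qed
qed

text \<open>One coordinate is moved at a time. The partials are uniformly continuous on the compact
  rectangle, so the remainder is small uniformly in both points.\<close>

lemma C1_box_expansion:
  assumes k: "C1_box {zl..zu} {wl..wu} k kz kw" and \<epsilon>: "\<epsilon> > 0"
  shows "\<exists>d>0. \<forall>z\<in>{zl..zu}. \<forall>w\<in>{wl..wu}. \<forall>z'\<in>{zl..zu}. \<forall>w'\<in>{wl..wu}. \<bar>z' - z\<bar> < d \<longrightarrow> \<bar>w' - w\<bar> < d \<longrightarrow>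
    \<bar>k z' w' - k z w - kz z w * (z' - z) - kw z w * (w' - w)\<bar> \<le> \<epsilon> * (\<bar>z' - z\<bar> + \<bar>w' - w\<bar>)"
proof -
  have comp: "compact ({zl..zu} \<times> {wl..wu})" by (intro compact_Times compact_Icc)
  have unif: "\<exists>d>0. \<forall>z\<in>{zl..zu}. \<forall>w\<in>{wl..wu}. \<forall>z'\<in>{zl..zu}. \<forall>w'\<in>{wl..wu}. \<bar>z' - z\<bar> < d \<longrightarrow> \<bar>w' - w\<bar> < d \<longrightarrow>
      \<bar>h z' w' - h z w\<bar> \<le> \<epsilon>" if h: "continuous_on ({zl..zu} \<times> {wl..wu}) (\<lambda>(z, w). h z w)" for h :: "real \<Rightarrow> real \<Rightarrow> real"
  proof -
    obtain d where d: "d > 0" "\<And>x x'. x \<in> {zl..zu} \<times> {wl..wu} \<Longrightarrow> x' \<in> {zl..zu} \<times> {wl..wu} \<Longrightarrow> dist x' x < d \<Longrightarrow>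
        dist ((\<lambda>(z, w). h z w) x') ((\<lambda>(z, w). h z w) x) < \<epsilon>"
      using compact_uniformly_continuous[OF h comp] \<epsilon>
      unfolding uniformly_continuous_on_def by metis
    have "\<bar>h z' w' - h z w\<bar> \<le> \<epsilon>"
      if "z \<in> {zl..zu}" "w \<in> {wl..wu}" "z' \<in> {zl..zu}" "w' \<in> {wl..wu}" "\<bar>z' - z\<bar> < d / 2" "\<bar>w' - w\<bar> < d / 2" for z w z' w'
    proof -
      have "dist (z', w') (z, w) \<le> \<bar>z' - z\<bar> + \<bar>w' - w\<bar>"
        unfolding dist_Pair_Pair dist_real_def using sqrt_sum_squares_le_sum_abs[of "z' - z" "w' - w"] by simp
      then have "dist (z', w') (z, w) < d" using that by linarith
      then show ?thesis using d(2)[of "(z, w)" "(z', w')"] that by (simp add: dist_real_def)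
    qed
    then show ?thesis using d(1) by (intro exI[of _ "d / 2"]) auto
  qed
  obtain d1 where d1: "d1 > 0" "\<forall>z\<in>{zl..zu}. \<forall>w\<in>{wl..wu}. \<forall>z'\<in>{zl..zu}. \<forall>w'\<in>{wl..wu}. \<bar>z' - z\<bar> < d1 \<longrightarrow> \<bar>w' - w\<bar> < d1 \<longrightarrow>
      \<bar>kz z' w' - kz z w\<bar> \<le> \<epsilon>"
    using unif[of kz] k unfolding C1_box_def by blast
  obtain d2 where d2: "d2 > 0" "\<forall>z\<in>{zl..zu}. \<forall>w\<in>{wl..wu}. \<forall>z'\<in>{zl..zu}. \<forall>w'\<in>{wl..wu}. \<bar>z' - z\<bar> < d2 \<longrightarrow> \<bar>w' - w\<bar> < d2 \<longrightarrow>
      \<bar>kw z' w' - kw z w\<bar> \<le> \<epsilon>"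
    using unif[of kw] k unfolding C1_box_def by blast
  show ?thesis
  proof (intro exI[of _ "min d1 d2"] conjI ballI impI)
    fix z w z' w' assume *: "z \<in> {zl..zu}" "w \<in> {wl..wu}" "z' \<in> {zl..zu}" "w' \<in> {wl..wu}"
      "\<bar>z' - z\<bar> < min d1 d2" "\<bar>w' - w\<bar> < min d1 d2"
    have "\<bar>k z' w' - k z w' - (z' - z) * kz z w\<bar> \<le> \<epsilon> * \<bar>z' - z\<bar>"
    proof (rule mean_value_linearization_real[where f = "\<lambda>z. k z w'" and f' = "\<lambda>z. kz z w'"])
      fix s assume s: "s \<in> {zl..zu}"
      then show "((\<lambda>z. k z w') has_real_derivative kz s w') (at s within {zl..zu})"
        using k * unfolding C1_box_def by blast
      assume "\<bar>s - z\<bar> \<le> \<bar>z' - z\<bar>"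
      then show "\<bar>kz s w' - kz z w\<bar> \<le> \<epsilon>"
        using d1(2)[rule_format, of z w s w'] s * by auto
    qed (use * in auto)
    moreover have "\<bar>k z w' - k z w - (w' - w) * kw z w\<bar> \<le> \<epsilon> * \<bar>w' - w\<bar>"
    proof (rule mean_value_linearization_real[where f = "\<lambda>w. k z w" and f' = "\<lambda>w. kw z w"])
      fix s assume s: "s \<in> {wl..wu}"
      then show "((\<lambda>w. k z w) has_real_derivative kw z s) (at s within {wl..wu})"
        using k * unfolding C1_box_def by blast
      assume "\<bar>s - w\<bar> \<le> \<bar>w' - w\<bar>"
      then show "\<bar>kw z s - kw z w\<bar> \<le> \<epsilon>"
        using d2(2)[rule_format, of z w z s] d1(1) s * by auto
    qed (use * in auto)
    ultimately show "\<bar>k z' w' - k z w - kz z w * (z' - z) - kw z w * (w' - w)\<bar> \<le> \<epsilon> * (\<bar>z' - z\<bar> + \<bar>w' - w\<bar>)"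
      by (simp add: algebra_simps abs_le_iff)
  qed (use d1 d2 in auto)
qed

lemma C1_box_has_derivative:
  assumes k: "C1_box {zl..zu} {wl..wu} k kz kw" and zw: "z \<in> {zl..zu}" "w \<in> {wl..wu}"
  shows "((\<lambda>(z, w). k z w) has_derivative (\<lambda>(h, l). kz z w * h + kw z w * l)) (at (z, w) within {zl..zu} \<times> {wl..wu})"
  unfolding has_derivative_within_alt
proof (intro conjI allI impI)
  show "bounded_linear (\<lambda>(h, l). kz z w * h + kw z w * l)"
    unfolding split_beta by (intro bounded_linear_intros)
  fix e :: real assume e: "e > 0"
  obtain d where d: "d > 0" "\<forall>z\<in>{zl..zu}. \<forall>w\<in>{wl..wu}. \<forall>z'\<in>{zl..zu}. \<forall>w'\<in>{wl..wu}. \<bar>z' - z\<bar> < d \<longrightarrow> \<bar>w' - w\<bar> < d \<longrightarrow>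
    \<bar>k z' w' - k z w - kz z w * (z' - z) - kw z w * (w' - w)\<bar> \<le> e / 2 * (\<bar>z' - z\<bar> + \<bar>w' - w\<bar>)"
    using C1_box_expansion[OF k half_gt_zero[OF e]] by (elim exE conjE)
  show "\<exists>d>0. \<forall>y\<in>{zl..zu} \<times> {wl..wu}. norm (y - (z, w)) < d \<longrightarrow>
      norm ((case y of (z, w) \<Rightarrow> k z w) - (case (z, w) of (z, w) \<Rightarrow> k z w) - (case y - (z, w) of (h, l) \<Rightarrow> kz z w * h + kw z w * l))
        \<le> e * norm (y - (z, w))"
  proof (intro exI[of _ d] conjI ballI impI)
    fix y assume y: "y \<in> {zl..zu} \<times> {wl..wu}" "norm (y - (z, w)) < d"
    obtain z' w' where y': "y = (z', w')" by (cases y)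
    have n: "\<bar>z' - z\<bar> \<le> norm (y - (z, w))" "\<bar>w' - w\<bar> \<le> norm (y - (z, w))"
      using norm_fst_le[of "z' - z" "w' - w"] norm_snd_le[of "w' - w" "z' - z"] by (simp_all add: y')
    have "\<bar>k z' w' - k z w - kz z w * (z' - z) - kw z w * (w' - w)\<bar> \<le> e / 2 * (\<bar>z' - z\<bar> + \<bar>w' - w\<bar>)"
      using d(2)[rule_format, of z w z' w'] zw y n by (auto simp: y')
    also have "\<dots> \<le> e / 2 * (norm (y - (z, w)) + norm (y - (z, w)))"
      using e n by (intro mult_left_mono add_mono) auto
    finally show "norm ((case y of (z, w) \<Rightarrow> k z w) - (case (z, w) of (z, w) \<Rightarrow> k z w) - (case y - (z, w) of (h, l) \<Rightarrow> kz z w * h + kw z w * l))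
        \<le> e * norm (y - (z, w))"
      by (simp add: y' diff_diff_eq)
  qed (rule d(1))
qed

lemma C1_box_chain:
  assumes k: "C1_box {zl..zu} {wl..wu} k kz kw"
    and z: "(z has_real_derivative z') (at s within S)" and w: "(w has_real_derivative w') (at s within S)"
    and S: "\<And>r. r \<in> S \<Longrightarrow> z r \<in> {zl..zu} \<and> w r \<in> {wl..wu}" "s \<in> S"
  shows "((\<lambda>s. k (z s) (w s)) has_real_derivative (kz (z s) (w s) * z' + kw (z s) (w s) * w')) (at s within S)"
proof -
  have "((\<lambda>s. (z s, w s)) has_vector_derivative (z', w')) (at s within S)"
    using z w by (auto intro: has_vector_derivative_Pair simp: has_real_derivative_iff_has_vector_derivative)
  moreover have "((\<lambda>(z, w). k z w) has_derivative (\<lambda>(h, l). kz (z s) (w s) * h + kw (z s) (w s) * l))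
      (at (z s, w s) within (\<lambda>s. (z s, w s)) ` S)"
    by (rule has_derivative_subset[OF C1_box_has_derivative[OF k]]) (use S in auto)
  ultimately show ?thesis
    using vector_derivative_diff_chain_within[of "\<lambda>s. (z s, w s)"]
    by (fastforce simp: o_def has_real_derivative_iff_has_vector_derivative)
qed

lemma C1_box_continuous:
  assumes k: "C1_box {zl..zu} {wl..wu} k kz kw"
  shows "continuous_on ({zl..zu} \<times> {wl..wu}) (\<lambda>(z, w). k z w)"
  unfolding continuous_on_eq_continuous_within
  using C1_box_has_derivative[OF k] has_derivative_continuous by blast

lemma triangle_bound:
  fixes f :: "real \<Rightarrow> real \<Rightarrow> real"
  assumes "continuous_on (triangle Q P) (\<lambda>(p, q). f p q)"
  obtains B where "B \<ge> 0" "\<And>p q. (p, q) \<in> triangle Q P \<Longrightarrow> \<bar>f p q\<bar> \<le> B"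
proof -
  have "bounded ((\<lambda>(p, q). f p q) ` triangle Q P)"
    using compact_continuous_image[OF assms compact_triangle] compact_imp_bounded by blast
  then obtain B where B: "\<forall>x\<in>(\<lambda>(p, q). f p q) ` triangle Q P. norm x \<le> B"
    unfolding bounded_iff by blast
  show ?thesis
  proof (rule that[of "max B 0"])
    fix p q assume "(p, q) \<in> triangle Q P"
    then have "f p q \<in> (\<lambda>(p, q). f p q) ` triangle Q P" by (intro image_eqI[of _ _ "(p, q)"]) auto
    then have "norm (f p q) \<le> B" by (rule B[rule_format])
    then show "\<bar>f p q\<bar> \<le> max B 0" by simp
  qed simp
qed

lemma uniform_difference:
  fixes f fp :: "real \<Rightarrow> real \<Rightarrow> real"
  assumes f: "\<And>p q. (p, q) \<in> triangle Q P \<Longrightarrow> ((\<lambda>p. f p q) has_real_derivative fp p q) (at p within {q..P})"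
    and fp: "continuous_on (triangle Q P) (\<lambda>(p, q). fp p q)" and \<epsilon>: "\<epsilon> > 0"
  shows "\<exists>\<delta>>0. \<forall>p1 p2 q. Q \<le> q \<and> q \<le> p1 \<and> p1 \<le> p2 \<and> p2 \<le> P \<and> p2 - p1 < \<delta> \<longrightarrow>
      \<bar>f p2 q - f p1 q - (p2 - p1) * fp p1 q\<bar> \<le> \<epsilon> * (p2 - p1)"
proof -
  obtain \<delta> where \<delta>: "\<delta> > 0" "\<And>p q p' q'. (p, q) \<in> triangle Q P \<Longrightarrow> (p', q') \<in> triangle Q P \<Longrightarrow>
        \<bar>p - p'\<bar> < \<delta> \<Longrightarrow> \<bar>q - q'\<bar> < \<delta> \<Longrightarrow> dist (fp p q) (fp p' q') < \<epsilon>"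
    by (rule triangle_uniformly_continuous[OF fp \<epsilon>]) (rule that)
  show ?thesis
  proof (intro exI[of _ \<delta>] conjI allI impI)
    fix p1 p2 q assume *: "Q \<le> q \<and> q \<le> p1 \<and> p1 \<le> p2 \<and> p2 \<le> P \<and> p2 - p1 < \<delta>"
    have "\<bar>f p2 q - f p1 q - (p2 - p1) * fp p1 q\<bar> \<le> \<epsilon> * \<bar>p2 - p1\<bar>"
    proof (rule mean_value_linearization_real[where f = "\<lambda>p. f p q" and f' = "\<lambda>p. fp p q"])
      fix s assume s: "s \<in> {q..P}"
      show "((\<lambda>p. f p q) has_real_derivative fp s q) (at s within {q..P})" by (rule f) (use s * in auto)
      assume "\<bar>s - p1\<bar> \<le> \<bar>p2 - p1\<bar>"
      then show "\<bar>fp s q - fp p1 q\<bar> \<le> \<epsilon>"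
        using \<delta>(2)[of s q p1 q] \<delta>(1) s * by (auto simp: dist_real_def)
    qed (use * in auto)
    then show "\<bar>f p2 q - f p1 q - (p2 - p1) * fp p1 q\<bar> \<le> \<epsilon> * (p2 - p1)" using * by simp
  qed (rule \<delta>(1))
qed

lemma continuous_on_triangle_box:
  assumes k: "continuous_on ({zl..zu} \<times> {wl..wu}) (\<lambda>(z, w). k z w)"
    and "continuous_on T (\<lambda>(p, q). z p q)" "continuous_on T (\<lambda>(p, q). w p q)"
    and "\<And>p q. (p, q) \<in> T \<Longrightarrow> z p q \<in> {zl..zu} \<and> w p q \<in> {wl..wu}"
  shows "continuous_on T (\<lambda>(p, q). k (z p q) (w p q))"
proof -
  have "continuous_on T (\<lambda>x. (z (fst x) (snd x), w (fst x) (snd x)))"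
    using assms(2,3) by (intro continuous_on_Pair) (simp_all add: split_beta)
  then have "continuous_on T (\<lambda>x. (\<lambda>(z, w). k z w) (z (fst x) (snd x), w (fst x) (snd x)))"
    by (rule continuous_on_compose2[OF k]) (use assms(4) in auto)
  then show ?thesis by (simp add: split_beta)
qed

text \<open>Supplies the error hypothesis of \<open>parameter_derivative\<close>. At this stage
  \<open>z\<close> and \<open>w\<close> are not known to be differentiable in p:
  \<open>\<beta>z\<close> and \<open>\<beta>w\<close> are candidates, and their defects appear on
  the right with a Lipschitz factor, ready for Gronwall.\<close>

lemma product_expansion:
  fixes f fp z w \<beta>z \<beta>w :: "real \<Rightarrow> real \<Rightarrow> real"
  assumes f: "\<And>p q. (p, q) \<in> triangle Q P \<Longrightarrow> ((\<lambda>p. f p q) has_real_derivative fp p q) (at p within {q..P})"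
    and k: "C1_box {zl..zu} {wl..wu} k kz kw"
    and cont: "continuous_on (triangle Q P) (\<lambda>(p, q). f p q)" "continuous_on (triangle Q P) (\<lambda>(p, q). fp p q)"
      "continuous_on (triangle Q P) (\<lambda>(p, q). z p q)" "continuous_on (triangle Q P) (\<lambda>(p, q). w p q)"
      "continuous_on (triangle Q P) (\<lambda>(p, q). \<beta>z p q)" "continuous_on (triangle Q P) (\<lambda>(p, q). \<beta>w p q)"
    and box: "\<And>p q. (p, q) \<in> triangle Q P \<Longrightarrow> z p q \<in> {zl..zu} \<and> w p q \<in> {wl..wu}"
  obtains L where "L \<ge> 0"
    "\<forall>\<epsilon>>0. \<exists>\<delta>>0. \<forall>p1 p2 q. Q \<le> q \<and> q \<le> p1 \<and> p1 \<le> p2 \<and> p2 \<le> P \<and> p2 - p1 < \<delta> \<longrightarrow>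
      \<bar>f p2 q * k (z p2 q) (w p2 q) - f p1 q * k (z p1 q) (w p1 q)
        - (p2 - p1) * (fp p1 q * k (z p1 q) (w p1 q)
            + f p1 q * (kz (z p1 q) (w p1 q) * \<beta>z p1 q + kw (z p1 q) (w p1 q) * \<beta>w p1 q))\<bar>
      \<le> L * (\<bar>z p2 q - z p1 q - (p2 - p1) * \<beta>z p1 q\<bar> + \<bar>w p2 q - w p1 q - (p2 - p1) * \<beta>w p1 q\<bar>) + \<epsilon> * (p2 - p1)"
proof -
  let ?T = "triangle Q P"
  have ck: "continuous_on ?T (\<lambda>(p, q). k (z p q) (w p q))"
    "continuous_on ?T (\<lambda>(p, q). kz (z p q) (w p q))" "continuous_on ?T (\<lambda>(p, q). kw (z p q) (w p q))"
    by (rule continuous_on_triangle_box[OF _ cont(3,4) box]; use k C1_box_continuous[OF k] in \<open>auto simp: C1_box_def\<close>)+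
  obtain Bf where Bf: "Bf \<ge> 0" "\<And>p q. (p, q) \<in> ?T \<Longrightarrow> \<bar>f p q\<bar> \<le> Bf" by (rule triangle_bound[OF cont(1)]) (rule that)
  obtain Bp where Bp: "Bp \<ge> 0" "\<And>p q. (p, q) \<in> ?T \<Longrightarrow> \<bar>fp p q\<bar> \<le> Bp" by (rule triangle_bound[OF cont(2)]) (rule that)
  obtain Bz where Bz: "Bz \<ge> 0" "\<And>p q. (p, q) \<in> ?T \<Longrightarrow> \<bar>\<beta>z p q\<bar> \<le> Bz" by (rule triangle_bound[OF cont(5)]) (rule that)
  obtain Bw where Bw: "Bw \<ge> 0" "\<And>p q. (p, q) \<in> ?T \<Longrightarrow> \<bar>\<beta>w p q\<bar> \<le> Bw" by (rule triangle_bound[OF cont(6)]) (rule that)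
  obtain Bk where Bk: "Bk \<ge> 0" "\<And>p q. (p, q) \<in> ?T \<Longrightarrow> \<bar>k (z p q) (w p q)\<bar> \<le> Bk" by (rule triangle_bound[OF ck(1)]) (rule that)
  obtain B1 where B1: "B1 \<ge> 0" "\<And>p q. (p, q) \<in> ?T \<Longrightarrow> \<bar>kz (z p q) (w p q)\<bar> \<le> B1" by (rule triangle_bound[OF ck(2)]) (rule that)
  obtain B2 where B2: "B2 \<ge> 0" "\<And>p q. (p, q) \<in> ?T \<Longrightarrow> \<bar>kw (z p q) (w p q)\<bar> \<le> B2" by (rule triangle_bound[OF ck(3)]) (rule that)
  \<comment> \<open>\<open>B1 + B2\<close> bounds the gradient of \<open>k\<close>; the extra 1
    takes up the defects inside the Taylor remainder, which enter with a factor
    \<open>\<eta> \<le> 1\<close>.\<close>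
  define L where "L = Bf * (B1 + B2 + 1)"
  show ?thesis
  proof (rule that[of L], goal_cases)
    case 1 show ?case using Bf B1 B2 by (simp add: L_def)
  next
    case 2 show ?case
    proof (intro allI impI)
    fix \<epsilon> :: real assume \<epsilon>: "\<epsilon> > 0"
    define D where "D = Bk + Bp + Bf * (Bz + Bw) + 1"
    have D: "D \<ge> 1" using Bk Bp Bf Bz Bw by (simp add: D_def)
    define \<eta> where "\<eta> = min 1 (\<epsilon> / D)"
    have \<eta>: "\<eta> > 0" "\<eta> \<le> 1" "\<eta> * D \<le> \<epsilon>"
      using D \<epsilon> by (auto simp: \<eta>_def min_def field_simps)
    obtain d1 where d1: "d1 > 0" "\<forall>p1 p2 q. Q \<le> q \<and> q \<le> p1 \<and> p1 \<le> p2 \<and> p2 \<le> P \<and> p2 - p1 < d1 \<longrightarrow>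
        \<bar>f p2 q - f p1 q - (p2 - p1) * fp p1 q\<bar> \<le> \<eta> * (p2 - p1)"
      using uniform_difference[where f = f, OF _ cont(2) \<eta>(1)] f by (elim meta_impE exE conjE)
    obtain d2 where d2: "d2 > 0" "\<And>p q p' q'. (p, q) \<in> ?T \<Longrightarrow> (p', q') \<in> ?T \<Longrightarrow> \<bar>p - p'\<bar> < d2 \<Longrightarrow> \<bar>q - q'\<bar> < d2 \<Longrightarrow>
        dist (k (z p q) (w p q)) (k (z p' q') (w p' q')) < \<eta>"
      by (rule triangle_uniformly_continuous[OF ck(1) \<eta>(1)]) (rule that)
    obtain e where e: "e > 0" "\<forall>z\<in>{zl..zu}. \<forall>w\<in>{wl..wu}. \<forall>z'\<in>{zl..zu}. \<forall>w'\<in>{wl..wu}. \<bar>z' - z\<bar> < e \<longrightarrow> \<bar>w' - w\<bar> < e \<longrightarrow>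
        \<bar>k z' w' - k z w - kz z w * (z' - z) - kw z w * (w' - w)\<bar> \<le> \<eta> * (\<bar>z' - z\<bar> + \<bar>w' - w\<bar>)"
      using C1_box_expansion[OF k \<eta>(1)] by (elim exE conjE)
    obtain d3 where d3: "d3 > 0" "\<And>p q p' q'. (p, q) \<in> ?T \<Longrightarrow> (p', q') \<in> ?T \<Longrightarrow> \<bar>p - p'\<bar> < d3 \<Longrightarrow> \<bar>q - q'\<bar> < d3 \<Longrightarrow>
        dist (z p q) (z p' q') < e"
      by (rule triangle_uniformly_continuous[OF cont(3) e(1)]) (rule that)
    obtain d4 where d4: "d4 > 0" "\<And>p q p' q'. (p, q) \<in> ?T \<Longrightarrow> (p', q') \<in> ?T \<Longrightarrow> \<bar>p - p'\<bar> < d4 \<Longrightarrow> \<bar>q - q'\<bar> < d4 \<Longrightarrow>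
        dist (w p q) (w p' q') < e"
      by (rule triangle_uniformly_continuous[OF cont(4) e(1)]) (rule that)
    define \<delta> where "\<delta> = min (min d1 d2) (min d3 d4)"
    have "\<bar>f p2 q * k (z p2 q) (w p2 q) - f p1 q * k (z p1 q) (w p1 q)
        - (p2 - p1) * (fp p1 q * k (z p1 q) (w p1 q)
            + f p1 q * (kz (z p1 q) (w p1 q) * \<beta>z p1 q + kw (z p1 q) (w p1 q) * \<beta>w p1 q))\<bar>
      \<le> L * (\<bar>z p2 q - z p1 q - (p2 - p1) * \<beta>z p1 q\<bar> + \<bar>w p2 q - w p1 q - (p2 - p1) * \<beta>w p1 q\<bar>) + \<epsilon> * (p2 - p1)"
      if *: "Q \<le> q" "q \<le> p1" "p1 \<le> p2" "p2 \<le> P" "p2 - p1 < \<delta>" for p1 p2 q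
    proof -
      define h where "h = p2 - p1"
      have h: "h \<ge> 0" using * by (simp add: h_def)
      have T: "(p1, q) \<in> ?T" "(p2, q) \<in> ?T" using * by auto
      define dz dw where "dz = z p2 q - z p1 q" and "dw = w p2 q - w p1 q"
      define ez ew where "ez = dz - h * \<beta>z p1 q" and "ew = dw - h * \<beta>w p1 q"
      define K1 K2 Kz Kw where "K1 = k (z p1 q) (w p1 q)" and "K2 = k (z p2 q) (w p2 q)"
        and "Kz = kz (z p1 q) (w p1 q)" and "Kw = kw (z p1 q) (w p1 q)"
      define rf where "rf = f p2 q - f p1 q - h * fp p1 q"
      define rk where "rk = K2 - K1 - Kz * dz - Kw * dw"
      have rf: "\<bar>rf\<bar> \<le> \<eta> * h" using d1(2)[rule_format, of q p1 p2] * by (auto simp: rf_def h_def \<delta>_def)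
      have dk: "\<bar>K2 - K1\<bar> \<le> \<eta>"
        using d2(2)[OF T(2,1)] d2(1) * by (auto simp: K1_def K2_def \<delta>_def dist_real_def)
      have "\<bar>dz\<bar> < e" "\<bar>dw\<bar> < e"
        using d3(2)[OF T(2,1)] d3(1) d4(2)[OF T(2,1)] d4(1) * by (auto simp: dz_def dw_def \<delta>_def dist_real_def)
      then have rk: "\<bar>rk\<bar> \<le> \<eta> * (\<bar>dz\<bar> + \<bar>dw\<bar>)"
        using e(2)[rule_format, of "z p1 q" "w p1 q" "z p2 q" "w p2 q"] box[OF T(1)] box[OF T(2)]
        by (simp add: rk_def dz_def dw_def K1_def K2_def Kz_def Kw_def)
      have dzw: "\<bar>dz\<bar> + \<bar>dw\<bar> \<le> (\<bar>ez\<bar> + \<bar>ew\<bar>) + h * (Bz + Bw)"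
      proof -
        have "\<bar>h * \<beta>z p1 q\<bar> \<le> h * Bz" "\<bar>h * \<beta>w p1 q\<bar> \<le> h * Bw"
          using Bz(2)[OF T(1)] Bw(2)[OF T(1)] h by (auto simp: abs_mult intro!: mult_left_mono)
        then show ?thesis by (simp add: ez_def ew_def algebra_simps)
      qed
      have eq: "f p2 q * K2 - f p1 q * K1 - h * (fp p1 q * K1 + f p1 q * (Kz * \<beta>z p1 q + Kw * \<beta>w p1 q))
          = K2 * rf + h * (fp p1 q * (K2 - K1)) + f p1 q * rk + f p1 q * (Kz * ez + Kw * ew)"
        by (simp add: rf_def rk_def ez_def ew_def algebra_simps)
      have t1: "\<bar>K2 * rf\<bar> \<le> Bk * (\<eta> * h)"
        unfolding abs_mult using Bk(2)[OF T(2)] rf Bk(1) by (intro mult_mono) (auto simp: K2_def)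
      have t2: "\<bar>h * (fp p1 q * (K2 - K1))\<bar> \<le> h * (Bp * \<eta>)"
        unfolding abs_mult using Bp(2)[OF T(1)] dk Bp(1) h by (intro mult_mono) auto
      have "\<eta> * (\<bar>dz\<bar> + \<bar>dw\<bar>) \<le> \<eta> * ((\<bar>ez\<bar> + \<bar>ew\<bar>) + h * (Bz + Bw))"
        using dzw \<eta> by (intro mult_left_mono) auto
      also have "\<dots> \<le> (\<bar>ez\<bar> + \<bar>ew\<bar>) + \<eta> * h * (Bz + Bw)"
        using \<eta> mult_right_mono[of \<eta> 1 "\<bar>ez\<bar> + \<bar>ew\<bar>"] by (simp add: distrib_left mult.assoc)
      finally have "\<bar>rk\<bar> \<le> (\<bar>ez\<bar> + \<bar>ew\<bar>) + \<eta> * h * (Bz + Bw)" using rk by simp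
      then have t3: "\<bar>f p1 q * rk\<bar> \<le> Bf * ((\<bar>ez\<bar> + \<bar>ew\<bar>) + \<eta> * h * (Bz + Bw))"
        unfolding abs_mult using Bf(2)[OF T(1)] Bf(1) by (intro mult_mono) auto
      have "\<bar>Kz * ez + Kw * ew\<bar> \<le> \<bar>Kz * ez\<bar> + \<bar>Kw * ew\<bar>" by (rule abs_triangle_ineq)
      also have "\<dots> \<le> (B1 + B2) * \<bar>ez\<bar> + (B1 + B2) * \<bar>ew\<bar>"
        unfolding abs_mult using B1(1) B2(1) B1(2)[OF T(1)] B2(2)[OF T(1)]
        by (intro add_mono mult_right_mono) (auto simp: Kz_def Kw_def)
      finally have "\<bar>Kz * ez + Kw * ew\<bar> \<le> (B1 + B2) * (\<bar>ez\<bar> + \<bar>ew\<bar>)" by (simp add: distrib_left)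
      then have t4: "\<bar>f p1 q * (Kz * ez + Kw * ew)\<bar> \<le> Bf * ((B1 + B2) * (\<bar>ez\<bar> + \<bar>ew\<bar>))"
        unfolding abs_mult using Bf(2)[OF T(1)] Bf(1) by (intro mult_mono) auto
      have "\<bar>f p2 q * K2 - f p1 q * K1 - h * (fp p1 q * K1 + f p1 q * (Kz * \<beta>z p1 q + Kw * \<beta>w p1 q))\<bar>
          \<le> Bk * (\<eta> * h) + h * (Bp * \<eta>) + Bf * ((\<bar>ez\<bar> + \<bar>ew\<bar>) + \<eta> * h * (Bz + Bw)) + Bf * ((B1 + B2) * (\<bar>ez\<bar> + \<bar>ew\<bar>))"
        unfolding eq using t1 t2 t3 t4 by linarith
      also have "\<dots> = L * (\<bar>ez\<bar> + \<bar>ew\<bar>) + (\<eta> * (D - 1)) * h"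
        by (simp add: L_def D_def algebra_simps)
      also have "(\<eta> * (D - 1)) * h \<le> \<epsilon> * h"
        using \<eta> h by (intro mult_right_mono) (auto simp: right_diff_distrib)
      finally show ?thesis
        by (simp add: h_def[symmetric] K1_def K2_def Kz_def Kw_def ez_def ew_def dz_def dw_def)
    qed
    moreover have "\<delta> > 0" using d1 d2 d3 d4 by (simp add: \<delta>_def)
    ultimately show "\<exists>\<delta>>0. \<forall>p1 p2 q. Q \<le> q \<and> q \<le> p1 \<and> p1 \<le> p2 \<and> p2 \<le> P \<and> p2 - p1 < \<delta> \<longrightarrow>
      \<bar>f p2 q * k (z p2 q) (w p2 q) - f p1 q * k (z p1 q) (w p1 q)
        - (p2 - p1) * (fp p1 q * k (z p1 q) (w p1 q)
            + f p1 q * (kz (z p1 q) (w p1 q) * \<beta>z p1 q + kw (z p1 q) (w p1 q) * \<beta>w p1 q))\<bar>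
      \<le> L * (\<bar>z p2 q - z p1 q - (p2 - p1) * \<beta>z p1 q\<bar> + \<bar>w p2 q - w p1 q - (p2 - p1) * \<beta>w p1 q\<bar>) + \<epsilon> * (p2 - p1)"
      by blast
    qed
  qed
qed

section \<open>Bounded Lipschitz functions and clamping\<close>

definition lipr :: "('a::metric_space \<Rightarrow> real) \<Rightarrow> bool" where
  "lipr f \<longleftrightarrow> (\<exists>L\<ge>0. \<forall>x y. \<bar>f x - f y\<bar> \<le> L * dist x y)"

text \<open>Boundedness is carried along because a product of Lipschitz functions is in general
  Lipschitz only if the factors are bounded.\<close>

definition blip :: "('a::metric_space \<Rightarrow> real) \<Rightarrow> bool" where
  "blip f \<longleftrightarrow> lipr f \<and> (\<exists>B\<ge>0. \<forall>x. \<bar>f x\<bar> \<le> B)"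

lemma lipr_const: "lipr (\<lambda>x. c)"
  unfolding lipr_def by (intro exI[of _ 0]) auto

lemma lipr_fst: "lipr f \<Longrightarrow> lipr (\<lambda>x. f (fst x))"
  unfolding lipr_def using dist_fst_le mult_left_mono order_trans by (metis (no_types, lifting))

lemma lipr_snd: "lipr f \<Longrightarrow> lipr (\<lambda>x. f (snd x))"
  unfolding lipr_def using dist_snd_le mult_left_mono order_trans by (metis (no_types, lifting))

lemma lipr_id: "lipr (\<lambda>x. x)"
  unfolding lipr_def by (intro exI[of _ 1]) (auto simp: dist_real_def)

lemma lipr_add:
  assumes "lipr f" "lipr g" shows "lipr (\<lambda>x. f x + g x)"
proof -
  obtain L L' where L: "L \<ge> 0" "\<forall>x y. \<bar>f x - f y\<bar> \<le> L * dist x y" "L' \<ge> 0" "\<forall>x y. \<bar>g x - g y\<bar> \<le> L' * dist x y"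
    using assms unfolding lipr_def by (elim exE conjE)
  have "\<bar>f x + g x - (f y + g y)\<bar> \<le> (L + L') * dist x y" for x y
  proof -
    have "\<bar>f x + g x - (f y + g y)\<bar> \<le> \<bar>f x - f y\<bar> + \<bar>g x - g y\<bar>" by linarith
    also have "\<dots> \<le> L * dist x y + L' * dist x y" using L by (intro add_mono) auto
    finally show ?thesis by (simp add: distrib_right)
  qed
  then show ?thesis unfolding lipr_def using L by (intro exI[of _ "L + L'"]) auto
qed

lemma lipr_minus: "lipr f \<Longrightarrow> lipr (\<lambda>x. - f x)"
  unfolding lipr_def by (simp add: abs_minus_commute)

lemma blip_const: "blip (\<lambda>x. c)"
  unfolding blip_def using lipr_const by (metis abs_ge_zero order_refl)

lemma blip_add:
  assumes "blip f" "blip g" shows "blip (\<lambda>x. f x + g x)"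
proof -
  obtain B B' where B: "B \<ge> 0" "\<forall>x. \<bar>f x\<bar> \<le> B" "B' \<ge> 0" "\<forall>x. \<bar>g x\<bar> \<le> B'"
    using assms unfolding blip_def by (elim exE conjE)
  then have "\<bar>f x + g x\<bar> \<le> B + B'" for x
    using abs_triangle_ineq[of "f x" "g x"] by (smt (verit))
  then have "\<exists>B\<ge>0. \<forall>x. \<bar>f x + g x\<bar> \<le> B" using B by (intro exI[of _ "B + B'"]) auto
  then show ?thesis using assms lipr_add unfolding blip_def by blast
qed

lemma blip_minus: "blip f \<Longrightarrow> blip (\<lambda>x. - f x)"
  unfolding blip_def using lipr_minus by auto

lemma blip_diff: "blip f \<Longrightarrow> blip g \<Longrightarrow> blip (\<lambda>x. f x - g x)"
  using blip_add[of f "\<lambda>x. - g x"] blip_minus[of g] by simp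

lemma blip_mult:
  assumes "blip f" "blip g" shows "blip (\<lambda>x. f x * g x)"
proof -
  obtain B B' where B: "B \<ge> 0" "\<forall>x. \<bar>f x\<bar> \<le> B" "B' \<ge> 0" "\<forall>x. \<bar>g x\<bar> \<le> B'"
    using assms unfolding blip_def by (elim exE conjE)
  obtain L L' where L: "L \<ge> 0" "\<forall>x y. \<bar>f x - f y\<bar> \<le> L * dist x y" "L' \<ge> 0" "\<forall>x y. \<bar>g x - g y\<bar> \<le> L' * dist x y"
    using assms unfolding blip_def lipr_def by (elim exE conjE)
  have "\<bar>f x * g x\<bar> \<le> B * B'" for x
    unfolding abs_mult using B by (intro mult_mono) auto
  moreover have "\<bar>f x * g x - f y * g y\<bar> \<le> (B * L' + B' * L) * dist x y" for x y
  proof -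
    have "f x * g x - f y * g y = f x * (g x - g y) + g y * (f x - f y)" by (simp add: algebra_simps)
    then have "\<bar>f x * g x - f y * g y\<bar> \<le> \<bar>f x\<bar> * \<bar>g x - g y\<bar> + \<bar>g y\<bar> * \<bar>f x - f y\<bar>"
      using abs_triangle_ineq[of "f x * (g x - g y)" "g y * (f x - f y)"] by (simp add: abs_mult)
    also have "\<dots> \<le> B * (L' * dist x y) + B' * (L * dist x y)"
      using B L by (intro add_mono mult_mono) auto
    finally show ?thesis by (simp add: algebra_simps)
  qed
  ultimately show ?thesis unfolding blip_def lipr_def
    using B L by (intro conjI exI[of _ "B * L' + B' * L"] exI[of _ "B * B'"]) auto
qed

lemma blip_inverse:
  assumes "blip g" and m: "m > 0" "\<And>x. m \<le> \<bar>g x\<bar>" shows "blip (\<lambda>x. inverse (g x))"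
proof -
  obtain L' where L: "L' \<ge> 0" "\<forall>x y. \<bar>g x - g y\<bar> \<le> L' * dist x y"
    using assms unfolding blip_def lipr_def by (elim exE conjE)
  have nz: "g x \<noteq> 0" for x using m(1) m(2)[of x] by auto
  have b: "\<bar>inverse (g x)\<bar> \<le> inverse m" for x
    unfolding abs_inverse using m by (intro le_imp_inverse_le) auto
  have "\<bar>inverse (g x) - inverse (g y)\<bar> \<le> (inverse m * inverse m * L') * dist x y" for x y
  proof -
    have "inverse (g x) - inverse (g y) = inverse (g x) * (g y - g x) * inverse (g y)"
      by (rule inverse_diff_inverse[OF nz nz, of x y, THEN trans]) (simp add: algebra_simps)
    then have "\<bar>inverse (g x) - inverse (g y)\<bar> = \<bar>inverse (g x)\<bar> * \<bar>inverse (g y)\<bar> * \<bar>g y - g x\<bar>"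
      by (simp only: abs_mult) simp
    also have "\<dots> \<le> inverse m * inverse m * (L' * dist y x)"
      using b m L by (intro mult_mono) auto
    finally show ?thesis by (simp add: dist_commute mult.assoc)
  qed
  then show ?thesis unfolding blip_def lipr_def
    using m L b by (intro conjI exI[of _ "inverse m * inverse m * L'"] exI[of _ "inverse m"]) auto
qed

lemma blip_divide:
  assumes "blip f" "blip g" and m: "m > 0" "\<And>x. m \<le> \<bar>g x\<bar>" shows "blip (\<lambda>x. f x / g x)"
  unfolding divide_inverse by (intro blip_mult assms(1) blip_inverse[OF assms(2) m])

definition clamp_real :: "real \<Rightarrow> real \<Rightarrow> real \<Rightarrow> real" where
  "clamp_real lo hi s = max lo (min hi s)"

lemma clamp_real_in: "lo \<le> hi \<Longrightarrow> clamp_real lo hi s \<in> {lo..hi}"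
  by (auto simp: clamp_real_def)

lemma clamp_real_id: "s \<in> {lo..hi} \<Longrightarrow> clamp_real lo hi s = s"
  by (auto simp: clamp_real_def)

lemma clamp_real_diff: "\<bar>clamp_real lo hi s - clamp_real lo hi s'\<bar> \<le> \<bar>s - s'\<bar>"
  by (auto simp: clamp_real_def max_def min_def)

lemma blip_clamp: "lipr f \<Longrightarrow> blip (\<lambda>x. clamp_real lo hi (f x))"
  unfolding blip_def lipr_def
proof (elim exE conjE, intro conjI)
  fix L assume L: "0 \<le> L" "\<forall>x y. \<bar>f x - f y\<bar> \<le> L * dist x y"
  show "\<exists>L\<ge>0. \<forall>x y. \<bar>clamp_real lo hi (f x) - clamp_real lo hi (f y)\<bar> \<le> L * dist x y"
    using L order_trans[OF clamp_real_diff] by blast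
  show "\<exists>B\<ge>0. \<forall>x. \<bar>clamp_real lo hi (f x)\<bar> \<le> B"
    by (intro exI[of _ "\<bar>lo\<bar> + \<bar>hi\<bar>"]) (auto simp: clamp_real_def max_def min_def)
qed

definition lip_box :: "real set \<Rightarrow> real set \<Rightarrow> (real \<Rightarrow> real \<Rightarrow> real) \<Rightarrow> bool" where
  "lip_box Z W k \<longleftrightarrow> (\<exists>L\<ge>0. \<forall>z\<in>Z. \<forall>w\<in>W. \<forall>z'\<in>Z. \<forall>w'\<in>W. \<bar>k z w - k z' w'\<bar> \<le> L * (\<bar>z - z'\<bar> + \<bar>w - w'\<bar>))"

lemma lip_box_bound:
  assumes "lip_box {zl..zu} {wl..wu} k" "zl \<le> zu" "wl \<le> wu"
  obtains B where "B \<ge> 0" "\<And>z w. z \<in> {zl..zu} \<Longrightarrow> w \<in> {wl..wu} \<Longrightarrow> \<bar>k z w\<bar> \<le> B"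
proof -
  obtain L where L: "L \<ge> 0" "\<forall>z\<in>{zl..zu}. \<forall>w\<in>{wl..wu}. \<forall>z'\<in>{zl..zu}. \<forall>w'\<in>{wl..wu}. \<bar>k z w - k z' w'\<bar> \<le> L * (\<bar>z - z'\<bar> + \<bar>w - w'\<bar>)"
    using assms(1) unfolding lip_box_def by (elim exE conjE)
  show ?thesis
  proof (rule that[of "\<bar>k zl wl\<bar> + L * ((zu - zl) + (wu - wl))"])
    show "\<bar>k zl wl\<bar> + L * ((zu - zl) + (wu - wl)) \<ge> 0" using L assms by simp
    fix z w assume zw: "z \<in> {zl..zu}" "w \<in> {wl..wu}"
    have "\<bar>k z w - k zl wl\<bar> \<le> L * (\<bar>z - zl\<bar> + \<bar>w - wl\<bar>)"
      by (rule L(2)[rule_format]) (use zw assms(2,3) in auto)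
    also have "\<dots> \<le> L * ((zu - zl) + (wu - wl))" using L zw by (intro mult_left_mono) auto
    finally show "\<bar>k z w\<bar> \<le> \<bar>k zl wl\<bar> + L * ((zu - zl) + (wu - wl))" by linarith
  qed
qed

text \<open>Lets coefficients that are controlled only on the rectangle enter the globally Lipschitz
  right-hand sides needed for Picard iteration.\<close>

lemma blip_box:
  assumes "lip_box {zl..zu} {wl..wu} k" and zw: "zl \<le> zu" "wl \<le> wu" and "lipr f" "lipr g"
  shows "blip (\<lambda>x. k (clamp_real zl zu (f x)) (clamp_real wl wu (g x)))"
proof -
  obtain L where L: "L \<ge> 0" "\<forall>z\<in>{zl..zu}. \<forall>w\<in>{wl..wu}. \<forall>z'\<in>{zl..zu}. \<forall>w'\<in>{wl..wu}. \<bar>k z w - k z' w'\<bar> \<le> L * (\<bar>z - z'\<bar> + \<bar>w - w'\<bar>)"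
    using assms(1) unfolding lip_box_def by (elim exE conjE)
  obtain Lf Lg where Lf: "Lf \<ge> 0" "\<forall>x y. \<bar>f x - f y\<bar> \<le> Lf * dist x y" and Lg: "Lg \<ge> 0" "\<forall>x y. \<bar>g x - g y\<bar> \<le> Lg * dist x y"
    using assms(4,5) unfolding lipr_def by (elim exE conjE)
  obtain B where B: "B \<ge> 0" "\<And>z w. z \<in> {zl..zu} \<Longrightarrow> w \<in> {wl..wu} \<Longrightarrow> \<bar>k z w\<bar> \<le> B"
    by (rule lip_box_bound[OF assms(1) zw]) (rule that)
  have "\<bar>k (clamp_real zl zu (f x)) (clamp_real wl wu (g x)) - k (clamp_real zl zu (f y)) (clamp_real wl wu (g y))\<bar>
      \<le> (L * (Lf + Lg)) * dist x y" for x y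
  proof -
    have "\<bar>k (clamp_real zl zu (f x)) (clamp_real wl wu (g x)) - k (clamp_real zl zu (f y)) (clamp_real wl wu (g y))\<bar>
        \<le> L * (\<bar>clamp_real zl zu (f x) - clamp_real zl zu (f y)\<bar> + \<bar>clamp_real wl wu (g x) - clamp_real wl wu (g y)\<bar>)"
      using L(2) clamp_real_in[OF zw(1)] clamp_real_in[OF zw(2)] by simp
    also have "\<dots> \<le> L * (Lf * dist x y + Lg * dist x y)"
      using L(1) Lf(2) Lg(2) by (intro mult_left_mono add_mono order_trans[OF clamp_real_diff]) auto
    finally show ?thesis by (simp add: algebra_simps)
  qed
  moreover have "\<bar>k (clamp_real zl zu (f x)) (clamp_real wl wu (g x))\<bar> \<le> B" for x
    using B clamp_real_in[OF zw(1)] clamp_real_in[OF zw(2)] by simp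
  ultimately show ?thesis unfolding blip_def lipr_def
    using B L Lf Lg by (intro conjI exI[of _ "L * (Lf + Lg)"] exI[of _ B]) auto
qed

lemma lipr_lipschitz: "lipr f \<Longrightarrow> \<exists>L. L-lipschitz_on UNIV f"
  unfolding lipr_def lipschitz_on_def by (auto simp: dist_real_def)

lemma lipschitz_Pair_ex:
  assumes "\<exists>L. L-lipschitz_on UNIV f" "\<exists>L. L-lipschitz_on UNIV g"
  shows "\<exists>L. L-lipschitz_on UNIV (\<lambda>x. (f x, g x))"
  using assms lipschitz_on_Pair by blast

lemma lipr_continuous_on: "lipr f \<Longrightarrow> continuous_on S f"
  using lipr_lipschitz lipschitz_on_continuous_on continuous_on_subset by blast

text \<open>\<open>(f s)\<^sup>2 * exp (2 * B * s)\<close> is nondecreasing and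
  \<open>(f s)\<^sup>2 * exp (- 2 * B * s)\<close> nonincreasing, so \<open>f\<close> vanishes on
  neither side of \<open>s0\<close>; the intermediate value theorem then fixes the sign.\<close>

lemma sign_preserved:
  fixes f f' :: "real \<Rightarrow> real"
  assumes f: "\<And>s. (f has_real_derivative f' s) (at s)" and b: "\<And>s. \<bar>f' s\<bar> \<le> B * \<bar>f s\<bar>"
    and s0: "f s0 > 0"
  shows "f s > 0"
proof -
  have g: "((\<lambda>s. (f s)\<^sup>2 * exp (c * s)) has_real_derivative (2 * f s * f' s + c * (f s)\<^sup>2) * exp (c * s)) (at s)" for c s
    by (auto intro!: derivative_eq_intros f simp: power2_eq_square algebra_simps)
  have b2: "\<bar>2 * f s * f' s\<bar> \<le> 2 * B * (f s)\<^sup>2" for s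
  proof -
    have "\<bar>f s\<bar> * \<bar>f' s\<bar> \<le> \<bar>f s\<bar> * (B * \<bar>f s\<bar>)" by (intro mult_left_mono b) simp
    also have "\<dots> = B * (f s)\<^sup>2" by (simp add: power2_eq_square)
    finally show ?thesis by (simp add: abs_mult)
  qed
  have nz: "f s \<noteq> 0" for s
  proof (cases "s0 \<le> s")
    case True
    have "(f s0)\<^sup>2 * exp (2 * B * s0) \<le> (f s)\<^sup>2 * exp (2 * B * s)"
    proof (rule DERIV_nonneg_imp_nondecreasing[OF True])
      fix t
      have "2 * f t * f' t + 2 * B * (f t)\<^sup>2 \<ge> 0" using b2[of t] by linarith
      then show "\<exists>y. ((\<lambda>s. (f s)\<^sup>2 * exp (2 * B * s)) has_real_derivative y) (at t) \<and> 0 \<le> y"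
        by (intro exI[of _ "(2 * f t * f' t + 2 * B * (f t)\<^sup>2) * exp (2 * B * t)"] conjI g) simp
    qed
    moreover have "(f s0)\<^sup>2 * exp (2 * B * s0) > 0" using s0 by simp
    ultimately show ?thesis by auto
  next
    case False
    then have le: "s \<le> s0" by simp
    have "(f s0)\<^sup>2 * exp (- 2 * B * s0) \<le> (f s)\<^sup>2 * exp (- 2 * B * s)"
    proof (rule DERIV_nonpos_imp_nonincreasing[OF le])
      fix t
      have "2 * f t * f' t + - 2 * B * (f t)\<^sup>2 \<le> 0" using b2[of t] by (simp add: abs_le_iff)
      then show "\<exists>y. ((\<lambda>s. (f s)\<^sup>2 * exp (- 2 * B * s)) has_real_derivative y) (at t) \<and> y \<le> 0"
        by (intro exI[of _ "(2 * f t * f' t + - 2 * B * (f t)\<^sup>2) * exp (- 2 * B * t)"] conjI g)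
          (simp add: mult_nonpos_nonneg)
    qed
    moreover have "(f s0)\<^sup>2 * exp (- 2 * B * s0) > 0" using s0 by simp
    ultimately show ?thesis by auto
  qed
  show ?thesis
  proof (rule ccontr)
    assume "\<not> f s > 0"
    then have neg: "f s < 0" using nz[of s] by simp
    have cont: "isCont f t" for t using f DERIV_isCont by blast
    show False
    proof (cases "s \<le> s0")
      case True
      then have "\<exists>t. s \<le> t \<and> t \<le> s0 \<and> f t = 0" using IVT[of f s 0 s0] neg s0 cont by auto
      then show False using nz by blast
    next
      case False
      then have "\<exists>t. s0 \<le> t \<and> t \<le> s \<and> f t = 0" using IVT2[of f s 0 s0] neg s0 cont by auto
      then show False using nz by blast
    qed
  qed
qed

section \<open>The system in characteristic coordinates\<close>

text \<open>The system is \<open>z\<^sub>x + m1 z\<^sub>t = k1 a\<close>, \<open>w\<^sub>x + m2 w\<^sub>t = k2 a\<close> with \<open>m1, m2\<close> the reciprocal speeds. The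
  unknowns \<open>ze = (m2 - m1) z\<^sub>t\<close> and \<open>om = (m1 - m2) w\<^sub>t\<close> measure how far \<open>z\<^sub>p / x\<^sub>p\<close> is from \<open>k1 a\<close> and \<open>w\<^sub>q / x\<^sub>q\<close> from \<open>k2 a\<close>.
  Eliminating \<open>t\<close> from \<open>t\<^sub>p = m2 x\<^sub>p\<close>, \<open>t\<^sub>q = m1 x\<^sub>q\<close> yields \<open>x\<^sub>p\<^sub>q = x\<^sub>p x\<^sub>q hco\<close>, and no derivative of \<open>a\<close>
  enters the equations.\<close>

locale char_coeffs =
  fixes m1 m2 k1 k2 m1z m1w m2z m2w k1z k1w k2z k2w :: "real \<Rightarrow> real \<Rightarrow> real"
begin

definition hco :: "real \<Rightarrow> real \<Rightarrow> real \<Rightarrow> real \<Rightarrow> real \<Rightarrow> real" where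
  "hco A z w ze om = (A * (k1 z w * (m2z z w - m1z z w) + k2 z w * (m2w z w - m1w z w))
     + m2w z w * om - m1z z w * ze) / (m1 z w - m2 z w)"

definition zrate :: "real \<Rightarrow> real \<Rightarrow> real \<Rightarrow> real \<Rightarrow> real \<Rightarrow> real" where
  "zrate A z w ze om = A * (k1z z w * ze - k1w z w * om) - ze * hco A z w ze om"

definition wrate :: "real \<Rightarrow> real \<Rightarrow> real \<Rightarrow> real \<Rightarrow> real \<Rightarrow> real" where
  "wrate A z w ze om = A * (k2w z w * om - k2z z w * ze) - om * hco A z w ze om"

end

locale char_data = char_coeffs +
  fixes a a' z0 z0' w0 w0' :: "real \<Rightarrow> real"
begin

text \<open>At t = 0 the equation z_x + m1 z_t = k1 a determines z_t from the data; this is the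
  resulting value of (m2 - m1) z_t.\<close>

definition ze_init :: "real \<Rightarrow> real" where
  "ze_init x = (z0' x - k1 (z0 x) (w0 x) * a x) * (m1 (z0 x) (w0 x) - m2 (z0 x) (w0 x)) / m1 (z0 x) (w0 x)"

definition om_init :: "real \<Rightarrow> real" where
  "om_init x = - ((w0' x - k2 (z0 x) (w0 x) * a x) * (m1 (z0 x) (w0 x) - m2 (z0 x) (w0 x)) / m2 (z0 x) (w0 x))"

end

text \<open>The nozzle problem is hidden behind abstract coefficients, and what it has to deliver
  are \<open>apriori1\<close> and \<open>apriori2\<close>. Each concerns a single characteristic run
  forward in time from the initial line, so that x decreases. Weak bounds along the whole curve must
  come out strict at its end; this strictness excludes a first failure.\<close>

locale char_system = char_data +
  fixes zl zu wl wu K b1 b2 m ca ca' :: real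
  assumes a_deriv: "\<And>x. x \<ge> 0 \<Longrightarrow> (a has_real_derivative a' x) (at x within {0..})"
    and a'_cont: "continuous_on {0..} a'"
    and a_bound: "\<And>x. x \<ge> 0 \<Longrightarrow> \<bar>a x\<bar> \<le> ca" "\<And>x. x \<ge> 0 \<Longrightarrow> \<bar>a' x\<bar> \<le> ca'"
    and zlu: "zl \<le> zu" and wlu: "wl \<le> wu"
    and C1_m1: "C1_box {zl..zu} {wl..wu} m1 m1z m1w" and C1_m2: "C1_box {zl..zu} {wl..wu} m2 m2z m2w"
    and C1_k1: "C1_box {zl..zu} {wl..wu} k1 k1z k1w" and C1_k2: "C1_box {zl..zu} {wl..wu} k2 k2z k2w"
    and lip: "lip_box {zl..zu} {wl..wu} m1" "lip_box {zl..zu} {wl..wu} m2"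
      "lip_box {zl..zu} {wl..wu} k1" "lip_box {zl..zu} {wl..wu} k2"
      "lip_box {zl..zu} {wl..wu} m1z" "lip_box {zl..zu} {wl..wu} m1w"
      "lip_box {zl..zu} {wl..wu} m2z" "lip_box {zl..zu} {wl..wu} m2w"
      "lip_box {zl..zu} {wl..wu} k1z" "lip_box {zl..zu} {wl..wu} k1w"
      "lip_box {zl..zu} {wl..wu} k2z" "lip_box {zl..zu} {wl..wu} k2w"
    and b1: "b1 > 0" and m: "m > 0"
    and speeds: "\<And>z w. z \<in> {zl..zu} \<Longrightarrow> w \<in> {wl..wu} \<Longrightarrow> - b2 \<le> m2 z w \<and> m1 z w \<le> - b1 \<and> m \<le> m1 z w - m2 z w"
    and z0_deriv: "\<And>x. x \<ge> 0 \<Longrightarrow> (z0 has_real_derivative z0' x) (at x within {0..})"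
    and w0_deriv: "\<And>x. x \<ge> 0 \<Longrightarrow> (w0 has_real_derivative w0' x) (at x within {0..})"
    and z0'_cont: "continuous_on {0..} z0'" and w0'_cont: "continuous_on {0..} w0'"
    and data_box: "\<And>x. x \<ge> 0 \<Longrightarrow> z0 x \<in> {zl..zu} \<and> w0 x \<in> {wl..wu}"
    and K: "K \<ge> 0"
    and data_K: "\<And>x. x \<ge> 0 \<Longrightarrow> \<bar>ze_init x\<bar> \<le> K \<and> \<bar>om_init x\<bar> \<le> K"
    and apriori1: "\<And>l x x' z w ze om. 0 \<le> l \<Longrightarrow>
      (\<And>s. s \<in> {0..l} \<Longrightarrow> 0 \<le> x s \<and> z s \<in> {zl..zu} \<and> w s \<in> {wl..wu} \<and> \<bar>ze s\<bar> \<le> K \<and> \<bar>om s\<bar> \<le> K \<and> x' s < 0 \<and>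
        (x has_real_derivative x' s) (at s within {0..l}) \<and>
        (z has_real_derivative x' s * (k1 (z s) (w s) * a (x s))) (at s within {0..l}) \<and>
        (w has_real_derivative x' s * (k2 (z s) (w s) * a (x s) + om s)) (at s within {0..l}) \<and>
        (ze has_real_derivative x' s * zrate (a (x s)) (z s) (w s) (ze s) (om s)) (at s within {0..l})) \<Longrightarrow>
      z 0 = z0 (x 0) \<Longrightarrow> w 0 = w0 (x 0) \<Longrightarrow> ze 0 = ze_init (x 0) \<Longrightarrow> zl < z l \<and> z l < zu \<and> \<bar>ze l\<bar> < K"
    and apriori2: "\<And>l x x' z w ze om. 0 \<le> l \<Longrightarrow>
      (\<And>s. s \<in> {0..l} \<Longrightarrow> 0 \<le> x s \<and> z s \<in> {zl..zu} \<and> w s \<in> {wl..wu} \<and> \<bar>ze s\<bar> \<le> K \<and> \<bar>om s\<bar> \<le> K \<and> x' s < 0 \<and>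
        (x has_real_derivative x' s) (at s within {0..l}) \<and>
        (z has_real_derivative x' s * (k1 (z s) (w s) * a (x s) + ze s)) (at s within {0..l}) \<and>
        (w has_real_derivative x' s * (k2 (z s) (w s) * a (x s))) (at s within {0..l}) \<and>
        (om has_real_derivative x' s * wrate (a (x s)) (z s) (w s) (ze s) (om s)) (at s within {0..l})) \<Longrightarrow>
      z 0 = z0 (x 0) \<Longrightarrow> w 0 = w0 (x 0) \<Longrightarrow> om 0 = om_init (x 0) \<Longrightarrow> wl < w l \<and> w l < wu \<and> \<bar>om l\<bar> < K"
begin

text \<open>\<open>b2 / m\<close> bounds the initial weights and, after an exponential correction,
  x_p and x_q wherever x is nonnegative; the 1 makes the bounds strict.\<close>

definition KX :: real where "KX = b2 / m + 1"

definition Hs :: "real \<Rightarrow> real \<Rightarrow> real \<Rightarrow> real \<Rightarrow> real \<Rightarrow> real" where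
  "Hs x z w ze om = hco (a (max 0 x)) (clamp_real zl zu z) (clamp_real wl wu w) (clamp_real (-K) K ze) (clamp_real (-K) K om)"

text \<open>The clamps for \<open>X\<close> and \<open>Y\<close> end at 0, so they do not increase
  absolute values. Hence this is at most a constant times \<open>\<bar>X\<bar>\<close> and times
  \<open>\<bar>Y\<bar>\<close>, and neither can change sign.\<close>

definition Ss :: "real \<Rightarrow> real \<Rightarrow> real \<Rightarrow> real \<Rightarrow> real \<Rightarrow> real \<Rightarrow> real \<Rightarrow> real" where
  "Ss x z w X ze Y om = clamp_real (-KX) 0 X * clamp_real 0 KX Y * Hs x z w ze om"

definition Fz :: "real \<Rightarrow> real \<Rightarrow> real \<Rightarrow> real \<Rightarrow> real" where
  "Fz x z w Y = clamp_real 0 KX Y * (k1 (clamp_real zl zu z) (clamp_real wl wu w) * a (max 0 x))"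

definition Fw :: "real \<Rightarrow> real \<Rightarrow> real \<Rightarrow> real \<Rightarrow> real \<Rightarrow> real" where
  "Fw x z w Y om = clamp_real 0 KX Y * (k2 (clamp_real zl zu z) (clamp_real wl wu w) * a (max 0 x) + clamp_real (-K) K om)"

definition Fze :: "real \<Rightarrow> real \<Rightarrow> real \<Rightarrow> real \<Rightarrow> real \<Rightarrow> real \<Rightarrow> real" where
  "Fze x z w ze Y om = clamp_real 0 KX Y *
     zrate (a (max 0 x)) (clamp_real zl zu z) (clamp_real wl wu w) (clamp_real (-K) K ze) (clamp_real (-K) K om)"

definition Fom :: "real \<Rightarrow> real \<Rightarrow> real \<Rightarrow> real \<Rightarrow> real \<Rightarrow> real \<Rightarrow> real" where
  "Fom x z w X ze om = clamp_real (-KX) 0 X *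
     wrate (a (max 0 x)) (clamp_real zl zu z) (clamp_real wl wu w) (clamp_real (-K) K ze) (clamp_real (-K) K om)"

lemma a_lipschitz: "x \<ge> 0 \<Longrightarrow> y \<ge> 0 \<Longrightarrow> \<bar>a y - a x\<bar> \<le> ca' * \<bar>y - x\<bar>"
  using mean_value_linearization_real[of 0 "max x y" a a' x y 0 ca'] a_bound(2)
    DERIV_subset[OF a_deriv, of _ "{0..max x y}"] by auto

lemma blip_a: assumes "lipr f" shows "blip (\<lambda>s. a (max 0 (f s)))"
proof -
  obtain L where L: "L \<ge> 0" "\<forall>x y. \<bar>f x - f y\<bar> \<le> L * dist x y" using assms unfolding lipr_def by (elim exE conjE)
  have ca: "ca \<ge> 0" "ca' \<ge> 0" using a_bound[of 0] by auto
  have "\<bar>a (max 0 (f s)) - a (max 0 (f t))\<bar> \<le> (ca' * L) * dist s t" for s t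
  proof -
    have "\<bar>a (max 0 (f s)) - a (max 0 (f t))\<bar> \<le> ca' * \<bar>max 0 (f s) - max 0 (f t)\<bar>"
      by (rule a_lipschitz) auto
    also have "\<dots> \<le> ca' * (L * dist s t)"
      using ca L(2)[rule_format, of s t] by (intro mult_left_mono) (auto simp: max_def)
    finally show ?thesis by simp
  qed
  then show ?thesis unfolding blip_def lipr_def
    using ca L a_bound(1) by (intro conjI exI[of _ "ca' * L"] exI[of _ ca]) auto
qed

lemma b2_pos: "b2 > 0"
  using speeds[of zl wl] zlu wlu m b1 by auto

lemma KX_pos: "KX > 0"
  using b2_pos m by (simp add: KX_def add_pos_pos)

lemmas blip_intros = blip_add blip_minus blip_diff blip_mult blip_const blip_clamp blip_a
  lip[THEN blip_box[OF _ zlu wlu]]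

lemma blip_Hs:
  assumes "lipr x" "lipr z" "lipr w" "lipr ze" "lipr om"
  shows "blip (\<lambda>s. Hs (x s) (z s) (w s) (ze s) (om s))"
  unfolding Hs_def hco_def
proof (rule blip_divide[OF _ _ m])
  show "m \<le> \<bar>m1 (clamp_real zl zu (z s)) (clamp_real wl wu (w s)) - m2 (clamp_real zl zu (z s)) (clamp_real wl wu (w s))\<bar>" for s
    using speeds[OF clamp_real_in[OF zlu] clamp_real_in[OF wlu], of "z s" "w s"] by auto
qed (intro blip_intros assms)+

lemma blip_rhs:
  assumes "lipr x" "lipr z" "lipr w" "lipr X" "lipr ze" "lipr Y" "lipr om"
  shows "blip (\<lambda>s. Ss (x s) (z s) (w s) (X s) (ze s) (Y s) (om s))"
    "blip (\<lambda>s. Fz (x s) (z s) (w s) (Y s))" "blip (\<lambda>s. Fw (x s) (z s) (w s) (Y s) (om s))"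
    "blip (\<lambda>s. Fze (x s) (z s) (w s) (ze s) (Y s) (om s))" "blip (\<lambda>s. Fom (x s) (z s) (w s) (X s) (ze s) (om s))"
  unfolding Ss_def Fz_def Fw_def Fze_def Fom_def zrate_def wrate_def Hs_def[symmetric]
  by (intro blip_intros blip_Hs assms)+

end

text \<open>\<open>X\<close> and \<open>Y\<close> stand for \<open>x\<^sub>p\<close> and \<open>x\<^sub>q\<close>; that \<open>X\<close> really is \<open>x\<^sub>p\<close> has to be proved. The initial line
  \<open>t = 0\<close> is the diagonal, labelled by \<open>x = ln (1 + CH p) / CH\<close> since then \<open>-KX < X\<close> and \<open>Y < KX\<close> persist.\<close>

locale char_picard = char_system +
  fixes CH :: real and x z w X ze Y om :: "real \<Rightarrow> real \<Rightarrow> real"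
  assumes CH: "CH > 0"
    and CH_bound: "\<And>x z w ze om. \<bar>Hs x z w ze om\<bar> \<le> CH"
    and cont_x: "continuous_on UNIV (\<lambda>(p, q). x p q)" and cont_z: "continuous_on UNIV (\<lambda>(p, q). z p q)"
    and cont_w: "continuous_on UNIV (\<lambda>(p, q). w p q)" and cont_X: "continuous_on UNIV (\<lambda>(p, q). X p q)"
    and cont_ze: "continuous_on UNIV (\<lambda>(p, q). ze p q)" and cont_Y: "continuous_on UNIV (\<lambda>(p, q). Y p q)"
    and cont_om: "continuous_on UNIV (\<lambda>(p, q). om p q)"
    and cont_S: "continuous_on UNIV (\<lambda>(p, q). Ss (x p q) (z p q) (w p q) (X p q) (ze p q) (Y p q) (om p q))"
    and x_diag: "\<And>p. p \<ge> 0 \<Longrightarrow> x p p = ln (1 + CH * p) / CH"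
    and z_diag: "\<And>p. p \<ge> 0 \<Longrightarrow> z p p = z0 (x p p)" and w_diag: "\<And>p. p \<ge> 0 \<Longrightarrow> w p p = w0 (x p p)"
    and X_diag: "\<And>p. p \<ge> 0 \<Longrightarrow> X p p = m1 (z p p) (w p p) / (m1 (z p p) (w p p) - m2 (z p p) (w p p)) / (1 + CH * p)"
    and Y_diag: "\<And>p. p \<ge> 0 \<Longrightarrow> Y p p = - m2 (z p p) (w p p) / (m1 (z p p) (w p p) - m2 (z p p) (w p p)) / (1 + CH * p)"
    and ze_diag: "\<And>p. p \<ge> 0 \<Longrightarrow> ze p p = ze_init (x p p)" and om_diag: "\<And>p. p \<ge> 0 \<Longrightarrow> om p p = om_init (x p p)"
    and x_q: "\<And>p q. ((\<lambda>q. x p q) has_real_derivative Y p q) (at q)"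
    and z_q0: "\<And>p q. ((\<lambda>q. z p q) has_real_derivative Fz (x p q) (z p q) (w p q) (Y p q)) (at q)"
    and w_q0: "\<And>p q. ((\<lambda>q. w p q) has_real_derivative Fw (x p q) (z p q) (w p q) (Y p q) (om p q)) (at q)"
    and X_q: "\<And>p q. ((\<lambda>q. X p q) has_real_derivative Ss (x p q) (z p q) (w p q) (X p q) (ze p q) (Y p q) (om p q)) (at q)"
    and ze_q0: "\<And>p q. ((\<lambda>q. ze p q) has_real_derivative Fze (x p q) (z p q) (w p q) (ze p q) (Y p q) (om p q)) (at q)"
    and Y_p: "\<And>p q. ((\<lambda>p. Y p q) has_real_derivative Ss (x p q) (z p q) (w p q) (X p q) (ze p q) (Y p q) (om p q)) (at p)"
    and om_p0: "\<And>p q. ((\<lambda>p. om p q) has_real_derivative Fom (x p q) (z p q) (w p q) (X p q) (ze p q) (om p q)) (at p)"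

context char_system begin

lemma continuous_on_half_line:
  assumes "\<And>x. x \<ge> 0 \<Longrightarrow> (f has_real_derivative f' x) (at x within {0..})"
  shows "continuous_on {0..} f"
  unfolding continuous_on_eq_continuous_within using assms DERIV_continuous by fastforce

lemma continuous_data_box:
  assumes "C1_box {zl..zu} {wl..wu} k kz kw"
  shows "continuous_on {0..} (\<lambda>x. k (z0 x) (w0 x))"
proof -
  have "continuous_on {0..} (\<lambda>x. (z0 x, w0 x))"
    by (intro continuous_on_Pair continuous_on_half_line[OF z0_deriv] continuous_on_half_line[OF w0_deriv])
  moreover have "(\<lambda>x. (z0 x, w0 x)) ` {0..} \<subseteq> {zl..zu} \<times> {wl..wu}" using data_box by auto
  ultimately show ?thesis
    using continuous_on_compose2[OF C1_box_continuous[OF assms]] by fastforce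
qed

text \<open>The first family collects the quantities with an equation in q (x, z, w, X, ze), the
  second those with an equation in p (Y, om). X_q and Y_p share the right-hand side
  \<open>Ss\<close>, as two expressions for x_pq must.\<close>

lemma picard_exists:
  obtains CH x z w X ze Y om where
    "char_picard m1 m2 k1 k2 m1z m1w m2z m2w k1z k1w k2z k2w a a' z0 z0' w0 w0' zl zu wl wu K b1 b2 m ca ca' CH x z w X ze Y om"
proof -
  have lipr_proj: "lipr (\<lambda>s :: (real \<times> real \<times> real \<times> real \<times> real) \<times> (real \<times> real). fst (fst s))"
    "lipr (\<lambda>s :: (real \<times> real \<times> real \<times> real \<times> real) \<times> (real \<times> real). fst (snd (fst s)))"
    "lipr (\<lambda>s :: (real \<times> real \<times> real \<times> real \<times> real) \<times> (real \<times> real). fst (snd (snd (fst s))))"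
    "lipr (\<lambda>s :: (real \<times> real \<times> real \<times> real \<times> real) \<times> (real \<times> real). fst (snd (snd (snd (fst s)))))"
    "lipr (\<lambda>s :: (real \<times> real \<times> real \<times> real \<times> real) \<times> (real \<times> real). snd (snd (snd (snd (fst s)))))"
    "lipr (\<lambda>s :: (real \<times> real \<times> real \<times> real \<times> real) \<times> (real \<times> real). fst (snd s))"
    "lipr (\<lambda>s :: (real \<times> real \<times> real \<times> real \<times> real) \<times> (real \<times> real). snd (snd s))"
    by (rule lipr_fst[OF lipr_fst[OF lipr_id]] lipr_fst[OF lipr_snd[OF lipr_fst[OF lipr_id]]]
        lipr_fst[OF lipr_snd[OF lipr_snd[OF lipr_fst[OF lipr_id]]]]
        lipr_fst[OF lipr_snd[OF lipr_snd[OF lipr_snd[OF lipr_fst[OF lipr_id]]]]]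
        lipr_fst[OF lipr_snd[OF lipr_snd[OF lipr_snd[OF lipr_snd[OF lipr_id]]]]]
        lipr_snd[OF lipr_fst[OF lipr_id]] lipr_snd[OF lipr_snd[OF lipr_id]])+
  define Sx Sz Sw SX Sze SY Som :: "(real \<times> real \<times> real \<times> real \<times> real) \<times> (real \<times> real) \<Rightarrow> real"
    where "Sx s = fst (fst s)" and "Sz s = fst (snd (fst s))" and "Sw s = fst (snd (snd (fst s)))"
      and "SX s = fst (snd (snd (snd (fst s))))" and "Sze s = snd (snd (snd (snd (fst s))))"
      and "SY s = fst (snd s)" and "Som s = snd (snd s)" for s
  have ls: "lipr Sx" "lipr Sz" "lipr Sw" "lipr SX" "lipr Sze" "lipr SY" "lipr Som"
    unfolding Sx_def[abs_def] Sz_def[abs_def] Sw_def[abs_def] SX_def[abs_def] Sze_def[abs_def] SY_def[abs_def] Som_def[abs_def]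
    by (rule lipr_proj)+
  note rhs = blip_rhs[OF ls]
  define f where "f s = (SY s, Fz (Sx s) (Sz s) (Sw s) (SY s), Fw (Sx s) (Sz s) (Sw s) (SY s) (Som s),
     Ss (Sx s) (Sz s) (Sw s) (SX s) (Sze s) (SY s) (Som s), Fze (Sx s) (Sz s) (Sw s) (Sze s) (SY s) (Som s))" for s
  define g where "g s = (Ss (Sx s) (Sz s) (Sw s) (SX s) (Sze s) (SY s) (Som s), Fom (Sx s) (Sz s) (Sw s) (SX s) (Sze s) (Som s))" for s
  have rl: "lipr (\<lambda>s. Ss (Sx s) (Sz s) (Sw s) (SX s) (Sze s) (SY s) (Som s))" "lipr (\<lambda>s. Fz (Sx s) (Sz s) (Sw s) (SY s))"
    "lipr (\<lambda>s. Fw (Sx s) (Sz s) (Sw s) (SY s) (Som s))" "lipr (\<lambda>s. Fze (Sx s) (Sz s) (Sw s) (Sze s) (SY s) (Som s))"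
    "lipr (\<lambda>s. Fom (Sx s) (Sz s) (Sw s) (SX s) (Sze s) (Som s))"
    using rhs unfolding blip_def by blast+
  obtain Lf where Lf: "Lf-lipschitz_on UNIV f"
    using lipschitz_Pair_ex[OF lipr_lipschitz[OF ls(6)] lipschitz_Pair_ex[OF lipr_lipschitz[OF rl(2)]
        lipschitz_Pair_ex[OF lipr_lipschitz[OF rl(3)] lipschitz_Pair_ex[OF lipr_lipschitz[OF rl(1)] lipr_lipschitz[OF rl(4)]]]]]
    unfolding f_def[abs_def] by (elim exE)
  obtain Lg where Lg: "Lg-lipschitz_on UNIV g"
    using lipschitz_Pair_ex[OF lipr_lipschitz[OF rl(1)] lipr_lipschitz[OF rl(5)]] unfolding g_def[abs_def] by (elim exE)
  have L: "(max Lf Lg)-lipschitz_on UNIV f" "(max Lf Lg)-lipschitz_on UNIV g"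
    using lipschitz_on_le[OF Lf] lipschitz_on_le[OF Lg] by simp_all
  have "blip (\<lambda>s. Hs (Sx s) (Sz s) (Sw s) (Sze s) (Som s))" by (rule blip_Hs[OF ls(1,2,3,5,7)])
  then obtain CH0 where CH0_all: "\<forall>s. \<bar>Hs (Sx s) (Sz s) (Sw s) (Sze s) (Som s)\<bar> \<le> CH0"
    unfolding blip_def by (elim conjE exE)
  have CH0: "\<bar>Hs x z w ze om\<bar> \<le> CH0" for x z w ze om
    using CH0_all[rule_format, of "((x, z, w, 0, ze), (0, om))"]
    by (simp add: Sx_def Sz_def Sw_def Sze_def Som_def)
  define CH where "CH = CH0 + 1"
  have CH: "CH > 0" "\<And>x z w ze om. \<bar>Hs x z w ze om\<bar> \<le> CH"
  proof -
    show "CH > 0" using CH0[of 0 0 0 0 0] by (simp add: CH_def)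
    show "\<bar>Hs x z w ze om\<bar> \<le> CH" for x z w ze om using CH0[of x z w ze om] by (simp add: CH_def)
  qed
  \<comment> \<open>The iteration runs on the whole plane, so \<open>max 0\<close> gives negative
    labels the data of label 0; the diagonal conditions are claimed for p \<ge> 0.\<close>
  define phi where "phi p = ln (1 + CH * max 0 p) / CH" for p
  have pos: "1 + CH * max 0 p > 0" for p using CH(1) by (simp add: add_pos_nonneg)
  have phi0: "phi p \<ge> 0" for p using CH(1) by (simp add: phi_def)
  have phi_cont: "continuous_on UNIV phi"
    unfolding phi_def[abs_def] using pos CH(1) by (intro continuous_intros) (auto simp: less_imp_neq[symmetric])
  define Rt where "Rt p = m1 (z0 (phi p)) (w0 (phi p)) / (m1 (z0 (phi p)) (w0 (phi p)) - m2 (z0 (phi p)) (w0 (phi p))) / (1 + CH * max 0 p)" for p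
  define Rs where "Rs p = - m2 (z0 (phi p)) (w0 (phi p)) / (m1 (z0 (phi p)) (w0 (phi p)) - m2 (z0 (phi p)) (w0 (phi p))) / (1 + CH * max 0 p)" for p
  define u0 where "u0 p = (phi p, z0 (phi p), w0 (phi p), Rt p, ze_init (phi p))" for p
  define v0 where "v0 p = (Rs p, om_init (phi p))" for p
  have cphi: "continuous_on UNIV (\<lambda>p. h (phi p))" if "continuous_on {0..} h" for h :: "real \<Rightarrow> real"
    by (rule continuous_on_compose2[OF that phi_cont]) (use phi0 in auto)
  have cdata: "continuous_on {0..} z0" "continuous_on {0..} w0" "continuous_on {0..} a"
    by (rule continuous_on_half_line[OF z0_deriv] continuous_on_half_line[OF w0_deriv] continuous_on_half_line[OF a_deriv]; simp)+
  note ck = continuous_data_box[OF C1_m1] continuous_data_box[OF C1_m2] continuous_data_box[OF C1_k1] continuous_data_box[OF C1_k2]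
  have nz: "m1 (z0 s) (w0 s) \<noteq> 0" "m2 (z0 s) (w0 s) \<noteq> 0" "m1 (z0 s) (w0 s) - m2 (z0 s) (w0 s) \<noteq> 0" if "s \<ge> 0" for s
    using speeds[of "z0 s" "w0 s"] data_box[OF that] b1 m by auto
  have cinit: "continuous_on {0..} ze_init" "continuous_on {0..} om_init"
    unfolding ze_init_def[abs_def] om_init_def[abs_def] using nz
    by (auto intro!: continuous_intros ck cdata z0'_cont w0'_cont)
  have u0_cont: "continuous_on UNIV u0"
    unfolding u0_def[abs_def] Rt_def using nz phi0 pos
    by (intro continuous_intros phi_cont cphi[OF cdata(1)] cphi[OF cdata(2)] cphi[OF cinit(1)] cphi[OF ck(1)] cphi[OF ck(2)])
      (auto simp: less_imp_neq[symmetric])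
  have v0_cont: "continuous_on UNIV v0"
    unfolding v0_def[abs_def] Rs_def using nz phi0 pos
    by (intro continuous_intros phi_cont cphi[OF cinit(2)] cphi[OF ck(1)] cphi[OF ck(2)])
      (auto simp: less_imp_neq[symmetric])
  obtain B1 B2 B3 B4 B5 where B: "B1 \<ge> 0" "\<forall>s. \<bar>Ss (Sx s) (Sz s) (Sw s) (SX s) (Sze s) (SY s) (Som s)\<bar> \<le> B1"
    "B2 \<ge> 0" "\<forall>s. \<bar>Fz (Sx s) (Sz s) (Sw s) (SY s)\<bar> \<le> B2" "B3 \<ge> 0" "\<forall>s. \<bar>Fw (Sx s) (Sz s) (Sw s) (SY s) (Som s)\<bar> \<le> B3"
    "B4 \<ge> 0" "\<forall>s. \<bar>Fze (Sx s) (Sz s) (Sw s) (Sze s) (SY s) (Som s)\<bar> \<le> B4"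
    "B5 \<ge> 0" "\<forall>s. \<bar>Fom (Sx s) (Sz s) (Sw s) (SX s) (Sze s) (Som s)\<bar> \<le> B5"
    using rhs unfolding blip_def by (elim exE conjE)
  \<comment> \<open>The x-component of \<open>f\<close> is the unclamped \<open>Y\<close>, so its
    size at the initial state has to come from the speeds instead of a clamp.\<close>
  have Rs_bound: "\<bar>Rs p\<bar> \<le> b2 / m" for p
  proof -
    define M1 M2 where "M1 = m1 (z0 (phi p)) (w0 (phi p))" and "M2 = m2 (z0 (phi p)) (w0 (phi p))"
    have M: "- b2 \<le> M2" "M1 \<le> - b1" "m \<le> M1 - M2"
      using speeds[of "z0 (phi p)" "w0 (phi p)"] data_box[OF phi0[of p]] by (auto simp: M1_def M2_def)
    have "\<bar>Rs p\<bar> = \<bar>M2\<bar> / (M1 - M2) / (1 + CH * max 0 p)"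
      using pos[of p] M m by (simp add: Rs_def M1_def[symmetric] M2_def[symmetric] abs_mult)
    also have "\<dots> \<le> \<bar>M2\<bar> / (M1 - M2)"
    proof -
      have "\<bar>M2\<bar> / (M1 - M2) / (1 + CH * max 0 p) \<le> \<bar>M2\<bar> / (M1 - M2) / 1"
        using M m CH(1) pos[of p] by (intro divide_left_mono) auto
      then show ?thesis by simp
    qed
    also have "\<dots> \<le> b2 / m" using M m b1 b2_pos by (intro frac_le) auto
    finally show ?thesis .
  qed
  have nP: "norm (x, y) \<le> norm x + norm y" for x :: "'c::real_normed_vector" and y :: "'d::real_normed_vector"
    by (rule norm_Pair_le)
  have fC: "norm (f (u0 p, v0 q)) \<le> b2 / m + (B2 + (B3 + (B1 + B4)))" for p q
  proof -
    let ?s = "(u0 p, v0 q)"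
    have "norm (f ?s) \<le> norm (SY ?s) + (norm (Fz (Sx ?s) (Sz ?s) (Sw ?s) (SY ?s)) + (norm (Fw (Sx ?s) (Sz ?s) (Sw ?s) (SY ?s) (Som ?s)) +
      (norm (Ss (Sx ?s) (Sz ?s) (Sw ?s) (SX ?s) (Sze ?s) (SY ?s) (Som ?s)) + norm (Fze (Sx ?s) (Sz ?s) (Sw ?s) (Sze ?s) (SY ?s) (Som ?s)))))"
      unfolding f_def by (intro order_trans[OF nP] add_left_mono order_refl)
    also have "\<dots> \<le> b2 / m + (B2 + (B3 + (B1 + B4)))"
      unfolding real_norm_def
      by (intro add_mono B(2)[rule_format] B(4)[rule_format] B(6)[rule_format] B(8)[rule_format])
        (simp add: SY_def v0_def Rs_bound)
    finally show ?thesis .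
  qed
  have gC: "norm (g (u0 p, v0 q)) \<le> B1 + B5" for p q
  proof -
    let ?s = "(u0 p, v0 q)"
    have "norm (g ?s) \<le> norm (Ss (Sx ?s) (Sz ?s) (Sw ?s) (SX ?s) (Sze ?s) (SY ?s) (Som ?s)) + norm (Fom (Sx ?s) (Sz ?s) (Sw ?s) (SX ?s) (Sze ?s) (Som ?s))"
      unfolding g_def by (rule nP)
    also have "\<dots> \<le> B1 + B5"
      unfolding real_norm_def by (intro add_mono B(2)[rule_format] B(10)[rule_format])
    finally show ?thesis .
  qed
  define C where "C = max (b2 / m + (B2 + (B3 + (B1 + B4)))) (B1 + B5)"
  obtain u v where uv: "continuous_on UNIV (\<lambda>(p, q). u p q)" "continuous_on UNIV (\<lambda>(p, q). v p q)"
    "\<And>p. u p p = u0 p" "\<And>q. v q q = v0 q"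
    "\<And>p q. ((\<lambda>q. u p q) has_vector_derivative f (u p q, v p q)) (at q)"
    "\<And>p q. ((\<lambda>p. v p q) has_vector_derivative g (u p q, v p q)) (at p)"
  proof (rule picard_two_families[OF L u0_cont v0_cont])
    show "norm (f (u0 p, v0 q)) \<le> C" "norm (g (u0 p, v0 q)) \<le> C" for p q
      using fC[of p q] gC[of p q] by (auto simp: C_def)
  qed (rule that)
  define x z w X ze Y om where "x p q = Sx (u p q, v p q)" and "z p q = Sz (u p q, v p q)" and "w p q = Sw (u p q, v p q)"
    and "X p q = SX (u p q, v p q)" and "ze p q = Sze (u p q, v p q)" and "Y p q = SY (u p q, v p q)" and "om p q = Som (u p q, v p q)" for p q
  have cuv: "continuous_on UNIV (\<lambda>y. (u (fst y) (snd y), v (fst y) (snd y)))"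
    using uv(1,2) by (intro continuous_on_Pair) (simp_all add: split_beta)
  have cS: "continuous_on UNIV (\<lambda>(p, q). h (u p q, v p q))" if "lipr h" for h :: "_ \<Rightarrow> real"
    using continuous_on_compose2[OF lipr_continuous_on[OF that] cuv, of UNIV] by (simp add: split_beta)
  have fst_d: "((\<lambda>s. fst (h s)) has_vector_derivative fst h') F" and snd_d: "((\<lambda>s. snd (h s)) has_vector_derivative snd h') F"
    if "(h has_vector_derivative h') F" for h :: "real \<Rightarrow> 'c::real_normed_vector \<times> 'd::real_normed_vector" and h' F
    using bounded_linear.has_vector_derivative[OF bounded_linear_fst that]
      bounded_linear.has_vector_derivative[OF bounded_linear_snd that] by auto
  note u_d = uv(5) and v_d = uv(6)
  have "char_picard m1 m2 k1 k2 m1z m1w m2z m2w k1z k1w k2z k2w a a' z0 z0' w0 w0' zl zu wl wu K b1 b2 m ca ca' CH x z w X ze Y om"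
  proof (unfold_locales, goal_cases)
    case 3 show ?case unfolding x_def by (rule cS[OF ls(1)])
  next
    case 4 show ?case unfolding z_def by (rule cS[OF ls(2)])
  next
    case 5 show ?case unfolding w_def by (rule cS[OF ls(3)])
  next
    case 6 show ?case unfolding X_def by (rule cS[OF ls(4)])
  next
    case 7 show ?case unfolding ze_def by (rule cS[OF ls(5)])
  next
    case 8 show ?case unfolding Y_def by (rule cS[OF ls(6)])
  next
    case 9 show ?case unfolding om_def by (rule cS[OF ls(7)])
  next
    case 10 show ?case unfolding x_def z_def w_def X_def ze_def Y_def om_def by (rule cS[OF rl(1)])
  next
    case (18 p q) show ?case
      using fst_d[OF u_d[of p q]] by (simp add: has_real_derivative_iff_has_vector_derivative f_def x_def Y_def Sx_def SY_def)
  next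
    case (19 p q) show ?case
      using fst_d[OF snd_d[OF u_d[of p q]]]
      by (simp add: has_real_derivative_iff_has_vector_derivative f_def z_def x_def w_def Y_def) (simp add: Sz_def)
  next
    case (20 p q) show ?case
      using fst_d[OF snd_d[OF snd_d[OF u_d[of p q]]]]
      by (simp add: has_real_derivative_iff_has_vector_derivative f_def z_def x_def w_def Y_def om_def) (simp add: Sw_def)
  next
    case (21 p q) show ?case
      using fst_d[OF snd_d[OF snd_d[OF snd_d[OF u_d[of p q]]]]]
      by (simp add: has_real_derivative_iff_has_vector_derivative f_def z_def x_def w_def X_def ze_def Y_def om_def) (simp add: SX_def)
  next
    case (22 p q) show ?case
      using snd_d[OF snd_d[OF snd_d[OF snd_d[OF u_d[of p q]]]]]
      by (simp add: has_real_derivative_iff_has_vector_derivative f_def z_def x_def w_def ze_def Y_def om_def) (simp add: Sze_def)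
  next
    case (23 q p) show ?case
      using fst_d[OF v_d[of p q]]
      by (simp add: has_real_derivative_iff_has_vector_derivative g_def z_def x_def w_def X_def ze_def Y_def om_def) (simp add: SY_def)
  next
    case (24 q p) show ?case
      using snd_d[OF v_d[of p q]]
      by (simp add: has_real_derivative_iff_has_vector_derivative g_def z_def x_def w_def X_def ze_def om_def) (simp add: Som_def)
  qed (use CH in \<open>auto simp: x_def z_def w_def X_def ze_def Y_def om_def uv(3,4) u0_def v0_def
        Sx_def Sz_def Sw_def SX_def Sze_def SY_def Som_def Rt_def Rs_def phi_def max_absorb2\<close>)
  then show ?thesis by (rule that)
qed

end

section \<open>Signs, monotonicity and derivatives across the families\<close>

lemma DERIV_image_chain':
  fixes f g :: "real \<Rightarrow> real"
  assumes "(f has_real_derivative D) (at x within S)" "(g has_real_derivative E) (at (f x) within f ` S)"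
  shows "((\<lambda>x. g (f x)) has_real_derivative E * D) (at x within S)"
  using DERIV_image_chain[OF assms(2,1)] by (simp add: o_def)

text \<open>On the diagonal X and Y are determined by X + Y = d/dp x(p,p) and by m2 X + m1 Y = 0,
  the latter because t = 0 there. This identity verifies the first relation.\<close>

lemma weights_sum:
  fixes M1 M2 D :: real
  assumes "M1 - M2 \<noteq> 0"
  shows "M1 / (M1 - M2) / D + - M2 / (M1 - M2) / D = 1 / D"
  unfolding add_divide_distrib[symmetric] using assms by simp

context char_picard begin

definition S :: "real \<Rightarrow> real \<Rightarrow> real" where
  "S p q = Ss (x p q) (z p q) (w p q) (X p q) (ze p q) (Y p q) (om p q)"

definition H :: "real \<Rightarrow> real \<Rightarrow> real" where
  "H p q = hco (a (x p q)) (z p q) (w p q) (ze p q) (om p q)"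

lemma cont_S': "continuous_on T (\<lambda>(p, q). S p q)"
  using cont_S continuous_on_subset unfolding S_def by blast

lemma S_bound: "\<bar>S p q\<bar> \<le> KX * CH * \<bar>X p q\<bar>" "\<bar>S p q\<bar> \<le> KX * CH * \<bar>Y p q\<bar>"
proof -
  have c: "\<bar>clamp_real (-KX) 0 (X p q)\<bar> \<le> \<bar>X p q\<bar>" "\<bar>clamp_real (-KX) 0 (X p q)\<bar> \<le> KX"
    "\<bar>clamp_real 0 KX (Y p q)\<bar> \<le> \<bar>Y p q\<bar>" "\<bar>clamp_real 0 KX (Y p q)\<bar> \<le> KX"
    using KX_pos by (auto simp: clamp_real_def max_def min_def)
  have "\<bar>S p q\<bar> = \<bar>clamp_real (-KX) 0 (X p q)\<bar> * \<bar>clamp_real 0 KX (Y p q)\<bar> * \<bar>Hs (x p q) (z p q) (w p q) (ze p q) (om p q)\<bar>"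
    by (simp add: S_def Ss_def abs_mult)
  also have "\<dots> \<le> \<bar>clamp_real (-KX) 0 (X p q)\<bar> * \<bar>clamp_real 0 KX (Y p q)\<bar> * CH"
    by (intro mult_left_mono CH_bound) auto
  finally have le: "\<bar>S p q\<bar> \<le> \<bar>clamp_real (-KX) 0 (X p q)\<bar> * \<bar>clamp_real 0 KX (Y p q)\<bar> * CH" .
  have "\<bar>clamp_real (-KX) 0 (X p q)\<bar> * \<bar>clamp_real 0 KX (Y p q)\<bar> * CH \<le> \<bar>X p q\<bar> * KX * CH"
    using c CH by (intro mult_right_mono mult_mono) auto
  with le show "\<bar>S p q\<bar> \<le> KX * CH * \<bar>X p q\<bar>" by (simp add: algebra_simps)
  have "\<bar>clamp_real (-KX) 0 (X p q)\<bar> * \<bar>clamp_real 0 KX (Y p q)\<bar> * CH \<le> KX * \<bar>Y p q\<bar> * CH"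
    using c CH KX_pos by (intro mult_right_mono mult_mono) auto
  with le show "\<bar>S p q\<bar> \<le> KX * CH * \<bar>Y p q\<bar>" by (simp add: algebra_simps)
qed

lemma x_diag_nonneg: "p \<ge> 0 \<Longrightarrow> x p p \<ge> 0"
  using CH by (simp add: x_diag)

lemma exp_x_diag: "p \<ge> 0 \<Longrightarrow> exp (CH * x p p) = 1 + CH * p"
  using CH by (simp add: x_diag add_pos_nonneg)

lemma box_diag: assumes "p \<ge> 0" shows "z p p \<in> {zl..zu}" "w p p \<in> {wl..wu}"
  using data_box[OF x_diag_nonneg[OF assms]] assms by (simp_all add: z_diag w_diag)

lemma diag_speeds:
  assumes "p \<ge> 0"
  shows "m1 (z p p) (w p p) \<le> - b1" "m2 (z p p) (w p p) < 0" "- b2 \<le> m2 (z p p) (w p p)"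
    "m \<le> m1 (z p p) (w p p) - m2 (z p p) (w p p)"
  using speeds[OF box_diag[OF assms]] b1 m by auto

lemma x_diag_deriv:
  assumes "0 \<le> Q" "p \<in> {Q..P}"
  shows "((\<lambda>s. x s s) has_real_derivative 1 / (1 + CH * p)) (at p within {Q..P})"
proof -
  have pos: "1 + CH * p > 0" using CH assms by (simp add: add_pos_nonneg)
  have "((\<lambda>s. ln (1 + CH * s)) has_real_derivative CH / (1 + CH * p)) (at p within {Q..P})"
    using pos by (auto intro!: derivative_eq_intros)
  from DERIV_cdivide[OF this, of CH]
  have "((\<lambda>s. ln (1 + CH * s) / CH) has_real_derivative 1 / (1 + CH * p)) (at p within {Q..P})"
    using CH by simp
  then show ?thesis
    by (rule has_field_derivative_transform_within[where d = 1]) (use assms x_diag in auto)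
qed

lemma X_neg: assumes "p \<ge> 0" shows "X p q < 0"
proof -
  have Xp: "X p p < 0"
    using diag_speeds[OF assms] b1 m CH assms
    by (simp add: X_diag[OF assms] divide_neg_pos add_pos_nonneg)
  have d: "((\<lambda>q. - X p q) has_real_derivative - S p s) (at s)" for s
    unfolding S_def by (intro derivative_intros X_q)
  have "- X p q > 0"
    by (rule sign_preserved[where f = "\<lambda>q. - X p q", OF d]) (use S_bound(1) Xp in auto)
  then show ?thesis by simp
qed

lemma Y_pos: assumes "q \<ge> 0" shows "Y p q > 0"
proof -
  have Yq: "Y q q > 0"
    unfolding Y_diag[OF assms] using diag_speeds[OF assms] m CH assms
    by (intro divide_pos_pos) (auto simp: add_pos_nonneg)
  have d: "((\<lambda>p. Y p q) has_real_derivative S s q) (at s)" for s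
    unfolding S_def by (intro Y_p)
  show ?thesis
    by (rule sign_preserved[where f = "\<lambda>p. Y p q", OF d]) (use S_bound(2) Yq in auto)
qed

text \<open>Y_p and X_q have the same right-hand side \<open>S\<close>, so the increment of
  \<open>Y\<close> in p can be expanded directly and the parameter lemma applies with
  \<open>L = 0\<close>, without feedback of the error.\<close>

lemma x_p:
  assumes "0 \<le> q" "q \<le> p" "p \<le> P"
  shows "((\<lambda>p. x p q) has_real_derivative X p q) (at p within {q..P})"
proof -
  have "((\<lambda>p. x p q) has_vector_derivative X p q) (at p within {q..P})"
  proof (rule parameter_derivative[where \<alpha> = Y and \<sigma> = S and L = 0 and Q = 0])
    fix p q :: real
    show "((\<lambda>q. x p q) has_vector_derivative Y p q) (at q within {0..p})"
      using x_q[of p q] by (simp add: has_real_derivative_iff_has_vector_derivative has_vector_derivative_at_within)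
    show "((\<lambda>q. X p q) has_vector_derivative S p q) (at q within {0..p})"
      using X_q[of p q] by (simp add: S_def has_real_derivative_iff_has_vector_derivative has_vector_derivative_at_within)
  next
    fix p assume p: "p \<in> {0..P}"
    let ?M1 = "m1 (z p p) (w p p)" and ?M2 = "m2 (z p p) (w p p)"
    have "((\<lambda>s. x s s) has_real_derivative 1 / (1 + CH * p)) (at p within {0..P})"
      by (rule x_diag_deriv) (use p in auto)
    moreover have "1 / (1 + CH * p) = Y p p + X p p"
    proof -
      have nz: "?M1 - ?M2 \<noteq> 0" and p0: "p \<ge> 0" using diag_speeds[of p] p m by auto
      show ?thesis unfolding X_diag[OF p0] Y_diag[OF p0] using weights_sum[OF nz] by (simp only: add.commute)
    qed
    ultimately show "((\<lambda>p. x p p) has_vector_derivative Y p p + X p p) (at p within {0..P})"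
      by (simp add: has_real_derivative_iff_has_vector_derivative)
  next
    fix \<epsilon> :: real assume \<epsilon>: "\<epsilon> > 0"
    have "\<exists>\<delta>>0. \<forall>p1 p2 q. 0 \<le> q \<and> q \<le> p1 \<and> p1 \<le> p2 \<and> p2 \<le> P \<and> p2 - p1 < \<delta> \<longrightarrow>
      \<bar>Y p2 q - Y p1 q - (p2 - p1) * S p1 q\<bar> \<le> \<epsilon> * (p2 - p1)"
      by (rule uniform_difference[OF _ cont_S' \<epsilon>])
        (auto simp: S_def intro: has_field_derivative_at_within Y_p)
    then show "\<exists>\<delta>>0. \<forall>p1 p2 q. 0 \<le> q \<and> q \<le> p1 \<and> p1 \<le> p2 \<and> p2 \<le> P \<and> p2 - p1 < \<delta> \<longrightarrow>
      norm (Y p2 q - Y p1 q - (p2 - p1) *\<^sub>R S p1 q) \<le> 0 * norm (x p2 q - x p1 q - (p2 - p1) *\<^sub>R X p1 q) + \<epsilon> * (p2 - p1)"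
      by simp
  qed (use assms continuous_on_subset[OF cont_X] continuous_on_subset[OF cont_Y] in auto)
  then show ?thesis by (simp add: has_real_derivative_iff_has_vector_derivative)
qed

lemma x_strict_mono_q: assumes "0 \<le> q1" "q1 < q2" shows "x p q1 < x p q2"
proof (rule DERIV_pos_imp_increasing[OF assms(2)])
  fix s assume "q1 \<le> s"
  then have "Y p s > 0" using Y_pos assms by simp
  then show "\<exists>y. ((\<lambda>q. x p q) has_real_derivative y) (at s) \<and> 0 < y" using x_q by blast
qed

lemma x_strict_antimono_p: assumes "0 \<le> q" "q \<le> p1" "p1 < p2" shows "x p2 q < x p1 q"
proof (rule DERIV_neg_imp_decreasing_open[OF assms(3)])
  fix s assume s: "p1 < s" "s < p2"
  have "((\<lambda>p. x p q) has_real_derivative X s q) (at s)"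
    using x_p[of q s p2] s assms by (simp add: at_within_Icc_at)
  then show "\<exists>y. ((\<lambda>p. x p q) has_real_derivative y) (at s) \<and> y < 0"
    using X_neg[of s q] s assms by auto
next
  have "continuous_on {q..p2} (\<lambda>p. x p q)"
    unfolding continuous_on_eq_continuous_within using x_p assms DERIV_continuous
    by (metis atLeastAtMost_iff)
  then show "continuous_on {p1..p2} (\<lambda>p. x p q)"
    by (rule continuous_on_subset) (use assms in auto)
qed

text \<open>x is smallest at the apex, so checking x \<ge> 0 there places the entire triangle in the
  physical half plane.\<close>

lemma x_mono: assumes "0 \<le> Q" "(p, q) \<in> triangle Q P" shows "x P Q \<le> x p q"
proof -
  have "x P Q \<le> x p Q" using x_strict_antimono_p[of Q p P] assms by (cases "p = P") auto
  also have "\<dots> \<le> x p q" using x_strict_mono_q[of Q q p] assms by (cases "q = Q") auto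
  finally show ?thesis .
qed

definition good :: "real \<Rightarrow> real \<Rightarrow> bool" where
  "good p q \<longleftrightarrow> z p q \<in> {zl..zu} \<and> w p q \<in> {wl..wu} \<and> X p q \<in> {-KX..0} \<and> Y p q \<in> {0..KX} \<and>
     ze p q \<in> {-K..K} \<and> om p q \<in> {-K..K}"

lemma unclamped:
  assumes g: "good p q" and x0: "0 \<le> x p q"
  shows "S p q = X p q * Y p q * H p q"
    and z_q: "((\<lambda>q. z p q) has_real_derivative Y p q * (k1 (z p q) (w p q) * a (x p q))) (at q)"
    and w_q: "((\<lambda>q. w p q) has_real_derivative Y p q * (k2 (z p q) (w p q) * a (x p q) + om p q)) (at q)"
    and ze_q: "((\<lambda>q. ze p q) has_real_derivative Y p q * zrate (a (x p q)) (z p q) (w p q) (ze p q) (om p q)) (at q)"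
    and om_p: "((\<lambda>p. om p q) has_real_derivative X p q * wrate (a (x p q)) (z p q) (w p q) (ze p q) (om p q)) (at p)"
    and "\<bar>H p q\<bar> \<le> CH"
proof -
  have c: "clamp_real zl zu (z p q) = z p q" "clamp_real wl wu (w p q) = w p q" "clamp_real (-KX) 0 (X p q) = X p q"
    "clamp_real 0 KX (Y p q) = Y p q" "clamp_real (-K) K (ze p q) = ze p q" "clamp_real (-K) K (om p q) = om p q"
    "max 0 (x p q) = x p q"
    using g x0 unfolding good_def by (simp_all only: clamp_real_id max_absorb2)
  show "S p q = X p q * Y p q * H p q" by (simp only: S_def Ss_def Hs_def H_def c)
  show "((\<lambda>q. z p q) has_real_derivative Y p q * (k1 (z p q) (w p q) * a (x p q))) (at q)"
    using z_q0[of p q] by (simp only: Fz_def c)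
  show "((\<lambda>q. w p q) has_real_derivative Y p q * (k2 (z p q) (w p q) * a (x p q) + om p q)) (at q)"
    using w_q0[of p q] by (simp only: Fw_def c)
  show "((\<lambda>q. ze p q) has_real_derivative Y p q * zrate (a (x p q)) (z p q) (w p q) (ze p q) (om p q)) (at q)"
    using ze_q0[of p q] by (simp only: Fze_def c)
  show "((\<lambda>p. om p q) has_real_derivative X p q * wrate (a (x p q)) (z p q) (w p q) (ze p q) (om p q)) (at p)"
    using om_p0[of q p] by (simp only: Fom_def c)
  show "\<bar>H p q\<bar> \<le> CH" using CH_bound[of "x p q" "z p q" "w p q" "ze p q" "om p q"] by (simp only: Hs_def H_def c)
qed

text \<open>Unlike for x, the right-hand sides in q depend on z and w themselves, so the defects
  feed back and Gronwall is applied to the pair. The candidates are X times the rates along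
  2-characteristics; \<open>hco\<close> and \<open>zrate\<close> are made so that their
  q-derivatives come out as \<open>\<sigma>\<close>.\<close>

lemma zw_p_triangle:
  assumes Q: "0 \<le> Q" and x0: "0 \<le> x P Q" and g: "\<And>p q. (p, q) \<in> triangle Q P \<Longrightarrow> good p q"
    and pq: "(p, q) \<in> triangle Q P"
  shows "((\<lambda>p. z p q) has_real_derivative X p q * (k1 (z p q) (w p q) * a (x p q) + ze p q)) (at p within {q..P})"
    and "((\<lambda>p. w p q) has_real_derivative X p q * (k2 (z p q) (w p q) * a (x p q))) (at p within {q..P})"
proof -
  let ?T = "triangle Q P"
  have xT: "0 \<le> x p q" if "(p, q) \<in> ?T" for p q using x_mono[OF Q that] x0 by simp
  have box: "z p q \<in> {zl..zu} \<and> w p q \<in> {wl..wu}" if "(p, q) \<in> ?T" for p q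
    using g[OF that] by (simp only: good_def)
  have SXY: "S p q = X p q * Y p q * H p q" if "(p, q) \<in> ?T" for p q by (rule unclamped(1)[OF g[OF that] xT[OF that]])
  define A where "A p q = a (x p q)" for p q
  define k1' k2' where "k1' p q = k1 (z p q) (w p q)" and "k2' p q = k2 (z p q) (w p q)" for p q
  define k1z' k1w' k2z' k2w' where "k1z' p q = k1z (z p q) (w p q)" and "k1w' p q = k1w (z p q) (w p q)"
    and "k2z' p q = k2z (z p q) (w p q)" and "k2w' p q = k2w (z p q) (w p q)" for p q
  define \<beta>z \<beta>w where "\<beta>z p q = X p q * (k1' p q * A p q + ze p q)" and "\<beta>w p q = X p q * (k2' p q * A p q)" for p q
  \<comment> \<open>z_q and w_q are split into \<open>f * k1'\<close>, \<open>f * k2'\<close> and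
    \<open>g2\<close>. The factors \<open>f\<close> and \<open>g2\<close> have known p-derivatives
    \<open>fp\<close> and \<open>gp\<close>; the coefficients depend on z and w and go through
    \<open>product_expansion\<close>.\<close>
  define f fp where "f p q = Y p q * A p q" and "fp p q = S p q * A p q + Y p q * (a' (x p q) * X p q)" for p q
  define g2 gp where "g2 p q = Y p q * om p q"
    and "gp p q = S p q * om p q + Y p q * (X p q * wrate (A p q) (z p q) (w p q) (ze p q) (om p q))" for p q
  note cs = continuous_on_subset[OF cont_x subset_UNIV, unfolded split_beta] continuous_on_subset[OF cont_z subset_UNIV, unfolded split_beta]
    continuous_on_subset[OF cont_w subset_UNIV, unfolded split_beta] continuous_on_subset[OF cont_X subset_UNIV, unfolded split_beta]
    continuous_on_subset[OF cont_ze subset_UNIV, unfolded split_beta] continuous_on_subset[OF cont_Y subset_UNIV, unfolded split_beta]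
    continuous_on_subset[OF cont_om subset_UNIV, unfolded split_beta] cont_S'[unfolded split_beta]
  have comp: "continuous_on ?T (\<lambda>y. h (x (fst y) (snd y)))" if "continuous_on {0..} h" for h :: "real \<Rightarrow> real"
    by (rule continuous_on_compose2[OF that cs(1)]) (auto simp: xT)
  have cA: "continuous_on ?T (\<lambda>y. A (fst y) (snd y))" "continuous_on ?T (\<lambda>y. a' (x (fst y) (snd y)))"
    unfolding A_def by (rule comp[OF continuous_on_half_line[OF a_deriv]], assumption) (rule comp[OF a'_cont])
  have cbox: "continuous_on ?T (\<lambda>y. k (z (fst y) (snd y)) (w (fst y) (snd y)))"
    if "continuous_on ({zl..zu} \<times> {wl..wu}) (\<lambda>(z, w). k z w)" for k
  proof -
    have "continuous_on ?T (\<lambda>(p, q). k (z p q) (w p q))"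
      by (rule continuous_on_triangle_box[OF that continuous_on_subset[OF cont_z subset_UNIV] continuous_on_subset[OF cont_w subset_UNIV] box])
    then show ?thesis by (simp only: case_prod_unfold)
  qed
  have ck: "continuous_on ?T (\<lambda>y. k1' (fst y) (snd y))" "continuous_on ?T (\<lambda>y. k2' (fst y) (snd y))"
    "continuous_on ?T (\<lambda>y. k1z' (fst y) (snd y))" "continuous_on ?T (\<lambda>y. k1w' (fst y) (snd y))"
    "continuous_on ?T (\<lambda>y. k2z' (fst y) (snd y))" "continuous_on ?T (\<lambda>y. k2w' (fst y) (snd y))"
    unfolding k1'_def k2'_def k1z'_def k1w'_def k2z'_def k2w'_def
    by (rule cbox C1_box_continuous[OF C1_k1] C1_box_continuous[OF C1_k2]
        C1_k1[unfolded C1_box_def, THEN conjunct2, THEN conjunct1] C1_k1[unfolded C1_box_def, THEN conjunct2, THEN conjunct2]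
        C1_k2[unfolded C1_box_def, THEN conjunct2, THEN conjunct1] C1_k2[unfolded C1_box_def, THEN conjunct2, THEN conjunct2])+
  have cH: "continuous_on ?T (\<lambda>y. H (fst y) (snd y))"
  proof -
    have nz: "m1 (z (fst y) (snd y)) (w (fst y) (snd y)) - m2 (z (fst y) (snd y)) (w (fst y) (snd y)) \<noteq> 0" if "y \<in> ?T" for y
      using speeds box[of "fst y" "snd y"] that m by fastforce
    show ?thesis
      unfolding H_def hco_def A_def[symmetric]
      by (intro continuous_intros cA cs(5,7) cbox C1_box_continuous[OF C1_k1] C1_box_continuous[OF C1_k2]
          C1_box_continuous[OF C1_m1] C1_box_continuous[OF C1_m2]
          C1_m1[unfolded C1_box_def, THEN conjunct2, THEN conjunct1] C1_m1[unfolded C1_box_def, THEN conjunct2, THEN conjunct2]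
          C1_m2[unfolded C1_box_def, THEN conjunct2, THEN conjunct1] C1_m2[unfolded C1_box_def, THEN conjunct2, THEN conjunct2])
        (use nz in auto)
  qed
  have c\<beta>: "continuous_on ?T (\<lambda>(p, q). \<beta>z p q)" "continuous_on ?T (\<lambda>(p, q). \<beta>w p q)"
    unfolding split_beta \<beta>z_def \<beta>w_def by (intro continuous_intros ck cA cs)+
  have cf: "continuous_on ?T (\<lambda>(p, q). f p q)" "continuous_on ?T (\<lambda>(p, q). fp p q)"
    "continuous_on ?T (\<lambda>(p, q). g2 p q)" "continuous_on ?T (\<lambda>(p, q). gp p q)"
    unfolding split_beta f_def fp_def g2_def gp_def wrate_def k1z'_def[symmetric] k1w'_def[symmetric] k2z'_def[symmetric] k2w'_def[symmetric]
      A_def H_def[symmetric] 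
    unfolding A_def[symmetric] by (intro continuous_intros ck cA cs cH)+
  have x_pT: "((\<lambda>p. x p q) has_real_derivative X p q) (at p within {q..P})" if "(p, q) \<in> ?T" for p q
    by (rule x_p) (use that Q in auto)
  have a_p: "((\<lambda>p. A p q) has_real_derivative a' (x p q) * X p q) (at p within {q..P})" if "(p, q) \<in> ?T" for p q
    unfolding A_def
  proof (rule DERIV_image_chain'[OF x_pT[OF that]])
    show "(a has_real_derivative a' (x p q)) (at (x p q) within (\<lambda>p. x p q) ` {q..P})"
      by (rule DERIV_subset[OF a_deriv]) (use xT that in auto)
  qed
  have f_p: "((\<lambda>p. f p q) has_real_derivative fp p q) (at p within {q..P})" if "(p, q) \<in> ?T" for p q
    unfolding f_def fp_def S_def
    by (rule derivative_eq_intros has_field_derivative_at_within[OF Y_p] a_p that refl)+ (simp add: algebra_simps)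
  have g_p: "((\<lambda>p. g2 p q) has_real_derivative gp p q) (at p within {q..P})" if "(p, q) \<in> ?T" for p q
    unfolding g2_def gp_def S_def A_def
    by (rule derivative_eq_intros has_field_derivative_at_within[OF Y_p] has_field_derivative_at_within[OF om_p[OF g[OF that] xT[OF that]]] refl)+
      (simp add: algebra_simps)
  note conts = cf(1,2) continuous_on_subset[OF cont_z subset_UNIV] continuous_on_subset[OF cont_w subset_UNIV] c\<beta>
  obtain L1 where L1: "L1 \<ge> 0"
    "\<forall>\<epsilon>>0. \<exists>\<delta>>0. \<forall>p1 p2 q. Q \<le> q \<and> q \<le> p1 \<and> p1 \<le> p2 \<and> p2 \<le> P \<and> p2 - p1 < \<delta> \<longrightarrow>
      \<bar>f p2 q * k1' p2 q - f p1 q * k1' p1 q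
        - (p2 - p1) * (fp p1 q * k1' p1 q + f p1 q * (k1z' p1 q * \<beta>z p1 q + k1w' p1 q * \<beta>w p1 q))\<bar>
      \<le> L1 * (\<bar>z p2 q - z p1 q - (p2 - p1) * \<beta>z p1 q\<bar> + \<bar>w p2 q - w p1 q - (p2 - p1) * \<beta>w p1 q\<bar>) + \<epsilon> * (p2 - p1)"
    by (rule product_expansion[where f = f and fp = fp, OF _ C1_k1 conts, folded k1'_def k1z'_def k1w'_def])
      (erule f_p, erule box, rule that)
  obtain L2 where L2: "L2 \<ge> 0"
    "\<forall>\<epsilon>>0. \<exists>\<delta>>0. \<forall>p1 p2 q. Q \<le> q \<and> q \<le> p1 \<and> p1 \<le> p2 \<and> p2 \<le> P \<and> p2 - p1 < \<delta> \<longrightarrow>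
      \<bar>f p2 q * k2' p2 q - f p1 q * k2' p1 q
        - (p2 - p1) * (fp p1 q * k2' p1 q + f p1 q * (k2z' p1 q * \<beta>z p1 q + k2w' p1 q * \<beta>w p1 q))\<bar>
      \<le> L2 * (\<bar>z p2 q - z p1 q - (p2 - p1) * \<beta>z p1 q\<bar> + \<bar>w p2 q - w p1 q - (p2 - p1) * \<beta>w p1 q\<bar>) + \<epsilon> * (p2 - p1)"
    by (rule product_expansion[where f = f and fp = fp, OF _ C1_k2 conts, folded k2'_def k2z'_def k2w'_def])
      (erule f_p, erule box, rule that)
  define \<alpha> where "\<alpha> p q = (f p q * k1' p q, f p q * k2' p q + g2 p q)" for p q
  define \<sigma> where "\<sigma> p q = (fp p q * k1' p q + f p q * (k1z' p q * \<beta>z p q + k1w' p q * \<beta>w p q),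
      fp p q * k2' p q + f p q * (k2z' p q * \<beta>z p q + k2w' p q * \<beta>w p q) + gp p q)" for p q
  have "((\<lambda>p. (z p q, w p q)) has_vector_derivative (\<beta>z p q, \<beta>w p q)) (at p within {q..P})"
  proof (rule parameter_derivative[where \<alpha> = \<alpha> and \<sigma> = \<sigma> and L = "2 * (L1 + L2)", OF _ _ _ _ _ _ _ pq])
    fix p q assume T: "(p, q) \<in> ?T"
    note gT = g[OF T] xT[OF T]
    have zq: "((\<lambda>q. z p q) has_real_derivative Y p q * (k1' p q * A p q)) (at q within S)"
      and wq: "((\<lambda>q. w p q) has_real_derivative Y p q * (k2' p q * A p q + om p q)) (at q within S)" for S
      using z_q[OF gT] w_q[OF gT] by (auto simp: k1'_def k2'_def A_def intro: has_field_derivative_at_within)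
    show "((\<lambda>q. (z p q, w p q)) has_vector_derivative \<alpha> p q) (at q within {Q..p})"
      using zq wq by (auto intro!: has_vector_derivative_Pair
          simp: \<alpha>_def f_def g2_def has_real_derivative_iff_has_vector_derivative algebra_simps)
    have aq: "((\<lambda>q. A p q) has_real_derivative a' (x p q) * Y p q) (at q within {Q..p})"
      unfolding A_def
    proof (rule DERIV_image_chain'[OF has_field_derivative_at_within[OF x_q]])
      show "(a has_real_derivative a' (x p q)) (at (x p q) within (\<lambda>q. x p q) ` {Q..p})"
        by (rule DERIV_subset[OF a_deriv]) (use xT T in auto)
    qed
    have bq: "r \<in> {Q..p} \<Longrightarrow> z p r \<in> {zl..zu} \<and> w p r \<in> {wl..wu}" for r using box[of p r] T by auto
    have qm: "q \<in> {Q..p}" using T by auto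
    have k1q: "((\<lambda>q. k1' p q) has_real_derivative k1z' p q * (Y p q * (k1' p q * A p q)) + k1w' p q * (Y p q * (k2' p q * A p q + om p q))) (at q within {Q..p})"
      unfolding k1'_def k1z'_def k1w'_def
      by (rule C1_box_chain[OF C1_k1 zq[unfolded k1'_def] wq bq qm])
    have k2q: "((\<lambda>q. k2' p q) has_real_derivative k2z' p q * (Y p q * (k1' p q * A p q)) + k2w' p q * (Y p q * (k2' p q * A p q + om p q))) (at q within {Q..p})"
      unfolding k2'_def k2z'_def k2w'_def
      by (rule C1_box_chain[OF C1_k2 zq wq[unfolded k2'_def] bq qm])
    have Xq: "((\<lambda>q. X p q) has_real_derivative S p q) (at q within {Q..p})"
      unfolding S_def by (rule has_field_derivative_at_within[OF X_q])
    have zeq: "((\<lambda>q. ze p q) has_real_derivative Y p q * zrate (A p q) (z p q) (w p q) (ze p q) (om p q)) (at q within {Q..p})"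
      unfolding A_def by (rule has_field_derivative_at_within[OF ze_q[OF gT]])
    have HA: "hco (A p q) (z p q) (w p q) (ze p q) (om p q) = H p q" by (simp only: H_def A_def)
    have zr: "zrate (A p q) (z p q) (w p q) (ze p q) (om p q) = A p q * (k1z' p q * ze p q - k1w' p q * om p q) - ze p q * H p q"
      by (simp only: zrate_def HA k1z'_def k1w'_def)
    have wr: "wrate (A p q) (z p q) (w p q) (ze p q) (om p q) = A p q * (k2w' p q * om p q - k2z' p q * ze p q) - om p q * H p q"
      by (simp only: wrate_def HA k2z'_def k2w'_def)
    have dz: "((\<lambda>q. \<beta>z p q) has_real_derivative
        X p q * (((k1z' p q * (Y p q * (k1' p q * A p q)) + k1w' p q * (Y p q * (k2' p q * A p q + om p q))) * A p q + a' (x p q) * Y p q * k1' p q)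
          + Y p q * zrate (A p q) (z p q) (w p q) (ze p q) (om p q)) + S p q * (k1' p q * A p q + ze p q)) (at q within {Q..p})"
      unfolding \<beta>z_def by (rule DERIV_cong[OF DERIV_mult[OF Xq DERIV_add[OF DERIV_mult[OF k1q aq] zeq]]]) (simp only: ac_simps)
    \<comment> \<open>The terms with \<open>a'\<close> agree on both sides, and what remains is the
      definition of \<open>zrate\<close>.\<close>
    have "((\<lambda>q. \<beta>z p q) has_real_derivative fst (\<sigma> p q)) (at q within {Q..p})"
      by (rule DERIV_cong[OF dz])
        (simp only: \<sigma>_def fst_conv f_def fp_def \<beta>z_def \<beta>w_def SXY[OF T] zr, simp only: algebra_simps)
    note dz1 = this
    have dw: "((\<lambda>q. \<beta>w p q) has_real_derivative
        X p q * ((k2z' p q * (Y p q * (k1' p q * A p q)) + k2w' p q * (Y p q * (k2' p q * A p q + om p q))) * A p q + a' (x p q) * Y p q * k2' p q)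
          + S p q * (k2' p q * A p q)) (at q within {Q..p})"
      unfolding \<beta>w_def by (rule DERIV_cong[OF DERIV_mult[OF Xq DERIV_mult[OF k2q aq]]]) (simp only: ac_simps)
    have "((\<lambda>q. \<beta>w p q) has_real_derivative snd (\<sigma> p q)) (at q within {Q..p})"
      by (rule DERIV_cong[OF dw])
        (simp only: \<sigma>_def snd_conv f_def fp_def gp_def \<beta>z_def \<beta>w_def SXY[OF T] wr, simp only: algebra_simps)
    with dz1 have "((\<lambda>q. (\<beta>z p q, \<beta>w p q)) has_vector_derivative (fst (\<sigma> p q), snd (\<sigma> p q))) (at q within {Q..p})"
      unfolding has_real_derivative_iff_has_vector_derivative by (intro has_vector_derivative_Pair)
    then show "((\<lambda>q. (\<beta>z p q, \<beta>w p q)) has_vector_derivative \<sigma> p q) (at q within {Q..p})" by simp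
  next
    fix p assume p: "p \<in> {Q..P}"
    have p0: "p \<ge> 0" using p Q by simp
    have pos: "1 + CH * p > 0" using CH p0 by (simp add: add_pos_nonneg)
    let ?M1 = "m1 (z p p) (w p p)" and ?M2 = "m2 (z p p) (w p p)"
    note sp = diag_speeds[OF p0]
    have xp: "((\<lambda>s. x s s) has_real_derivative 1 / (1 + CH * p)) (at p within {Q..P})"
      by (rule x_diag_deriv[OF Q p])
    have dd: "((\<lambda>s. h (x s s)) has_real_derivative h' * (1 / (1 + CH * p))) (at p within {Q..P})"
      if "(h has_real_derivative h') (at (x p p) within {0..})" for h h'
    proof (rule DERIV_image_chain'[OF xp])
      have "(\<lambda>s. x s s) ` {Q..P} \<subseteq> {0..}"
      proof (rule image_subsetI)
        fix s assume "s \<in> {Q..P}"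
        then have "s \<ge> 0" using Q by simp
        then show "x s s \<in> {0..}" by (simp add: x_diag_nonneg)
      qed
      with that show "(h has_real_derivative h') (at (x p p) within (\<lambda>s. x s s) ` {Q..P})" by (rule DERIV_subset)
    qed
    have "((\<lambda>s. z s s) has_real_derivative z0' (x p p) * (1 / (1 + CH * p))) (at p within {Q..P})"
      by (rule has_field_derivative_transform_within[OF dd[OF z0_deriv[OF x_diag_nonneg[OF p0]]], where d = 1])
        (use p Q in \<open>auto simp: z_diag\<close>)
    moreover have "((\<lambda>s. w s s) has_real_derivative w0' (x p p) * (1 / (1 + CH * p))) (at p within {Q..P})"
      by (rule has_field_derivative_transform_within[OF dd[OF w0_deriv[OF x_diag_nonneg[OF p0]]], where d = 1])
        (use p Q in \<open>auto simp: w_diag\<close>)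
    \<comment> \<open>\<open>X p p\<close> carries the factor m1 / (m1 - m2), which undoes the one
      in \<open>ze_init\<close>; together with X + Y = 1 / D the source terms cancel and
      \<open>z0'\<close> is left.\<close>
    moreover have "fst (\<alpha> p p) + \<beta>z p p = z0' (x p p) * (1 / (1 + CH * p))"
    proof -
      have zz: "ze p p = (z0' (x p p) - k1' p p * A p p) * (?M1 - ?M2) / ?M1"
        by (simp add: ze_diag[OF p0] ze_init_def z_diag[OF p0] w_diag[OF p0] k1'_def A_def)
      have XY: "X p p = ?M1 / (?M1 - ?M2) / (1 + CH * p)" "Y p p = - ?M2 / (?M1 - ?M2) / (1 + CH * p)"
        by (rule X_diag[OF p0] Y_diag[OF p0])+
      define N1 N2 D where "N1 = ?M1" and "N2 = ?M2" and "D = 1 + CH * p"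
      have n: "N1 \<noteq> 0" "N1 - N2 \<noteq> 0" "D \<noteq> 0" using sp b1 m pos by (auto simp: N1_def N2_def D_def)
      have "X p p * ze p p = (z0' (x p p) - k1' p p * A p p) / D"
        unfolding zz XY N1_def[symmetric] N2_def[symmetric] D_def[symmetric] using n by simp
      moreover have "X p p + Y p p = 1 / D"
        unfolding XY N1_def[symmetric] N2_def[symmetric] D_def[symmetric] by (rule weights_sum[OF n(2)])
      moreover have "fst (\<alpha> p p) + \<beta>z p p = (X p p + Y p p) * (k1' p p * A p p) + X p p * ze p p"
        by (simp add: \<alpha>_def \<beta>z_def f_def algebra_simps)
      ultimately show ?thesis by (simp add: D_def diff_divide_distrib)
    qed
    moreover have "snd (\<alpha> p p) + \<beta>w p p = w0' (x p p) * (1 / (1 + CH * p))"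
    proof -
      have zz: "om p p = - ((w0' (x p p) - k2' p p * A p p) * (?M1 - ?M2) / ?M2)"
        by (simp add: om_diag[OF p0] om_init_def z_diag[OF p0] w_diag[OF p0] k2'_def A_def)
      have XY: "X p p = ?M1 / (?M1 - ?M2) / (1 + CH * p)" "Y p p = - ?M2 / (?M1 - ?M2) / (1 + CH * p)"
        by (rule X_diag[OF p0] Y_diag[OF p0])+
      define N1 N2 D where "N1 = ?M1" and "N2 = ?M2" and "D = 1 + CH * p"
      have n: "N2 \<noteq> 0" "N1 - N2 \<noteq> 0" "D \<noteq> 0" using sp b1 m pos by (auto simp: N1_def N2_def D_def)
      have "Y p p * om p p = (w0' (x p p) - k2' p p * A p p) / D"
        unfolding zz XY N1_def[symmetric] N2_def[symmetric] D_def[symmetric] using n by simp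
      moreover have "X p p + Y p p = 1 / D"
        unfolding XY N1_def[symmetric] N2_def[symmetric] D_def[symmetric] by (rule weights_sum[OF n(2)])
      moreover have "snd (\<alpha> p p) + \<beta>w p p = (X p p + Y p p) * (k2' p p * A p p) + Y p p * om p p"
        by (simp add: \<alpha>_def \<beta>w_def f_def g2_def algebra_simps)
      ultimately show ?thesis by (simp add: D_def diff_divide_distrib)
    qed
    ultimately have "((\<lambda>p. (z p p, w p p)) has_vector_derivative (fst (\<alpha> p p) + \<beta>z p p, snd (\<alpha> p p) + \<beta>w p p)) (at p within {Q..P})"
      unfolding has_real_derivative_iff_has_vector_derivative by (intro has_vector_derivative_Pair) simp_all
    moreover have "(fst (\<alpha> p p) + \<beta>z p p, snd (\<alpha> p p) + \<beta>w p p) = \<alpha> p p + (\<beta>z p p, \<beta>w p p)"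
      by (simp add: prod_eq_iff)
    ultimately show "((\<lambda>p. (z p p, w p p)) has_vector_derivative \<alpha> p p + (\<beta>z p p, \<beta>w p p)) (at p within {Q..P})"
      by simp
  next
    show "continuous_on ?T (\<lambda>(p, q). \<alpha> p q)" unfolding \<alpha>_def split_beta
      using cf unfolding split_beta by (intro continuous_intros ck)
    show "continuous_on ?T (\<lambda>(p, q). (\<beta>z p q, \<beta>w p q))" unfolding split_beta
      using c\<beta> unfolding split_beta by (intro continuous_intros)
  next
    fix \<epsilon> :: real assume \<epsilon>: "\<epsilon> > 0"
    then have \<epsilon>3: "\<epsilon> / 3 > 0" by simp
    obtain d1 where d1: "d1 > 0" "\<forall>p1 p2 q. Q \<le> q \<and> q \<le> p1 \<and> p1 \<le> p2 \<and> p2 \<le> P \<and> p2 - p1 < d1 \<longrightarrow>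
      \<bar>f p2 q * k1' p2 q - f p1 q * k1' p1 q
        - (p2 - p1) * (fp p1 q * k1' p1 q + f p1 q * (k1z' p1 q * \<beta>z p1 q + k1w' p1 q * \<beta>w p1 q))\<bar>
      \<le> L1 * (\<bar>z p2 q - z p1 q - (p2 - p1) * \<beta>z p1 q\<bar> + \<bar>w p2 q - w p1 q - (p2 - p1) * \<beta>w p1 q\<bar>) + \<epsilon> / 3 * (p2 - p1)"
      using L1(2)[rule_format, OF \<epsilon>3] by (elim exE conjE)
    obtain d2 where d2: "d2 > 0" "\<forall>p1 p2 q. Q \<le> q \<and> q \<le> p1 \<and> p1 \<le> p2 \<and> p2 \<le> P \<and> p2 - p1 < d2 \<longrightarrow>
      \<bar>f p2 q * k2' p2 q - f p1 q * k2' p1 q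
        - (p2 - p1) * (fp p1 q * k2' p1 q + f p1 q * (k2z' p1 q * \<beta>z p1 q + k2w' p1 q * \<beta>w p1 q))\<bar>
      \<le> L2 * (\<bar>z p2 q - z p1 q - (p2 - p1) * \<beta>z p1 q\<bar> + \<bar>w p2 q - w p1 q - (p2 - p1) * \<beta>w p1 q\<bar>) + \<epsilon> / 3 * (p2 - p1)"
      using L2(2)[rule_format, OF \<epsilon>3] by (elim exE conjE)
    have "\<exists>\<delta>>0. \<forall>p1 p2 q. Q \<le> q \<and> q \<le> p1 \<and> p1 \<le> p2 \<and> p2 \<le> P \<and> p2 - p1 < \<delta> \<longrightarrow>
      \<bar>g2 p2 q - g2 p1 q - (p2 - p1) * gp p1 q\<bar> \<le> \<epsilon> / 3 * (p2 - p1)"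
      by (rule uniform_difference[where f = g2, OF _ cf(4) \<epsilon>3]) (erule g_p)
    then obtain d3 where d3: "d3 > 0" "\<forall>p1 p2 q. Q \<le> q \<and> q \<le> p1 \<and> p1 \<le> p2 \<and> p2 \<le> P \<and> p2 - p1 < d3 \<longrightarrow>
      \<bar>g2 p2 q - g2 p1 q - (p2 - p1) * gp p1 q\<bar> \<le> \<epsilon> / 3 * (p2 - p1)"
      by (elim exE conjE)
    show "\<exists>\<delta>>0. \<forall>p1 p2 q. Q \<le> q \<and> q \<le> p1 \<and> p1 \<le> p2 \<and> p2 \<le> P \<and> p2 - p1 < \<delta> \<longrightarrow>
      norm (\<alpha> p2 q - \<alpha> p1 q - (p2 - p1) *\<^sub>R \<sigma> p1 q)
        \<le> 2 * (L1 + L2) * norm ((z p2 q, w p2 q) - (z p1 q, w p1 q) - (p2 - p1) *\<^sub>R (\<beta>z p1 q, \<beta>w p1 q)) + \<epsilon> * (p2 - p1)"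
    proof (intro exI[of _ "min d1 (min d2 d3)"] conjI allI impI)
      fix p1 p2 q assume *: "Q \<le> q \<and> q \<le> p1 \<and> p1 \<le> p2 \<and> p2 \<le> P \<and> p2 - p1 < min d1 (min d2 d3)"
      define ez ew N where "ez = z p2 q - z p1 q - (p2 - p1) * \<beta>z p1 q" and "ew = w p2 q - w p1 q - (p2 - p1) * \<beta>w p1 q"
        and "N = norm ((z p2 q, w p2 q) - (z p1 q, w p1 q) - (p2 - p1) *\<^sub>R (\<beta>z p1 q, \<beta>w p1 q))"
      have N: "\<bar>ez\<bar> + \<bar>ew\<bar> \<le> 2 * N"
        using norm_fst_le[of ez ew] norm_snd_le[of ew ez] by (simp add: N_def ez_def ew_def)
      define e1 e2 e3 where "e1 = f p2 q * k1' p2 q - f p1 q * k1' p1 q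
          - (p2 - p1) * (fp p1 q * k1' p1 q + f p1 q * (k1z' p1 q * \<beta>z p1 q + k1w' p1 q * \<beta>w p1 q))"
        and "e2 = f p2 q * k2' p2 q - f p1 q * k2' p1 q
          - (p2 - p1) * (fp p1 q * k2' p1 q + f p1 q * (k2z' p1 q * \<beta>z p1 q + k2w' p1 q * \<beta>w p1 q))"
        and "e3 = g2 p2 q - g2 p1 q - (p2 - p1) * gp p1 q"
      have e: "\<bar>e1\<bar> \<le> L1 * (\<bar>ez\<bar> + \<bar>ew\<bar>) + \<epsilon> / 3 * (p2 - p1)" "\<bar>e2\<bar> \<le> L2 * (\<bar>ez\<bar> + \<bar>ew\<bar>) + \<epsilon> / 3 * (p2 - p1)"
        "\<bar>e3\<bar> \<le> \<epsilon> / 3 * (p2 - p1)"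
        using d1(2)[rule_format, of q p1 p2] d2(2)[rule_format, of q p1 p2] d3(2)[rule_format, of q p1 p2] *
        by (simp_all add: e1_def e2_def e3_def ez_def ew_def)
      have "\<alpha> p2 q - \<alpha> p1 q - (p2 - p1) *\<^sub>R \<sigma> p1 q = (e1, e2 + e3)"
        by (simp add: \<alpha>_def \<sigma>_def e1_def e2_def e3_def algebra_simps)
      then have "norm (\<alpha> p2 q - \<alpha> p1 q - (p2 - p1) *\<^sub>R \<sigma> p1 q) \<le> \<bar>e1\<bar> + \<bar>e2 + e3\<bar>"
        using norm_Pair_le[of e1 "e2 + e3"] by simp
      also have "\<dots> \<le> (L1 + L2) * (\<bar>ez\<bar> + \<bar>ew\<bar>) + \<epsilon> * (p2 - p1)"
      proof -
        have "(L1 + L2) * (\<bar>ez\<bar> + \<bar>ew\<bar>) + \<epsilon> * (p2 - p1) = (L1 * (\<bar>ez\<bar> + \<bar>ew\<bar>) + \<epsilon> / 3 * (p2 - p1))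
            + ((L2 * (\<bar>ez\<bar> + \<bar>ew\<bar>) + \<epsilon> / 3 * (p2 - p1)) + \<epsilon> / 3 * (p2 - p1))"
          by (simp add: field_simps)
        then show ?thesis using e by linarith
      qed
      also have "(L1 + L2) * (\<bar>ez\<bar> + \<bar>ew\<bar>) \<le> (L1 + L2) * (2 * N)"
        using L1(1) L2(1) N by (intro mult_left_mono) auto
      also have "(L1 + L2) * (2 * N) = 2 * (L1 + L2) * N" by simp
      finally show "norm (\<alpha> p2 q - \<alpha> p1 q - (p2 - p1) *\<^sub>R \<sigma> p1 q)
        \<le> 2 * (L1 + L2) * norm ((z p2 q, w p2 q) - (z p1 q, w p1 q) - (p2 - p1) *\<^sub>R (\<beta>z p1 q, \<beta>w p1 q)) + \<epsilon> * (p2 - p1)"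
        by (simp only: N_def)
    qed (use d1 d2 d3 in auto)
  qed (use L1 L2 in auto)
  from bounded_linear.has_vector_derivative[OF bounded_linear_fst this] bounded_linear.has_vector_derivative[OF bounded_linear_snd this]
  show "((\<lambda>p. z p q) has_real_derivative X p q * (k1 (z p q) (w p q) * a (x p q) + ze p q)) (at p within {q..P})"
    "((\<lambda>p. w p q) has_real_derivative X p q * (k2 (z p q) (w p q) * a (x p q))) (at p within {q..P})"
    by (simp_all add: has_real_derivative_iff_has_vector_derivative \<beta>z_def \<beta>w_def k1'_def k2'_def A_def)
qed

end

section \<open>The clamps are inactive\<close>

lemma DERIV_reflect:
  fixes f :: "real \<Rightarrow> real"
  assumes "(f has_real_derivative D) (at (c - s))"
  shows "((\<lambda>s. f (c - s)) has_real_derivative - D) (at s within S)"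
proof -
  have "((\<lambda>s. c - s) has_real_derivative - 1) (at s within S)" by (auto intro!: derivative_eq_intros)
  from DERIV_chain'[OF this assms] show ?thesis by simp
qed

lemma DERIV_translate:
  fixes f :: "real \<Rightarrow> real"
  assumes "(f has_real_derivative D) (at (c + s) within {c..c + l})"
  shows "((\<lambda>s. f (c + s)) has_real_derivative D) (at s within {0..l})"
proof -
  have 1: "((\<lambda>s. c + s) has_real_derivative 1) (at s within {0..l})" by (auto intro!: derivative_eq_intros)
  have "(\<lambda>s. c + s) ` {0..l} \<subseteq> {c..c + l}" by auto
  with assms have "(f has_real_derivative D) (at (c + s) within (\<lambda>s. c + s) ` {0..l})" by (rule DERIV_subset)
  from DERIV_image_chain'[OF 1 this] show ?thesis by simp
qed

lemma nonincreasing_within: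
  fixes f f' :: "real \<Rightarrow> real"
  assumes "a \<le> b" and f: "\<And>s. s \<in> {a..b} \<Longrightarrow> (f has_real_derivative f' s) (at s within {a..b})"
    and le: "\<And>s. s \<in> {a..b} \<Longrightarrow> f' s \<le> 0"
  shows "f b \<le> f a"
proof -
  have "\<exists>s\<in>{a..b}. f b - f a = f' s * (b - a)"
    by (rule mvt_very_simple[OF assms(1)]) (use f in \<open>auto simp: has_field_derivative_def\<close>)
  then obtain s where "s \<in> {a..b}" "f b - f a = f' s * (b - a)" by blast
  moreover have "f' s * (b - a) \<le> 0" using le[of s] calculation assms(1) by (intro mult_nonpos_nonneg) auto
  ultimately show ?thesis by linarith
qed

context char_picard begin

text \<open>The strict counterpart of \<open>good\<close>, an open condition, so that the set of
  failures is closed. The signs of X and Y are left to \<open>X_neg\<close> and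
  \<open>Y_pos\<close>.\<close>

definition sgood :: "real \<Rightarrow> real \<Rightarrow> bool" where
  "sgood p q \<longleftrightarrow> zl < z p q \<and> z p q < zu \<and> wl < w p q \<and> w p q < wu \<and> - KX < X p q \<and> Y p q < KX \<and>
     \<bar>ze p q\<bar> < K \<and> \<bar>om p q\<bar> < K"

lemma sgood_imp_good: "sgood p q \<Longrightarrow> 0 \<le> q \<Longrightarrow> q \<le> p \<Longrightarrow> good p q"
  using X_neg[of p q] Y_pos[of q p] by (auto simp: sgood_def good_def)

lemma weight_bounds:
  assumes "p \<ge> 0"
  shows "- (b2 / m) \<le> m1 (z p p) (w p p) / (m1 (z p p) (w p p) - m2 (z p p) (w p p))"
    and "- m2 (z p p) (w p p) / (m1 (z p p) (w p p) - m2 (z p p) (w p p)) \<le> b2 / m"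
proof -
  note s = diag_speeds[OF assms]
  have "- m1 (z p p) (w p p) / (m1 (z p p) (w p p) - m2 (z p p) (w p p)) \<le> b2 / m"
    using s(1,3,4) b1 m b2_pos by (intro frac_le) linarith+
  then show "- (b2 / m) \<le> m1 (z p p) (w p p) / (m1 (z p p) (w p p) - m2 (z p p) (w p p))" by simp
  show "- m2 (z p p) (w p p) / (m1 (z p p) (w p p) - m2 (z p p) (w p p)) \<le> b2 / m"
    using s(2,3,4) b1 m b2_pos by (intro frac_le) linarith+
qed

lemma good_diag:
  assumes "p \<ge> 0"
  shows "good p p"
proof -
  have D: "1 + CH * p \<ge> 1" using CH assms by simp
  have XD: "X p p * (1 + CH * p) = m1 (z p p) (w p p) / (m1 (z p p) (w p p) - m2 (z p p) (w p p))"
    and YD: "Y p p * (1 + CH * p) = - m2 (z p p) (w p p) / (m1 (z p p) (w p p) - m2 (z p p) (w p p))"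
    using D by (simp_all add: X_diag[OF assms] Y_diag[OF assms])
  have X0: "X p p < 0" and Y0: "Y p p > 0" using X_neg[OF assms] Y_pos[OF assms] by auto
  have "X p p * (1 + CH * p) \<le> X p p" using mult_left_mono_neg[OF D, of "X p p"] X0 by simp
  moreover have "Y p p \<le> Y p p * (1 + CH * p)" using mult_left_mono[OF D, of "Y p p"] Y0 by simp
  ultimately have "- KX \<le> X p p" "Y p p \<le> KX"
    using weight_bounds[OF assms] XD YD unfolding KX_def by linarith+
  moreover have "\<bar>ze p p\<bar> \<le> K" "\<bar>om p p\<bar> \<le> K"
    using data_K[OF x_diag_nonneg[OF assms]] by (simp_all add: ze_diag[OF assms] om_diag[OF assms])
  ultimately show ?thesis
    using box_diag[OF assms] X0 Y0 unfolding good_def abs_le_iff by auto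
qed

text \<open>The leg p = P is a 1-characteristic run from the diagonal by q = P - s, the leg q = Q a
  2-characteristic run by p = Q + s; \<open>apriori1\<close> and \<open>apriori2\<close> apply to
  them. X and Y are controlled by the factor \<open>exp (CH * x)\<close>, whose growth dominates
  \<open>H\<close>.\<close>

lemma apex_strict:
  assumes QP: "0 \<le> Q" "Q \<le> P" and x0: "0 \<le> x P Q" and g: "\<And>p q. (p, q) \<in> triangle Q P \<Longrightarrow> good p q"
  shows "sgood P Q"
proof -
  let ?T = "triangle Q P"
  define l where "l = P - Q"
  have l: "l \<ge> 0" "Q + l = P" using QP by (auto simp: l_def)
  have xT: "0 \<le> x p q" if "(p, q) \<in> ?T" for p q using x_mono[OF QP(1) that] x0 by simp
  have xp: "((\<lambda>p. x p Q) has_real_derivative X p Q) (at p within {Q..P})" if "p \<in> {Q..P}" for p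
    by (rule x_p) (use that QP in auto)
  have Pn: "P \<ge> 0" using QP by simp
  have A: "zl < z P (P - l) \<and> z P (P - l) < zu \<and> \<bar>ze P (P - l)\<bar> < K"
  proof (rule apriori1[where x = "\<lambda>s. x P (P - s)" and z = "\<lambda>s. z P (P - s)" and w = "\<lambda>s. w P (P - s)"
        and ze = "\<lambda>s. ze P (P - s)" and om = "\<lambda>s. om P (P - s)" and x' = "\<lambda>s. - Y P (P - s)", OF l(1)])
    fix s assume s: "s \<in> {0..l}"
    then have T: "(P, P - s) \<in> ?T" using QP by (auto simp: l_def)
    note gT = g[OF T] xT[OF T]
    have "Y P (P - s) > 0" by (rule Y_pos) (use T QP in auto)
    moreover have "((\<lambda>s. x P (P - s)) has_real_derivative - Y P (P - s)) (at s within {0..l})"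
      by (rule DERIV_reflect[OF x_q])
    moreover note DERIV_reflect[OF z_q[OF gT], of "{0..l}"] DERIV_reflect[OF w_q[OF gT], of "{0..l}"] DERIV_reflect[OF ze_q[OF gT], of "{0..l}"]
    ultimately show "0 \<le> x P (P - s) \<and> z P (P - s) \<in> {zl..zu} \<and> w P (P - s) \<in> {wl..wu} \<and> \<bar>ze P (P - s)\<bar> \<le> K \<and>
        \<bar>om P (P - s)\<bar> \<le> K \<and> - Y P (P - s) < 0 \<and>
        ((\<lambda>s. x P (P - s)) has_real_derivative - Y P (P - s)) (at s within {0..l}) \<and>
        ((\<lambda>s. z P (P - s)) has_real_derivative - Y P (P - s) * (k1 (z P (P - s)) (w P (P - s)) * a (x P (P - s)))) (at s within {0..l}) \<and>
        ((\<lambda>s. w P (P - s)) has_real_derivative - Y P (P - s) * (k2 (z P (P - s)) (w P (P - s)) * a (x P (P - s)) + om P (P - s))) (at s within {0..l}) \<and>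
        ((\<lambda>s. ze P (P - s)) has_real_derivative - Y P (P - s) * zrate (a (x P (P - s))) (z P (P - s)) (w P (P - s)) (ze P (P - s)) (om P (P - s))) (at s within {0..l})"
      using gT unfolding good_def by (auto simp: abs_le_iff)
  qed (use z_diag[OF Pn] w_diag[OF Pn] ze_diag[OF Pn] in auto)
  have B: "wl < w (Q + l) Q \<and> w (Q + l) Q < wu \<and> \<bar>om (Q + l) Q\<bar> < K"
  proof (rule apriori2[where x = "\<lambda>s. x (Q + s) Q" and z = "\<lambda>s. z (Q + s) Q" and w = "\<lambda>s. w (Q + s) Q"
        and ze = "\<lambda>s. ze (Q + s) Q" and om = "\<lambda>s. om (Q + s) Q" and x' = "\<lambda>s. X (Q + s) Q", OF l(1)])
    fix s assume s: "s \<in> {0..l}"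
    then have T: "(Q + s, Q) \<in> ?T" using QP by (auto simp: l_def)
    note gT = g[OF T] xT[OF T]
    have "X (Q + s) Q < 0" by (rule X_neg) (use T QP in auto)
    moreover have "Q + s \<in> {Q..P}" using T by auto
    moreover note DERIV_translate[of "\<lambda>p. x p Q" _ Q s l, unfolded l(2), OF xp[OF this]]
      DERIV_translate[of "\<lambda>p. z p Q" _ Q s l, unfolded l(2), OF zw_p_triangle(1)[OF QP(1) x0 g T]]
      DERIV_translate[of "\<lambda>p. w p Q" _ Q s l, unfolded l(2), OF zw_p_triangle(2)[OF QP(1) x0 g T]]
      DERIV_translate[of "\<lambda>p. om p Q" _ Q s l, unfolded l(2), OF has_field_derivative_at_within[OF om_p[OF gT]]]
    ultimately show "0 \<le> x (Q + s) Q \<and> z (Q + s) Q \<in> {zl..zu} \<and> w (Q + s) Q \<in> {wl..wu} \<and> \<bar>ze (Q + s) Q\<bar> \<le> K \<and>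
        \<bar>om (Q + s) Q\<bar> \<le> K \<and> X (Q + s) Q < 0 \<and>
        ((\<lambda>s. x (Q + s) Q) has_real_derivative X (Q + s) Q) (at s within {0..l}) \<and>
        ((\<lambda>s. z (Q + s) Q) has_real_derivative X (Q + s) Q * (k1 (z (Q + s) Q) (w (Q + s) Q) * a (x (Q + s) Q) + ze (Q + s) Q)) (at s within {0..l}) \<and>
        ((\<lambda>s. w (Q + s) Q) has_real_derivative X (Q + s) Q * (k2 (z (Q + s) Q) (w (Q + s) Q) * a (x (Q + s) Q))) (at s within {0..l}) \<and>
        ((\<lambda>s. om (Q + s) Q) has_real_derivative X (Q + s) Q * wrate (a (x (Q + s) Q)) (z (Q + s) Q) (w (Q + s) Q) (ze (Q + s) Q) (om (Q + s) Q)) (at s within {0..l})"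
      using gT unfolding good_def by (auto simp: abs_le_iff)
  qed (use z_diag[OF QP(1)] w_diag[OF QP(1)] om_diag[OF QP(1)] in auto)
  \<comment> \<open>The q-derivative of \<open>X * exp (CH * x)\<close> is X Y (H + CH) times a
    positive factor, hence nonpositive. On the diagonal the function equals the initial weight
    because \<open>exp (CH * x p p) = 1 + CH * p\<close>, the reason for the logarithmic labels; x
    \<ge> 0 finally discards the exponential.\<close>
  have XQ: "- (b2 / m) \<le> X P Q"
  proof -
    have d: "((\<lambda>q. X P q * exp (CH * x P q)) has_real_derivative (S P q + X P q * (CH * Y P q)) * exp (CH * x P q)) (at q within {Q..P})" for q
      unfolding S_def
      by (rule derivative_eq_intros has_field_derivative_at_within[OF X_q] has_field_derivative_at_within[OF x_q] refl)+ (simp add: algebra_simps)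
    have "X P P * exp (CH * x P P) \<le> X P Q * exp (CH * x P Q)"
    proof (rule nonincreasing_within[OF QP(2) d])
      fix q assume q: "q \<in> {Q..P}"
      then have T: "(P, q) \<in> ?T" by auto
      have "\<bar>H P q\<bar> \<le> CH" by (rule unclamped(6)[OF g[OF T] xT[OF T]])
      then have "X P q * Y P q * (H P q + CH) \<le> 0"
        using X_neg[OF Pn, of q] Y_pos[of q P] q QP by (intro mult_nonpos_nonneg mult_neg_pos[THEN less_imp_le]) auto
      then have "S P q + X P q * (CH * Y P q) \<le> 0"
        unfolding unclamped(1)[OF g[OF T] xT[OF T]] by (simp add: algebra_simps)
      then show "(S P q + X P q * (CH * Y P q)) * exp (CH * x P q) \<le> 0" by (simp add: mult_nonpos_nonneg)
    qed
    moreover have "X P P * exp (CH * x P P) = m1 (z P P) (w P P) / (m1 (z P P) (w P P) - m2 (z P P) (w P P))"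
      using CH Pn by (simp add: exp_x_diag[OF Pn] X_diag[OF Pn] add_pos_nonneg less_imp_neq[symmetric])
    moreover have "X P Q * exp (CH * x P Q) \<le> X P Q"
      using mult_left_mono_neg[of 1 "exp (CH * x P Q)" "X P Q"] X_neg[OF Pn, of Q] CH x0 by simp
    ultimately show ?thesis using weight_bounds(1)[OF Pn] by linarith
  qed
  have YP: "Y P Q \<le> b2 / m"
  proof -
    have d: "((\<lambda>p. Y p Q * exp (CH * x p Q)) has_real_derivative (S p Q + Y p Q * (CH * X p Q)) * exp (CH * x p Q)) (at p within {Q..P})"
      if "p \<in> {Q..P}" for p
      unfolding S_def
      by (rule derivative_eq_intros has_field_derivative_at_within[OF Y_p] xp that refl)+ (simp add: algebra_simps)
    have "Y P Q * exp (CH * x P Q) \<le> Y Q Q * exp (CH * x Q Q)"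
    proof (rule nonincreasing_within[OF QP(2) d])
      fix p assume p: "p \<in> {Q..P}"
      then have T: "(p, Q) \<in> ?T" by auto
      have "\<bar>H p Q\<bar> \<le> CH" by (rule unclamped(6)[OF g[OF T] xT[OF T]])
      then have "X p Q * Y p Q * (H p Q + CH) \<le> 0"
        using X_neg[of p Q] Y_pos[OF QP(1), of p] p QP by (intro mult_nonpos_nonneg mult_neg_pos[THEN less_imp_le]) auto
      then have "S p Q + Y p Q * (CH * X p Q) \<le> 0"
        unfolding unclamped(1)[OF g[OF T] xT[OF T]] by (simp add: algebra_simps)
      then show "(S p Q + Y p Q * (CH * X p Q)) * exp (CH * x p Q) \<le> 0" by (simp add: mult_nonpos_nonneg)
    qed
    moreover have "Y Q Q * exp (CH * x Q Q) = - m2 (z Q Q) (w Q Q) / (m1 (z Q Q) (w Q Q) - m2 (z Q Q) (w Q Q))"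
      using CH QP(1) by (simp add: exp_x_diag[OF QP(1)] Y_diag[OF QP(1)] add_pos_nonneg less_imp_neq[symmetric])
    moreover have "Y P Q \<le> Y P Q * exp (CH * x P Q)"
      using mult_left_mono[of 1 "exp (CH * x P Q)" "Y P Q"] Y_pos[OF QP(1), of P] CH x0 by simp
    ultimately show ?thesis using weight_bounds(2)[OF QP(1)] by linarith
  qed
  show ?thesis using A B XQ YP unfolding sgood_def KX_def l(2) by (auto simp: l_def)
qed

lemma continuous_line:
  assumes "continuous_on UNIV (\<lambda>(p, q). f p q :: real)"
  shows "continuous_on I (\<lambda>p. f p q)"
proof -
  have "continuous_on I (\<lambda>p. (p, q))" by (intro continuous_intros)
  from continuous_on_compose2[OF assms this] show ?thesis by simp
qed

lemma all_sgood:
  assumes pq: "0 \<le> q" "q \<le> p" "0 \<le> x p q"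
  shows "sgood p q"
proof (rule ccontr)
  assume bad: "\<not> sgood p q"
  \<comment> \<open>Cutting off at \<open>p\<close> makes the set of failures compact, so that the
    width fst - snd attains its minimum on it.\<close>
  define B where "B = {y. 0 \<le> snd y \<and> snd y \<le> fst y \<and> fst y \<le> p \<and> 0 \<le> x (fst y) (snd y) \<and> \<not> sgood (fst y) (snd y)}"
  note c = cont_x[unfolded split_beta] cont_z[unfolded split_beta] cont_w[unfolded split_beta] cont_X[unfolded split_beta]
    cont_ze[unfolded split_beta] cont_Y[unfolded split_beta] cont_om[unfolded split_beta]
  have "closed B"
    unfolding B_def sgood_def de_Morgan_conj not_less
    by (intro closed_Collect_conj closed_Collect_disj closed_Collect_le continuous_intros c)
  moreover have "B \<subseteq> cbox (0, 0) (p, p)" by (auto simp: B_def cbox_Pair_eq)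
  ultimately have "compact B" by (meson bounded_cbox bounded_subset compact_eq_bounded_closed)
  moreover have "B \<noteq> {}"
  proof -
    have "(p, q) \<in> B" using bad pq by (simp add: B_def)
    then show ?thesis by (metis empty_iff)
  qed
  moreover have "continuous_on B (\<lambda>y. fst y - snd y)" by (intro continuous_intros)
  ultimately have "\<exists>y\<in>B. \<forall>y'\<in>B. fst y - snd y \<le> fst y' - snd y'"
    by (rule continuous_attains_inf)
  then obtain y where y: "y \<in> B" "\<forall>y'\<in>B. fst y - snd y \<le> fst y' - snd y'" by (elim bexE)
  \<comment> \<open>\<open>(P, Q)\<close> is the apex of the smallest triangle on which the bounds fail, so the a priori estimates
     hold along both of its sides.\<close>
  define P Q where "P = fst y" and "Q = snd y"
  have PQ: "0 \<le> Q" "Q \<le> P" "P \<le> p" "0 \<le> x P Q" "\<not> sgood P Q" using y(1) by (auto simp: B_def P_def Q_def)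
  have min: "P - Q \<le> p' - q'" if "0 \<le> q'" "q' \<le> p'" "p' \<le> p" "0 \<le> x p' q'" "\<not> sgood p' q'" for p' q'
    using y(2)[rule_format, of "(p', q')"] that by (simp add: B_def P_def Q_def)
  have g': "good p' q'" if T: "(p', q') \<in> triangle Q P" and ne: "(p', q') \<noteq> (P, Q)" for p' q'
  proof -
    have T': "Q \<le> q'" "q' \<le> p'" "p' \<le> P" using T by simp_all
    have "p' \<noteq> P \<or> q' \<noteq> Q" using ne by simp
    then have lt: "p' - q' < P - Q" using T' by linarith
    have x0: "0 \<le> x p' q'" using x_mono[OF PQ(1) T] PQ(4) by linarith
    have q0: "0 \<le> q'" "p' \<le> p" using T' PQ by linarith+
    have "sgood p' q'"
    proof (rule ccontr)
      assume "\<not> sgood p' q'"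
      from min[OF q0(1) T'(2) q0(2) x0 this] lt show False by linarith
    qed
    then show ?thesis by (rule sgood_imp_good[OF _ q0(1) T'(2)])
  qed
  \<comment> \<open>The apex may violate the strict bounds, but it is a limit of good points on the
    side q = Q, and \<open>good\<close> is a closed condition. If the triangle is a single point,
    the initial data decide.\<close>
  have "good P Q"
  proof (cases "P = Q")
    case True then show ?thesis using good_diag PQ by simp
  next
    case False
    then have lt: "Q < P" using PQ by simp
    have cl: "closed {r. good r Q}"
      unfolding good_def atLeastAtMost_iff
      by (intro closed_Collect_conj closed_Collect_le continuous_on_const continuous_line[OF cont_z] continuous_line[OF cont_w]
          continuous_line[OF cont_X] continuous_line[OF cont_Y] continuous_line[OF cont_ze] continuous_line[OF cont_om])
    have "{Q..<P} \<subseteq> {r. good r Q}"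
    proof (rule subsetI, rule CollectI)
      fix r assume "r \<in> {Q..<P}" then show "good r Q" by (intro g') auto
    qed
    then have "closure {Q..<P} \<subseteq> {r. good r Q}" using cl by (rule closure_minimal)
    moreover have "P \<in> closure {Q..<P}" using lt by simp
    ultimately have "P \<in> {r. good r Q}" by (rule subsetD)
    then show ?thesis by simp
  qed
  then have "good p' q'" if "(p', q') \<in> triangle Q P" for p' q'
    using g'[OF that] by (cases "(p', q') = (P, Q)") simp_all
  then have "sgood P Q" by (rule apex_strict[OF PQ(1,2,4)])
  with PQ(5) show False by simp
qed

lemma dom_good: "0 \<le> q \<Longrightarrow> q \<le> p \<Longrightarrow> 0 \<le> x p q \<Longrightarrow> good p q"
  by (rule sgood_imp_good[OF all_sgood])

lemma dom_triangle:
  assumes "0 \<le> Q" "0 \<le> x P Q" "(p, q) \<in> triangle Q P"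
  shows "0 \<le> x p q" "good p q"
proof -
  show "0 \<le> x p q" using x_mono[OF assms(1,3)] assms(2) by simp
  then show "good p q" using assms by (intro dom_good) auto
qed

end

section \<open>The map to the physical quadrant\<close>

context char_picard begin

text \<open>The part of the label plane that corresponds to the quadrant: q \<le> p stands for t
  \<ge> 0, while x \<ge> 0 is imposed.\<close>

definition Dom :: "(real \<times> real) set" where
  "Dom = {(p, q). 0 \<le> q \<and> q \<le> p \<and> 0 \<le> x p q}"

lemma in_Dom: "(p, q) \<in> Dom \<longleftrightarrow> 0 \<le> q \<and> q \<le> p \<and> 0 \<le> x p q"
  by (simp add: Dom_def)

lemma triangle_Dom: "0 \<le> Q \<Longrightarrow> 0 \<le> x P Q \<Longrightarrow> triangle Q P \<subseteq> Dom"
proof (rule subsetI)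
  fix y assume "0 \<le> Q" "0 \<le> x P Q" "y \<in> triangle Q P"
  then show "y \<in> Dom" using dom_triangle(1)[of Q P "fst y" "snd y"] by (cases y) (simp add: in_Dom)
qed

lemma Dom_good: "(p, q) \<in> Dom \<Longrightarrow> good p q"
  by (rule dom_good) (simp_all add: in_Dom)

lemma Dom_box: "(p, q) \<in> Dom \<Longrightarrow> z p q \<in> {zl..zu} \<and> w p q \<in> {wl..wu}"
  using Dom_good[of p q] by (simp add: good_def)

lemma Dom_down: "(P, Q) \<in> Dom \<Longrightarrow> (p, q) \<in> triangle Q P \<Longrightarrow> (p, q) \<in> Dom"
  by (rule subsetD[OF triangle_Dom[of Q P]]) (simp_all add: in_Dom)

lemma Dom_speeds:
  assumes "(p, q) \<in> Dom"
  shows "- b2 \<le> m2 (z p q) (w p q)" "m1 (z p q) (w p q) \<le> - b1" "m \<le> m1 (z p q) (w p q) - m2 (z p q) (w p q)"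
  using speeds[of "z p q" "w p q"] Dom_box[OF assms] by auto

lemma Dom_cont_box:
  assumes "continuous_on ({zl..zu} \<times> {wl..wu}) (\<lambda>(z, w). k z w)"
  shows "continuous_on Dom (\<lambda>y. k (z (fst y) (snd y)) (w (fst y) (snd y)))"
proof -
  have "continuous_on Dom (\<lambda>(p, q). k (z p q) (w p q))"
    by (rule continuous_on_triangle_box[OF assms continuous_on_subset[OF cont_z subset_UNIV] continuous_on_subset[OF cont_w subset_UNIV] Dom_box])
  then show ?thesis by (simp only: case_prod_unfold)
qed

lemma Dom_cont:
  "continuous_on Dom (\<lambda>y. x (fst y) (snd y))" "continuous_on Dom (\<lambda>y. z (fst y) (snd y))" "continuous_on Dom (\<lambda>y. w (fst y) (snd y))"
  "continuous_on Dom (\<lambda>y. X (fst y) (snd y))" "continuous_on Dom (\<lambda>y. Y (fst y) (snd y))"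
  "continuous_on Dom (\<lambda>y. ze (fst y) (snd y))" "continuous_on Dom (\<lambda>y. om (fst y) (snd y))" "continuous_on Dom (\<lambda>y. S (fst y) (snd y))"
  using cont_x cont_z cont_w cont_X cont_Y cont_ze cont_om cont_S'[of UNIV]
  unfolding case_prod_unfold by (auto elim: continuous_on_subset)

lemma Dom_cont_a: "continuous_on Dom (\<lambda>y. a (x (fst y) (snd y)))"
  by (rule continuous_on_compose2[OF continuous_on_half_line[OF a_deriv] Dom_cont(1)]) (auto simp: Dom_def)

lemmas C1_conts = C1_box_continuous[OF C1_m1] C1_box_continuous[OF C1_m2] C1_box_continuous[OF C1_k1] C1_box_continuous[OF C1_k2]
  C1_m1[unfolded C1_box_def, THEN conjunct2, THEN conjunct1] C1_m1[unfolded C1_box_def, THEN conjunct2, THEN conjunct2]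
  C1_m2[unfolded C1_box_def, THEN conjunct2, THEN conjunct1] C1_m2[unfolded C1_box_def, THEN conjunct2, THEN conjunct2]

text \<open>Clamped so that \<open>t\<close> is defined and continuous on the whole plane; on
  \<open>Dom\<close> the clamps do nothing.\<close>

definition m1c :: "real \<Rightarrow> real \<Rightarrow> real" where
  "m1c p q = m1 (clamp_real zl zu (z p q)) (clamp_real wl wu (w p q))"

definition t :: "real \<Rightarrow> real \<Rightarrow> real" where
  "t p q = - oint (\<lambda>r. m1c p r * Y p r) q p"

lemma cont_m1c: "continuous_on UNIV (\<lambda>y. m1c (fst y) (snd y))"
proof -
  have c: "continuous_on UNIV (\<lambda>(p, q). clamp_real zl zu (z p q))" "continuous_on UNIV (\<lambda>(p, q). clamp_real wl wu (w p q))"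
    using cont_z cont_w unfolding clamp_real_def case_prod_unfold by (auto intro!: continuous_intros)
  have "continuous_on UNIV (\<lambda>(p, q). m1 (clamp_real zl zu (z p q)) (clamp_real wl wu (w p q)))"
    by (rule continuous_on_triangle_box[OF C1_conts(1) c]) (simp only: clamp_real_in[OF zlu] clamp_real_in[OF wlu] simp_thms)
  then show ?thesis by (simp only: m1c_def case_prod_unfold)
qed

lemma t_diag: "t p p = 0"
  by (simp add: t_def)

lemma cont_t: "continuous_on UNIV (\<lambda>y. t (fst y) (snd y))"
proof -
  have "continuous_on UNIV (\<lambda>yr :: (real \<times> real) \<times> real. (fst (fst yr), snd yr))" by (intro continuous_intros)
  from continuous_on_compose2[OF cont_m1c this] continuous_on_compose2[OF cont_Y[unfolded case_prod_unfold] this]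
  have "continuous_on UNIV (\<lambda>yr :: (real \<times> real) \<times> real. m1c (fst (fst yr)) (snd yr) * Y (fst (fst yr)) (snd yr))"
    by (intro continuous_on_mult) simp_all
  then have "continuous_on UNIV (\<lambda>(y :: real \<times> real, r). m1c (fst y) r * Y (fst y) r)"
    by (simp only: case_prod_unfold)
  then show ?thesis unfolding t_def by (intro continuous_on_minus continuous_on_oint continuous_intros)
qed

lemma t_q:
  assumes "(p, q) \<in> Dom"
  shows "((\<lambda>q. t p q) has_real_derivative m1 (z p q) (w p q) * Y p q) (at q)"
proof -
  have "continuous_on UNIV (\<lambda>r. (p, r))" by (intro continuous_intros)
  from continuous_on_compose2[OF cont_m1c this] continuous_on_compose2[OF cont_Y[unfolded case_prod_unfold] this]
  have "continuous_on UNIV (\<lambda>r. m1c p r * Y p r)" by (intro continuous_on_mult) simp_all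
  then have "((\<lambda>q. - oint (\<lambda>r. m1c p r * Y p r) q p) has_vector_derivative - (- (m1c p q * Y p q))) (at q)"
    by (intro derivative_intros oint_has_vector_derivative)
  moreover have "m1c p q = m1 (z p q) (w p q)"
    using Dom_box[OF assms] by (simp only: m1c_def clamp_real_id)
  ultimately show ?thesis by (simp add: has_real_derivative_iff_has_vector_derivative t_def)
qed

text \<open>\<open>hco\<close> was obtained from the requirement (m2 X)_q = (m1 Y)_p, and
  \<open>\<sigma>\<close> is the common value. As for x, the error hypothesis then holds with
  \<open>L = 0\<close>; on the diagonal t = 0 matches m1 Y + m2 X = 0.\<close>

lemma t_p:
  assumes Q: "0 \<le> Q" and x0: "0 \<le> x P Q" and pq: "(p, q) \<in> triangle Q P"
  shows "((\<lambda>p. t p q) has_real_derivative m2 (z p q) (w p q) * X p q) (at p within {q..P})"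
proof -
  let ?T = "triangle Q P"
  have TD: "?T \<subseteq> Dom" by (rule triangle_Dom[OF Q x0])
  have gT: "good p q" "0 \<le> x p q" if "(p, q) \<in> ?T" for p q using dom_triangle[OF Q x0 that] by auto
  have bT: "z p q \<in> {zl..zu} \<and> w p q \<in> {wl..wu}" if "(p, q) \<in> ?T" for p q using gT[OF that] by (simp only: good_def)
  define \<sigma> where "\<sigma> p q = (m1z (z p q) (w p q) * (X p q * (k1 (z p q) (w p q) * a (x p q) + ze p q))
      + m1w (z p q) (w p q) * (X p q * (k2 (z p q) (w p q) * a (x p q)))) * Y p q + S p q * m1 (z p q) (w p q)" for p q
  have c: "continuous_on ?T (\<lambda>(p, q). m1 (z p q) (w p q) * Y p q)" "continuous_on ?T (\<lambda>(p, q). m2 (z p q) (w p q) * X p q)"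
    "continuous_on ?T (\<lambda>(p, q). \<sigma> p q)"
    unfolding case_prod_unfold \<sigma>_def
    by (rule continuous_on_subset[OF _ TD], intro continuous_on_add continuous_on_mult Dom_cont Dom_cont_a Dom_cont_box C1_conts)+
  have "((\<lambda>p. t p q) has_vector_derivative m2 (z p q) (w p q) * X p q) (at p within {q..P})"
  proof (rule parameter_derivative[where \<alpha> = "\<lambda>p q. m1 (z p q) (w p q) * Y p q" and \<beta> = "\<lambda>p q. m2 (z p q) (w p q) * X p q"
        and \<sigma> = \<sigma> and L = 0, OF _ _ _ c(1,2) _ _ pq])
    fix p q assume T: "(p, q) \<in> ?T"
    then have D: "(p, q) \<in> Dom" using TD by blast
    show "((\<lambda>q. t p q) has_vector_derivative m1 (z p q) (w p q) * Y p q) (at q within {Q..p})"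
      using t_q[OF D] by (simp add: has_real_derivative_iff_has_vector_derivative has_vector_derivative_at_within)
    have Tq: "(p, r) \<in> ?T" if "r \<in> {Q..p}" for r using T that by auto
    have qm: "q \<in> {Q..p}" using T by auto
    have m2q: "((\<lambda>q. m2 (z p q) (w p q)) has_real_derivative m2z (z p q) (w p q) * (Y p q * (k1 (z p q) (w p q) * a (x p q)))
        + m2w (z p q) (w p q) * (Y p q * (k2 (z p q) (w p q) * a (x p q) + om p q))) (at q within {Q..p})"
      by (rule C1_box_chain[OF C1_m2 has_field_derivative_at_within[OF z_q[OF gT[OF T]]] has_field_derivative_at_within[OF w_q[OF gT[OF T]]] bT[OF Tq] qm])
    have "S p q * (m1 (z p q) (w p q) - m2 (z p q) (w p q)) = X p q * Y p q *
        (a (x p q) * (k1 (z p q) (w p q) * (m2z (z p q) (w p q) - m1z (z p q) (w p q)) + k2 (z p q) (w p q) * (m2w (z p q) (w p q) - m1w (z p q) (w p q)))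
          + m2w (z p q) (w p q) * om p q - m1z (z p q) (w p q) * ze p q)"
      unfolding unclamped(1)[OF gT[OF T]] H_def hco_def using Dom_speeds(3)[OF D] m by simp
    then have eq: "(m2z (z p q) (w p q) * (Y p q * (k1 (z p q) (w p q) * a (x p q)))
        + m2w (z p q) (w p q) * (Y p q * (k2 (z p q) (w p q) * a (x p q) + om p q))) * X p q + S p q * m2 (z p q) (w p q) = \<sigma> p q"
      unfolding \<sigma>_def by (simp add: algebra_simps)
    have Xq: "((\<lambda>q. X p q) has_real_derivative S p q) (at q within {Q..p})"
      unfolding S_def by (rule has_field_derivative_at_within[OF X_q])
    have "((\<lambda>q. m2 (z p q) (w p q) * X p q) has_real_derivative \<sigma> p q) (at q within {Q..p})"
      unfolding eq[symmetric] by (rule DERIV_mult[OF m2q Xq])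
    then show "((\<lambda>q. m2 (z p q) (w p q) * X p q) has_vector_derivative \<sigma> p q) (at q within {Q..p})"
      by (simp add: has_real_derivative_iff_has_vector_derivative)
  next
    fix p assume p: "p \<in> {Q..P}"
    then have p0: "p \<ge> 0" using Q by simp
    have "m1 (z p p) (w p p) * Y p p + m2 (z p p) (w p p) * X p p = 0"
      unfolding X_diag[OF p0] Y_diag[OF p0] by simp
    then show "((\<lambda>p. t p p) has_vector_derivative m1 (z p p) (w p p) * Y p p + m2 (z p p) (w p p) * X p p) (at p within {Q..P})"
      by (simp add: t_diag)
  next
    fix \<epsilon> :: real assume \<epsilon>: "\<epsilon> > 0"
    have "\<exists>\<delta>>0. \<forall>p1 p2 q. Q \<le> q \<and> q \<le> p1 \<and> p1 \<le> p2 \<and> p2 \<le> P \<and> p2 - p1 < \<delta> \<longrightarrow>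
      \<bar>m1 (z p2 q) (w p2 q) * Y p2 q - m1 (z p1 q) (w p1 q) * Y p1 q - (p2 - p1) * \<sigma> p1 q\<bar> \<le> \<epsilon> * (p2 - p1)"
    proof (rule uniform_difference[OF _ c(3) \<epsilon>])
      fix p q assume T: "(p, q) \<in> ?T"
      have Tp: "(r, q) \<in> ?T" if "r \<in> {q..P}" for r using T that by auto
      have pm: "p \<in> {q..P}" using T by auto
      note zwp = zw_p_triangle[OF Q x0 dom_triangle(2)[OF Q x0] T]
      have "((\<lambda>p. m1 (z p q) (w p q)) has_real_derivative m1z (z p q) (w p q) * (X p q * (k1 (z p q) (w p q) * a (x p q) + ze p q))
        + m1w (z p q) (w p q) * (X p q * (k2 (z p q) (w p q) * a (x p q)))) (at p within {q..P})"
        by (rule C1_box_chain[OF C1_m1 zwp bT[OF Tp] pm])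
      moreover have "((\<lambda>p. Y p q) has_real_derivative S p q) (at p within {q..P})"
        unfolding S_def by (rule has_field_derivative_at_within[OF Y_p])
      ultimately have "((\<lambda>p. m1 (z p q) (w p q) * Y p q) has_real_derivative (m1z (z p q) (w p q) * (X p q * (k1 (z p q) (w p q) * a (x p q) + ze p q))
        + m1w (z p q) (w p q) * (X p q * (k2 (z p q) (w p q) * a (x p q)))) * Y p q + S p q * m1 (z p q) (w p q)) (at p within {q..P})"
        by (rule DERIV_mult)
      then show "((\<lambda>p. m1 (z p q) (w p q) * Y p q) has_real_derivative \<sigma> p q) (at p within {q..P})"
        by (simp only: \<sigma>_def)
    qed
    then show "\<exists>\<delta>>0. \<forall>p1 p2 q. Q \<le> q \<and> q \<le> p1 \<and> p1 \<le> p2 \<and> p2 \<le> P \<and> p2 - p1 < \<delta> \<longrightarrow>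
      norm (m1 (z p2 q) (w p2 q) * Y p2 q - m1 (z p1 q) (w p1 q) * Y p1 q - (p2 - p1) *\<^sub>R \<sigma> p1 q)
        \<le> 0 * norm (t p2 q - t p1 q - (p2 - p1) *\<^sub>R (m2 (z p1 q) (w p1 q) * X p1 q)) + \<epsilon> * (p2 - p1)"
      by simp
  qed simp
  then show ?thesis by (simp add: has_real_derivative_iff_has_vector_derivative)
qed

lemma t_nonneg:
  assumes "(p, q) \<in> Dom" shows "0 \<le> t p q"
proof -
  have "t p p \<le> t p q"
  proof (rule nonincreasing_within[where f = "\<lambda>q. t p q" and f' = "\<lambda>q. m1 (z p q) (w p q) * Y p q"])
    fix s assume s: "s \<in> {q..p}"
    then have D: "(p, s) \<in> Dom" using Dom_down[OF assms, of p s] by auto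
    show "((\<lambda>q. t p q) has_real_derivative m1 (z p s) (w p s) * Y p s) (at s within {q..p})"
      by (rule has_field_derivative_at_within[OF t_q[OF D]])
    show "m1 (z p s) (w p s) * Y p s \<le> 0"
      using Dom_speeds(2)[OF D] b1 Y_pos[of s p] D by (intro mult_nonpos_nonneg) (auto simp: in_Dom intro: less_imp_le)
  qed (use assms in \<open>simp add: in_Dom\<close>)
  then show ?thesis by (simp add: t_diag)
qed

text \<open>Speeds are at most \<open>1 / b1\<close> in modulus: along the 1-characteristic
  \<open>p\<close>, x + t / b1 does not increase with q, and at q = p it is the foot
  \<open>x p p\<close>.\<close>

lemma upper_cone:
  assumes "(p, q) \<in> Dom" shows "x p p \<le> x p q + t p q / b1"
proof -
  have "x p p + t p p / b1 \<le> x p q + t p q / b1"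
  proof (rule nonincreasing_within[where f = "\<lambda>q. x p q + t p q / b1" and f' = "\<lambda>q. Y p q + m1 (z p q) (w p q) * Y p q / b1"])
    fix s assume s: "s \<in> {q..p}"
    then have D: "(p, s) \<in> Dom" using Dom_down[OF assms, of p s] by auto
    show "((\<lambda>q. x p q + t p q / b1) has_real_derivative Y p s + m1 (z p s) (w p s) * Y p s / b1) (at s within {q..p})"
      by (intro DERIV_add DERIV_cdivide has_field_derivative_at_within[OF x_q] has_field_derivative_at_within[OF t_q[OF D]])
    have "Y p s > 0" using Y_pos[of s p] D by (simp add: in_Dom)
    then have "m1 (z p s) (w p s) * Y p s \<le> - b1 * Y p s" using Dom_speeds(2)[OF D] by (intro mult_right_mono) auto
    then show "Y p s + m1 (z p s) (w p s) * Y p s / b1 \<le> 0" using b1 by (simp add: field_simps)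
  qed (use assms in \<open>simp add: in_Dom\<close>)
  then show ?thesis by (simp add: t_diag)
qed

text \<open>Speeds are at least \<open>1 / b2\<close> in modulus, so a 2-characteristic cannot
  remain in the quadrant beyond time \<open>b2 * x q q\<close>.\<close>

lemma lower_cone:
  assumes "(p, q) \<in> Dom" shows "x p q + t p q / b2 \<le> x q q"
proof -
  have D0: "0 \<le> q" "q \<le> p" "0 \<le> x p q" using assms by (auto simp: in_Dom)
  have "x p q + t p q / b2 \<le> x q q + t q q / b2"
  proof (rule nonincreasing_within[where f = "\<lambda>p. x p q + t p q / b2" and f' = "\<lambda>p. X p q + m2 (z p q) (w p q) * X p q / b2"])
    fix s assume s: "s \<in> {q..p}"
    then have T: "(s, q) \<in> triangle q p" by auto
    then have D: "(s, q) \<in> Dom" using Dom_down[OF assms] by auto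
    show "((\<lambda>p. x p q + t p q / b2) has_real_derivative X s q + m2 (z s q) (w s q) * X s q / b2) (at s within {q..p})"
      by (intro DERIV_add DERIV_cdivide x_p t_p[OF D0(1,3) T]) (use s D0 in auto)
    have "X s q < 0" using X_neg[of s q] D by (simp add: in_Dom)
    then have "m2 (z s q) (w s q) * X s q \<le> - b2 * X s q" using Dom_speeds(1)[OF D] by (intro mult_right_mono_neg) auto
    then show "X s q + m2 (z s q) (w s q) * X s q / b2 \<le> 0" using b2_pos by (simp add: field_simps)
  qed (use D0 in auto)
  then show ?thesis by (simp add: t_diag)
qed

lemma x_diag_strict_mono: "0 \<le> p \<Longrightarrow> p < q \<Longrightarrow> x p p < x q q"
  using CH by (simp add: x_diag divide_strict_right_mono add_pos_nonneg)

lemma x_diag_surj: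
  assumes "0 \<le> \<xi>" obtains p where "0 \<le> p" "x p p = \<xi>"
proof (rule that[of "(exp (CH * \<xi>) - 1) / CH"])
  show "0 \<le> (exp (CH * \<xi>) - 1) / CH" using CH assms by simp
  then show "x ((exp (CH * \<xi>) - 1) / CH) ((exp (CH * \<xi>) - 1) / CH) = \<xi>" using CH by (simp add: x_diag)
qed

text \<open>If the 2-characteristic \<open>q\<close> stayed in the quadrant for all p,
  \<open>lower_cone\<close> would bound its time and position, and \<open>upper_cone\<close> would
  then bound the feet \<open>x p p\<close>, which are unbounded.\<close>

lemma crossing_exists:
  assumes "0 \<le> q" obtains p where "q \<le> p" "x p q < 0"
proof -
  obtain p where p: "0 \<le> p" "x p p = max (x q q) (x q q + b2 * x q q / b1) + 1"
    using x_diag_surj[of "max (x q q) (x q q + b2 * x q q / b1) + 1"] x_diag_nonneg[OF assms] by auto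
  have qp: "q \<le> p"
  proof (rule ccontr)
    assume "\<not> q \<le> p"
    then have "x p p < x q q" using x_diag_strict_mono p(1) by simp
    then show False using p(2) by simp
  qed
  have "x p q < 0"
  proof (rule ccontr)
    assume "\<not> x p q < 0"
    then have D: "(p, q) \<in> Dom" using assms qp by (simp add: in_Dom)
    have "t p q / b2 \<le> x q q" using lower_cone[OF D] D by (simp add: in_Dom)
    then have "t p q \<le> b2 * x q q" using b2_pos by (simp add: field_simps)
    then have "t p q / b1 \<le> b2 * x q q / b1" using b1 by (intro divide_right_mono) auto
    moreover have "t p q / b2 \<ge> 0" using t_nonneg[OF D] b2_pos by simp
    then have "x p q \<le> x q q" using lower_cone[OF D] by linarith
    ultimately show False using upper_cone[OF D] p(2) by simp
  qed
  with qp show ?thesis by (rule that)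
qed

end

text \<open>\<open>\<delta>\<close> is uniform, so finitely many equal steps shorter than
  \<open>\<delta>\<close> lead from \<open>a\<close> to \<open>b\<close>.\<close>

lemma local_strict_mono:
  fixes f :: "real \<Rightarrow> real"
  assumes \<delta>: "\<delta> > 0" and loc: "\<And>q q'. a \<le> q \<Longrightarrow> q < q' \<Longrightarrow> q' \<le> b \<Longrightarrow> q' - q < \<delta> \<Longrightarrow> f q < f q'" and ab: "a < b"
  shows "f a < f b"
proof -
  obtain n :: nat where n: "(b - a) / \<delta> < real n" using reals_Archimedean2 by blast
  have n0: "real n > 0" using n ab \<delta> by (meson diff_gt_0_iff_gt divide_pos_pos less_trans)
  define h where "h = (b - a) / real n"
  have h: "h > 0" "h < \<delta>" "real n * h = b - a" using n n0 ab \<delta> by (auto simp: h_def field_simps)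
  have "f a < f (a + real (Suc k) * h)" if "Suc k \<le> n" for k
    using that
  proof (induction k)
    case 0
    have "1 * h \<le> real n * h" using 0 h by (intro mult_right_mono) auto
    then show ?case using loc[of a "a + h"] h by simp
  next
    case (Suc k)
    have "real (Suc (Suc k)) * h \<le> real n * h" using Suc.prems h by (intro mult_right_mono) auto
    then have "f (a + real (Suc k) * h) < f (a + real (Suc (Suc k)) * h)"
      using h by (intro loc) (auto simp: algebra_simps)
    then show ?case using Suc by simp
  qed
  from this[of "n - 1"] n0 h(3) show ?thesis by simp
qed

text \<open>The increment is split at \<open>(p', q)\<close>: the first part needs the p-derivative
  at the point itself, the second a mean value estimate with the continuous q-derivative.\<close>

lemma has_derivative_partials_real:
  fixes f fp fq :: "real \<Rightarrow> real \<Rightarrow> real"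
  assumes Sop: "open S" "(p, q) \<in> S"
    and dp: "((\<lambda>p. f p q) has_real_derivative fp p q) (at p)"
    and dq: "\<And>p q. (p, q) \<in> S \<Longrightarrow> ((\<lambda>q. f p q) has_real_derivative fq p q) (at q)"
    and cont: "continuous_on S (\<lambda>y. fq (fst y) (snd y))"
  shows "((\<lambda>y. f (fst y) (snd y)) has_derivative (\<lambda>y. fp p q * fst y + fq p q * snd y)) (at (p, q))"
  unfolding has_derivative_at_alt
proof (intro conjI allI impI)
  show "bounded_linear (\<lambda>y. fp p q * fst y + fq p q * snd y)" by (intro bounded_linear_intros)
  fix e :: real assume e: "e > 0"
  have e2: "e / 2 > 0" using e by simp
  have "continuous (at (p, q)) (\<lambda>y. fq (fst y) (snd y))"
    using cont Sop by (simp add: continuous_on_eq_continuous_at)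
  from mp[OF spec[OF this[unfolded continuous_at_eps_delta fst_conv snd_conv]] e2]
  have "\<exists>d>0. \<forall>y. dist y (p, q) < d \<longrightarrow> dist (fq (fst y) (snd y)) (fq p q) < e / 2" .
  then obtain d1 where d1: "d1 > 0" "\<forall>y. dist y (p, q) < d1 \<longrightarrow> dist (fq (fst y) (snd y)) (fq p q) < e / 2"
    by (elim exE conjE)
  obtain d2 where d2: "d2 > 0" "ball (p, q) d2 \<subseteq> S" by (rule openE[OF Sop])
  have "((\<lambda>p. f p q) has_derivative (\<lambda>h. fp p q * h)) (at p)" using dp by (simp add: has_field_derivative_def)
  from mp[OF spec[OF conjunct2[OF this[unfolded has_derivative_at_alt]]] e2]
  have "\<exists>d>0. \<forall>y. norm (y - p) < d \<longrightarrow> norm (f y q - f p q - fp p q * (y - p)) \<le> e / 2 * norm (y - p)"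
    .
  then obtain d3 where d3: "d3 > 0" "\<forall>y. norm (y - p) < d3 \<longrightarrow> norm (f y q - f p q - fp p q * (y - p)) \<le> e / 2 * norm (y - p)"
    by (elim exE conjE)
  define d where "d = min d1 (min d2 d3) / 2"
  show "\<exists>d>0. \<forall>y. norm (y - (p, q)) < d \<longrightarrow>
      norm (f (fst y) (snd y) - f (fst (p, q)) (snd (p, q)) - (fp p q * fst (y - (p, q)) + fq p q * snd (y - (p, q)))) \<le> e * norm (y - (p, q))"
  proof (intro exI[of _ d] conjI allI impI)
    show "d > 0" using d1 d2 d3 by (simp add: d_def)
    fix y assume y: "norm (y - (p, q)) < d"
    obtain p' q' where yy: "y = (p', q')" by (cases y)
    define N where "N = norm (y - (p, q))"
    have n: "\<bar>p' - p\<bar> \<le> N" "\<bar>q' - q\<bar> \<le> N"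
      using norm_fst_le[of "p' - p" "q' - q"] norm_snd_le[of "q' - q" "p' - p"] by (simp_all add: yy N_def)
    have close: "dist (p', s) (p, q) < min d1 (min d2 d3)" if "\<bar>s - q\<bar> \<le> \<bar>q' - q\<bar>" for s
    proof -
      have "dist (p', s) (p, q) \<le> \<bar>p' - p\<bar> + \<bar>s - q\<bar>"
        unfolding dist_Pair_Pair dist_real_def using sqrt_sum_squares_le_sum_abs[of "p' - p" "s - q"] by simp
      also have "\<dots> < 2 * d" using n that y by (simp add: N_def)
      finally show ?thesis by (simp add: d_def)
    qed
    have 1: "\<bar>f p' q - f p q - fp p q * (p' - p)\<bar> \<le> e / 2 * N"
    proof -
      have "N < d3" using y d3(1) d1 d2 by (simp add: N_def d_def)
      then have "\<bar>f p' q - f p q - fp p q * (p' - p)\<bar> \<le> e / 2 * \<bar>p' - p\<bar>" using d3(2)[rule_format, of p'] n by simp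
      also have "\<dots> \<le> e / 2 * N" using n e by (intro mult_left_mono) auto
      finally show ?thesis .
    qed
    have 2: "\<bar>f p' q' - f p' q - (q' - q) * fq p q\<bar> \<le> e / 2 * \<bar>q' - q\<bar>"
    proof (rule mean_value_linearization_real[where f' = "\<lambda>s. fq p' s" and a = "min q q'" and b = "max q q'"])
      fix s assume s: "s \<in> {min q q'..max q q'}"
      then have sq: "\<bar>s - q\<bar> \<le> \<bar>q' - q\<bar>" by (auto simp: min_def max_def split: if_splits)
      have "(p', s) \<in> ball (p, q) d2" using close[OF sq] by (simp add: dist_commute)
      then have "(p', s) \<in> S" by (rule subsetD[OF d2(2)])
      then show "((\<lambda>q. f p' q) has_real_derivative fq p' s) (at s within {min q q'..max q q'})"
        by (rule has_field_derivative_at_within[OF dq])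
      show "\<bar>fq p' s - fq p q\<bar> \<le> e / 2"
        using d1(2)[rule_format, of "(p', s)"] close[OF sq] by (simp add: dist_real_def less_imp_le)
    qed auto
    have "\<bar>f p' q' - f p' q - (q' - q) * fq p q\<bar> \<le> e / 2 * N"
      by (rule order_trans[OF 2 mult_left_mono[OF n(2)]]) (use e in simp)
    with 1 have "\<bar>(f p' q - f p q - fp p q * (p' - p)) + (f p' q' - f p' q - (q' - q) * fq p q)\<bar> \<le> e / 2 * N + e / 2 * N"
      by (rule order_trans[OF abs_triangle_ineq add_mono])
    moreover have "(f p' q - f p q - fp p q * (p' - p)) + (f p' q' - f p' q - (q' - q) * fq p q)
        = f p' q' - f p q - (fp p q * (p' - p) + fq p q * (q' - q))" by (simp add: algebra_simps)
    ultimately have "\<bar>f p' q' - f p q - (fp p q * (p' - p) + fq p q * (q' - q))\<bar> \<le> e * N" by (simp add: mult.commute)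
    then show "norm (f (fst y) (snd y) - f (fst (p, q)) (snd (p, q)) - (fp p q * fst (y - (p, q)) + fq p q * snd (y - (p, q)))) \<le> e * norm (y - (p, q))"
      by (simp add: yy N_def)
  qed
qed

section \<open>Bijectivity of the map (p, q) to (x, t) onto the quadrant\<close>

context char_picard begin

text \<open>The path follows the 1-characteristic \<open>p1\<close> to label \<open>q2\<close> and
  then the 2-characteristic \<open>q2\<close> back to the same x. On the first piece dx > 0 and dt =
  m1 dx \<ge> c1 dx, on the second dx < 0 and dt = m2 dx \<ge> c2 dx, so the net gain in t is at
  least \<open>c1 - c2\<close> times the excursion in x.\<close>

lemma t_step:
  assumes D1: "(p1, q1) \<in> Dom" and D2: "(p2, q2) \<in> Dom" and eq: "x p1 q1 = x p2 q2"
    and o: "q1 < q2" "q2 \<le> p1" "p1 \<le> p2"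
    and c1: "\<And>q. q \<in> {q1..q2} \<Longrightarrow> c1 \<le> m1 (z p1 q) (w p1 q)"
    and c2: "\<And>p. p \<in> {p1..p2} \<Longrightarrow> m2 (z p q2) (w p q2) \<le> c2" and c: "c2 < c1"
  shows "t p1 q1 < t p2 q2"
proof -
  have q1: "0 \<le> q1" using D1 by (simp add: in_Dom)
  have Ds: "(p1, s) \<in> Dom" if "s \<in> {q1..q2}" for s
    by (rule Dom_down[OF D1]) (use that o in auto)
  have Tr: "(r, q2) \<in> triangle q2 p2" if "r \<in> {p1..p2}" for r using that o by auto
  have "t p1 q1 - c1 * x p1 q1 \<le> t p1 q2 - c1 * x p1 q2"
  proof -
    have "- (t p1 q2 - c1 * x p1 q2) \<le> - (t p1 q1 - c1 * x p1 q1)"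
    proof (rule nonincreasing_within[where f = "\<lambda>q. - (t p1 q - c1 * x p1 q)"
          and f' = "\<lambda>q. - (m1 (z p1 q) (w p1 q) * Y p1 q - c1 * Y p1 q)"])
      fix s assume s: "s \<in> {q1..q2}"
      show "((\<lambda>q. - (t p1 q - c1 * x p1 q)) has_real_derivative - (m1 (z p1 s) (w p1 s) * Y p1 s - c1 * Y p1 s)) (at s within {q1..q2})"
        by (intro DERIV_minus DERIV_diff DERIV_cmult has_field_derivative_at_within[OF x_q] has_field_derivative_at_within[OF t_q[OF Ds[OF s]]])
      have "Y p1 s > 0" by (rule Y_pos) (use s q1 in auto)
      then show "- (m1 (z p1 s) (w p1 s) * Y p1 s - c1 * Y p1 s) \<le> 0" using c1[OF s] by (simp add: mult_right_mono)
    qed (use o in auto)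
    then show ?thesis by simp
  qed
  moreover have "t p1 q2 - c2 * x p1 q2 \<le> t p2 q2 - c2 * x p2 q2"
  proof -
    have q2: "0 \<le> q2" "0 \<le> x p2 q2" using D2 by (auto simp: in_Dom)
    have "- (t p2 q2 - c2 * x p2 q2) \<le> - (t p1 q2 - c2 * x p1 q2)"
    proof (rule nonincreasing_within[where f = "\<lambda>p. - (t p q2 - c2 * x p q2)"
          and f' = "\<lambda>p. - (m2 (z p q2) (w p q2) * X p q2 - c2 * X p q2)"])
      fix s assume s: "s \<in> {p1..p2}"
      have sub: "{p1..p2} \<subseteq> {q2..p2}" using o by auto
      show "((\<lambda>p. - (t p q2 - c2 * x p q2)) has_real_derivative - (m2 (z s q2) (w s q2) * X s q2 - c2 * X s q2)) (at s within {p1..p2})"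
        by (intro DERIV_minus DERIV_diff DERIV_cmult DERIV_subset[OF t_p[OF q2 Tr[OF s]] sub] DERIV_subset[OF x_p sub]) (use s o q2 in auto)
      have "X s q2 < 0" by (rule X_neg) (use s o q2 in auto)
      then show "- (m2 (z s q2) (w s q2) * X s q2 - c2 * X s q2) \<le> 0" using c2[OF s] by (simp add: mult_right_mono_neg)
    qed (use o in auto)
    then show ?thesis by simp
  qed
  moreover have "0 < (c1 - c2) * (x p1 q2 - x p1 q1)"
    using c x_strict_mono_q[OF q1 o(1), of p1] by (intro mult_pos_pos) auto
  ultimately show ?thesis using eq by (simp add: algebra_simps)
qed

text \<open>For each label q a point with x = \<open>\<xi>\<close> exists by the intermediate value
  theorem. Continuity in q is that of the inverse of the injective map \<open>F\<close> on a compact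
  triangle.\<close>

lemma level_curve:
  assumes q: "0 \<le> qa" "qa \<le> qb" "qb \<le> P" and \<xi>: "\<xi> \<le> x qa qa" "x P qb \<le> \<xi>"
  obtains pc where "continuous_on {qa..qb} pc" "\<And>q. q \<in> {qa..qb} \<Longrightarrow> q \<le> pc q \<and> pc q \<le> P \<and> x (pc q) q = \<xi>"
proof -
  have ex: "\<exists>p. q \<le> p \<and> p \<le> P \<and> x p q = \<xi>" if q': "q \<in> {qa..qb}" for q
  proof -
    have "\<xi> \<le> x q q" using \<xi>(1) x_diag_strict_mono[of qa q] q q' by (cases "qa = q") auto
    moreover have "x P q \<le> \<xi>" using \<xi>(2) x_strict_mono_q[of q qb P] q q' by (cases "q = qb") auto
    ultimately show ?thesis
      using IVT2'[of "\<lambda>p. x p q" P \<xi> q] continuous_line[OF cont_x, of "{q..P}" q] q q' by auto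
  qed
  define pc where "pc q = (SOME p. q \<le> p \<and> p \<le> P \<and> x p q = \<xi>)" for q
  have pc: "q \<le> pc q \<and> pc q \<le> P \<and> x (pc q) q = \<xi>" if "q \<in> {qa..qb}" for q
    unfolding pc_def by (rule someI_ex[OF ex[OF that]])
  define F where "F y = (x (fst y) (snd y), snd y)" for y :: "real \<times> real"
  have "inj_on F (triangle 0 P)"
  proof (rule inj_onI)
    fix y y' assume y: "y \<in> triangle 0 P" "y' \<in> triangle 0 P" "F y = F y'"
    obtain p1 q1 p2 q2 where yy: "y = (p1, q1)" "y' = (p2, q2)" by (cases y, cases y')
    have *: "q1 = q2" "x p1 q1 = x p2 q1" "0 \<le> q1" "q1 \<le> p1" "q1 \<le> p2" using y by (auto simp: yy F_def)
    have "p1 = p2"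
      using x_strict_antimono_p[of q1 p1 p2] x_strict_antimono_p[of q1 p2 p1] * by (cases p1 p2 rule: linorder_cases) auto
    then show "y = y'" using * yy by simp
  qed
  moreover have cF: "continuous_on (triangle 0 P) F"
    unfolding F_def using continuous_on_subset[OF cont_x[unfolded case_prod_unfold] subset_UNIV] by (intro continuous_intros)
  ultimately have ci: "continuous_on (F ` triangle 0 P) (inv_into (triangle 0 P) F)"
    by (intro continuous_on_inv compact_triangle) (auto simp: inv_into_f_f)
  have T: "(pc q, q) \<in> triangle 0 P" if "q \<in> {qa..qb}" for q using pc[OF that] that q by auto
  have Fpc: "F (pc q, q) = (\<xi>, q)" if "q \<in> {qa..qb}" for q using pc[OF that] by (simp add: F_def)
  have "continuous_on {qa..qb} (\<lambda>q. fst (inv_into (triangle 0 P) F (\<xi>, q)))"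
  proof (intro continuous_on_fst continuous_on_compose2[OF ci] continuous_intros image_subsetI)
    fix q assume "q \<in> {qa..qb}"
    then show "(\<xi>, q) \<in> F ` triangle 0 P" using T Fpc by (metis image_eqI)
  qed
  moreover have "fst (inv_into (triangle 0 P) F (\<xi>, q)) = pc q" if "q \<in> {qa..qb}" for q
    using inv_into_f_f[OF \<open>inj_on F (triangle 0 P)\<close> T[OF that]] Fpc[OF that] by simp
  ultimately have "continuous_on {qa..qb} pc"
    using continuous_on_cong[OF refl, of "{qa..qb}" "\<lambda>q. fst (inv_into (triangle 0 P) F (\<xi>, q))" pc] by simp
  then show ?thesis using pc by (rule that)
qed

lemma level_order:
  assumes D: "(p1, q1) \<in> Dom" "(p2, q2) \<in> Dom" and eq: "x p1 q1 = x p2 q2" and q: "q1 < q2"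
  shows "p1 < p2"
proof (rule ccontr)
  assume "\<not> p1 < p2"
  then have "x p1 q1 \<le> x p2 q1"
    using x_strict_antimono_p[of q1 p2 p1] D q by (cases "p1 = p2") (auto simp: in_Dom)
  also have "\<dots> < x p2 q2" using x_strict_mono_q[of q1 q2 p2] D q by (simp add: in_Dom)
  finally show False using eq by simp
qed

lemma closed_Dom: "closed Dom"
  unfolding Dom_def case_prod_unfold
  by (intro closed_Collect_conj closed_Collect_le continuous_intros cont_x[unfolded case_prod_unfold])

lemma compact_Dom: "compact (Dom \<inter> {y. fst y \<le> P})"
proof -
  have "closed (Dom \<inter> {y. fst y \<le> P})"
    by (intro closed_Int closed_Dom closed_Collect_le continuous_intros)
  moreover have "Dom \<inter> {y. fst y \<le> P} \<subseteq> cbox (0, 0) (P, P)" by (auto simp: Dom_def cbox_Pair_eq)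
  ultimately show ?thesis by (meson bounded_cbox bounded_subset compact_eq_bounded_closed)
qed

text \<open>A vertical line in the quadrant crosses both families, and moving up it means moving to
  larger labels. \<open>t_step\<close> compares nearby points only, where m1 and m2 vary little and
  stay separated, so the level curve is cut into short steps.\<close>

lemma t_increasing:
  assumes D1: "(p1, q1) \<in> Dom" and D2: "(p2, q2) \<in> Dom" and eq: "x p1 q1 = x p2 q2" and lt: "q1 < q2"
  shows "t p1 q1 < t p2 q2"
proof (cases "p1 = q1")
  case True
  have ne: "q2 < p2"
  proof (rule ccontr)
    assume "\<not> q2 < p2"
    then have "p2 = q2" using D2 by (simp add: in_Dom)
    then show False using eq True x_diag_strict_mono[of q1 q2] lt D1 by (simp add: in_Dom)
  qed
  have "x p2 q2 < x p2 p2" using x_strict_mono_q[OF _ ne] D2 by (simp add: in_Dom)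
  then have "0 < t p2 q2 / b1" using upper_cone[OF D2] by linarith
  then show ?thesis using True b1 by (simp add: t_diag zero_less_divide_iff)
next
  case False
  then have pq1: "q1 < p1" using D1 by (simp add: in_Dom)
  define \<xi> where "\<xi> = x p1 q1"
  have \<xi>0: "0 \<le> \<xi>" using D1 by (simp add: \<xi>_def in_Dom)
  have p12: "p1 < p2" by (rule level_order[OF D1 D2 eq lt])
  have d: "0 \<le> q1" "q1 \<le> q2" "q2 \<le> p2" using D1 D2 lt by (auto simp: in_Dom)
  have \<xi>1: "\<xi> < x q1 q1" using x_strict_antimono_p[of q1 q1 p1] d pq1 by (simp add: \<xi>_def)
  have \<xi>2: "x p2 q2 \<le> \<xi>" using eq by (simp add: \<xi>_def)
  obtain pc where pc: "continuous_on {q1..q2} pc" "\<And>q. q \<in> {q1..q2} \<Longrightarrow> q \<le> pc q \<and> pc q \<le> p2 \<and> x (pc q) q = \<xi>"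
    by (rule level_curve[OF d less_imp_le[OF \<xi>1] \<xi>2]) (rule that)
  have pcD: "(pc q, q) \<in> Dom" if "q \<in> {q1..q2}" for q using pc(2)[OF that] that d \<xi>0 by (simp add: in_Dom)
  have uniq: "p = p'" if "(p, q) \<in> Dom" "(p', q) \<in> Dom" "x p q = x p' q" for p p' q
    using x_strict_antimono_p[of q p p'] x_strict_antimono_p[of q p' p] that
    by (cases p p' rule: linorder_cases) (auto simp: in_Dom)
  have e1: "pc q1 = p1" by (rule uniq[OF pcD D1]) (use pc(2)[of q1] d in \<open>auto simp: \<xi>_def\<close>)
  have e2: "pc q2 = p2" by (rule uniq[OF pcD D2]) (use pc(2)[of q2] d eq in \<open>auto simp: \<xi>_def\<close>)
  have pcgt: "q < pc q" if q: "q \<in> {q1..q2}" for q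
  proof (rule ccontr)
    assume "\<not> q < pc q"
    then have "pc q = q" using pc(2)[OF q] by simp
    then have "x q q = \<xi>" using pc(2)[OF q] by simp
    moreover have "x q1 q1 \<le> x q q" using x_diag_strict_mono[of q1 q] d q by (cases "q1 = q") auto
    ultimately show False using \<xi>1 by simp
  qed
  let ?K = "Dom \<inter> {y. fst y \<le> p2}"
  define h1 h2 where "h1 y = m1 (z (fst y) (snd y)) (w (fst y) (snd y))" and "h2 y = m2 (z (fst y) (snd y)) (w (fst y) (snd y))" for y
  have ch: "continuous_on ?K h1" "continuous_on ?K h2"
    unfolding h1_def h2_def by (rule continuous_on_subset[OF Dom_cont_box[OF C1_conts(1)]] continuous_on_subset[OF Dom_cont_box[OF C1_conts(2)]]; simp)+
  \<comment> \<open>The reciprocal speeds differ by at least \<open>m\<close>; letting each vary by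
    less than a third keeps a gap between them.\<close>
  have m3: "m / 3 > 0" using m by simp
  obtain d1 where d1: "d1 > 0" "\<forall>y\<in>?K. \<forall>y'\<in>?K. dist y' y < d1 \<longrightarrow> dist (h1 y') (h1 y) < m / 3"
    using compact_uniformly_continuous[OF ch(1) compact_Dom] m3 unfolding uniformly_continuous_on_def by blast
  obtain d2 where d2: "d2 > 0" "\<forall>y\<in>?K. \<forall>y'\<in>?K. dist y' y < d2 \<longrightarrow> dist (h2 y') (h2 y) < m / 3"
    using compact_uniformly_continuous[OF ch(2) compact_Dom] m3 unfolding uniformly_continuous_on_def by blast
  define e where "e = min d1 d2 / 2"
  have e: "e > 0" using d1 d2 by (simp add: e_def)
  obtain d3 where d3: "d3 > 0" "\<forall>q\<in>{q1..q2}. \<forall>q'\<in>{q1..q2}. dist q' q < d3 \<longrightarrow> dist (pc q') (pc q) < e"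
    using compact_uniformly_continuous[OF pc(1) compact_Icc] e unfolding uniformly_continuous_on_def by blast
  have "continuous_on {q1..q2} (\<lambda>q. pc q - q)" by (intro continuous_intros pc(1))
  moreover have "{q1..q2} \<noteq> {}" using d by simp
  ultimately have "\<exists>q\<in>{q1..q2}. \<forall>q'\<in>{q1..q2}. pc q - q \<le> pc q' - q'"
    using continuous_attains_inf[OF compact_Icc] by simp
  then obtain q0 where q0: "q0 \<in> {q1..q2}" "\<forall>q'\<in>{q1..q2}. pc q0 - q0 \<le> pc q' - q'" by (elim bexE)
  \<comment> \<open>Besides closeness of the labels, q' must not exceed \<open>pc q\<close>, so that
    the corner \<open>(pc q, q')\<close> of the two-piece path belongs to the domain;
    \<open>q0\<close> is where this room is smallest.\<close>
  define \<delta> where "\<delta> = min (min e d3) (pc q0 - q0)"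
  have \<delta>: "\<delta> > 0" using e d3 pcgt[OF q0(1)] by (simp add: \<delta>_def)
  have "t (pc q1) q1 < t (pc q2) q2"
  proof (rule local_strict_mono[where f = "\<lambda>q. t (pc q) q", OF \<delta> _ lt])
    fix q q' assume *: "q1 \<le> q" "q < q'" "q' \<le> q2" "q' - q < \<delta>"
    have qq: "q \<in> {q1..q2}" "q' \<in> {q1..q2}" using * by auto
    have D: "(pc q, q) \<in> Dom" "(pc q', q') \<in> Dom" by (rule pcD[OF qq(1)] pcD[OF qq(2)])+
    have xeq: "x (pc q) q = x (pc q') q'" using pc(2)[OF qq(1)] pc(2)[OF qq(2)] by simp
    have plt: "pc q < pc q'" by (rule level_order[OF D xeq *(2)])
    have q'p: "q' \<le> pc q" using q0(2)[rule_format, OF qq(1)] * by (simp add: \<delta>_def)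
    have pe: "\<bar>pc q' - pc q\<bar> < e" using d3(2)[rule_format, OF qq] * by (simp add: \<delta>_def dist_real_def)
    have qe: "q' - q < e" using * by (simp add: \<delta>_def)
    have near: "dist (r, s) (pc q, q) < min d1 d2" if "\<bar>r - pc q\<bar> < e" "\<bar>s - q\<bar> < e" for r s
    proof -
      have "dist (r, s) (pc q, q) \<le> \<bar>r - pc q\<bar> + \<bar>s - q\<bar>"
        unfolding dist_Pair_Pair dist_real_def using sqrt_sum_squares_le_sum_abs[of "r - pc q" "s - q"] by simp
      then show ?thesis using that by (simp add: e_def)
    qed
    have K0: "(pc q, q) \<in> ?K" using D(1) pc(2)[OF qq(1)] by simp
    show "t (pc q) q < t (pc q') q'"
    proof (rule t_step[OF D xeq *(2) q'p less_imp_le[OF plt], where ?c1.0 = "h1 (pc q, q) - m / 3" and ?c2.0 = "h2 (pc q, q) + m / 3"])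
      fix s assume s: "s \<in> {q..q'}"
      have "(pc q, s) \<in> Dom" by (rule Dom_down[OF D(1)]) (use s q'p in auto)
      then have "(pc q, s) \<in> ?K" using pc(2)[OF qq(1)] by simp
      moreover have "dist (pc q, s) (pc q, q) < d1" using near[of "pc q" s] e s qe by simp
      ultimately have "dist (h1 (pc q, s)) (h1 (pc q, q)) < m / 3" using d1(2) K0 by blast
      then show "h1 (pc q, q) - m / 3 \<le> m1 (z (pc q) s) (w (pc q) s)" unfolding h1_def dist_real_def fst_conv snd_conv by linarith
    next
      fix r assume r: "r \<in> {pc q..pc q'}"
      have "(r, q') \<in> Dom" by (rule Dom_down[OF D(2)]) (use r q'p in auto)
      then have "(r, q') \<in> ?K" using pc(2)[OF qq(2)] r by simp
      moreover have "dist (r, q') (pc q, q) < d2" using near[of r q'] pe r qe * by simp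
      ultimately have "dist (h2 (r, q')) (h2 (pc q, q)) < m / 3" using d2(2) K0 by blast
      then show "m2 (z r q') (w r q') \<le> h2 (pc q, q) + m / 3" unfolding h2_def dist_real_def fst_conv snd_conv by linarith
    next
      show "h2 (pc q, q) + m / 3 < h1 (pc q, q) - m / 3"
        using Dom_speeds(3)[OF D(1)] m by (simp add: h1_def h2_def)
    qed
  qed
  then show ?thesis by (simp add: e1 e2)
qed

definition Theta :: "real \<times> real \<Rightarrow> real \<times> real" where
  "Theta y = (x (fst y) (snd y), t (fst y) (snd y))"

lemma inj_Theta: "inj_on Theta Dom"
proof (rule inj_onI)
  fix y y' assume y: "y \<in> Dom" "y' \<in> Dom" "Theta y = Theta y'"
  obtain p1 q1 p2 q2 where yy: "y = (p1, q1)" "y' = (p2, q2)" by (cases y, cases y')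
  have D: "(p1, q1) \<in> Dom" "(p2, q2) \<in> Dom" and eq: "x p1 q1 = x p2 q2" "t p1 q1 = t p2 q2"
    using y by (auto simp: yy Theta_def)
  have "q1 = q2"
    using t_increasing[OF D eq(1)] t_increasing[OF D(2,1) eq(1)[symmetric]] eq(2) by (cases q1 q2 rule: linorder_cases) auto
  moreover have "p1 = p2"
    using x_strict_antimono_p[of q1 p1 p2] x_strict_antimono_p[of q1 p2 p1] eq(1) D \<open>q1 = q2\<close>
    by (cases p1 p2 rule: linorder_cases) (auto simp: in_Dom)
  ultimately show "y = y'" using yy by simp
qed

text \<open>On the vertical line x = \<open>\<xi>\<close> the level curve begins at the initial line
  with t = 0. At label \<open>R\<close>, whose foot lies \<open>\<tau> / b1\<close> further out, the
  cone condition forces t \<ge> \<open>\<tau>\<close>; the intermediate value theorem gives the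
  point between.\<close>

lemma surj_Theta:
  assumes "0 \<le> \<xi>" "0 \<le> \<tau>" obtains p q where "(p, q) \<in> Dom" "x p q = \<xi>" "t p q = \<tau>"
proof -
  obtain q0 where q0: "0 \<le> q0" "x q0 q0 = \<xi>" by (rule x_diag_surj[OF assms(1)])
  have "0 \<le> \<xi> + \<tau> / b1" using assms b1 by simp
  then obtain R where R: "0 \<le> R" "x R R = \<xi> + \<tau> / b1" by (rule x_diag_surj)
  have q0R: "q0 \<le> R"
  proof (rule ccontr)
    assume "\<not> q0 \<le> R"
    then have "x R R < x q0 q0" using x_diag_strict_mono[of R q0] R by simp
    then show False using q0 R assms b1 by (simp add: divide_less_0_iff)
  qed
  obtain P where P: "R \<le> P" "x P R < 0" by (rule crossing_exists[OF R(1)])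
  have le: "\<xi> \<le> x q0 q0" "x P R \<le> \<xi>" using q0 P assms by auto
  obtain pc where pc: "continuous_on {q0..R} pc" "\<And>q. q \<in> {q0..R} \<Longrightarrow> q \<le> pc q \<and> pc q \<le> P \<and> x (pc q) q = \<xi>"
    by (rule level_curve[OF q0(1) q0R P(1) le]) (rule that)
  have D: "(pc q, q) \<in> Dom" if "q \<in> {q0..R}" for q using pc(2)[OF that] that q0 assms by (simp add: in_Dom)
  have "pc q0 = q0"
  proof (rule ccontr)
    assume "pc q0 \<noteq> q0"
    then have "q0 < pc q0" using pc(2)[of q0] q0R by auto
    then have "x (pc q0) q0 < x q0 q0" using x_strict_antimono_p[of q0 q0 "pc q0"] q0 by simp
    then show False using pc(2)[of q0] q0 q0R by simp
  qed
  then have t0: "t (pc q0) q0 = 0" by (simp add: t_diag)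
  have t1: "\<tau> \<le> t (pc R) R"
  proof -
    have Rm: "R \<in> {q0..R}" using q0R by simp
    have "x R R \<le> x (pc R) (pc R)" using x_diag_strict_mono[of R "pc R"] pc(2)[OF Rm] R by (cases "R = pc R") auto
    also have "\<dots> \<le> \<xi> + t (pc R) R / b1" using upper_cone[OF D[OF Rm]] pc(2)[OF Rm] by simp
    finally show ?thesis using R b1 by (simp add: divide_le_cancel)
  qed
  have "continuous_on {q0..R} (\<lambda>q. (pc q, q))" by (intro continuous_intros pc(1))
  from continuous_on_compose2[OF cont_t this] have "continuous_on {q0..R} (\<lambda>q. t (pc q) q)" by simp
  then obtain q where "q0 \<le> q" "q \<le> R" "t (pc q) q = \<tau>"
    using IVT'[of "\<lambda>q. t (pc q) q" q0 \<tau> R] t0 t1 assms q0R by auto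
  then show ?thesis using that[of "pc q" q] D[of q] pc(2)[of q] by simp
qed

lemma J_Theta: "(p, q) \<in> Dom \<Longrightarrow> inv_into Dom Theta (x p q, t p q) = (p, q)"
  using inv_into_f_f[OF inj_Theta, of "(p, q)"] by (simp add: Theta_def)

lemma J_Dom:
  assumes "0 \<le> \<xi>" "0 \<le> \<tau>"
  obtains p q where "inv_into Dom Theta (\<xi>, \<tau>) = (p, q)" "(p, q) \<in> Dom" "x p q = \<xi>" "t p q = \<tau>"
proof -
  obtain p q where pq: "(p, q) \<in> Dom" "x p q = \<xi>" "t p q = \<tau>" by (rule surj_Theta[OF assms])
  have "inv_into Dom Theta (\<xi>, \<tau>) = (p, q)" using J_Theta[OF pq(1)] pq(2,3) by simp
  then show ?thesis using pq by (rule that)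
qed

lemma cont_Theta: "continuous_on UNIV Theta"
  unfolding Theta_def by (intro continuous_on_Pair cont_t cont_x[unfolded case_prod_unfold])

text \<open>Continuous injections have continuous inverses on images of compact sets. The cone
  condition confines the preimages of a bounded part of the quadrant to labels p \<le> R, which
  supplies the compact set; the summand 1 makes that part a neighbourhood of the given
  point.\<close>

lemma cont_J: "continuous_on ({0..} \<times> {0..}) (inv_into Dom Theta)"
  unfolding continuous_on_eq_continuous_within
proof (rule ballI)
  fix y :: "real \<times> real" assume y: "y \<in> {0..} \<times> {0..}"
  let ?Q = "{0..} \<times> {0..} :: (real \<times> real) set"
  let ?f = "\<lambda>y :: real \<times> real. fst y + snd y / b1"
  have "0 \<le> ?f y + 1" using y b1 by auto
  then obtain R where R: "0 \<le> R" "x R R = ?f y + 1" by (rule x_diag_surj)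
  let ?K = "Dom \<inter> {y. fst y \<le> R}" and ?V = "?Q \<inter> {y'. ?f y' \<le> x R R}"
  have "continuous_on (Theta ` ?K) (inv_into Dom Theta)"
    by (intro continuous_on_inv continuous_on_subset[OF cont_Theta] compact_Dom) (auto simp: inv_into_f_f[OF inj_Theta])
  moreover have "?V \<subseteq> Theta ` ?K"
  proof (rule subsetI)
    fix y' assume y': "y' \<in> ?V"
    obtain p q where pq: "(p, q) \<in> Dom" "x p q = fst y'" "t p q = snd y'"
      by (rule surj_Theta[of "fst y'" "snd y'"]) (use y' in auto)
    have "x p p \<le> x R R" using upper_cone[OF pq(1)] pq(2,3) y' by simp
    then have "p \<le> R" using x_diag_strict_mono[of R p] R by (cases "p \<le> R") auto
    then have "(p, q) \<in> ?K" using pq by simp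
    moreover have "Theta (p, q) = y'" using pq by (simp add: Theta_def)
    ultimately show "y' \<in> Theta ` ?K" by (metis image_eqI)
  qed
  ultimately have cV: "continuous_on ?V (inv_into Dom Theta)" by (rule continuous_on_subset)
  have yV: "y \<in> ?V" using y R by simp
  have "at y within ?Q = at y within ?V"
  proof (rule at_within_nhd)
    show "open {y'. ?f y' < x R R}" by (intro open_Collect_less continuous_intros) (use b1 in auto)
    show "y \<in> {y'. ?f y' < x R R}" using R by simp
    show "?Q \<inter> {y'. ?f y' < x R R} - {y} = ?V \<inter> {y'. ?f y' < x R R} - {y}" by auto
  qed
  moreover have "continuous (at y within ?V) (inv_into Dom Theta)"
    using cV yV continuous_on_eq_continuous_within by blast
  ultimately show "continuous (at y within ?Q) (inv_into Dom Theta)" by simp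
qed

section \<open>Differentiability of the inverse map in the interior\<close>

definition Dint :: "(real \<times> real) set" where
  "Dint = {y. 0 < snd y \<and> snd y < fst y \<and> 0 < x (fst y) (snd y)}"

lemma open_Dint: "open Dint"
  unfolding Dint_def
  by (intro open_Collect_conj open_Collect_less continuous_intros cont_x[unfolded case_prod_unfold])

lemma Dint_Dom: "Dint \<subseteq> Dom"
  by (auto simp: Dint_def Dom_def)

text \<open>Room beyond p turns the one-sided p-derivatives obtained on triangles into two-sided
  ones.\<close>

lemma Dint_extend:
  assumes "(p, q) \<in> Dint"
  obtains P where "p < P" "0 \<le> x P q"
proof -
  obtain e where e: "e > 0" "ball (p, q) e \<subseteq> Dint" by (rule openE[OF open_Dint assms])
  have "(p + e / 2, q) \<in> ball (p, q) e" using e(1) by (simp add: dist_Pair_Pair dist_real_def)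
  then have "(p + e / 2, q) \<in> Dint" using e(2) by (rule subsetD[rotated])
  then show ?thesis using that[of "p + e / 2"] e(1) by (simp add: Dint_def less_imp_le)
qed

lemma p_derivs:
  assumes "(p, q) \<in> Dint"
  shows "((\<lambda>p. x p q) has_real_derivative X p q) (at p)"
    "((\<lambda>p. t p q) has_real_derivative m2 (z p q) (w p q) * X p q) (at p)"
    "((\<lambda>p. z p q) has_real_derivative X p q * (k1 (z p q) (w p q) * a (x p q) + ze p q)) (at p)"
    "((\<lambda>p. w p q) has_real_derivative X p q * (k2 (z p q) (w p q) * a (x p q))) (at p)"
proof -
  obtain P where P: "p < P" "0 \<le> x P q" by (rule Dint_extend[OF assms])
  have q: "0 \<le> q" "q < p" using assms by (auto simp: Dint_def)
  have T: "(p, q) \<in> triangle q P" using q P by simp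
  have at: "at p within {q..P} = at p" by (rule at_within_Icc_at[OF q(2) P(1)])
  show "((\<lambda>p. x p q) has_real_derivative X p q) (at p)"
    using x_p[of q p P] q P by (simp add: at)
  show "((\<lambda>p. t p q) has_real_derivative m2 (z p q) (w p q) * X p q) (at p)"
    using t_p[OF q(1) P(2) T] by (simp add: at)
  note zw = zw_p_triangle[OF q(1) P(2) dom_triangle(2)[OF q(1) P(2)] T]
  show "((\<lambda>p. z p q) has_real_derivative X p q * (k1 (z p q) (w p q) * a (x p q) + ze p q)) (at p)"
    using zw(1) by (simp add: at)
  show "((\<lambda>p. w p q) has_real_derivative X p q * (k2 (z p q) (w p q) * a (x p q))) (at p)"
    using zw(2) by (simp add: at)
qed

lemma full_derivs:
  assumes y: "(p, q) \<in> Dint"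
  shows "((\<lambda>y. x (fst y) (snd y)) has_derivative (\<lambda>y. X p q * fst y + Y p q * snd y)) (at (p, q))"
    "((\<lambda>y. t (fst y) (snd y)) has_derivative (\<lambda>y. m2 (z p q) (w p q) * X p q * fst y + m1 (z p q) (w p q) * Y p q * snd y)) (at (p, q))"
    "((\<lambda>y. z (fst y) (snd y)) has_derivative
       (\<lambda>y. X p q * (k1 (z p q) (w p q) * a (x p q) + ze p q) * fst y + Y p q * (k1 (z p q) (w p q) * a (x p q)) * snd y)) (at (p, q))"
    "((\<lambda>y. w (fst y) (snd y)) has_derivative
       (\<lambda>y. X p q * (k2 (z p q) (w p q) * a (x p q)) * fst y + Y p q * (k2 (z p q) (w p q) * a (x p q) + om p q) * snd y)) (at (p, q))"
proof -
  have D: "(p, q) \<in> Dom" if "(p, q) \<in> Dint" for p q by (rule subsetD[OF Dint_Dom that])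
  have g: "good p q" "0 \<le> x p q" if "(p, q) \<in> Dint" for p q using Dom_good[OF D[OF that]] D[OF that] by (simp_all add: in_Dom)
  have c: "continuous_on Dint (\<lambda>y. Y (fst y) (snd y))"
    "continuous_on Dint (\<lambda>y. m1 (z (fst y) (snd y)) (w (fst y) (snd y)) * Y (fst y) (snd y))"
    "continuous_on Dint (\<lambda>y. Y (fst y) (snd y) * (k1 (z (fst y) (snd y)) (w (fst y) (snd y)) * a (x (fst y) (snd y))))"
    "continuous_on Dint (\<lambda>y. Y (fst y) (snd y) * (k2 (z (fst y) (snd y)) (w (fst y) (snd y)) * a (x (fst y) (snd y)) + om (fst y) (snd y)))"
    by (rule continuous_on_subset[OF _ Dint_Dom], rule Dom_cont(5))
      (rule continuous_on_subset[OF _ Dint_Dom], intro continuous_on_add continuous_on_mult Dom_cont Dom_cont_a Dom_cont_box C1_conts)+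
  show "((\<lambda>y. x (fst y) (snd y)) has_derivative (\<lambda>y. X p q * fst y + Y p q * snd y)) (at (p, q))"
    by (rule has_derivative_partials_real[where f = x and fp = X and fq = Y, OF open_Dint y p_derivs(1)[OF y] x_q c(1)])
  show "((\<lambda>y. t (fst y) (snd y)) has_derivative (\<lambda>y. m2 (z p q) (w p q) * X p q * fst y + m1 (z p q) (w p q) * Y p q * snd y)) (at (p, q))"
    by (rule has_derivative_partials_real[where f = t and fp = "\<lambda>p q. m2 (z p q) (w p q) * X p q"
        and fq = "\<lambda>p q. m1 (z p q) (w p q) * Y p q", OF open_Dint y p_derivs(2)[OF y] t_q[OF D] c(2)])
  show "((\<lambda>y. z (fst y) (snd y)) has_derivative
       (\<lambda>y. X p q * (k1 (z p q) (w p q) * a (x p q) + ze p q) * fst y + Y p q * (k1 (z p q) (w p q) * a (x p q)) * snd y)) (at (p, q))"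
    by (rule has_derivative_partials_real[where f = z and fp = "\<lambda>p q. X p q * (k1 (z p q) (w p q) * a (x p q) + ze p q)"
        and fq = "\<lambda>p q. Y p q * (k1 (z p q) (w p q) * a (x p q))", OF open_Dint y p_derivs(3)[OF y] z_q[OF g] c(3)])
  show "((\<lambda>y. w (fst y) (snd y)) has_derivative
       (\<lambda>y. X p q * (k2 (z p q) (w p q) * a (x p q)) * fst y + Y p q * (k2 (z p q) (w p q) * a (x p q) + om p q) * snd y)) (at (p, q))"
    by (rule has_derivative_partials_real[where f = w and fp = "\<lambda>p q. X p q * (k2 (z p q) (w p q) * a (x p q))"
        and fq = "\<lambda>p q. Y p q * (k2 (z p q) (w p q) * a (x p q) + om p q)", OF open_Dint y p_derivs(4)[OF y] w_q[OF g] c(4)])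
qed

text \<open>The Jacobian has columns X (1, m2) and Y (1, m1), so its determinant X Y (m1 - m2) does
  not vanish. Its inverse \<open>G'\<close> converts derivatives in p and q into z_t = ze / (m2 -
  m1) and z_x = k1 a - m1 z_t, which confirms the meaning intended for \<open>ze\<close>; likewise
  for \<open>om\<close>.\<close>

lemma inverse_derivs:
  assumes y: "(p, q) \<in> Dint"
  defines "M1 \<equiv> m1 (z p q) (w p q)" and "M2 \<equiv> m2 (z p q) (w p q)"
    and "A1 \<equiv> k1 (z p q) (w p q) * a (x p q)" and "A2 \<equiv> k2 (z p q) (w p q) * a (x p q)"
  shows "((\<lambda>s. z (fst (inv_into Dom Theta s)) (snd (inv_into Dom Theta s))) has_derivative
      (\<lambda>s. (A1 - M1 * (ze p q / (M2 - M1))) * fst s + ze p q / (M2 - M1) * snd s)) (at (x p q, t p q))"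
    and "((\<lambda>s. w (fst (inv_into Dom Theta s)) (snd (inv_into Dom Theta s))) has_derivative
      (\<lambda>s. (A2 - M2 * (om p q / (M1 - M2))) * fst s + om p q / (M1 - M2) * snd s)) (at (x p q, t p q))"
proof -
  let ?J = "inv_into Dom Theta"
  define F' where "F' s = (X p q * fst s + Y p q * snd s, M2 * X p q * fst s + M1 * Y p q * snd s)" for s :: "real \<times> real"
  define G' where "G' s = ((snd s - M1 * fst s) / ((M2 - M1) * X p q), (snd s - M2 * fst s) / ((M1 - M2) * Y p q))" for s :: "real \<times> real"
  have D: "(p, q) \<in> Dom" by (rule subsetD[OF Dint_Dom y])
  have nz: "M1 - M2 \<noteq> 0" "M2 - M1 \<noteq> 0" using Dom_speeds(3)[OF D] m unfolding M1_def M2_def by linarith+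
  have XY: "X p q \<noteq> 0" "Y p q \<noteq> 0" using X_neg[of p q] Y_pos[of q p] y unfolding Dint_def by simp_all
  have Fd: "(Theta has_derivative F') (at (p, q))"
    unfolding Theta_def F'_def M1_def M2_def by (intro has_derivative_Pair full_derivs[OF y])
  have id: "F' \<circ> G' = id"
  proof (rule ext)
    fix s :: "real \<times> real"
    have 1: "X p q * fst (G' s) = (snd s - M1 * fst s) / (M2 - M1)" "Y p q * snd (G' s) = (snd s - M2 * fst s) / (M1 - M2)"
      using XY by (simp_all add: G'_def)
    have 2: "(snd s - M2 * fst s) / (M1 - M2) = - ((snd s - M2 * fst s) / (M2 - M1))"
      using minus_divide_right[of "snd s - M2 * fst s" "M2 - M1"] by simp
    have "(snd s - M1 * fst s) / (M2 - M1) + (snd s - M2 * fst s) / (M1 - M2) = ((M2 - M1) * fst s) / (M2 - M1)"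
      unfolding 2 by (simp add: diff_divide_distrib[symmetric] algebra_simps)
    moreover have "M2 * ((snd s - M1 * fst s) / (M2 - M1)) + M1 * ((snd s - M2 * fst s) / (M1 - M2)) = ((M2 - M1) * snd s) / (M2 - M1)"
      unfolding 2 by (simp add: diff_divide_distrib[symmetric] algebra_simps)
    moreover have "(F' \<circ> G') s = (X p q * fst (G' s) + Y p q * snd (G' s), M2 * (X p q * fst (G' s)) + M1 * (Y p q * snd (G' s)))"
      by (simp add: F'_def mult.assoc)
    ultimately show "(F' \<circ> G') s = id s"
      unfolding 1 using nz(2) by (simp only: nonzero_mult_div_cancel_left) simp
  qed
  have "(?J has_derivative G') (at (Theta (p, q)))"
    by (rule has_derivative_inverse_strong[OF open_Dint y continuous_on_subset[OF cont_Theta subset_UNIV] _ Fd id])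
      (rule inv_into_f_f[OF inj_Theta], erule subsetD[OF Dint_Dom])
  then have Jd: "(?J has_derivative G') (at (x p q, t p q))" by (simp add: Theta_def)
  have Je: "?J (x p q, t p q) = (p, q)" by (rule J_Theta[OF D])
  have zz: "X p q * (A1 + ze p q) * fst (G' s) + Y p q * A1 * snd (G' s) = (A1 - M1 * (ze p q / (M2 - M1))) * fst s + ze p q / (M2 - M1) * snd s" for s
  proof -
    have *: "X p q * fst (G' s) + Y p q * snd (G' s) = fst s" using fun_cong[OF id, of s] by (simp add: F'_def prod_eq_iff)
    have **: "X p q * fst (G' s) = (snd s - M1 * fst s) / (M2 - M1)" using XY by (simp add: G'_def)
    have "X p q * (A1 + ze p q) * fst (G' s) + Y p q * A1 * snd (G' s)
        = A1 * (X p q * fst (G' s) + Y p q * snd (G' s)) + ze p q * (X p q * fst (G' s))" by (simp add: algebra_simps)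
    also have "\<dots> = A1 * fst s + ze p q * ((snd s - M1 * fst s) / (M2 - M1))" by (subst *, subst **) (rule refl)
    finally show ?thesis by (simp add: algebra_simps diff_divide_distrib)
  qed
  have ww: "X p q * A2 * fst (G' s) + Y p q * (A2 + om p q) * snd (G' s) = (A2 - M2 * (om p q / (M1 - M2))) * fst s + om p q / (M1 - M2) * snd s" for s
  proof -
    have *: "X p q * fst (G' s) + Y p q * snd (G' s) = fst s" using fun_cong[OF id, of s] by (simp add: F'_def prod_eq_iff)
    have **: "Y p q * snd (G' s) = (snd s - M2 * fst s) / (M1 - M2)" using XY by (simp add: G'_def)
    have "X p q * A2 * fst (G' s) + Y p q * (A2 + om p q) * snd (G' s)
        = A2 * (X p q * fst (G' s) + Y p q * snd (G' s)) + om p q * (Y p q * snd (G' s))" by (simp add: algebra_simps)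
    also have "\<dots> = A2 * fst s + om p q * ((snd s - M2 * fst s) / (M1 - M2))" by (subst *, subst **) (rule refl)
    finally show ?thesis by (simp add: algebra_simps diff_divide_distrib)
  qed
  show "((\<lambda>s. z (fst (?J s)) (snd (?J s))) has_derivative
      (\<lambda>s. (A1 - M1 * (ze p q / (M2 - M1))) * fst s + ze p q / (M2 - M1) * snd s)) (at (x p q, t p q))"
  proof -
    have "((\<lambda>y. z (fst y) (snd y)) has_derivative (\<lambda>y. X p q * (A1 + ze p q) * fst y + Y p q * A1 * snd y)) (at (?J (x p q, t p q)))"
      unfolding Je A1_def by (rule full_derivs(3)[OF y])
    then show ?thesis
      by (rule has_derivative_eq_rhs[OF has_derivative_compose[OF Jd]]) (rule ext, rule zz)
  qed
  show "((\<lambda>s. w (fst (?J s)) (snd (?J s))) has_derivative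
      (\<lambda>s. (A2 - M2 * (om p q / (M1 - M2))) * fst s + om p q / (M1 - M2) * snd s)) (at (x p q, t p q))"
  proof -
    have "((\<lambda>y. w (fst y) (snd y)) has_derivative (\<lambda>y. X p q * A2 * fst y + Y p q * (A2 + om p q) * snd y)) (at (?J (x p q, t p q)))"
      unfolding Je A2_def by (rule full_derivs(4)[OF y])
    then show ?thesis
      by (rule has_derivative_eq_rhs[OF has_derivative_compose[OF Jd]]) (rule ext, rule ww)
  qed
qed

end

section \<open>Regularity up to the boundary\<close>

text \<open>On the open quadrant near (x, t) the mean value inequality holds for u minus the
  candidate linear map. Shifting both points inward by a multiple of (1, 1) and letting the shift
  tend to 0 carries the inequality to the closed quadrant by continuity of u.\<close>

lemma quadrant_extension:
  fixes u ux ut :: "real \<Rightarrow> real \<Rightarrow> real"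
  assumes cu: "continuous_on ({0..} \<times> {0..}) (\<lambda>(x, t). u x t)"
    and cx: "continuous_on ({0..} \<times> {0..}) (\<lambda>(x, t). ux x t)" and ct: "continuous_on ({0..} \<times> {0..}) (\<lambda>(x, t). ut x t)"
    and int: "\<And>x t. 0 < x \<Longrightarrow> 0 < t \<Longrightarrow>
      ((\<lambda>y. u (fst y) (snd y)) has_derivative (\<lambda>y. ux x t * fst y + ut x t * snd y)) (at (x, t))"
    and xt: "0 \<le> x" "0 \<le> t"
  shows "((\<lambda>(y, s). u y s) has_derivative (\<lambda>(h, k). ux x t * h + ut x t * k)) (at (x, t) within {0..} \<times> {0..})"
  unfolding has_derivative_within_alt
proof (intro conjI allI impI)
  let ?Q = "{0..} \<times> {0..} :: (real \<times> real) set"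
  let ?L = "\<lambda>y. ux x t * fst y + ut x t * snd y"
  show "bounded_linear (\<lambda>(h, k). ux x t * h + ut x t * k)"
    unfolding case_prod_unfold by (intro bounded_linear_intros)
  have bl: "bounded_linear ?L" by (intro bounded_linear_intros)
  fix \<epsilon> :: real assume \<epsilon>: "\<epsilon> > 0"
  have \<epsilon>2: "\<epsilon> / 2 > 0" using \<epsilon> by simp
  have xtQ: "(x, t) \<in> ?Q" using xt by simp
  obtain d1 where d1: "d1 > 0" "\<forall>y\<in>?Q. dist y (x, t) < d1 \<longrightarrow> dist (ux (fst y) (snd y)) (ux x t) < \<epsilon> / 2"
    using cx[unfolded continuous_on_iff, rule_format, OF xtQ \<epsilon>2] unfolding case_prod_unfold fst_conv snd_conv by (elim exE conjE)
  obtain d2 where d2: "d2 > 0" "\<forall>y\<in>?Q. dist y (x, t) < d2 \<longrightarrow> dist (ut (fst y) (snd y)) (ut x t) < \<epsilon> / 2"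
    using ct[unfolded continuous_on_iff, rule_format, OF xtQ \<epsilon>2] unfolding case_prod_unfold fst_conv snd_conv by (elim exE conjE)
  define d where "d = min d1 d2"
  have d: "d > 0" using d1 d2 by (simp add: d_def)
  define B where "B = ({0<..} \<times> {0<..}) \<inter> ball (x, t) d"
  have "convex B" unfolding B_def by (intro convex_Int convex_Times convex_ball convex_real_interval)
  have est: "norm ((u (fst y') (snd y') - ?L y') - (u (fst y) (snd y) - ?L y)) \<le> \<epsilon> * norm (y' - y)"
    if y: "y \<in> B" "y' \<in> B" for y y'
  proof (rule differentiable_bound[OF \<open>convex B\<close> _ _ y(2,1)])
    fix b assume b: "b \<in> B"
    obtain p q where pq: "b = (p, q)" by (cases b)
    have pos: "0 < p" "0 < q" using b by (auto simp: B_def pq)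
    have Lb: "(?L has_derivative ?L) (at b within B)" by (rule bounded_linear_imp_has_derivative[OF bl])
    have ub: "((\<lambda>y. u (fst y) (snd y)) has_derivative (\<lambda>y. ux p q * fst y + ut p q * snd y)) (at b within B)"
      unfolding pq by (rule has_derivative_at_withinI[OF int[OF pos]])
    from has_derivative_diff[OF ub Lb]
    show "((\<lambda>y. u (fst y) (snd y) - ?L y) has_derivative
        (\<lambda>y. (ux (fst b) (snd b) * fst y + ut (fst b) (snd b) * snd y) - ?L y)) (at b within B)"
      by (simp only: pq fst_conv snd_conv)
    have bQ: "b \<in> ?Q" using pos by (simp add: pq)
    have db: "dist b (x, t) < d" using b by (simp add: B_def dist_commute)
    show "onorm (\<lambda>y. (ux (fst b) (snd b) * fst y + ut (fst b) (snd b) * snd y) - ?L y) \<le> \<epsilon>"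
    proof (rule onorm_le)
      fix y :: "real \<times> real"
      define e1 e2 where "e1 = ux (fst b) (snd b) - ux x t" and "e2 = ut (fst b) (snd b) - ut x t"
      have e: "\<bar>e1\<bar> \<le> \<epsilon> / 2" "\<bar>e2\<bar> \<le> \<epsilon> / 2"
        using d1(2)[rule_format, OF bQ] d2(2)[rule_format, OF bQ] db by (auto simp: d_def e1_def e2_def dist_real_def)
      have n: "\<bar>fst y\<bar> \<le> norm y" "\<bar>snd y\<bar> \<le> norm y"
        using norm_fst_le[of "fst y" "snd y"] norm_snd_le[of "snd y" "fst y"] by simp_all
      have "(ux (fst b) (snd b) * fst y + ut (fst b) (snd b) * snd y) - ?L y = e1 * fst y + e2 * snd y"
        by (simp add: e1_def e2_def algebra_simps)
      moreover have "\<bar>e1 * fst y\<bar> \<le> \<epsilon> / 2 * norm y" "\<bar>e2 * snd y\<bar> \<le> \<epsilon> / 2 * norm y"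
        unfolding abs_mult by (rule mult_mono[OF e(1) n(1)] mult_mono[OF e(2) n(2)]; use \<epsilon> in simp)+
      ultimately have "norm ((ux (fst b) (snd b) * fst y + ut (fst b) (snd b) * snd y) - ?L y) \<le> \<epsilon> / 2 * norm y + \<epsilon> / 2 * norm y"
        using abs_triangle_ineq[of "e1 * fst y" "e2 * snd y"] by simp
      then show "norm ((ux (fst b) (snd b) * fst y + ut (fst b) (snd b) * snd y) - ?L y) \<le> \<epsilon> * norm y" by simp
    qed
  qed
  show "\<exists>d>0. \<forall>y\<in>?Q. norm (y - (x, t)) < d \<longrightarrow>
      norm ((case y of (y, s) \<Rightarrow> u y s) - (case (x, t) of (y, s) \<Rightarrow> u y s) - (case y - (x, t) of (h, k) \<Rightarrow> ux x t * h + ut x t * k))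
        \<le> \<epsilon> * norm (y - (x, t))"
  proof (intro exI[of _ d] conjI ballI impI)
    fix y assume y: "y \<in> ?Q" "norm (y - (x, t)) < d"
    define e :: "real \<times> real" where "e = (1, 1)"
    have path: "((\<lambda>s. u (fst (y + s *\<^sub>R e)) (snd (y + s *\<^sub>R e))) \<longlongrightarrow> u (fst y) (snd y)) (at_right 0)" if y: "y \<in> ?Q" for y
    proof -
      have c1: "continuous_on {0..} (\<lambda>s. y + s *\<^sub>R e)" by (intro continuous_intros)
      have c2: "(\<lambda>s. y + s *\<^sub>R e) ` {0..} \<subseteq> ?Q"
        by (rule image_subsetI) (use y in \<open>simp add: e_def mem_Times_iff\<close>)
      from continuous_on_compose2[OF cu[unfolded case_prod_unfold] c1 c2]
      have "continuous (at 0 within {0..}) (\<lambda>s. u (fst (y + s *\<^sub>R e)) (snd (y + s *\<^sub>R e)))"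
        by (simp add: continuous_on_eq_continuous_within)
      then have "((\<lambda>s. u (fst (y + s *\<^sub>R e)) (snd (y + s *\<^sub>R e))) \<longlongrightarrow> u (fst y) (snd y)) (at 0 within {0..})"
        by (simp add: continuous_within)
      then show ?thesis by (rule tendsto_within_subset) auto
    qed
    have inB: "\<forall>\<^sub>F s in at_right 0. y + s *\<^sub>R e \<in> B" if y: "y \<in> ?Q" "dist y (x, t) < d" for y
    proof -
      have "((\<lambda>s. y + s *\<^sub>R e) \<longlongrightarrow> y + 0 *\<^sub>R e) (at_right 0)" by (intro tendsto_intros)
      then have "((\<lambda>s. y + s *\<^sub>R e) \<longlongrightarrow> y) (at_right 0)" by simp
      moreover have "y \<in> ball (x, t) d" using y by (simp add: dist_commute)
      ultimately have "\<forall>\<^sub>F s in at_right 0. y + s *\<^sub>R e \<in> ball (x, t) d" using topological_tendstoD open_ball by blast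
      moreover have "\<forall>\<^sub>F s in at_right (0::real). s > 0" by (rule eventually_at_right_less)
      ultimately show ?thesis
      proof eventually_elim
        case (elim s)
        then show ?case using y by (simp add: B_def e_def mem_Times_iff)
      qed
    qed
    have xtd: "dist (x, t) (x, t) < d" using d by simp
    have yd: "dist y (x, t) < d" using y by (simp add: dist_norm)
    have ev: "\<forall>\<^sub>F s in at_right 0. norm (u (fst (y + s *\<^sub>R e)) (snd (y + s *\<^sub>R e)) - u (fst ((x, t) + s *\<^sub>R e)) (snd ((x, t) + s *\<^sub>R e)) - ?L (y - (x, t)))
        \<le> \<epsilon> * norm (y - (x, t))"
      using inB[OF y(1) yd] inB[OF xtQ xtd]
    proof eventually_elim
      case (elim s)
      have "norm ((u (fst (y + s *\<^sub>R e)) (snd (y + s *\<^sub>R e)) - ?L (y + s *\<^sub>R e)) - (u (fst ((x, t) + s *\<^sub>R e)) (snd ((x, t) + s *\<^sub>R e)) - ?L ((x, t) + s *\<^sub>R e)))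
          \<le> \<epsilon> * norm ((y + s *\<^sub>R e) - ((x, t) + s *\<^sub>R e))"
        by (rule est[OF elim(2,1)])
      moreover have "(y + s *\<^sub>R e) - ((x, t) + s *\<^sub>R e) = y - (x, t)" by simp
      moreover have "?L (y + s *\<^sub>R e) - ?L ((x, t) + s *\<^sub>R e) = ?L (y - (x, t))" by (simp add: algebra_simps)
      ultimately show ?case by (simp add: algebra_simps)
    qed
    have "((\<lambda>s. norm (u (fst (y + s *\<^sub>R e)) (snd (y + s *\<^sub>R e)) - u (fst ((x, t) + s *\<^sub>R e)) (snd ((x, t) + s *\<^sub>R e)) - ?L (y - (x, t))))
        \<longlongrightarrow> norm (u (fst y) (snd y) - u (fst (x, t)) (snd (x, t)) - ?L (y - (x, t)))) (at_right 0)"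
      by (intro tendsto_norm tendsto_diff path y(1) xtQ tendsto_const)
    from tendsto_upperbound[OF this ev]
    have "norm (u (fst y) (snd y) - u (fst (x, t)) (snd (x, t)) - ?L (y - (x, t))) \<le> \<epsilon> * norm (y - (x, t))" by simp
    then show "norm ((case y of (y, s) \<Rightarrow> u y s) - (case (x, t) of (y, s) \<Rightarrow> u y s) - (case y - (x, t) of (h, k) \<Rightarrow> ux x t * h + ut x t * k))
        \<le> \<epsilon> * norm (y - (x, t))"
      by (simp only: case_prod_unfold)
  qed (rule d)
qed

lemma at_within_halfline_neq_bot: "0 \<le> (x :: real) \<Longrightarrow> at x within {0..} \<noteq> bot"
proof
  assume x: "0 \<le> x" and "at x within {0..} = bot"
  moreover have "at_right x \<le> at x within {0..}" by (rule at_le) (use x in auto)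
  ultimately have "at_right x = bot" by (simp add: bot_unique)
  then show False by simp
qed

lemma hderiv_eqI:
  assumes "0 \<le> x" "(f has_real_derivative d) (at x within {0..})"
  shows "hderiv f x = d"
  unfolding hderiv_def
  by (rule vector_derivative_within[OF at_within_halfline_neq_bot[OF assms(1)]])
    (use assms(2) in \<open>simp add: has_real_derivative_iff_has_vector_derivative\<close>)

lemma hderiv_partials:
  fixes u :: "real \<Rightarrow> real \<Rightarrow> real"
  assumes d: "((\<lambda>(y, s). u y s) has_derivative (\<lambda>(h, k). p * h + q * k)) (at (x, t) within {0..} \<times> {0..})"
    and xt: "0 \<le> x" "0 \<le> t"
  shows "hderiv (\<lambda>y. u y t) x = p" "hderiv (\<lambda>s. u x s) t = q"
proof -
  have "((\<lambda>y. (y, t)) has_derivative (\<lambda>h. (h, 0))) (at x within {0..})"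
    by (intro has_derivative_Pair has_derivative_ident has_derivative_const)
  moreover have "((\<lambda>(y, s). u y s) has_derivative (\<lambda>(h, k). p * h + q * k)) (at (x, t) within (\<lambda>y. (y, t)) ` {0..})"
    by (rule has_derivative_subset[OF d]) (use xt in auto)
  ultimately have "((\<lambda>y. u y t) has_derivative (\<lambda>h. p * h)) (at x within {0..})"
    using has_derivative_in_compose[of "\<lambda>y. (y, t)" "\<lambda>h. (h, 0)" x "{0..}" "\<lambda>(y, s). u y s" "\<lambda>(h, k). p * h + q * k"]
    by simp
  then have "((\<lambda>y. u y t) has_real_derivative p) (at x within {0..})"
    by (simp add: has_field_derivative_def)
  then show "hderiv (\<lambda>y. u y t) x = p" by (rule hderiv_eqI[OF xt(1)])
  have "((\<lambda>s. (x, s)) has_derivative (\<lambda>h. (0, h))) (at t within {0..})"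
    by (intro has_derivative_Pair has_derivative_ident has_derivative_const)
  moreover have "((\<lambda>(y, s). u y s) has_derivative (\<lambda>(h, k). p * h + q * k)) (at (x, t) within (\<lambda>s. (x, s)) ` {0..})"
    by (rule has_derivative_subset[OF d]) (use xt in auto)
  ultimately have "((\<lambda>s. u x s) has_derivative (\<lambda>h. q * h)) (at t within {0..})"
    using has_derivative_in_compose[of "\<lambda>s. (x, s)" "\<lambda>h. (0, h)" t "{0..}" "\<lambda>(y, s). u y s" "\<lambda>(h, k). p * h + q * k"]
    by simp
  then have "((\<lambda>s. u x s) has_real_derivative q) (at t within {0..})"
    by (simp add: has_field_derivative_def)
  then show "hderiv (\<lambda>s. u x s) t = q" by (rule hderiv_eqI[OF xt(2)])
qed

context char_picard begin

lemma J_interior: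
  assumes "0 < \<xi>" "0 < \<tau>"
  obtains p q where "inv_into Dom Theta (\<xi>, \<tau>) = (p, q)" "(p, q) \<in> Dint" "x p q = \<xi>" "t p q = \<tau>"
proof -
  obtain p q where pq: "inv_into Dom Theta (\<xi>, \<tau>) = (p, q)" "(p, q) \<in> Dom" "x p q = \<xi>" "t p q = \<tau>"
    by (rule J_Dom[of \<xi> \<tau>]) (use assms in auto)
  have D: "0 \<le> q" "q \<le> p" using pq(2) by (auto simp: in_Dom)
  have "p \<noteq> q" using pq(4) assms t_diag by auto
  then have "q < p" using D by simp
  have "q \<noteq> 0"
  proof
    assume "q = 0"
    then have "x p 0 < x 0 0" using x_strict_antimono_p[of 0 0 p] \<open>q < p\<close> by simp
    then show False using pq(3) \<open>q = 0\<close> assms by (simp add: x_diag)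
  qed
  then have "(p, q) \<in> Dint" using D \<open>q < p\<close> pq(3) assms by (simp add: Dint_def)
  with pq show ?thesis using that by blast
qed

text \<open>With the derivatives read off from \<open>ze\<close> and \<open>om\<close> the equations
  hold by definition. The content is that these functions are derivatives of u and v: in the
  interior through the inverse map, at the boundary through
  \<open>quadrant_extension\<close>.\<close>

lemma quadrant_solution:
  obtains u v ux ut vx vt where
    "continuous_on ({0..} \<times> {0..}) (\<lambda>(x, t). u x t)" "continuous_on ({0..} \<times> {0..}) (\<lambda>(x, t). v x t)"
    "continuous_on ({0..} \<times> {0..}) (\<lambda>(x, t). ux x t)" "continuous_on ({0..} \<times> {0..}) (\<lambda>(x, t). ut x t)"
    "continuous_on ({0..} \<times> {0..}) (\<lambda>(x, t). vx x t)" "continuous_on ({0..} \<times> {0..}) (\<lambda>(x, t). vt x t)"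
    "\<And>x t. 0 \<le> x \<Longrightarrow> 0 \<le> t \<Longrightarrow> ((\<lambda>(y, s). u y s) has_derivative (\<lambda>(h, k). ux x t * h + ut x t * k)) (at (x, t) within {0..} \<times> {0..})"
    "\<And>x t. 0 \<le> x \<Longrightarrow> 0 \<le> t \<Longrightarrow> ((\<lambda>(y, s). v y s) has_derivative (\<lambda>(h, k). vx x t * h + vt x t * k)) (at (x, t) within {0..} \<times> {0..})"
    "\<And>x t. 0 \<le> x \<Longrightarrow> 0 \<le> t \<Longrightarrow> u x t \<in> {zl..zu} \<and> v x t \<in> {wl..wu}"
    "\<And>x t. 0 \<le> x \<Longrightarrow> 0 \<le> t \<Longrightarrow> ux x t + m1 (u x t) (v x t) * ut x t = k1 (u x t) (v x t) * a x"
    "\<And>x t. 0 \<le> x \<Longrightarrow> 0 \<le> t \<Longrightarrow> vx x t + m2 (u x t) (v x t) * vt x t = k2 (u x t) (v x t) * a x"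
    "\<And>x. 0 \<le> x \<Longrightarrow> u x 0 = z0 x" "\<And>x. 0 \<le> x \<Longrightarrow> v x 0 = w0 x"
proof -
  let ?Q = "{0..} \<times> {0..} :: (real \<times> real) set"
  let ?J = "inv_into Dom Theta"
  define Zt Zx Wt Wx where
    "Zt y = ze (fst y) (snd y) / (m2 (z (fst y) (snd y)) (w (fst y) (snd y)) - m1 (z (fst y) (snd y)) (w (fst y) (snd y)))"
    and "Zx y = k1 (z (fst y) (snd y)) (w (fst y) (snd y)) * a (x (fst y) (snd y)) - m1 (z (fst y) (snd y)) (w (fst y) (snd y)) * Zt y"
    and "Wt y = om (fst y) (snd y) / (m1 (z (fst y) (snd y)) (w (fst y) (snd y)) - m2 (z (fst y) (snd y)) (w (fst y) (snd y)))"
    and "Wx y = k2 (z (fst y) (snd y)) (w (fst y) (snd y)) * a (x (fst y) (snd y)) - m2 (z (fst y) (snd y)) (w (fst y) (snd y)) * Wt y" for y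
  have nz: "m2 (z (fst y) (snd y)) (w (fst y) (snd y)) - m1 (z (fst y) (snd y)) (w (fst y) (snd y)) \<noteq> 0"
    "m1 (z (fst y) (snd y)) (w (fst y) (snd y)) - m2 (z (fst y) (snd y)) (w (fst y) (snd y)) \<noteq> 0" if "y \<in> Dom" for y
    using Dom_speeds(3)[of "fst y" "snd y"] that m by auto
  have cZ: "continuous_on Dom Zt" "continuous_on Dom Wt"
    unfolding Zt_def Wt_def
    by (intro continuous_on_divide continuous_on_diff Dom_cont Dom_cont_box C1_conts ballI nz; assumption)+
  have cZx: "continuous_on Dom Zx" "continuous_on Dom Wx"
    unfolding Zx_def Wx_def
    by (intro continuous_on_mult continuous_on_diff Dom_cont_a Dom_cont_box C1_conts cZ)+
  have JD: "?J ` ?Q \<subseteq> Dom"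
  proof (rule image_subsetI)
    fix y assume "y \<in> ?Q"
    then have "0 \<le> fst y" "0 \<le> snd y" by (auto simp: mem_Times_iff)
    then obtain p q where "?J (fst y, snd y) = (p, q)" "(p, q) \<in> Dom" using J_Dom by metis
    then show "?J y \<in> Dom" by simp
  qed
  have comp: "continuous_on ?Q (\<lambda>(x, t). h (?J (x, t)))" if "continuous_on Dom h" for h :: "real \<times> real \<Rightarrow> real"
    using continuous_on_compose2[OF that cont_J JD] by (simp add: case_prod_unfold)
  define Z W where "Z y = z (fst y) (snd y)" and "W y = w (fst y) (snd y)" for y
  have cZW: "continuous_on Dom Z" "continuous_on Dom W"
    unfolding Z_def W_def by (rule Dom_cont)+
  define u v ux ut vx vt where "u \<xi> \<tau> = Z (?J (\<xi>, \<tau>))" and "v \<xi> \<tau> = W (?J (\<xi>, \<tau>))" and "ux \<xi> \<tau> = Zx (?J (\<xi>, \<tau>))"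
    and "ut \<xi> \<tau> = Zt (?J (\<xi>, \<tau>))" and "vx \<xi> \<tau> = Wx (?J (\<xi>, \<tau>))" and "vt \<xi> \<tau> = Wt (?J (\<xi>, \<tau>))" for \<xi> \<tau>
  have c: "continuous_on ?Q (\<lambda>(x, t). u x t)" "continuous_on ?Q (\<lambda>(x, t). v x t)"
    "continuous_on ?Q (\<lambda>(x, t). ux x t)" "continuous_on ?Q (\<lambda>(x, t). ut x t)"
    "continuous_on ?Q (\<lambda>(x, t). vx x t)" "continuous_on ?Q (\<lambda>(x, t). vt x t)"
    unfolding u_def v_def ux_def ut_def vx_def vt_def by (rule comp cZW cZ cZx)+
  have du: "((\<lambda>y. u (fst y) (snd y)) has_derivative (\<lambda>y. ux \<xi> \<tau> * fst y + ut \<xi> \<tau> * snd y)) (at (\<xi>, \<tau>))"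
    and dv: "((\<lambda>y. v (fst y) (snd y)) has_derivative (\<lambda>y. vx \<xi> \<tau> * fst y + vt \<xi> \<tau> * snd y)) (at (\<xi>, \<tau>))"
    if pos: "0 < \<xi>" "0 < \<tau>" for \<xi> \<tau>
  proof -
    obtain p q where pq: "?J (\<xi>, \<tau>) = (p, q)" "(p, q) \<in> Dint" "x p q = \<xi>" "t p q = \<tau>" by (rule J_interior[OF pos])
    show "((\<lambda>y. u (fst y) (snd y)) has_derivative (\<lambda>y. ux \<xi> \<tau> * fst y + ut \<xi> \<tau> * snd y)) (at (\<xi>, \<tau>))"
      using inverse_derivs(1)[OF pq(2)] unfolding pq(3,4)
      by (simp add: u_def Z_def ux_def ut_def pq(1) Zx_def Zt_def pq(3))
    show "((\<lambda>y. v (fst y) (snd y)) has_derivative (\<lambda>y. vx \<xi> \<tau> * fst y + vt \<xi> \<tau> * snd y)) (at (\<xi>, \<tau>))"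
      using inverse_derivs(2)[OF pq(2)] unfolding pq(3,4)
      by (simp add: v_def W_def vx_def vt_def pq(1) Wx_def Wt_def pq(3))
  qed
  show ?thesis
  proof (rule that[OF c(1,2,3,4,5,6)])
    fix \<xi> \<tau> :: real assume nn: "0 \<le> \<xi>" "0 \<le> \<tau>"
    show "((\<lambda>(y, s). u y s) has_derivative (\<lambda>(h, k). ux \<xi> \<tau> * h + ut \<xi> \<tau> * k)) (at (\<xi>, \<tau>) within ?Q)"
      by (rule quadrant_extension[OF c(1,3,4) du nn])
    show "((\<lambda>(y, s). v y s) has_derivative (\<lambda>(h, k). vx \<xi> \<tau> * h + vt \<xi> \<tau> * k)) (at (\<xi>, \<tau>) within ?Q)"
      by (rule quadrant_extension[OF c(2,5,6) dv nn])
    obtain p q where pq: "?J (\<xi>, \<tau>) = (p, q)" "(p, q) \<in> Dom" "x p q = \<xi>" "t p q = \<tau>" by (rule J_Dom[OF nn])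
    show "u \<xi> \<tau> \<in> {zl..zu} \<and> v \<xi> \<tau> \<in> {wl..wu}"
      using Dom_box[OF pq(2)] by (simp add: u_def v_def Z_def W_def pq(1))
    show "ux \<xi> \<tau> + m1 (u \<xi> \<tau>) (v \<xi> \<tau>) * ut \<xi> \<tau> = k1 (u \<xi> \<tau>) (v \<xi> \<tau>) * a \<xi>"
      "vx \<xi> \<tau> + m2 (u \<xi> \<tau>) (v \<xi> \<tau>) * vt \<xi> \<tau> = k2 (u \<xi> \<tau>) (v \<xi> \<tau>) * a \<xi>"
      by (simp_all add: u_def v_def ux_def ut_def vx_def vt_def Z_def W_def pq(1) Zx_def Wx_def pq(3))
  next
    fix \<xi> :: real assume "0 \<le> \<xi>"
    then obtain p where p: "0 \<le> p" "x p p = \<xi>" by (rule x_diag_surj)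
    then have "(p, p) \<in> Dom" using \<open>0 \<le> \<xi>\<close> by (simp add: in_Dom)
    from J_Theta[OF this] have "?J (\<xi>, 0) = (p, p)" by (simp add: p t_diag)
    then show "u \<xi> 0 = z0 \<xi>" "v \<xi> 0 = w0 \<xi>" by (simp_all add: u_def v_def Z_def W_def z_diag w_diag p)
  qed
qed

end

section \<open>Riccati equations along characteristics\<close>

definition Ephi :: "real \<Rightarrow> real \<Rightarrow> real" where "Ephi \<gamma> y = y powr beta \<gamma>"

text \<open>An antiderivative of \<open>Ephi\<close>. The logarithm at \<beta> = -1 is absorbed
  here, so both forms of \<open>Phi\<close> are treated at once from now on.\<close>

definition Fphi :: "real \<Rightarrow> real \<Rightarrow> real" where
  "Fphi \<gamma> y = (if beta \<gamma> \<noteq> -1 then y powr (beta \<gamma> + 1) / (beta \<gamma> + 1) else ln y)"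

lemma Phi_eq: "z < w \<Longrightarrow> Phi \<gamma> a z w r =
    Ephi \<gamma> (w - z) * r + a * z * Ephi \<gamma> (w - z) / (2 * beta \<gamma>) + a * Fphi \<gamma> (w - z) / 2"
  by (cases "beta \<gamma> = -1") (simp_all add: Phi_def Ephi_def Fphi_def Let_def powr_minus_divide mult.commute)

lemma Psi_eq: "z < w \<Longrightarrow> Psi \<gamma> a z w s =
    Ephi \<gamma> (w - z) * s + a * w * Ephi \<gamma> (w - z) / (2 * beta \<gamma>) - a * Fphi \<gamma> (w - z) / 2"
  by (cases "beta \<gamma> = -1") (simp_all add: Psi_def Ephi_def Fphi_def Let_def powr_minus_divide mult.commute)

lemma Psi_eq_Phi: "z < w \<Longrightarrow> Psi \<gamma> a z w s = Phi \<gamma> (- a) (- w) (- z) s"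
  by (simp add: Psi_eq Phi_eq)

lemma Ephi_deriv:
  assumes "(y has_real_derivative y') (at s within I)" "y s > 0"
  shows "((\<lambda>s. Ephi \<gamma> (y s)) has_real_derivative beta \<gamma> * Ephi \<gamma> (y s) / y s * y') (at s within I)"
proof -
  have "((\<lambda>s. y s powr beta \<gamma>) has_real_derivative beta \<gamma> * y s powr (beta \<gamma> - 1) * y') (at s within I)"
    using assms by (auto intro!: derivative_eq_intros)
  then show ?thesis using assms(2) by (simp add: Ephi_def powr_diff)
qed

lemma Fphi_deriv:
  assumes "(y has_real_derivative y') (at s within I)" "y s > 0"
  shows "((\<lambda>s. Fphi \<gamma> (y s)) has_real_derivative Ephi \<gamma> (y s) * y') (at s within I)"
proof (cases "beta \<gamma> = -1")
  case True
  have "((\<lambda>s. ln (y s)) has_real_derivative inverse (y s) * y') (at s within I)"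
    using assms by (auto intro!: derivative_eq_intros simp: field_simps)
  then show ?thesis using True assms(2) by (simp add: Fphi_def Ephi_def powr_minus field_simps)
next
  case False
  then have "beta \<gamma> + 1 \<noteq> 0" by auto
  have "((\<lambda>s. y s powr (beta \<gamma> + 1) / (beta \<gamma> + 1)) has_real_derivative (beta \<gamma> + 1) * y s powr (beta \<gamma> + 1 - 1) * y' / (beta \<gamma> + 1)) (at s within I)"
    using assms by (auto intro!: derivative_eq_intros)
  then show ?thesis using False \<open>beta \<gamma> + 1 \<noteq> 0\<close> by (simp add: Fphi_def Ephi_def)
qed

text \<open>\<open>a1\<close> is the value of \<open>a'\<close> and \<open>lam\<close> the speed, so that \<open>lam * a1\<close> is the rate of change of \<open>a\<close> in time.\<close>

definition riccati :: "real \<Rightarrow> real \<Rightarrow> real \<Rightarrow> real \<Rightarrow> real \<Rightarrow> real \<Rightarrow> real \<Rightarrow> real" where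
  "riccati \<gamma> lam a a1 z w r = (let E = Ephi \<gamma> (w - z); F = Fphi \<gamma> (w - z); g = (\<gamma> - 1) / 8 * (w\<^sup>2 - z\<^sup>2) in
     - (E * ((\<gamma> + 1) / 4 * r\<^sup>2 + a * (2 * beta \<gamma> * g / (w - z) + (\<gamma> - 1) / 4 * z) * r))
     + a1 * (g * E + lam * (z * E / (2 * beta \<gamma>) + F / 2)) + a\<^sup>2 * (g * E * (1 / (2 * beta \<gamma>) - z / (w - z) - 1)))"

lemma beta_neg: "1 < \<gamma> \<Longrightarrow> \<gamma> \<le> 5 / 3 \<Longrightarrow> beta \<gamma> < 0"
  unfolding beta_def by (intro divide_neg_pos) auto

text \<open>The correction terms of \<open>Phi\<close> are chosen so that the derivative \<open>s\<close> of the other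
  Riemann invariant drops out.\<close>

lemma Phi_deriv:
  assumes \<gamma>: "1 < \<gamma>" "\<gamma> \<le> 5 / 3" and lt: "z t < w t"
    and z: "(z has_real_derivative \<kappa> * (A t * ((\<gamma> - 1) / 8 * ((w t)\<^sup>2 - (z t)\<^sup>2)))) (at t within I)"
    and w: "(w has_real_derivative \<kappa> * (- (A t * ((\<gamma> - 1) / 8 * ((w t)\<^sup>2 - (z t)\<^sup>2))) - (\<gamma> - 1) / 2 * (w t - z t) * s)) (at t within I)"
    and r: "(r has_real_derivative \<kappa> * (a1 * ((\<gamma> - 1) / 8 * ((w t)\<^sup>2 - (z t)\<^sup>2))
        + r t * (A t * (- (\<gamma> - 1) / 4 * z t) - (\<gamma> + 1) / 4 * r t) + s * (A t * ((\<gamma> - 1) / 4 * w t) - (3 - \<gamma>) / 4 * r t))) (at t within I)"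
    and A: "(A has_real_derivative \<kappa> * (lam * a1)) (at t within I)"
    and ev: "\<And>t. t \<in> I \<Longrightarrow> z t < w t" and tI: "t \<in> I"
  shows "((\<lambda>t. Phi \<gamma> (A t) (z t) (w t) (r t)) has_real_derivative \<kappa> * riccati \<gamma> lam (A t) a1 (z t) (w t) (r t)) (at t within I)"
proof -
  define b c y E F g where "b = beta \<gamma>" and "c = (\<gamma> - 1) / 2" and "y = w t - z t" and "E = Ephi \<gamma> (w t - z t)"
    and "F = Fphi \<gamma> (w t - z t)" and "g = (\<gamma> - 1) / 8 * ((w t)\<^sup>2 - (z t)\<^sup>2)"
  have y0: "y > 0" using lt by (simp add: y_def)
  have b0: "b \<noteq> 0" using beta_neg[OF \<gamma>] by (simp add: b_def)
  \<comment> \<open>The value of \<beta> enters through this identity: the s-terms produced by the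
    power of w - z cancel those in the equation for \<open>r\<close>.\<close>
  have bc: "(3 - \<gamma>) / 4 = - (b * c)" using \<gamma> by (simp add: b_def c_def beta_def field_simps)
  have c4: "(\<gamma> - 1) / 4 = c / 2" "- (\<gamma> - 1) / 4 = - (c / 2)" by (simp_all add: c_def field_simps)
  define y' where "y' = \<kappa> * (- (2 * (A t * g)) - c * y * s)"
  have yd: "((\<lambda>t. w t - z t) has_real_derivative y') (at t within I)"
    by (rule DERIV_cong[OF DERIV_diff[OF w z]]) (simp add: y'_def g_def c_def y_def field_simps)
  have Ed: "((\<lambda>t. Ephi \<gamma> (w t - z t)) has_real_derivative b * E / y * y') (at t within I)"
    unfolding b_def E_def y_def by (rule Ephi_deriv[OF yd]) (use y0 in \<open>simp add: y_def\<close>)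
  have Fd: "((\<lambda>t. Fphi \<gamma> (w t - z t)) has_real_derivative E * y') (at t within I)"
    unfolding E_def by (rule Fphi_deriv[OF yd]) (use y0 in \<open>simp add: y_def\<close>)
  define r' where "r' = \<kappa> * (a1 * g + r t * (A t * (- (c / 2) * z t) - (\<gamma> + 1) / 4 * r t) + s * (A t * (c / 2 * w t) + b * c * r t))"
  have rd: "(r has_real_derivative r') (at t within I)"
    by (rule DERIV_cong[OF r]) (simp only: r'_def g_def c4 bc mult_minus_left diff_minus_eq_add)
  have zd: "(z has_real_derivative \<kappa> * (A t * g)) (at t within I)" using z by (simp only: g_def)
  have D: "((\<lambda>t. Ephi \<gamma> (w t - z t) * r t + A t * z t * Ephi \<gamma> (w t - z t) / (2 * b) + A t * Fphi \<gamma> (w t - z t) / 2) has_real_derivative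
      (b * E / y * y' * r t + r' * E) + ((\<kappa> * (lam * a1) * z t + \<kappa> * (A t * g) * A t) * E + b * E / y * y' * (A t * z t)) / (2 * b)
       + (\<kappa> * (lam * a1) * F + E * y' * A t) / 2) (at t within I)"
    unfolding E_def[symmetric] F_def[symmetric]
    by (rule DERIV_cong, rule DERIV_add[OF DERIV_add[OF DERIV_mult[OF Ed rd] DERIV_cdivide[OF DERIV_mult[OF DERIV_mult[OF A zd] Ed]]] DERIV_cdivide[OF DERIV_mult[OF A Fd]]])
      (simp add: E_def F_def)
  have eq: "(b * E / y * y' * r t + r' * E) + ((\<kappa> * (lam * a1) * z t + \<kappa> * (A t * g) * A t) * E + b * E / y * y' * (A t * z t)) / (2 * b)
       + (\<kappa> * (lam * a1) * F + E * y' * A t) / 2 = \<kappa> * riccati \<gamma> lam (A t) a1 (z t) (w t) (r t)"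
  proof -
    have wy: "w t = y + z t" by (simp add: y_def)
    \<comment> \<open>Reciprocals become variables subject to \<open>iy * y = 1\<close> and
      \<open>ib * b = 1\<close>, which makes the remaining identity polynomial.\<close>
    define iy where "iy = 1 / y"
    have iy: "iy * y = 1" using y0 by (simp add: iy_def)
    define ib where "ib = 1 / b"
    have ib: "ib * b = 1" using b0 by (simp add: ib_def)
    have d1: "u / y = u * iy" "u / b = u * ib" "u / (2 * b) = u * ib / 2" for u by (simp_all add: iy_def ib_def)
    have L: "(b * E / y * y' * r t + r' * E) + ((\<kappa> * (lam * a1) * z t + \<kappa> * (A t * g) * A t) * E + b * E / y * y' * (A t * z t)) / (2 * b)
       + (\<kappa> * (lam * a1) * F + E * y' * A t) / 2 =
       (b * E * iy * y' * r t + r' * E) + ((\<kappa> * (lam * a1) * z t + \<kappa> * (A t * g) * A t) * E + b * E * iy * y' * (A t * z t)) * ib / 2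
       + (\<kappa> * (lam * a1) * F + E * y' * A t) / 2" by (simp only: d1)
    have R: "\<kappa> * riccati \<gamma> lam (A t) a1 (z t) (w t) (r t) =
      \<kappa> * (- (E * ((\<gamma> + 1) / 4 * (r t)\<^sup>2 + A t * (2 * b * g * iy + c / 2 * z t) * r t))
       + a1 * (g * E + lam * (z t * E * ib / 2 + F / 2)) + (A t)\<^sup>2 * (g * E * (ib / 2 - z t * iy - 1)))"
      unfolding riccati_def Let_def E_def[symmetric] F_def[symmetric] g_def[symmetric] y_def[symmetric] b_def[symmetric] c4 d1 by (simp add: E_def F_def y_def)
    have y'r: "iy * y' = \<kappa> * (- (2 * (A t * g)) * iy - c * s)"
    proof -
      have "iy * y' = \<kappa> * (- (2 * (A t * g)) * iy - c * s * (iy * y))" by (simp only: y'_def algebra_simps)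
      then show ?thesis by (simp only: iy mult_1_right)
    qed
    have b1: "b * E * iy * y' * r t = b * E * (iy * y') * r t"
      "b * E * iy * y' * (A t * z t) * ib = (ib * b) * E * (iy * y') * (A t * z t)" by (simp_all only: ac_simps)
    show ?thesis unfolding L R
      unfolding distrib_right[of _ _ ib] unfolding b1 unfolding y'r ib unfolding r'_def y'_def wy power2_eq_square
      by (simp add: field_simps)
  qed
  have "((\<lambda>t. Phi \<gamma> (A t) (z t) (w t) (r t)) has_real_derivative
      (b * E / y * y' * r t + r' * E) + ((\<kappa> * (lam * a1) * z t + \<kappa> * (A t * g) * A t) * E + b * E / y * y' * (A t * z t)) / (2 * b)
       + (\<kappa> * (lam * a1) * F + E * y' * A t) / 2) (at t within I)"
    by (rule has_field_derivative_transform_within[OF D zero_less_one tI]) (simp add: Phi_eq[OF ev] b_def)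
  then show ?thesis unfolding eq .
qed

context char_coeffs begin

text \<open>A substitute for differentiating z_x + m1 z_t = k1 a in x, for which second derivatives
  are missing: \<open>p\<close> and \<open>q\<close> are z_t and w_t, and the derivative of z_x
  along the 1-characteristic is drawn from the equation for \<open>ze\<close>. There
  \<open>hco\<close> cancels all derivatives of m2.\<close>

lemma riemann_slope_deriv:
  assumes dm: "m1 (z t) (w t) \<noteq> m2 (z t) (w t)"
    and ze: "(ze has_real_derivative \<xi> * zrate (A t) (z t) (w t) (ze t) om) (at t within I)"
    and A: "(A has_real_derivative \<xi> * a1) (at t within I)"
    and M1: "((\<lambda>t. m1 (z t) (w t)) has_real_derivative m1z (z t) (w t) * (\<xi> * (k1 (z t) (w t) * A t))
       + m1w (z t) (w t) * (\<xi> * (k2 (z t) (w t) * A t + om))) (at t within I)"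
    and M2: "((\<lambda>t. m2 (z t) (w t)) has_real_derivative m2z (z t) (w t) * (\<xi> * (k1 (z t) (w t) * A t))
       + m2w (z t) (w t) * (\<xi> * (k2 (z t) (w t) * A t + om))) (at t within I)"
    and K1: "((\<lambda>t. k1 (z t) (w t)) has_real_derivative k1z (z t) (w t) * (\<xi> * (k1 (z t) (w t) * A t))
       + k1w (z t) (w t) * (\<xi> * (k2 (z t) (w t) * A t + om))) (at t within I)"
  defines "p \<equiv> \<lambda>t. ze t / (m2 (z t) (w t) - m1 (z t) (w t))" and "q \<equiv> om / (m1 (z t) (w t) - m2 (z t) (w t))"
  shows "((\<lambda>t. k1 (z t) (w t) * A t - m1 (z t) (w t) * p t) has_real_derivative
     \<xi> * (k1 (z t) (w t) * a1 + (k1 (z t) (w t) * A t - m1 (z t) (w t) * p t) * (A t * k1z (z t) (w t) - p t * m1z (z t) (w t))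
       + (k2 (z t) (w t) * A t - m2 (z t) (w t) * q) * (A t * k1w (z t) (w t) - p t * m1w (z t) (w t)))) (at t within I)"
proof -
  define \<delta> where "\<delta> = m2 (z t) (w t) - m1 (z t) (w t)"
  define P where "P = p t"
  have d0: "\<delta> \<noteq> 0" using dm by (simp add: \<delta>_def)
  have ze_eq: "ze t = \<delta> * P" using d0 by (simp add: P_def p_def \<delta>_def)
  have om_eq: "om = - \<delta> * q" using d0 by (simp add: q_def \<delta>_def field_simps)
  define m1' m2' where "m1' = m1z (z t) (w t) * (\<xi> * (k1 (z t) (w t) * A t)) + m1w (z t) (w t) * (\<xi> * (k2 (z t) (w t) * A t + om))"
    and "m2' = m2z (z t) (w t) * (\<xi> * (k1 (z t) (w t) * A t)) + m2w (z t) (w t) * (\<xi> * (k2 (z t) (w t) * A t + om))"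
  have h: "ze t * hco (A t) (z t) (w t) (ze t) om = - P * (A t * (k1 (z t) (w t) * (m2z (z t) (w t) - m1z (z t) (w t)) + k2 (z t) (w t) * (m2w (z t) (w t) - m1w (z t) (w t)))
     + m2w (z t) (w t) * om - m1z (z t) (w t) * ze t)"
  proof -
    have "m1 (z t) (w t) - m2 (z t) (w t) = - \<delta>" by (simp add: \<delta>_def)
    then show ?thesis using d0 unfolding hco_def by (simp add: ze_eq)
  qed
  have key: "\<xi> * zrate (A t) (z t) (w t) (ze t) om - P * (m2' - m1')
    = \<delta> * (\<xi> * (A t * (k1z (z t) (w t) * P + k1w (z t) (w t) * q) - P * (m1w (z t) (w t) * q + m1z (z t) (w t) * P)))"
    unfolding zrate_def h unfolding m1'_def m2'_def ze_eq om_eq by (simp add: algebra_simps)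
  have pd: "(p has_real_derivative \<xi> * (A t * (k1z (z t) (w t) * P + k1w (z t) (w t) * q) - P * (m1w (z t) (w t) * q + m1z (z t) (w t) * P))) (at t within I)"
  proof -
    have "(p has_real_derivative (\<xi> * zrate (A t) (z t) (w t) (ze t) om * \<delta> - ze t * (m2' - m1')) / (\<delta> * \<delta>)) (at t within I)"
      unfolding p_def \<delta>_def m1'_def m2'_def
      by (rule DERIV_divide[OF ze DERIV_diff[OF M2 M1]]) (use d0 in \<open>simp add: \<delta>_def\<close>)
    moreover have "(\<xi> * zrate (A t) (z t) (w t) (ze t) om * \<delta> - ze t * (m2' - m1')) / (\<delta> * \<delta>) = (\<xi> * zrate (A t) (z t) (w t) (ze t) om - P * (m2' - m1')) / \<delta>"
      unfolding ze_eq using d0 by (simp add: field_simps)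
    ultimately show ?thesis unfolding key using d0 by simp
  qed
  show ?thesis
    by (rule DERIV_cong[OF DERIV_diff[OF DERIV_mult[OF K1 A] DERIV_mult[OF M1 pd]]])
      (unfold P_def[symmetric], unfold om_eq \<delta>_def, simp add: algebra_simps)
qed

end

lemma continuous_bound:
  fixes f :: "'a :: topological_space \<Rightarrow> real"
  assumes "compact S" "continuous_on S f"
  shows "\<exists>B>0. \<forall>p\<in>S. \<bar>f p\<bar> \<le> B"
proof -
  have "bounded (f ` S)" using assms by (intro compact_imp_bounded compact_continuous_image)
  then obtain B where "B > 0" "\<forall>v\<in>f ` S. norm v \<le> B" unfolding bounded_pos by auto
  then show ?thesis by auto
qed

text \<open>Since \<open>e \<ge> 1 / 2\<close>, the linear term is absorbed by the quadratic one,
  whose good sign leaves an upper bound free of \<open>r\<close>. From below r^2 is paid for by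
  \<phi>^2 and a^2, because \<open>r\<close> is recovered from \<open>\<phi>\<close> on dividing by
  \<open>E \<ge> E0\<close>.\<close>

lemma riccati_form_bounds:
  fixes e E E0 E1 b1 b2 b3 b4 B c r a a1 \<phi> :: real
  assumes e: "1 / 2 \<le> e" "e \<le> 1" and E: "E0 > 0" "E0 \<le> E" "E \<le> E1"
    and b: "\<bar>b1\<bar> \<le> B" "\<bar>b2\<bar> \<le> B" "\<bar>b3\<bar> \<le> B" "\<bar>b4\<bar> \<le> B"
    and \<phi>: "\<phi> = E * r + a * b4"
  shows "- (E * (e * r\<^sup>2 + a * b1 * r)) + a1 * b2 + a\<^sup>2 * b3 \<le> (E1 * B\<^sup>2 + B) * (a\<^sup>2 + \<bar>a1\<bar>)"
    and "- ((4 * E1 / E0\<^sup>2) * (\<phi>\<^sup>2 + a\<^sup>2 * B\<^sup>2) + (E1 * B\<^sup>2 + B) * (a\<^sup>2 + \<bar>a1\<bar>)) \<le> - (E * (e * r\<^sup>2 + a * b1 * r)) + a1 * b2 + a\<^sup>2 * b3"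
    and "\<bar>r\<bar> \<le> (\<bar>\<phi>\<bar> + \<bar>a\<bar> * B) / E0"
proof -
  have B: "B \<ge> 0" "E1 \<ge> 0" using b E by linarith+
  have 1: "a1 * b2 \<le> B * \<bar>a1\<bar>" "- (B * \<bar>a1\<bar>) \<le> a1 * b2"
  proof -
    have "\<bar>a1 * b2\<bar> \<le> B * \<bar>a1\<bar>"
      using mult_right_mono[OF b(2), of "\<bar>a1\<bar>"] by (simp add: abs_mult mult.commute)
    then show "a1 * b2 \<le> B * \<bar>a1\<bar>" "- (B * \<bar>a1\<bar>) \<le> a1 * b2" by linarith+
  qed
  have 3: "a\<^sup>2 * b3 \<le> B * a\<^sup>2" "- (B * a\<^sup>2) \<le> a\<^sup>2 * b3"
    using mult_left_mono[of b3 B "a\<^sup>2"] mult_left_mono[of "-B" b3 "a\<^sup>2"] b(3) by (auto simp: mult.commute)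
  have b1s: "(a * b1)\<^sup>2 \<le> B\<^sup>2 * a\<^sup>2"
    using power_mono[OF b(1), of 2] mult_left_mono[of "b1\<^sup>2" "B\<^sup>2" "a\<^sup>2"] by (simp add: power_mult_distrib mult.commute)
  have q1: "- (e * r\<^sup>2 + a * b1 * r) \<le> B\<^sup>2 * a\<^sup>2"
  proof -
    have "0 \<le> (r / 2 + a * b1)\<^sup>2" by simp
    then have "- (a * b1 * r) \<le> r\<^sup>2 / 4 + (a * b1)\<^sup>2" by (simp add: power2_eq_square algebra_simps)
    moreover have "e * r\<^sup>2 \<ge> 1 / 2 * r\<^sup>2" by (rule mult_right_mono) (use e in auto)
    moreover have "r\<^sup>2 \<ge> 0" by simp
    ultimately show ?thesis using b1s by linarith
  qed
  have q2: "e * r\<^sup>2 + a * b1 * r \<le> 2 * r\<^sup>2 + B\<^sup>2 * a\<^sup>2"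
  proof -
    have "0 \<le> (r / 2 - a * b1)\<^sup>2" by simp
    then have "a * b1 * r \<le> r\<^sup>2 / 4 + (a * b1)\<^sup>2" by (simp add: power2_eq_square algebra_simps)
    moreover have "e * r\<^sup>2 \<le> 1 * r\<^sup>2" by (rule mult_right_mono) (use e in auto)
    moreover have "r\<^sup>2 \<ge> 0" by simp
    ultimately show ?thesis using b1s by linarith
  qed
  have "E * - (e * r\<^sup>2 + a * b1 * r) \<le> E * (B\<^sup>2 * a\<^sup>2)" using q1 E by (intro mult_left_mono) auto
  also have "\<dots> \<le> E1 * (B\<^sup>2 * a\<^sup>2)" using E by (intro mult_right_mono) auto
  also have "\<dots> \<le> E1 * B\<^sup>2 * (a\<^sup>2 + \<bar>a1\<bar>)" using B by (simp add: algebra_simps)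
  finally show "- (E * (e * r\<^sup>2 + a * b1 * r)) + a1 * b2 + a\<^sup>2 * b3 \<le> (E1 * B\<^sup>2 + B) * (a\<^sup>2 + \<bar>a1\<bar>)"
    using 1 3 by (simp add: algebra_simps)
  have Er: "E * r = \<phi> - a * b4" using \<phi> by simp
  have b4: "\<bar>a * b4\<bar> \<le> \<bar>a\<bar> * B" using mult_left_mono[OF b(4), of "\<bar>a\<bar>"] by (simp add: abs_mult)
  have "E0 * \<bar>r\<bar> \<le> E * \<bar>r\<bar>" using E by (intro mult_right_mono) auto
  also have "\<dots> = \<bar>\<phi> - a * b4\<bar>" using E by (simp add: Er[symmetric] abs_mult)
  also have "\<dots> \<le> \<bar>\<phi>\<bar> + \<bar>a\<bar> * B" using b4 by linarith
  finally have rE: "E0 * \<bar>r\<bar> \<le> \<bar>\<phi>\<bar> + \<bar>a\<bar> * B" .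
  then show "\<bar>r\<bar> \<le> (\<bar>\<phi>\<bar> + \<bar>a\<bar> * B) / E0" using E by (simp add: field_simps)
  have "(E0 * \<bar>r\<bar>)\<^sup>2 \<le> (\<bar>\<phi>\<bar> + \<bar>a\<bar> * B)\<^sup>2" using rE E by (intro power_mono) auto
  also have "\<dots> \<le> 2 * (\<phi>\<^sup>2 + a\<^sup>2 * B\<^sup>2)"
    using sum_squares_bound[of "\<bar>\<phi>\<bar>" "\<bar>a\<bar> * B"] by (simp add: power2_sum power_mult_distrib algebra_simps)
  finally have r2: "2 * r\<^sup>2 \<le> 4 / E0\<^sup>2 * (\<phi>\<^sup>2 + a\<^sup>2 * B\<^sup>2)" using E by (simp add: power_mult_distrib field_simps)
  have "E * (e * r\<^sup>2 + a * b1 * r) \<le> E * (2 * r\<^sup>2 + B\<^sup>2 * a\<^sup>2)" using q2 E by (intro mult_left_mono) auto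
  also have "\<dots> \<le> E1 * (2 * r\<^sup>2 + B\<^sup>2 * a\<^sup>2)" using E by (intro mult_right_mono) auto
  also have "\<dots> \<le> E1 * (4 / E0\<^sup>2 * (\<phi>\<^sup>2 + a\<^sup>2 * B\<^sup>2) + B\<^sup>2 * a\<^sup>2)" using B r2 by (intro mult_left_mono) auto
  also have "\<dots> \<le> (4 * E1 / E0\<^sup>2) * (\<phi>\<^sup>2 + a\<^sup>2 * B\<^sup>2) + E1 * B\<^sup>2 * (a\<^sup>2 + \<bar>a1\<bar>)" using B by (simp add: algebra_simps)
  finally show "- ((4 * E1 / E0\<^sup>2) * (\<phi>\<^sup>2 + a\<^sup>2 * B\<^sup>2) + (E1 * B\<^sup>2 + B) * (a\<^sup>2 + \<bar>a1\<bar>)) \<le> - (E * (e * r\<^sup>2 + a * b1 * r)) + a1 * b2 + a\<^sup>2 * b3"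
    using 1 3 by (simp add: algebra_simps)
qed

text \<open>z, w and the speed range over a compact set where w - z stays away from 0, so all
  coefficients and the reciprocal of \<open>Ephi\<close> are bounded. The constant depends on
  neither \<open>a\<close> nor M, hence is available before M is chosen.\<close>

lemma riccati_bounds:
  assumes \<gamma>: "1 < \<gamma>" "\<gamma> \<le> 5 / 3" and y0: "y0 > 0"
  obtains C where "C > 0"
    "\<And>lam a a1 z w r. \<bar>lam\<bar> \<le> R \<Longrightarrow> \<bar>z\<bar> \<le> R \<Longrightarrow> \<bar>w\<bar> \<le> R \<Longrightarrow> y0 \<le> w - z \<Longrightarrow>
       riccati \<gamma> lam a a1 z w r \<le> C * (a\<^sup>2 + \<bar>a1\<bar>) \<and>
       - C * ((Phi \<gamma> a z w r)\<^sup>2 + a\<^sup>2 + \<bar>a1\<bar>) \<le> riccati \<gamma> lam a a1 z w r \<and>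
       \<bar>r\<bar> \<le> C * (\<bar>Phi \<gamma> a z w r\<bar> + \<bar>a\<bar>)"
proof -
  define S where "S = {(lam, z, w). \<bar>lam\<bar> \<le> R \<and> \<bar>z\<bar> \<le> R \<and> \<bar>w\<bar> \<le> R \<and> y0 \<le> w - z}"
  have S: "compact S"
  proof -
    have "S = ({-R..R} \<times> {-R..R} \<times> {-R..R}) \<inter> {p. y0 \<le> snd (snd p) - fst (snd p)}"
      by (auto simp: S_def abs_le_iff)
    moreover have "closed {p :: real \<times> real \<times> real. y0 \<le> snd (snd p) - fst (snd p)}"
      by (intro closed_Collect_le continuous_intros)
    ultimately show ?thesis by (simp add: compact_Int_closed compact_Times)
  qed
  have pos: "snd (snd p) - fst (snd p) > 0" if "p \<in> S" for p using that y0 by (auto simp: S_def)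
  have b0: "beta \<gamma> \<noteq> 0" using beta_neg[OF \<gamma>] by simp
  have cE: "continuous_on S (\<lambda>p. Ephi \<gamma> (snd (snd p) - fst (snd p)))"
    unfolding Ephi_def by (intro continuous_intros) (use pos in force)
  have cF: "continuous_on S (\<lambda>p. Fphi \<gamma> (snd (snd p) - fst (snd p)))"
  proof (cases "beta \<gamma> = -1")
    case True
    have "continuous_on S (\<lambda>p. ln (snd (snd p) - fst (snd p)))"
      by (intro continuous_intros) (use pos in force)
    then show ?thesis unfolding Fphi_def using True by simp
  next
    case False
    moreover from False have "beta \<gamma> + 1 \<noteq> 0" by auto
    moreover have "continuous_on S (\<lambda>p. (snd (snd p) - fst (snd p)) powr (beta \<gamma> + 1))"
      by (intro continuous_intros) (use pos in force)
    ultimately show ?thesis unfolding Fphi_def by (auto intro!: continuous_intros)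
  qed
  define g where "g = (\<lambda>p :: real \<times> real \<times> real. (\<gamma> - 1) / 8 * ((snd (snd p))\<^sup>2 - (fst (snd p))\<^sup>2))"
  have cg: "continuous_on S g" unfolding g_def by (intro continuous_intros)
  define f1 where "f1 = (\<lambda>p :: real \<times> real \<times> real. 2 * beta \<gamma> * g p / (snd (snd p) - fst (snd p)) + (\<gamma> - 1) / 4 * fst (snd p))"
  define f2 where "f2 = (\<lambda>p :: real \<times> real \<times> real. g p * Ephi \<gamma> (snd (snd p) - fst (snd p)) + fst p * (fst (snd p) * Ephi \<gamma> (snd (snd p) - fst (snd p)) / (2 * beta \<gamma>) + Fphi \<gamma> (snd (snd p) - fst (snd p)) / 2))"
  define f3 where "f3 = (\<lambda>p :: real \<times> real \<times> real. g p * Ephi \<gamma> (snd (snd p) - fst (snd p)) * (1 / (2 * beta \<gamma>) - fst (snd p) / (snd (snd p) - fst (snd p)) - 1))"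
  define f4 where "f4 = (\<lambda>p :: real \<times> real \<times> real. fst (snd p) * Ephi \<gamma> (snd (snd p) - fst (snd p)) / (2 * beta \<gamma>) + Fphi \<gamma> (snd (snd p) - fst (snd p)) / 2)"
  have c1: "continuous_on S f1" unfolding f1_def by (intro continuous_intros cg) (use pos in force)+
  have c2: "continuous_on S f2" unfolding f2_def by (intro continuous_intros cg cE cF) (use b0 in force)+
  have c3: "continuous_on S f3" unfolding f3_def by (intro continuous_intros cg cE) (use pos b0 in force)+
  have c4: "continuous_on S f4" unfolding f4_def by (intro continuous_intros cE cF) (use b0 in force)+
  obtain B1 where B1: "B1 > 0" "\<forall>p\<in>S. \<bar>f1 p\<bar> \<le> B1" using continuous_bound[OF S c1] by (elim exE conjE)
  obtain B2 where B2: "B2 > 0" "\<forall>p\<in>S. \<bar>f2 p\<bar> \<le> B2" using continuous_bound[OF S c2] by (elim exE conjE)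
  obtain B3 where B3: "B3 > 0" "\<forall>p\<in>S. \<bar>f3 p\<bar> \<le> B3" using continuous_bound[OF S c3] by (elim exE conjE)
  obtain B4 where B4: "B4 > 0" "\<forall>p\<in>S. \<bar>f4 p\<bar> \<le> B4" using continuous_bound[OF S c4] by (elim exE conjE)
  obtain E1 where E1: "E1 > 0" "\<forall>p\<in>S. \<bar>Ephi \<gamma> (snd (snd p) - fst (snd p))\<bar> \<le> E1" using continuous_bound[OF S cE] by (elim exE conjE)
  have cE': "continuous_on S (\<lambda>p. 1 / Ephi \<gamma> (snd (snd p) - fst (snd p)))"
    by (intro continuous_intros cE) (use pos in \<open>force simp: Ephi_def\<close>)
  obtain E2 where E2: "E2 > 0" "\<forall>p\<in>S. \<bar>1 / Ephi \<gamma> (snd (snd p) - fst (snd p))\<bar> \<le> E2"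
    using continuous_bound[OF S cE'] by (elim exE conjE)
  define E0 where "E0 = 1 / E2"
  define B where "B = max (max B1 B2) (max B3 B4)"
  have E0: "E0 > 0" using E2 by (simp add: E0_def)
  define D where "D = 4 * E1 / E0\<^sup>2"
  define C where "C = D + D * B\<^sup>2 + (E1 * B\<^sup>2 + B) + (1 + B) / E0"
  have B0: "B > 0" using B1(1) by (simp add: B_def)
  have D0: "D > 0" using E0 E1 by (simp add: D_def)
  have nn: "D * B\<^sup>2 \<ge> 0" "E1 * B\<^sup>2 + B > 0" "(1 + B) / E0 > 0" "1 / E0 > 0"
    using B0 D0 E0 E1 by (simp_all add: add_nonneg_pos)
  show ?thesis
  proof (rule that[of C])
    show "C > 0" using D0 nn unfolding C_def by linarith
    fix lam a a1 z w r assume h: "\<bar>lam\<bar> \<le> R" "\<bar>z\<bar> \<le> R" "\<bar>w\<bar> \<le> R" "y0 \<le> w - z"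
    define p where "p = (lam, z, w)"
    have p: "p \<in> S" using h by (simp add: p_def S_def)
    define \<phi> where "\<phi> = Phi \<gamma> a z w r"
    have ph: "\<phi> = Ephi \<gamma> (w - z) * r + a * f4 p" 
      using h y0 by (simp add: \<phi>_def Phi_eq f4_def p_def algebra_simps)
    have ric: "riccati \<gamma> lam a a1 z w r = - (Ephi \<gamma> (w - z) * ((\<gamma> + 1) / 4 * r\<^sup>2 + a * f1 p * r)) + a1 * f2 p + a\<^sup>2 * f3 p"
      by (simp add: riccati_def Let_def f1_def f2_def f3_def p_def g_def)
    have E: "E0 \<le> Ephi \<gamma> (w - z)" "Ephi \<gamma> (w - z) \<le> E1"
    proof -
      have "Ephi \<gamma> (w - z) > 0" using h y0 by (simp add: Ephi_def)
      then show "E0 \<le> Ephi \<gamma> (w - z)" using E2(2)[rule_format, OF p] E2(1) by (simp add: E0_def p_def field_simps)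
      show "Ephi \<gamma> (w - z) \<le> E1" using E1(2)[rule_format, OF p] by (simp add: p_def)
    qed
    have e: "1 / 2 \<le> (\<gamma> + 1) / 4" "(\<gamma> + 1) / 4 \<le> 1" using \<gamma> by auto
    have b: "\<bar>f1 p\<bar> \<le> B" "\<bar>f2 p\<bar> \<le> B" "\<bar>f3 p\<bar> \<le> B" "\<bar>f4 p\<bar> \<le> B"
      using B1(2)[rule_format, OF p] B2(2)[rule_format, OF p] B3(2)[rule_format, OF p] B4(2)[rule_format, OF p] by (auto simp: B_def)
    note main = riccati_form_bounds(1,2)[OF e E0 E b ph, of a1, folded ric D_def] riccati_form_bounds(3)[OF e E0 E b ph]
    have C1: "E1 * B\<^sup>2 + B \<le> C" using D0 nn unfolding C_def by linarith
    have "riccati \<gamma> lam a a1 z w r \<le> C * (a\<^sup>2 + \<bar>a1\<bar>)"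
      using main(1) mult_right_mono[OF C1, of "a\<^sup>2 + \<bar>a1\<bar>"] by simp
    moreover have "- C * (\<phi>\<^sup>2 + a\<^sup>2 + \<bar>a1\<bar>) \<le> riccati \<gamma> lam a a1 z w r"
    proof -
      have "D * (\<phi>\<^sup>2 + a\<^sup>2 * B\<^sup>2) + (E1 * B\<^sup>2 + B) * (a\<^sup>2 + \<bar>a1\<bar>) = D * \<phi>\<^sup>2 + (D * B\<^sup>2 + (E1 * B\<^sup>2 + B)) * a\<^sup>2 + (E1 * B\<^sup>2 + B) * \<bar>a1\<bar>"
        by (simp add: algebra_simps)
      also have "\<dots> \<le> C * \<phi>\<^sup>2 + C * a\<^sup>2 + C * \<bar>a1\<bar>"
        by (intro add_mono mult_right_mono) (use D0 nn in \<open>auto simp: C_def\<close>)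
      finally show ?thesis using main(2) by (simp add: algebra_simps)
    qed
    moreover have CE: "1 / E0 \<le> C" "B / E0 \<le> C"
    proof -
      have "(1 + B) / E0 = 1 / E0 + B / E0" "B / E0 > 0" using E0 B0 by (simp_all add: add_divide_distrib)
      then show "1 / E0 \<le> C" "B / E0 \<le> C" using D0 nn unfolding C_def by linarith+
    qed
    moreover have "\<bar>r\<bar> \<le> C * (\<bar>\<phi>\<bar> + \<bar>a\<bar>)"
    proof -
      have "(\<bar>\<phi>\<bar> + \<bar>a\<bar> * B) / E0 = 1 / E0 * \<bar>\<phi>\<bar> + B / E0 * \<bar>a\<bar>" by (simp add: add_divide_distrib mult.commute)
      also have "\<dots> \<le> C * \<bar>\<phi>\<bar> + C * \<bar>a\<bar>"
        by (intro add_mono mult_right_mono CE) auto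
      finally show ?thesis using main(3) by (simp add: algebra_simps)
    qed
    ultimately show "riccati \<gamma> lam a a1 z w r \<le> C * (a\<^sup>2 + \<bar>a1\<bar>) \<and>
       - C * ((Phi \<gamma> a z w r)\<^sup>2 + a\<^sup>2 + \<bar>a1\<bar>) \<le> riccati \<gamma> lam a a1 z w r \<and>
       \<bar>r\<bar> \<le> C * (\<bar>Phi \<gamma> a z w r\<bar> + \<bar>a\<bar>)" by (simp add: \<phi>_def)
  qed
qed

section \<open>Barriers\<close>

lemma first_zero:
  fixes f :: "real \<Rightarrow> real"
  assumes cont: "continuous_on {0..l} f" and f0: "f 0 > 0" and s: "s \<in> {0..l}" "f s \<le> 0"
  shows "\<exists>\<tau>\<in>{0<..l}. f \<tau> = 0 \<and> (\<forall>s\<in>{0..<\<tau>}. f s > 0)"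
proof -
  have ivt: "\<exists>u\<in>{0..s}. f u = 0" if "s \<in> {0..l}" "f s \<le> 0" for s
    using IVT2'[of f s 0 0] that f0 continuous_on_subset[OF cont, of "{0..s}"] by auto
  define Z where "Z = {u \<in> {0..l}. f u = 0}"
  have "closed Z" unfolding Z_def by (rule continuous_closed_preimage_constant[OF cont]) auto
  then have "compact ({0..l} \<inter> Z)" by (intro compact_Int_closed compact_Icc)
  moreover have "{0..l} \<inter> Z = Z" by (auto simp: Z_def)
  ultimately have "compact Z" by simp
  moreover obtain u where "u \<in> {0..s}" "f u = 0" using ivt[OF s] by blast
  then have "Z \<noteq> {}" using s(1) by (force simp: Z_def)
  ultimately obtain \<tau> where t: "\<tau> \<in> Z" "\<forall>u\<in>Z. \<tau> \<le> u" using compact_attains_inf[of Z] by blast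
  show ?thesis
  proof (intro bexI[of _ \<tau>] conjI ballI)
    show "\<tau> \<in> {0<..l}" "f \<tau> = 0" using t f0 by (auto simp: Z_def less_le)
    show "f s > 0" if "s \<in> {0..<\<tau>}" for s
    proof (rule ccontr)
      assume "\<not> f s > 0"
      then have "\<exists>u\<in>{0..s}. f u = 0" by (intro ivt) (use that t(1) in \<open>auto simp: Z_def\<close>)
      then obtain u where "u \<in> {0..s}" "f u = 0" by blast
      then show False using t that by (force simp: Z_def)
    qed
  qed
qed

lemma weight_deriv:
  fixes x :: "real \<Rightarrow> real"
  assumes "(x has_real_derivative x') (at s within I)" "x s \<ge> 0" "M > 0" "b \<noteq> 0"
  shows "((\<lambda>s. (1 + M * x s) powr (- b) / (b * M)) has_real_derivative - x' * (1 + M * x s) powr (- b - 1)) (at s within I)"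
proof -
  have p: "1 + M * x s > 0" using assms by (simp add: add_pos_nonneg)
  have "((\<lambda>s. (1 + M * x s) powr (- b)) has_real_derivative - b * (1 + M * x s) powr (- b - 1) * (M * x')) (at s within I)"
    using assms(1) p by (auto intro!: derivative_eq_intros)
  from DERIV_cdivide[OF this, of "b * M"] show ?thesis by (rule DERIV_cong) (use assms in auto)
qed

text \<open>Subtracting \<open>G\<close> times the primitive of the decay weight from
  \<open>f\<close> leaves a nonincreasing function, and the primitive lies between 0 and
  \<open>1 / (b * M)\<close>. All smallness for large M has this origin.\<close>

lemma weighted_drift:
  fixes x f :: "real \<Rightarrow> real"
  assumes l: "l \<ge> 0" and M: "M > 0" and b: "b > 0" and G: "G \<ge> 0"
    and x: "\<And>s. s \<in> {0..l} \<Longrightarrow> x s \<ge> 0"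
      "\<And>s. s \<in> {0..l} \<Longrightarrow> (x has_real_derivative x' s) (at s within {0..l})"
    and f: "\<And>s. s \<in> {0..l} \<Longrightarrow> (f has_real_derivative f' s) (at s within {0..l})"
    and f': "\<And>s. s \<in> {0..l} \<Longrightarrow> f' s \<le> G * (- x' s * (1 + M * x s) powr (- b - 1))"
  shows "f l \<le> f 0 + G / (b * M)"
proof -
  define h where "h = (\<lambda>s. f s - G * ((1 + M * x s) powr (- b) / (b * M)))"
  have "h l \<le> h 0"
  proof (rule nonincreasing_within[OF l])
    show "(h has_real_derivative f' s - G * (- x' s * (1 + M * x s) powr (- b - 1))) (at s within {0..l})" if "s \<in> {0..l}" for s
      unfolding h_def using b by (intro DERIV_diff[OF f[OF that]] DERIV_cmult weight_deriv x M that) auto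
    show "f' s - G * (- x' s * (1 + M * x s) powr (- b - 1)) \<le> 0" if "s \<in> {0..l}" for s
      using f'[OF that] by simp
  qed
  then have "f l \<le> f 0 + G * ((1 + M * x l) powr (- b) / (b * M)) - G * ((1 + M * x 0) powr (- b) / (b * M))"
    by (simp add: h_def)
  moreover have "(1 + M * x l) powr (- b) \<le> 1 powr (- b)"
    by (rule powr_mono2') (use b M x(1)[of l] l in auto)
  then have "G * ((1 + M * x l) powr (- b) / (b * M)) \<le> G * (1 / (b * M))"
    using b M G by (intro mult_left_mono divide_right_mono) auto
  moreover have "G * ((1 + M * x 0) powr (- b) / (b * M)) \<ge> 0" using b M G by simp
  ultimately show ?thesis by simp
qed

text \<open>\<open>\<kappa>\<close> is the rate of time along the curve, at most
  \<open>- x' / lm\<close> when speeds are at least \<open>lm\<close>. The upper bound is the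
  integrated forcing. The lower barrier is twice the initial bound, so \<open>\<phi>\<close> starts
  strictly above it; as x decreases the barrier descends at a rate proportional to M, which by
  \<open>large\<close> beats the quadratic term and the forcing at a first contact.\<close>

lemma riccati_barrier:
  fixes x x' \<kappa> Rr \<phi> :: "real \<Rightarrow> real"
  assumes l: "l \<ge> 0" and M: "M > 0" and \<alpha>: "\<alpha> > 0" and C: "C \<ge> 0" "k \<ge> 0" and lm: "lm > 0" and \<delta>: "\<delta> > 0"
    and x: "\<And>s. s \<in> {0..l} \<Longrightarrow> x s \<ge> 0" "\<And>s. s \<in> {0..l} \<Longrightarrow> x' s < 0"
      "\<And>s. s \<in> {0..l} \<Longrightarrow> (x has_real_derivative x' s) (at s within {0..l})"
    and \<phi>: "\<And>s. s \<in> {0..l} \<Longrightarrow> (\<phi> has_real_derivative \<kappa> s * Rr s) (at s within {0..l})"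
    and \<kappa>: "\<And>s. s \<in> {0..l} \<Longrightarrow> 0 \<le> \<kappa> s \<and> \<kappa> s \<le> - x' s / lm"
    and Rr: "\<And>s. s \<in> {0..l} \<Longrightarrow> Rr s \<le> C * (k * (1 + M * x s) powr (- 2 - \<alpha>))"
      "\<And>s. s \<in> {0..l} \<Longrightarrow> - C * ((\<phi> s)\<^sup>2 + k * (1 + M * x s) powr (- 2 - \<alpha>)) \<le> Rr s"
    and \<phi>0: "- \<delta> * (1 + M * x 0) powr (- 1 - \<alpha>) \<le> \<phi> 0"
    and large: "C * (4 * \<delta>\<^sup>2 + k) / lm < 2 * \<delta> * ((1 + \<alpha>) * M)"
  shows "- 2 * \<delta> \<le> \<phi> l" and "\<phi> l \<le> \<phi> 0 + C * k / lm / ((1 + \<alpha>) * M)"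
proof -
  have eq: "- 1 - \<alpha> = - (1 + \<alpha>)" "- 2 - \<alpha> = - (1 + \<alpha>) - 1" by auto
  have p1: "1 \<le> 1 + M * x s" if "s \<in> {0..l}" for s using M x(1)[OF that] by simp
  have \<kappa>P: "\<kappa> s * c \<le> - x' s / lm * c" if "s \<in> {0..l}" "c \<ge> 0" for s c
    using \<kappa>[OF that(1)] that(2) by (intro mult_right_mono) auto
  show "\<phi> l \<le> \<phi> 0 + C * k / lm / ((1 + \<alpha>) * M)"
  proof (rule weighted_drift[OF l M _ _ x(1) x(3) \<phi>])
    show "0 < 1 + \<alpha>" "0 \<le> C * k / lm" using \<alpha> C lm by auto
    fix s assume s: "s \<in> {0..l}"
    have "\<kappa> s * Rr s \<le> \<kappa> s * (C * (k * (1 + M * x s) powr (- 2 - \<alpha>)))"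
      using Rr(1)[OF s] \<kappa>[OF s] by (intro mult_left_mono) auto
    also have "\<dots> \<le> - x' s / lm * (C * (k * (1 + M * x s) powr (- 2 - \<alpha>)))"
      by (rule \<kappa>P[OF s]) (use C in auto)
    finally show "\<kappa> s * Rr s \<le> C * k / lm * (- x' s * (1 + M * x s) powr (- (1 + \<alpha>) - 1))"
      unfolding eq by (simp add: algebra_simps)
  qed
  define B where "B = (\<lambda>s. (1 + M * x s) powr (- (1 + \<alpha>)))"
  define f where "f = (\<lambda>s. \<phi> s + 2 * \<delta> * B s)"
  define N where "N = (1 + \<alpha>) * M"
  have N: "N > 0" using \<alpha> M by (simp add: N_def)
  have fd: "(f has_real_derivative \<kappa> s * Rr s + 2 * \<delta> * N * (- x' s * (1 + M * x s) powr (- 2 - \<alpha>))) (at s within {0..l})"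
    if s: "s \<in> {0..l}" for s
  proof -
    have "f = (\<lambda>s. \<phi> s + 2 * \<delta> * N * ((1 + M * x s) powr (- (1 + \<alpha>)) / ((1 + \<alpha>) * M)))"
      using \<alpha> M by (simp add: f_def B_def N_def mult.assoc)
    then show ?thesis unfolding eq
      using \<alpha> by (simp only:) (intro DERIV_add[OF \<phi>[OF s]] DERIV_cmult weight_deriv x M s, simp)
  qed
  have fpos: "f s > 0" if s: "s \<in> {0..l}" for s
  proof (rule ccontr)
    assume "\<not> f s > 0"
    then have "f s \<le> 0" by simp
    moreover have "f 0 > 0"
    proof -
      have "B 0 > 0" using p1[of 0] l by (simp add: B_def)
      then have "\<delta> * B 0 > 0" using \<delta> by simp
      then show ?thesis using \<phi>0 unfolding f_def eq B_def by linarith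
    qed
    moreover have "continuous_on {0..l} f" unfolding continuous_on_eq_continuous_within
      by (intro ballI DERIV_continuous[OF fd])
    ultimately have "\<exists>\<tau>\<in>{0<..l}. f \<tau> = 0 \<and> (\<forall>s\<in>{0..<\<tau>}. f s > 0)" using s by (intro first_zero)
    then obtain \<tau> where t: "\<tau> \<in> {0<..l}" "f \<tau> = 0" "\<forall>s\<in>{0..<\<tau>}. f s > 0" by blast
    have tI: "\<tau> \<in> {0..l}" using t by auto
    define P where "P = (1 + M * x \<tau>) powr (- 2 - \<alpha>)"
    have P: "P > 0" using p1[OF tI] by (simp add: P_def)
    have "\<phi> \<tau> = - (2 * \<delta> * B \<tau>)" using t(2) by (simp add: f_def)
    then have "(\<phi> \<tau>)\<^sup>2 = 4 * \<delta>\<^sup>2 * (B \<tau> * B \<tau>)" by (simp add: power2_eq_square)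
    also have "B \<tau> * B \<tau> = (1 + M * x \<tau>) powr (- 2 - 2 * \<alpha>)" unfolding B_def powr_add[symmetric] by (simp add: algebra_simps)
    \<comment> \<open>At a contact \<phi>^2 decays even faster than the forcing, so the weight
      \<open>P\<close> of the forcing dominates both.\<close>
    also have "4 * \<delta>\<^sup>2 * \<dots> \<le> 4 * \<delta>\<^sup>2 * P" unfolding P_def
      by (intro mult_left_mono powr_mono) (use p1[OF tI] \<alpha> in auto)
    finally have "C * ((\<phi> \<tau>)\<^sup>2 + k * P) \<le> C * (4 * \<delta>\<^sup>2 * P + k * P)" using C by (intro mult_left_mono) auto
    then have "- (C * (4 * \<delta>\<^sup>2 + k) * P) \<le> Rr \<tau>" using Rr(2)[OF tI] by (simp add: P_def algebra_simps)
    then have "\<kappa> \<tau> * (- (C * (4 * \<delta>\<^sup>2 + k) * P)) \<le> \<kappa> \<tau> * Rr \<tau>" using \<kappa>[OF tI] by (intro mult_left_mono) auto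
    then have "- (\<kappa> \<tau> * (C * (4 * \<delta>\<^sup>2 + k) * P)) \<le> \<kappa> \<tau> * Rr \<tau>" by (simp only: mult_minus_right)
    moreover have "\<kappa> \<tau> * (C * (4 * \<delta>\<^sup>2 + k) * P) \<le> - x' \<tau> / lm * (C * (4 * \<delta>\<^sup>2 + k) * P)"
      by (rule \<kappa>P[OF tI]) (use C P in auto)
    moreover have "- x' \<tau> / lm * (C * (4 * \<delta>\<^sup>2 + k) * P) = (C * (4 * \<delta>\<^sup>2 + k) / lm) * (- x' \<tau> * P)" by simp
    moreover have "(C * (4 * \<delta>\<^sup>2 + k) / lm) * (- x' \<tau> * P) < 2 * \<delta> * N * (- x' \<tau> * P)"
      unfolding N_def by (rule mult_strict_right_mono[OF large]) (use x(2)[OF tI] P in \<open>simp add: mult_neg_pos\<close>)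
    ultimately have "\<kappa> \<tau> * Rr \<tau> + 2 * \<delta> * N * (- x' \<tau> * P) > 0" by linarith
    \<comment> \<open>A positive derivative makes \<open>f\<close> negative just before
      \<open>\<tau>\<close>, against the choice of \<open>\<tau>\<close> as first zero.\<close>
    from has_real_derivative_pos_inc_left[OF fd[OF tI] this[unfolded P_def]]
    obtain d where d: "d > 0" "\<And>h. h > 0 \<Longrightarrow> \<tau> - h \<in> {0..l} \<Longrightarrow> h < d \<Longrightarrow> f (\<tau> - h) < f \<tau>" by blast
    have "f (\<tau> - min (d / 2) \<tau>) < f \<tau>" using d(1) t(1) by (intro d(2)) auto
    moreover have "f (\<tau> - min (d / 2) \<tau>) > 0" using d(1) t(1) by (intro t(3)[rule_format]) auto
    ultimately show False using t(2) by simp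
  qed
  have "B l \<le> 1 powr (- (1 + \<alpha>))" unfolding B_def
    by (rule powr_mono2') (use \<alpha> p1[of l] l in auto)
  then have "2 * \<delta> * B l \<le> 2 * \<delta> * 1" using \<delta> by (intro mult_left_mono) auto
  then show "- 2 * \<delta> \<le> \<phi> l" using fpos[of l] l by (simp add: f_def)
qed

section \<open>The nozzle flow system\<close>

text \<open>A converse of \<open>blip_box\<close>: Lipschitz bounds on the rectangle follow from the
  closure properties of \<open>blip\<close>, applied to the clamped coordinates.\<close>

lemma lip_box_of_blip:
  assumes "blip (\<lambda>s :: real \<times> real. k (clamp_real zl zu (fst s)) (clamp_real wl wu (snd s)))"
  shows "lip_box {zl..zu} {wl..wu} k"
proof -
  obtain L where L: "L \<ge> 0" "\<forall>x y. \<bar>k (clamp_real zl zu (fst x)) (clamp_real wl wu (snd x))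
      - k (clamp_real zl zu (fst y)) (clamp_real wl wu (snd y))\<bar> \<le> L * dist x y"
    using assms unfolding blip_def lipr_def by (elim exE conjE)
  have "\<bar>k z w - k z' w'\<bar> \<le> L * (\<bar>z - z'\<bar> + \<bar>w - w'\<bar>)"
    if "z \<in> {zl..zu}" "w \<in> {wl..wu}" "z' \<in> {zl..zu}" "w' \<in> {wl..wu}" for z w z' w'
  proof -
    have "\<bar>k z w - k z' w'\<bar> \<le> L * dist (z, w) (z', w')"
      using L(2)[rule_format, of "(z, w)" "(z', w')"] that by (simp add: clamp_real_id)
    also have "dist (z, w) (z', w') \<le> \<bar>z - z'\<bar> + \<bar>w - w'\<bar>"
      using sqrt_sum_squares_le_sum_abs[of "z - z'" "w - w'"] by (simp add: dist_Pair_Pair dist_real_def)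
    finally show ?thesis using L(1) mult_left_mono by fastforce
  qed
  then show ?thesis unfolding lip_box_def using L(1) by blast
qed

text \<open>\<open>zu < wl\<close> keeps w - z uniformly positive, that is, excludes vacuum.
  \<open>wu < 0\<close> makes both speeds negative, as they are convex combinations of z and
  w.\<close>

locale nozzle_box =
  fixes \<gamma> zl zu wl wu :: real
  assumes \<gamma>: "1 < \<gamma>" "\<gamma> \<le> 5 / 3"
    and box: "zl \<le> zu" "zu < wl" "wl \<le> wu" "wu < 0"
begin

definition src :: "real \<Rightarrow> real \<Rightarrow> real" where "src z w = (\<gamma> - 1) / 8 * (w\<^sup>2 - z\<^sup>2)"

text \<open>\<open>i1, i2, h1, h2\<close> play the roles of \<open>m1, m2, k1, k2\<close>; a suffix \<open>z\<close> or \<open>w\<close> marks the partial derivative.\<close>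

definition i1 :: "real \<Rightarrow> real \<Rightarrow> real" where "i1 z w = inverse (lambda1 \<gamma> z w)"
definition i2 :: "real \<Rightarrow> real \<Rightarrow> real" where "i2 z w = inverse (lambda2 \<gamma> z w)"

definition "i1z z w = - ((\<gamma> + 1) / 4) * (i1 z w * i1 z w)"
definition "i1w z w = - ((3 - \<gamma>) / 4) * (i1 z w * i1 z w)"
definition "i2z z w = - ((3 - \<gamma>) / 4) * (i2 z w * i2 z w)"
definition "i2w z w = - ((\<gamma> + 1) / 4) * (i2 z w * i2 z w)"

definition "h1 z w = src z w * i1 z w"
definition "h2 z w = - (src z w * i2 z w)"
definition "h1z z w = - ((\<gamma> - 1) / 4) * z * i1 z w + src z w * i1z z w"
definition "h1w z w = (\<gamma> - 1) / 4 * w * i1 z w + src z w * i1w z w"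
definition "h2z z w = - (- ((\<gamma> - 1) / 4) * z * i2 z w + src z w * i2z z w)"
definition "h2w z w = - ((\<gamma> - 1) / 4 * w * i2 z w + src z w * i2w z w)"

lemma lambda_bounds:
  assumes "z \<in> {zl..zu}" "w \<in> {wl..wu}"
  shows "zl \<le> lambda1 \<gamma> z w" "lambda1 \<gamma> z w \<le> wu" "zl \<le> lambda2 \<gamma> z w" "lambda2 \<gamma> z w \<le> wu"
proof -
  have e: "0 \<le> (\<gamma> + 1) / 4" "0 \<le> (3 - \<gamma>) / 4" using \<gamma> by (auto simp: field_simps)
  have "(\<gamma> + 1) / 4 * zl + (3 - \<gamma>) / 4 * zl = zl" "(3 - \<gamma>) / 4 * zl + (\<gamma> + 1) / 4 * zl = zl"
    "(\<gamma> + 1) / 4 * wu + (3 - \<gamma>) / 4 * wu = wu" "(3 - \<gamma>) / 4 * wu + (\<gamma> + 1) / 4 * wu = wu" by (simp_all add: field_simps)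
  moreover have "v \<le> wu \<Longrightarrow> (\<gamma> + 1) / 4 * v \<le> (\<gamma> + 1) / 4 * wu" "v \<le> wu \<Longrightarrow> (3 - \<gamma>) / 4 * v \<le> (3 - \<gamma>) / 4 * wu"
    "zl \<le> v \<Longrightarrow> (\<gamma> + 1) / 4 * zl \<le> (\<gamma> + 1) / 4 * v" "zl \<le> v \<Longrightarrow> (3 - \<gamma>) / 4 * zl \<le> (3 - \<gamma>) / 4 * v" for v
    using e by (auto intro!: mult_left_mono)
  note mono = this
  have zw: "z \<le> wu" "w \<le> wu" "zl \<le> z" "zl \<le> w" using assms box by auto
  show "zl \<le> lambda1 \<gamma> z w" unfolding lambda1_def using mono(3)[OF zw(3)] mono(4)[OF zw(4)] calculation(1) by linarith
  show "lambda1 \<gamma> z w \<le> wu" unfolding lambda1_def using mono(1)[OF zw(1)] mono(2)[OF zw(2)] calculation(3) by linarith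
  show "zl \<le> lambda2 \<gamma> z w" unfolding lambda2_def using mono(4)[OF zw(3)] mono(3)[OF zw(4)] calculation(2) by linarith
  show "lambda2 \<gamma> z w \<le> wu" unfolding lambda2_def using mono(2)[OF zw(1)] mono(1)[OF zw(2)] calculation(4) by linarith
qed

lemma lambda_diff: "lambda2 \<gamma> z w - lambda1 \<gamma> z w = (\<gamma> - 1) / 2 * (w - z)"
  by (simp add: lambda1_def lambda2_def field_simps)

lemma lambda_neg:
  assumes "z \<in> {zl..zu}" "w \<in> {wl..wu}"
  shows "lambda1 \<gamma> z w < 0" "lambda2 \<gamma> z w < 0"
  using lambda_bounds[OF assms] box by auto

lemma cont_i:
  shows "continuous_on ({zl..zu} \<times> {wl..wu}) (\<lambda>x. i1 (fst x) (snd x))"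
    "continuous_on ({zl..zu} \<times> {wl..wu}) (\<lambda>x. i2 (fst x) (snd x))"
    "continuous_on ({zl..zu} \<times> {wl..wu}) (\<lambda>x. src (fst x) (snd x))"
proof -
  have "continuous_on ({zl..zu} \<times> {wl..wu}) (\<lambda>x. lambda1 \<gamma> (fst x) (snd x))"
    "continuous_on ({zl..zu} \<times> {wl..wu}) (\<lambda>x. lambda2 \<gamma> (fst x) (snd x))"
    unfolding lambda1_def lambda2_def by (intro continuous_intros)+
  then show "continuous_on ({zl..zu} \<times> {wl..wu}) (\<lambda>x. i1 (fst x) (snd x))"
    "continuous_on ({zl..zu} \<times> {wl..wu}) (\<lambda>x. i2 (fst x) (snd x))"
    unfolding i1_def i2_def by (intro continuous_on_inverse; use lambda_neg in force)+
  show "continuous_on ({zl..zu} \<times> {wl..wu}) (\<lambda>x. src (fst x) (snd x))"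
    unfolding src_def by (intro continuous_intros)
qed

lemma C1_boxes:
  shows "C1_box {zl..zu} {wl..wu} i1 i1z i1w" "C1_box {zl..zu} {wl..wu} i2 i2z i2w"
    "C1_box {zl..zu} {wl..wu} h1 h1z h1w" "C1_box {zl..zu} {wl..wu} h2 h2z h2w"
proof -
  have d1: "((\<lambda>z. i1 z w) has_real_derivative i1z z w) (at z within A)" "((\<lambda>w. i1 z w) has_real_derivative i1w z w) (at w within A)"
    "((\<lambda>z. i2 z w) has_real_derivative i2z z w) (at z within A)" "((\<lambda>w. i2 z w) has_real_derivative i2w z w) (at w within A)"
    if "z \<in> {zl..zu}" "w \<in> {wl..wu}" for z w A
    using lambda_neg[OF that] unfolding i1_def i2_def i1z_def i2z_def i1w_def i2w_def lambda1_def lambda2_def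
    by (auto intro!: derivative_eq_intros)
  have ds: "((\<lambda>z. src z w) has_real_derivative - ((\<gamma> - 1) / 4) * z) (at z within A)"
     "((\<lambda>w. src z w) has_real_derivative (\<gamma> - 1) / 4 * w) (at w within A)" for z w A
    unfolding src_def by (auto intro!: derivative_eq_intros simp: field_simps)
  have d2: "((\<lambda>z. h1 z w) has_real_derivative h1z z w) (at z within A)" "((\<lambda>w. h1 z w) has_real_derivative h1w z w) (at w within A)"
    "((\<lambda>z. h2 z w) has_real_derivative h2z z w) (at z within A)" "((\<lambda>w. h2 z w) has_real_derivative h2w z w) (at w within A)"
    if "z \<in> {zl..zu}" "w \<in> {wl..wu}" for z w A
    unfolding h1_def h2_def h1z_def h2z_def h1w_def h2w_def
    by (rule DERIV_cong[OF DERIV_mult[OF ds(1) d1(1)[OF that]]] DERIV_cong[OF DERIV_mult[OF ds(2) d1(2)[OF that]]]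
        DERIV_cong[OF DERIV_minus[OF DERIV_mult[OF ds(1) d1(3)[OF that]]]] DERIV_cong[OF DERIV_minus[OF DERIV_mult[OF ds(2) d1(4)[OF that]]]],
        simp add: algebra_simps)+
  show "C1_box {zl..zu} {wl..wu} i1 i1z i1w" "C1_box {zl..zu} {wl..wu} i2 i2z i2w"
    "C1_box {zl..zu} {wl..wu} h1 h1z h1w" "C1_box {zl..zu} {wl..wu} h2 h2z h2w"
    unfolding C1_box_def using d1 d2
    by (auto simp: i1z_def i1w_def i2z_def i2w_def h1z_def h1w_def h2z_def h2w_def case_prod_unfold
        intro!: continuous_intros cont_i)
qed

lemma lip_boxes:
  shows "lip_box {zl..zu} {wl..wu} i1" "lip_box {zl..zu} {wl..wu} i2"
      "lip_box {zl..zu} {wl..wu} h1" "lip_box {zl..zu} {wl..wu} h2"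
      "lip_box {zl..zu} {wl..wu} i1z" "lip_box {zl..zu} {wl..wu} i1w"
      "lip_box {zl..zu} {wl..wu} i2z" "lip_box {zl..zu} {wl..wu} i2w"
      "lip_box {zl..zu} {wl..wu} h1z" "lip_box {zl..zu} {wl..wu} h1w"
      "lip_box {zl..zu} {wl..wu} h2z" "lip_box {zl..zu} {wl..wu} h2w"
proof -
  have pr: "lipr (\<lambda>s :: real \<times> real. fst s)" "lipr (\<lambda>s :: real \<times> real. snd s)"
    by (rule lipr_fst[OF lipr_id] lipr_snd[OF lipr_id])+
  define Z W where "Z = (\<lambda>s :: real \<times> real. clamp_real zl zu (fst s))" and "W = (\<lambda>s :: real \<times> real. clamp_real wl wu (snd s))"
  have ZW: "blip Z" "blip W" unfolding Z_def W_def by (rule blip_clamp pr)+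
  have in_box: "Z s \<in> {zl..zu}" "W s \<in> {wl..wu}" for s
    unfolding Z_def W_def using box by (auto intro: clamp_real_in simp del: atLeastAtMost_iff)
  have bi: "blip (\<lambda>s. i1 (Z s) (W s))" "blip (\<lambda>s. i2 (Z s) (W s))"
    unfolding i1_def i2_def
  proof (rule_tac [!] blip_inverse)
    show "blip (\<lambda>s. lambda1 \<gamma> (Z s) (W s))" "blip (\<lambda>s. lambda2 \<gamma> (Z s) (W s))"
      unfolding lambda1_def lambda2_def by (intro blip_add blip_mult blip_const ZW)+
    show "- wu > 0" "- wu > 0" using box by auto
    show "- wu \<le> \<bar>lambda1 \<gamma> (Z s) (W s)\<bar>" "- wu \<le> \<bar>lambda2 \<gamma> (Z s) (W s)\<bar>" for s
      using lambda_bounds[OF in_box, of s s] by auto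
  qed
  have bs: "blip (\<lambda>s. src (Z s) (W s))"
    unfolding src_def power2_eq_square by (intro blip_mult blip_diff blip_const ZW)
  have key: "blip (\<lambda>s. k (Z s) (W s)) \<Longrightarrow> lip_box {zl..zu} {wl..wu} k" for k
    unfolding Z_def W_def by (rule lip_box_of_blip)
  show "lip_box {zl..zu} {wl..wu} i1" "lip_box {zl..zu} {wl..wu} i2"
      "lip_box {zl..zu} {wl..wu} h1" "lip_box {zl..zu} {wl..wu} h2"
      "lip_box {zl..zu} {wl..wu} i1z" "lip_box {zl..zu} {wl..wu} i1w"
      "lip_box {zl..zu} {wl..wu} i2z" "lip_box {zl..zu} {wl..wu} i2w"
      "lip_box {zl..zu} {wl..wu} h1z" "lip_box {zl..zu} {wl..wu} h1w"
      "lip_box {zl..zu} {wl..wu} h2z" "lip_box {zl..zu} {wl..wu} h2w"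
    by (rule key, (unfold h1_def h2_def h1z_def h1w_def h2z_def h2w_def i1z_def i1w_def i2z_def i2w_def)?,
        intro blip_mult blip_add blip_minus blip_diff blip_const ZW bi bs)+
qed

lemma speed_bounds:
  assumes "z \<in> {zl..zu}" "w \<in> {wl..wu}"
  shows "- inverse (- wu) \<le> i2 z w" "i1 z w \<le> - inverse (- zl)" "(\<gamma> - 1) / 2 * (wl - zu) / zl\<^sup>2 \<le> i1 z w - i2 z w"
    "\<bar>i1 z w\<bar> \<le> inverse (- wu)" "\<bar>i2 z w\<bar> \<le> inverse (- wu)"
proof -
  note b = lambda_bounds[OF assms] lambda_neg[OF assms]
  show "- inverse (- wu) \<le> i2 z w" "i1 z w \<le> - inverse (- zl)"
    "\<bar>i1 z w\<bar> \<le> inverse (- wu)" "\<bar>i2 z w\<bar> \<le> inverse (- wu)"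
    using b box by (auto simp: i1_def i2_def field_simps abs_if)
  have "(\<gamma> - 1) / 2 * (wl - zu) / zl\<^sup>2 \<le> (\<gamma> - 1) / 2 * (w - z) / (lambda1 \<gamma> z w * lambda2 \<gamma> z w)"
  proof (rule frac_le)
    show "(\<gamma> - 1) / 2 * (wl - zu) \<le> (\<gamma> - 1) / 2 * (w - z)" using assms \<gamma> by (intro mult_left_mono) auto
    show "0 \<le> (\<gamma> - 1) / 2 * (w - z)" using assms \<gamma> box by auto
    show "0 < lambda1 \<gamma> z w * lambda2 \<gamma> z w" using b by (simp add: mult_neg_neg)
    show "lambda1 \<gamma> z w * lambda2 \<gamma> z w \<le> zl\<^sup>2"
      using mult_mono[of "- lambda1 \<gamma> z w" "- zl" "- lambda2 \<gamma> z w" "- zl"] b box by (simp add: power2_eq_square)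
  qed
  also have "\<dots> = i1 z w - i2 z w" using b unfolding lambda_diff[symmetric] i1_def i2_def by (simp add: field_simps)
  finally show "(\<gamma> - 1) / 2 * (wl - zu) / zl\<^sup>2 \<le> i1 z w - i2 z w" .
qed

end

section \<open>The functionals along the characteristics of the nozzle system\<close>

context nozzle_box begin

sublocale char_coeffs i1 i2 h1 h2 i1z i1w i2z i2w h1z h1w h2z h2w .

text \<open>The values of \<open>z\<^sub>x\<close> and \<open>w\<^sub>x\<close> recovered from \<open>ze = (i2 - i1) z\<^sub>t\<close> and \<open>om = (i1 - i2) w\<^sub>t\<close>.\<close>

definition zslope :: "real \<Rightarrow> real \<Rightarrow> real \<Rightarrow> real \<Rightarrow> real" where
  "zslope A z w ze = h1 z w * A - i1 z w * (ze / (i2 z w - i1 z w))"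

definition wslope :: "real \<Rightarrow> real \<Rightarrow> real \<Rightarrow> real \<Rightarrow> real" where
  "wslope A z w om = h2 z w * A - i2 z w * (om / (i1 z w - i2 z w))"

lemma i_lambda:
  assumes "z \<in> {zl..zu}" "w \<in> {wl..wu}"
  shows "i1 z w * lambda1 \<gamma> z w = 1" "i2 z w * lambda2 \<gamma> z w = 1"
    "i1 z w * ((\<gamma> - 1) / 2 * (w - z)) * i2 z w = i1 z w - i2 z w"
  using lambda_neg[OF assms] unfolding lambda_diff[symmetric] i1_def i2_def by (simp_all add: field_simps)

lemma i_diff:
  assumes "z \<in> {zl..zu}" "w \<in> {wl..wu}"
  shows "i1 z w - i2 z w > 0"
proof -
  have "(\<gamma> - 1) / 2 * (wl - zu) / zl\<^sup>2 > 0" using \<gamma> box by simp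
  then show ?thesis using speed_bounds(3)[OF assms] by linarith
qed

text \<open>If \<open>\<xi>\<close> is the rate of x along the curve, then \<open>\<xi> * i1\<close>
  is the rate of t, the variable for which \<open>Phi_deriv\<close> is set up. \<open>zslope\<close>
  obeys the required equation by \<open>riemann_slope_deriv\<close>, and \<open>wslope\<close> takes
  the part of the quantity that drops out.\<close>

lemma Phi_along_characteristic:
  assumes tI: "t \<in> I" and bx: "\<And>s. s \<in> I \<Longrightarrow> z s \<in> {zl..zu} \<and> w s \<in> {wl..wu}"
    and z: "(z has_real_derivative \<xi> * (h1 (z t) (w t) * A t)) (at t within I)"
    and w: "(w has_real_derivative \<xi> * (h2 (z t) (w t) * A t + om)) (at t within I)"
    and ze: "(ze has_real_derivative \<xi> * zrate (A t) (z t) (w t) (ze t) om) (at t within I)"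
    and A: "(A has_real_derivative \<xi> * a1) (at t within I)"
  shows "((\<lambda>s. Phi \<gamma> (A s) (z s) (w s) (zslope (A s) (z s) (w s) (ze s))) has_real_derivative
    \<xi> * i1 (z t) (w t) * riccati \<gamma> (lambda1 \<gamma> (z t) (w t)) (A t) a1 (z t) (w t) (zslope (A t) (z t) (w t) (ze t))) (at t within I)"
proof -
  have b: "z t \<in> {zl..zu}" "w t \<in> {wl..wu}" using bx[OF tI] by auto
  note chain = C1_box_chain[OF _ z w bx tI]
  define p q where "p = ze t / (i2 (z t) (w t) - i1 (z t) (w t))" and "q = om / (i1 (z t) (w t) - i2 (z t) (w t))"
  have om: "om = (i1 (z t) (w t) - i2 (z t) (w t)) * q" using i_diff[OF b] by (simp add: q_def)
  have rd: "((\<lambda>t. zslope (A t) (z t) (w t) (ze t)) has_real_derivative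
     \<xi> * (h1 (z t) (w t) * a1 + zslope (A t) (z t) (w t) (ze t) * (A t * h1z (z t) (w t) - p * i1z (z t) (w t))
       + wslope (A t) (z t) (w t) om * (A t * h1w (z t) (w t) - p * i1w (z t) (w t)))) (at t within I)"
    unfolding zslope_def wslope_def p_def
    by (rule riemann_slope_deriv[OF _ ze A chain[OF C1_boxes(1)] chain[OF C1_boxes(2)] chain[OF C1_boxes(3)]])
      (use i_diff[OF b] in auto)
  have r: "zslope (A t) (z t) (w t) (ze t) = src (z t) (w t) * i1 (z t) (w t) * A t - i1 (z t) (w t) * p"
    by (simp add: zslope_def p_def h1_def)
  have s: "wslope (A t) (z t) (w t) om = - (i2 (z t) (w t) * (src (z t) (w t) * A t + q))"
    by (simp add: wslope_def q_def h2_def algebra_simps)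
  show ?thesis
  proof (rule Phi_deriv[where s = "wslope (A t) (z t) (w t) om" and I = I])
    show "z s < w s" if "s \<in> I" for s using bx[OF that] box by auto
    then show "z t < w t" using tI .
    show "(z has_real_derivative \<xi> * i1 (z t) (w t) * (A t * ((\<gamma> - 1) / 8 * ((w t)\<^sup>2 - (z t)\<^sup>2)))) (at t within I)"
      by (rule DERIV_cong[OF z]) (simp add: h1_def src_def)
    show "(w has_real_derivative \<xi> * i1 (z t) (w t) * (- (A t * ((\<gamma> - 1) / 8 * ((w t)\<^sup>2 - (z t)\<^sup>2)))
       - (\<gamma> - 1) / 2 * (w t - z t) * wslope (A t) (z t) (w t) om)) (at t within I)"
    proof (rule DERIV_cong[OF w])
      have gen: "i * (- (a * u) - c * - (j * (u * a + v))) = - (i * (a * u)) + i * c * j * (u * a + v)" for i j a u v c :: real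
        by (simp add: algebra_simps)
      have "i1 (z t) (w t) * (- (A t * src (z t) (w t)) - (\<gamma> - 1) / 2 * (w t - z t) * wslope (A t) (z t) (w t) om)
        = - (i1 (z t) (w t) * (A t * src (z t) (w t))) + (i1 (z t) (w t) * ((\<gamma> - 1) / 2 * (w t - z t)) * i2 (z t) (w t)) * (src (z t) (w t) * A t + q)"
        unfolding s by (rule gen)
      also have "\<dots> = h2 (z t) (w t) * A t + om" unfolding i_lambda(3)[OF b] om h2_def by (simp add: algebra_simps)
      finally show "\<xi> * (h2 (z t) (w t) * A t + om) = \<xi> * i1 (z t) (w t) * (- (A t * ((\<gamma> - 1) / 8 * ((w t)\<^sup>2 - (z t)\<^sup>2)))
       - (\<gamma> - 1) / 2 * (w t - z t) * wslope (A t) (z t) (w t) om)" by (simp only: src_def mult.assoc)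
    qed
    show "((\<lambda>t. zslope (A t) (z t) (w t) (ze t)) has_real_derivative \<xi> * i1 (z t) (w t) * (a1 * ((\<gamma> - 1) / 8 * ((w t)\<^sup>2 - (z t)\<^sup>2))
        + zslope (A t) (z t) (w t) (ze t) * (A t * (- (\<gamma> - 1) / 4 * z t) - (\<gamma> + 1) / 4 * zslope (A t) (z t) (w t) (ze t))
        + wslope (A t) (z t) (w t) om * (A t * ((\<gamma> - 1) / 4 * w t) - (3 - \<gamma>) / 4 * zslope (A t) (z t) (w t) (ze t)))) (at t within I)"
    proof (rule DERIV_cong[OF rd])
      have "A t * h1z (z t) (w t) - p * i1z (z t) (w t) = i1 (z t) (w t) * (A t * (- (\<gamma> - 1) / 4 * z t) - (\<gamma> + 1) / 4 * zslope (A t) (z t) (w t) (ze t))"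
        "A t * h1w (z t) (w t) - p * i1w (z t) (w t) = i1 (z t) (w t) * (A t * ((\<gamma> - 1) / 4 * w t) - (3 - \<gamma>) / 4 * zslope (A t) (z t) (w t) (ze t))"
        unfolding r h1z_def h1w_def i1z_def i1w_def by (simp_all add: field_simps)
      then show "\<xi> * (h1 (z t) (w t) * a1 + zslope (A t) (z t) (w t) (ze t) * (A t * h1z (z t) (w t) - p * i1z (z t) (w t))
       + wslope (A t) (z t) (w t) om * (A t * h1w (z t) (w t) - p * i1w (z t) (w t))) =
        \<xi> * i1 (z t) (w t) * (a1 * ((\<gamma> - 1) / 8 * ((w t)\<^sup>2 - (z t)\<^sup>2))
        + zslope (A t) (z t) (w t) (ze t) * (A t * (- (\<gamma> - 1) / 4 * z t) - (\<gamma> + 1) / 4 * zslope (A t) (z t) (w t) (ze t))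
        + wslope (A t) (z t) (w t) om * (A t * ((\<gamma> - 1) / 4 * w t) - (3 - \<gamma>) / 4 * zslope (A t) (z t) (w t) (ze t)))"
        unfolding h1_def src_def by (simp only: distrib_left mult.assoc mult.left_commute mult.commute)
    qed
    show "(A has_real_derivative \<xi> * i1 (z t) (w t) * (lambda1 \<gamma> (z t) (w t) * a1)) (at t within I)"
    proof (rule DERIV_cong[OF A])
      have "\<xi> * i1 (z t) (w t) * (lambda1 \<gamma> (z t) (w t) * a1) = \<xi> * (i1 (z t) (w t) * lambda1 \<gamma> (z t) (w t)) * a1" by (simp only: ac_simps)
      then show "\<xi> * a1 = \<xi> * i1 (z t) (w t) * (lambda1 \<gamma> (z t) (w t) * a1)" using i_lambda(1)[OF b] by simp
    qed
  qed (use \<gamma> tI in auto)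
qed

text \<open>Two exchanges are combined: swapping the families gives the derivative of w_x, and the
  reflection (z, w, a) to (-w, -z, -a) brings the equations into the form of
  \<open>Phi_deriv\<close>. As -a changes in time at the rate - lambda2 a', the speed argument
  carries a minus sign while \<open>a1\<close> keeps its own.\<close>

lemma Psi_along_characteristic:
  assumes tI: "t \<in> I" and bx: "\<And>s. s \<in> I \<Longrightarrow> z s \<in> {zl..zu} \<and> w s \<in> {wl..wu}"
    and z: "(z has_real_derivative \<xi> * (h1 (z t) (w t) * A t + ze)) (at t within I)"
    and w: "(w has_real_derivative \<xi> * (h2 (z t) (w t) * A t)) (at t within I)"
    and om: "(om has_real_derivative \<xi> * wrate (A t) (z t) (w t) ze (om t)) (at t within I)"
    and A: "(A has_real_derivative \<xi> * a1) (at t within I)"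
  shows "((\<lambda>s. Psi \<gamma> (A s) (z s) (w s) (wslope (A s) (z s) (w s) (om s))) has_real_derivative
    \<xi> * i2 (z t) (w t) * riccati \<gamma> (- lambda2 \<gamma> (z t) (w t)) (- A t) a1 (- w t) (- z t) (wslope (A t) (z t) (w t) (om t))) (at t within I)"
proof -
  have b: "z t \<in> {zl..zu}" "w t \<in> {wl..wu}" using bx[OF tI] by auto
  note chain = C1_box_chain[OF _ z w bx tI]
  interpret swap: char_coeffs "\<lambda>w z. i2 z w" "\<lambda>w z. i1 z w" "\<lambda>w z. h2 z w" "\<lambda>w z. h1 z w"
    "\<lambda>w z. i2w z w" "\<lambda>w z. i2z z w" "\<lambda>w z. i1w z w" "\<lambda>w z. i1z z w"
    "\<lambda>w z. h2w z w" "\<lambda>w z. h2z z w" "\<lambda>w z. h1w z w" "\<lambda>w z. h1z z w" .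
  \<comment> \<open>\<open>hco\<close> is symmetric under the swap, since numerator and denominator
    both change sign.\<close>
  have rate: "swap.zrate A w z om ze = wrate A z w ze om" for A z w ze om
  proof -
    have "swap.hco A w z om ze = - (A * (h2 z w * (i1w z w - i2w z w) + h1 z w * (i1z z w - i2z z w)) + i1z z w * ze - i2w z w * om) / (i1 z w - i2 z w)"
      unfolding swap.hco_def by (metis minus_diff_eq minus_divide_left minus_divide_right)
    also have "- (A * (h2 z w * (i1w z w - i2w z w) + h1 z w * (i1z z w - i2z z w)) + i1z z w * ze - i2w z w * om) =
       A * (h1 z w * (i2z z w - i1z z w) + h2 z w * (i2w z w - i1w z w)) + i2w z w * om - i1z z w * ze" by (simp add: algebra_simps)
    finally have "swap.hco A w z om ze = hco A z w ze om" unfolding hco_def .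
    then show ?thesis by (simp add: swap.zrate_def wrate_def)
  qed
  define p q where "p = ze / (i2 (z t) (w t) - i1 (z t) (w t))" and "q = om t / (i1 (z t) (w t) - i2 (z t) (w t))"
  have ze: "ze = (i2 (z t) (w t) - i1 (z t) (w t)) * p" using i_diff[OF b] by (simp add: p_def)
  have rd: "((\<lambda>t. wslope (A t) (z t) (w t) (om t)) has_real_derivative
     \<xi> * (h2 (z t) (w t) * a1 + wslope (A t) (z t) (w t) (om t) * (A t * h2w (z t) (w t) - q * i2w (z t) (w t))
       + zslope (A t) (z t) (w t) ze * (A t * h2z (z t) (w t) - q * i2z (z t) (w t)))) (at t within I)"
    unfolding zslope_def wslope_def q_def
    by (rule swap.riemann_slope_deriv[where z = w and w = z, unfolded rate, OF _ om A])
      (use i_diff[OF b] chain[OF C1_boxes(2)] chain[OF C1_boxes(1)] chain[OF C1_boxes(4)] in \<open>simp_all add: add.commute\<close>)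
  have r: "zslope (A t) (z t) (w t) ze = i1 (z t) (w t) * (src (z t) (w t) * A t - p)"
    by (simp add: zslope_def p_def h1_def algebra_simps)
  have s: "wslope (A t) (z t) (w t) (om t) = - (i2 (z t) (w t) * (src (z t) (w t) * A t + q))"
    by (simp add: wslope_def q_def h2_def algebra_simps)
  have src_swap: "(\<gamma> - 1) / 8 * ((- z t)\<^sup>2 - (- w t)\<^sup>2) = - src (z t) (w t)" for t by (simp add: src_def field_simps)
  have lt: "z s < w s" if "s \<in> I" for s using bx[OF that] box by auto
  have "((\<lambda>s. Phi \<gamma> (- A s) (- w s) (- z s) (wslope (A s) (z s) (w s) (om s))) has_real_derivative
    \<xi> * i2 (z t) (w t) * riccati \<gamma> (- lambda2 \<gamma> (z t) (w t)) (- A t) a1 (- w t) (- z t) (wslope (A t) (z t) (w t) (om t))) (at t within I)"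
  proof (rule Phi_deriv[where s = "zslope (A t) (z t) (w t) ze" and I = I and z = "\<lambda>s. - w s" and w = "\<lambda>s. - z s" and A = "\<lambda>s. - A s" and \<gamma> = \<gamma>, unfolded src_swap])
    show "- w s < - z s" if "s \<in> I" for s using lt[OF that] by simp
    then show "- w t < - z t" using tI .
    show "((\<lambda>s. - w s) has_real_derivative \<xi> * i2 (z t) (w t) * (- A t * - src (z t) (w t))) (at t within I)"
      by (rule DERIV_cong[OF DERIV_minus[OF w]]) (simp add: h2_def)
    show "((\<lambda>s. - z s) has_real_derivative \<xi> * i2 (z t) (w t) * (- (- A t * - src (z t) (w t))
       - (\<gamma> - 1) / 2 * (- z t - - w t) * zslope (A t) (z t) (w t) ze)) (at t within I)"
    proof (rule DERIV_cong[OF DERIV_minus[OF z]])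
      have gen: "j * (- (- a * - u) - c * (- x - - y) * (i * (u * a - v))) = - (j * (a * u)) - i * (c * (y - x)) * j * (u * a - v)" for i j a u v c x y :: real
        by (simp add: algebra_simps)
      have "i2 (z t) (w t) * (- (- A t * - src (z t) (w t)) - (\<gamma> - 1) / 2 * (- z t - - w t) * zslope (A t) (z t) (w t) ze)
        = - (i2 (z t) (w t) * (A t * src (z t) (w t))) - (i1 (z t) (w t) * ((\<gamma> - 1) / 2 * (w t - z t)) * i2 (z t) (w t)) * (src (z t) (w t) * A t - p)"
        unfolding r by (rule gen)
      also have "\<dots> = - (h1 (z t) (w t) * A t + ze)" unfolding i_lambda(3)[OF b] ze h1_def by (simp add: algebra_simps)
      finally show "- (\<xi> * (h1 (z t) (w t) * A t + ze)) = \<xi> * i2 (z t) (w t) * (- (- A t * - src (z t) (w t))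
       - (\<gamma> - 1) / 2 * (- z t - - w t) * zslope (A t) (z t) (w t) ze)" by (simp only: mult.assoc mult_minus_right)
    qed
    show "((\<lambda>t. wslope (A t) (z t) (w t) (om t)) has_real_derivative \<xi> * i2 (z t) (w t) * (a1 * - src (z t) (w t)
        + wslope (A t) (z t) (w t) (om t) * (- A t * (- (\<gamma> - 1) / 4 * - w t) - (\<gamma> + 1) / 4 * wslope (A t) (z t) (w t) (om t))
        + zslope (A t) (z t) (w t) ze * (- A t * ((\<gamma> - 1) / 4 * - z t) - (3 - \<gamma>) / 4 * wslope (A t) (z t) (w t) (om t)))) (at t within I)"
    proof (rule DERIV_cong[OF rd])
      have "A t * h2w (z t) (w t) - q * i2w (z t) (w t) = i2 (z t) (w t) * (- A t * (- (\<gamma> - 1) / 4 * - w t) - (\<gamma> + 1) / 4 * wslope (A t) (z t) (w t) (om t))"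
        "A t * h2z (z t) (w t) - q * i2z (z t) (w t) = i2 (z t) (w t) * (- A t * ((\<gamma> - 1) / 4 * - z t) - (3 - \<gamma>) / 4 * wslope (A t) (z t) (w t) (om t))"
        unfolding s h2z_def h2w_def i2z_def i2w_def by (simp_all add: field_simps)
      moreover have "h2 (z t) (w t) * a1 = i2 (z t) (w t) * (a1 * - src (z t) (w t))" by (simp add: h2_def)
      ultimately show "\<xi> * (h2 (z t) (w t) * a1 + wslope (A t) (z t) (w t) (om t) * (A t * h2w (z t) (w t) - q * i2w (z t) (w t))
       + zslope (A t) (z t) (w t) ze * (A t * h2z (z t) (w t) - q * i2z (z t) (w t))) =
        \<xi> * i2 (z t) (w t) * (a1 * - src (z t) (w t)
        + wslope (A t) (z t) (w t) (om t) * (- A t * (- (\<gamma> - 1) / 4 * - w t) - (\<gamma> + 1) / 4 * wslope (A t) (z t) (w t) (om t))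
        + zslope (A t) (z t) (w t) ze * (- A t * ((\<gamma> - 1) / 4 * - z t) - (3 - \<gamma>) / 4 * wslope (A t) (z t) (w t) (om t)))"
        by (simp only: distrib_left mult.assoc mult.left_commute mult.commute)
    qed
    show "((\<lambda>s. - A s) has_real_derivative \<xi> * i2 (z t) (w t) * (- lambda2 \<gamma> (z t) (w t) * a1)) (at t within I)"
    proof (rule DERIV_cong[OF DERIV_minus[OF A]])
      have "\<xi> * i2 (z t) (w t) * (- lambda2 \<gamma> (z t) (w t) * a1) = - (\<xi> * (i2 (z t) (w t) * lambda2 \<gamma> (z t) (w t)) * a1)" by (simp add: ac_simps)
      then show "- (\<xi> * a1) = \<xi> * i2 (z t) (w t) * (- lambda2 \<gamma> (z t) (w t) * a1)" using i_lambda(2)[OF b] by simp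
    qed
  qed (use \<gamma> tI in auto)
  then show ?thesis
    by (rule has_field_derivative_transform_within[OF _ zero_less_one tI]) (simp add: Psi_eq_Phi[OF lt])
qed

end

text \<open>The box contains the data with a margin \<open>\<epsilon>\<close> on every side. The
  three inequalities in \<open>large\<close> make the lower barrier work, limit the growth of the
  functionals to 1, and keep z and w from using up the margin.\<close>

locale nozzle_problem = nozzle_box +
  fixes a a' z0 z0' w0 w0' :: "real \<Rightarrow> real" and \<alpha> M \<kappa>1 \<kappa>2 \<delta>1 \<delta>2 C \<epsilon> :: real
  assumes pos: "\<alpha> > 0" "M > 0" "\<kappa>1 > 0" "\<kappa>2 > 0" "\<delta>1 > 0" "C > 0" "\<epsilon> > 0"
    and riccati_bound: "\<And>lam a a1 z w r. \<bar>lam\<bar> \<le> - zl \<Longrightarrow> \<bar>z\<bar> \<le> - zl \<Longrightarrow> \<bar>w\<bar> \<le> - zl \<Longrightarrow> wl - zu \<le> w - z \<Longrightarrow>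
       riccati \<gamma> lam a a1 z w r \<le> C * (a\<^sup>2 + \<bar>a1\<bar>) \<and>
       - C * ((Phi \<gamma> a z w r)\<^sup>2 + a\<^sup>2 + \<bar>a1\<bar>) \<le> riccati \<gamma> lam a a1 z w r \<and>
       \<bar>r\<bar> \<le> C * (\<bar>Phi \<gamma> a z w r\<bar> + \<bar>a\<bar>)"
    and a_deriv: "\<And>x. x \<ge> 0 \<Longrightarrow> (a has_real_derivative a' x) (at x within {0..})"
    and a'_cont: "continuous_on {0..} a'"
    and a_sq: "\<And>x. x \<ge> 0 \<Longrightarrow> (a x)\<^sup>2 \<le> \<kappa>1 * (1 + M * x) powr (- 2 - \<alpha>)"
    and a'_bd: "\<And>x. x \<ge> 0 \<Longrightarrow> \<bar>a' x\<bar> \<le> \<kappa>2 * (1 + M * x) powr (- 2 - \<alpha>)"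
    and z0_deriv: "\<And>x. x \<ge> 0 \<Longrightarrow> (z0 has_real_derivative z0' x) (at x within {0..})"
    and w0_deriv: "\<And>x. x \<ge> 0 \<Longrightarrow> (w0 has_real_derivative w0' x) (at x within {0..})"
    and z0'_cont: "continuous_on {0..} z0'" and w0'_cont: "continuous_on {0..} w0'"
    and z0_range: "\<And>x. x \<ge> 0 \<Longrightarrow> zl + \<epsilon> \<le> z0 x \<and> z0 x \<le> zu - \<epsilon>"
    and w0_range: "\<And>x. x \<ge> 0 \<Longrightarrow> wl + \<epsilon> \<le> w0 x \<and> w0 x \<le> wu - \<epsilon>"
    and Phi0: "\<And>x. x \<ge> 0 \<Longrightarrow> - \<delta>1 * (1 + M * x) powr (- 1 - \<alpha>) \<le> Phi \<gamma> (a x) (z0 x) (w0 x) (z0' x) \<and>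
        Phi \<gamma> (a x) (z0 x) (w0 x) (z0' x) \<le> \<delta>2"
    and Psi0: "\<And>x. x \<ge> 0 \<Longrightarrow> - \<delta>1 * (1 + M * x) powr (- 1 - \<alpha>) \<le> Psi \<gamma> (a x) (z0 x) (w0 x) (w0' x) \<and>
        Psi \<gamma> (a x) (z0 x) (w0 x) (w0' x) \<le> \<delta>2"
    and large: "C * (4 * \<delta>1\<^sup>2 + (\<kappa>1 + \<kappa>2)) / (- wu) < 2 * \<delta>1 * ((1 + \<alpha>) * M)"
      "C * (\<kappa>1 + \<kappa>2) / (- wu) / ((1 + \<alpha>) * M) \<le> 1"
      "zl\<^sup>2 / (- wu) * sqrt \<kappa>1 / (\<alpha> / 2 * M) < \<epsilon>"
begin

sublocale char_data i1 i2 h1 h2 i1z i1w i2z i2w h1z h1w h2z h2w a a' z0 z0' w0 w0' .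

definition N :: real where "N = \<bar>\<delta>2\<bar> + 1 + 2 * \<delta>1"

text \<open>From ze = (i2 - i1) z_t and i1 z_t = h1 a - z_x: the factors bound the difference of the
  reciprocal speeds, the speed, and the two terms h1 a and z_x, the last one through
  \<open>N\<close>. The final 1 makes \<open>slope_bound\<close> strict.\<close>

definition K :: real where
  "K = 2 * inverse (- wu) * (- zl) * (zl\<^sup>2 / (- wu) * sqrt \<kappa>1 + C * (N + sqrt \<kappa>1)) + 1"

lemma lower_speed: "- wu > 0" "- zl > 0" using box by auto

lemma box_abs:
  assumes "z \<in> {zl..zu}" "w \<in> {wl..wu}"
  shows "\<bar>z\<bar> \<le> - zl" "\<bar>w\<bar> \<le> - zl" "wl - zu \<le> w - z" "z < w"
  using assms box by auto

text \<open>The square root of the bound on a^2 leaves the exponent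
  \<open>- (\<alpha> / 2) - 1\<close>, which is still integrable, with total of order 1 / M. This
  explains the half of \<open>\<alpha>\<close> in \<open>large\<close>.\<close>

lemma a_abs:
  assumes "x \<ge> 0"
  shows "\<bar>a x\<bar> \<le> sqrt \<kappa>1 * (1 + M * x) powr (- (\<alpha> / 2) - 1)" "\<bar>a x\<bar> \<le> sqrt \<kappa>1" "\<bar>a' x\<bar> \<le> \<kappa>2"
    "(a x)\<^sup>2 + \<bar>a' x\<bar> \<le> (\<kappa>1 + \<kappa>2) * (1 + M * x) powr (- 2 - \<alpha>)"
proof -
  have q: "1 \<le> 1 + M * x" using assms pos by simp
  have "((1 + M * x) powr (- (\<alpha> / 2) - 1))\<^sup>2 = (1 + M * x) powr (- 2 - \<alpha>)"
    unfolding power2_eq_square powr_add[symmetric] by (rule arg_cong[where f = "\<lambda>b. _ powr b"]) simp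
  then have "(a x)\<^sup>2 \<le> (sqrt \<kappa>1 * (1 + M * x) powr (- (\<alpha> / 2) - 1))\<^sup>2"
    using a_sq[OF assms] pos by (simp add: power_mult_distrib)
  moreover have nn: "0 \<le> sqrt \<kappa>1 * (1 + M * x) powr (- (\<alpha> / 2) - 1)" using pos by simp
  ultimately show 1: "\<bar>a x\<bar> \<le> sqrt \<kappa>1 * (1 + M * x) powr (- (\<alpha> / 2) - 1)"
    using abs_le_square_iff[of "a x" "sqrt \<kappa>1 * (1 + M * x) powr (- (\<alpha> / 2) - 1)"] by simp
  have le1: "(1 + M * x) powr (- b) \<le> 1" if "b > 0" for b
    using powr_mono2'[of "- b" 1 "1 + M * x"] that q by simp
  have "sqrt \<kappa>1 * (1 + M * x) powr (- (\<alpha> / 2) - 1) \<le> sqrt \<kappa>1 * 1"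
    using le1[of "\<alpha> / 2 + 1"] pos by (intro mult_left_mono) auto
  then show "\<bar>a x\<bar> \<le> sqrt \<kappa>1" using 1 by simp
  have "\<kappa>2 * (1 + M * x) powr (- 2 - \<alpha>) \<le> \<kappa>2 * 1"
    using le1[of "2 + \<alpha>"] pos by (intro mult_left_mono) auto
  then show "\<bar>a' x\<bar> \<le> \<kappa>2" using a'_bd[OF assms] by simp
  show "(a x)\<^sup>2 + \<bar>a' x\<bar> \<le> (\<kappa>1 + \<kappa>2) * (1 + M * x) powr (- 2 - \<alpha>)"
    using a_sq[OF assms] a'_bd[OF assms] by (simp add: distrib_right)
qed

lemma source_abs:
  assumes "z \<in> {zl..zu}" "w \<in> {wl..wu}"
  shows "\<bar>h1 z w\<bar> \<le> zl\<^sup>2 / (- wu)" "\<bar>h2 z w\<bar> \<le> zl\<^sup>2 / (- wu)"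
proof -
  have sq: "z\<^sup>2 \<le> zl\<^sup>2" "w\<^sup>2 \<le> zl\<^sup>2"
    using box_abs[OF assms] power_mono[of "\<bar>z\<bar>" "- zl" 2] power_mono[of "\<bar>w\<bar>" "- zl" 2] by auto
  have "\<bar>w\<^sup>2 - z\<^sup>2\<bar> \<le> zl\<^sup>2" using sq zero_le_power2[of z] zero_le_power2[of w] by linarith
  then have "(\<gamma> - 1) / 8 * \<bar>w\<^sup>2 - z\<^sup>2\<bar> \<le> 1 * zl\<^sup>2" using \<gamma> by (intro mult_mono) auto
  then have s: "\<bar>src z w\<bar> \<le> zl\<^sup>2" using \<gamma> by (simp add: src_def abs_mult)
  show "\<bar>h1 z w\<bar> \<le> zl\<^sup>2 / (- wu)" "\<bar>h2 z w\<bar> \<le> zl\<^sup>2 / (- wu)"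
    unfolding h1_def h2_def abs_mult abs_minus_cancel divide_inverse
    by (intro mult_mono s speed_bounds assms; simp)+
qed

lemma speed_inverse_abs:
  assumes "z \<in> {zl..zu}" "w \<in> {wl..wu}"
  shows "\<bar>u\<bar> \<le> - zl * \<bar>i1 z w * u\<bar>" "\<bar>u\<bar> \<le> - zl * \<bar>i2 z w * u\<bar>" "\<bar>i1 z w - i2 z w\<bar> \<le> 2 * inverse (- wu)"
proof -
  have "\<bar>u\<bar> = \<bar>lambda1 \<gamma> z w\<bar> * \<bar>i1 z w * u\<bar>" "\<bar>u\<bar> = \<bar>lambda2 \<gamma> z w\<bar> * \<bar>i2 z w * u\<bar>"
    unfolding abs_mult[symmetric] mult.assoc[symmetric]
    using i_lambda(1,2)[OF assms] by (simp_all add: mult.commute)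
  moreover have "\<bar>lambda1 \<gamma> z w\<bar> \<le> - zl" "\<bar>lambda2 \<gamma> z w\<bar> \<le> - zl"
    using lambda_bounds[OF assms] lambda_neg[OF assms] by auto
  ultimately show "\<bar>u\<bar> \<le> - zl * \<bar>i1 z w * u\<bar>" "\<bar>u\<bar> \<le> - zl * \<bar>i2 z w * u\<bar>"
    by (metis abs_ge_zero mult_right_mono)+
  show "\<bar>i1 z w - i2 z w\<bar> \<le> 2 * inverse (- wu)" using speed_bounds(4,5)[OF assms] by linarith
qed

lemma slope_bound:
  assumes "\<bar>d\<bar> \<le> 2 * inverse (- wu)" "d \<noteq> 0" "\<bar>ze / d\<bar> \<le> - zl * \<bar>h - r\<bar>"
    and "\<bar>h\<bar> \<le> zl\<^sup>2 / (- wu) * sqrt \<kappa>1" "\<bar>r\<bar> \<le> C * (\<bar>\<phi>\<bar> + \<bar>A\<bar>)" "\<bar>\<phi>\<bar> \<le> N" "\<bar>A\<bar> \<le> sqrt \<kappa>1"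
  shows "\<bar>ze\<bar> < K"
proof -
  have "C * (\<bar>\<phi>\<bar> + \<bar>A\<bar>) \<le> C * (N + sqrt \<kappa>1)" using assms pos by (intro mult_left_mono add_mono) auto
  then have hr: "\<bar>h - r\<bar> \<le> zl\<^sup>2 / (- wu) * sqrt \<kappa>1 + C * (N + sqrt \<kappa>1)" using assms(4,5) by linarith
  have "\<bar>ze\<bar> = \<bar>d\<bar> * \<bar>ze / d\<bar>" using assms(2) by (simp add: abs_mult)
  also have "\<dots> \<le> (2 * inverse (- wu)) * (- zl * \<bar>h - r\<bar>)"
    using assms lower_speed by (intro mult_mono) auto
  also have "\<dots> \<le> (2 * inverse (- wu)) * (- zl * (zl\<^sup>2 / (- wu) * sqrt \<kappa>1 + C * (N + sqrt \<kappa>1)))"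
    using hr lower_speed by (intro mult_left_mono) auto
  finally show ?thesis unfolding K_def by (simp add: mult.assoc)
qed

lemma ze_bound:
  assumes b: "z \<in> {zl..zu}" "w \<in> {wl..wu}" and A: "\<bar>A\<bar> \<le> sqrt \<kappa>1"
    and \<phi>: "\<bar>Phi \<gamma> A z w (zslope A z w ze)\<bar> \<le> N"
  shows "\<bar>ze\<bar> < K"
proof (rule slope_bound[OF _ _ _ _ _ \<phi> A])
  have eq: "i1 z w * (ze / (i2 z w - i1 z w)) = h1 z w * A - zslope A z w ze" by (simp add: zslope_def)
  show "\<bar>i2 z w - i1 z w\<bar> \<le> 2 * inverse (- wu)" "i2 z w - i1 z w \<noteq> 0"
    using speed_inverse_abs(3)[OF b] i_diff[OF b] by auto
  show "\<bar>ze / (i2 z w - i1 z w)\<bar> \<le> - zl * \<bar>h1 z w * A - zslope A z w ze\<bar>"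
    using speed_inverse_abs(1)[OF b, of "ze / (i2 z w - i1 z w)"] unfolding eq .
  show "\<bar>h1 z w * A\<bar> \<le> zl\<^sup>2 / (- wu) * sqrt \<kappa>1"
    unfolding abs_mult using source_abs[OF b] A lower_speed by (intro mult_mono) auto
  show "\<bar>zslope A z w ze\<bar> \<le> C * (\<bar>Phi \<gamma> A z w (zslope A z w ze)\<bar> + \<bar>A\<bar>)"
    using riccati_bound[of 0 z w A 0] box_abs[OF b] lower_speed by auto
qed

lemma om_bound:
  assumes b: "z \<in> {zl..zu}" "w \<in> {wl..wu}" and A: "\<bar>A\<bar> \<le> sqrt \<kappa>1"
    and \<phi>: "\<bar>Psi \<gamma> A z w (wslope A z w om)\<bar> \<le> N"
  shows "\<bar>om\<bar> < K"
proof (rule slope_bound[OF _ _ _ _ _ \<phi> A])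
  have eq: "i2 z w * (om / (i1 z w - i2 z w)) = h2 z w * A - wslope A z w om" by (simp add: wslope_def)
  show "\<bar>i1 z w - i2 z w\<bar> \<le> 2 * inverse (- wu)" "i1 z w - i2 z w \<noteq> 0"
    using speed_inverse_abs(3)[OF b] i_diff[OF b] by auto
  show "\<bar>om / (i1 z w - i2 z w)\<bar> \<le> - zl * \<bar>h2 z w * A - wslope A z w om\<bar>"
    using speed_inverse_abs(2)[OF b, of "om / (i1 z w - i2 z w)"] unfolding eq .
  show "\<bar>h2 z w * A\<bar> \<le> zl\<^sup>2 / (- wu) * sqrt \<kappa>1"
    unfolding abs_mult using source_abs[OF b] A lower_speed by (intro mult_mono) auto
  show "\<bar>wslope A z w om\<bar> \<le> C * (\<bar>Psi \<gamma> A z w (wslope A z w om)\<bar> + \<bar>A\<bar>)"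
    using riccati_bound[of 0 "- w" "- z" "- A" 0] box_abs[OF b] lower_speed by (simp add: Psi_eq_Phi)
qed

lemma data_box: "x \<ge> 0 \<Longrightarrow> z0 x \<in> {zl..zu}" "x \<ge> 0 \<Longrightarrow> w0 x \<in> {wl..wu}"
  using z0_range[of x] w0_range[of x] pos by auto

lemma init_slopes:
  assumes "x \<ge> 0"
  shows "zslope (a x) (z0 x) (w0 x) (ze_init x) = z0' x" "wslope (a x) (z0 x) (w0 x) (om_init x) = w0' x"
proof -
  note b = data_box[OF assms]
  have nz: "i1 (z0 x) (w0 x) \<noteq> 0" "i2 (z0 x) (w0 x) \<noteq> 0" using i_lambda(1,2)[OF b] by auto
  have "ze_init x / (i2 (z0 x) (w0 x) - i1 (z0 x) (w0 x)) = - ((z0' x - h1 (z0 x) (w0 x) * a x) / i1 (z0 x) (w0 x))"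
    using i_diff[OF b] nz unfolding ze_init_def by (simp add: field_simps)
  then show "zslope (a x) (z0 x) (w0 x) (ze_init x) = z0' x" using nz unfolding zslope_def by simp
  have "om_init x / (i1 (z0 x) (w0 x) - i2 (z0 x) (w0 x)) = - ((w0' x - h2 (z0 x) (w0 x) * a x) / i2 (z0 x) (w0 x))"
    using i_diff[OF b] nz unfolding om_init_def by (simp add: field_simps)
  then show "wslope (a x) (z0 x) (w0 x) (om_init x) = w0' x" using nz unfolding wslope_def by simp
qed

lemma init_N:
  assumes "x \<ge> 0" "- \<delta>1 * (1 + M * x) powr (- 1 - \<alpha>) \<le> v \<and> v \<le> \<delta>2"
  shows "\<bar>v\<bar> \<le> N"
proof -
  have "(1 + M * x) powr (- 1 - \<alpha>) \<le> 1"
    using powr_mono2'[of "- 1 - \<alpha>" 1 "1 + M * x"] assms pos by simp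
  then have "\<delta>1 * (1 + M * x) powr (- 1 - \<alpha>) \<le> \<delta>1" using pos by simp
  then show ?thesis using assms(2) pos unfolding N_def mult_minus_left by linarith
qed

lemma data_K:
  assumes "x \<ge> 0"
  shows "\<bar>ze_init x\<bar> \<le> K \<and> \<bar>om_init x\<bar> \<le> K"
  using ze_bound[OF data_box[OF assms] a_abs(2)[OF assms], of "ze_init x"] init_N[OF assms Phi0[OF assms]]
    om_bound[OF data_box[OF assms] a_abs(2)[OF assms], of "om_init x"] init_N[OF assms Psi0[OF assms]]
  by (simp add: init_slopes[OF assms])

text \<open>Along its own characteristic a Riemann invariant changes through the source alone, which
  is integrable with a total of order 1 / M. Applying \<open>weighted_drift\<close> to
  \<open>f\<close> and to its negative controls both directions.\<close>

lemma drift: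
  assumes l: "0 \<le> l" and x: "\<And>s. s \<in> {0..l} \<Longrightarrow> 0 \<le> x s" "\<And>s. s \<in> {0..l} \<Longrightarrow> x' s < 0"
      "\<And>s. s \<in> {0..l} \<Longrightarrow> (x has_real_derivative x' s) (at s within {0..l})"
    and f: "\<And>s. s \<in> {0..l} \<Longrightarrow> (f has_real_derivative x' s * (h s * a (x s))) (at s within {0..l})"
    and h: "\<And>s. s \<in> {0..l} \<Longrightarrow> \<bar>h s\<bar> \<le> zl\<^sup>2 / (- wu)"
  shows "\<bar>f l - f 0\<bar> < \<epsilon>"
proof -
  have bd: "\<bar>x' s * (h s * a (x s))\<bar> \<le> zl\<^sup>2 / (- wu) * sqrt \<kappa>1 * (- x' s * (1 + M * x s) powr (- (\<alpha> / 2) - 1))"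
    if s: "s \<in> {0..l}" for s
  proof -
    have "0 \<le> zl\<^sup>2 / (- wu)" by (rule divide_nonneg_pos[OF _ lower_speed(1)]) simp
    then have "\<bar>h s\<bar> * \<bar>a (x s)\<bar> \<le> zl\<^sup>2 / (- wu) * (sqrt \<kappa>1 * (1 + M * x s) powr (- (\<alpha> / 2) - 1))"
      by (intro mult_mono h a_abs x s) auto
    then have "- x' s * (\<bar>h s\<bar> * \<bar>a (x s)\<bar>) \<le> - x' s * (zl\<^sup>2 / (- wu) * (sqrt \<kappa>1 * (1 + M * x s) powr (- (\<alpha> / 2) - 1)))"
      using x(2)[OF s] by (intro mult_left_mono) auto
    then show ?thesis using x(2)[OF s] by (simp add: abs_mult ac_simps)
  qed
  have G: "0 \<le> zl\<^sup>2 / (- wu) * sqrt \<kappa>1"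
    using pos by (intro mult_nonneg_nonneg divide_nonneg_pos[OF _ lower_speed(1)]) auto
  have a2: "\<alpha> / 2 > 0" using pos by simp
  have "f l \<le> f 0 + zl\<^sup>2 / (- wu) * sqrt \<kappa>1 / (\<alpha> / 2 * M)"
  proof (rule weighted_drift[OF l pos(2) a2 G x(1) x(3) f])
    show "x' s * (h s * a (x s)) \<le> zl\<^sup>2 / (- wu) * sqrt \<kappa>1 * (- x' s * (1 + M * x s) powr (- (\<alpha> / 2) - 1))" if "s \<in> {0..l}" for s
      using bd[OF that] by linarith
  qed
  moreover have "- f l \<le> - f 0 + zl\<^sup>2 / (- wu) * sqrt \<kappa>1 / (\<alpha> / 2 * M)"
  proof (rule weighted_drift[OF l pos(2) a2 G x(1) x(3) DERIV_minus[OF f]])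
    show "- (x' s * (h s * a (x s))) \<le> zl\<^sup>2 / (- wu) * sqrt \<kappa>1 * (- x' s * (1 + M * x s) powr (- (\<alpha> / 2) - 1))" if "s \<in> {0..l}" for s
      using bd[OF that] by linarith
  qed
  ultimately show ?thesis using large(3) by linarith
qed

text \<open>Shared by \<open>Phi\<close> and \<open>Psi\<close>: the family enters only through the
  reciprocal speed \<open>i\<close> and the Riccati right-hand side \<open>R\<close>.\<close>

lemma functional_bound:
  assumes l: "0 \<le> l" and x: "\<And>s. s \<in> {0..l} \<Longrightarrow> 0 \<le> x s" "\<And>s. s \<in> {0..l} \<Longrightarrow> x' s < 0"
      "\<And>s. s \<in> {0..l} \<Longrightarrow> (x has_real_derivative x' s) (at s within {0..l})"
    and \<phi>: "\<And>s. s \<in> {0..l} \<Longrightarrow> (\<phi> has_real_derivative x' s * i s * R s) (at s within {0..l})"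
    and i: "\<And>s. s \<in> {0..l} \<Longrightarrow> i s \<le> 0 \<and> \<bar>i s\<bar> \<le> inverse (- wu)"
    and R: "\<And>s. s \<in> {0..l} \<Longrightarrow> R s \<le> C * ((a (x s))\<^sup>2 + \<bar>a' (x s)\<bar>)"
      "\<And>s. s \<in> {0..l} \<Longrightarrow> - C * ((\<phi> s)\<^sup>2 + (a (x s))\<^sup>2 + \<bar>a' (x s)\<bar>) \<le> R s"
    and \<phi>0: "- \<delta>1 * (1 + M * x 0) powr (- 1 - \<alpha>) \<le> \<phi> 0 \<and> \<phi> 0 \<le> \<delta>2"
  shows "\<bar>\<phi> l\<bar> \<le> N"
proof -
  have C: "C \<ge> 0" "\<kappa>1 + \<kappa>2 \<ge> 0" using pos by auto
  have \<kappa>: "0 \<le> x' s * i s \<and> x' s * i s \<le> - x' s / (- wu)" if s: "s \<in> {0..l}" for s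
  proof
    show "0 \<le> x' s * i s" using x(2)[OF s] i[OF s] by (simp add: mult_nonpos_nonpos)
    have "- x' s * - i s \<le> - x' s * inverse (- wu)" using x(2)[OF s] i[OF s] by (intro mult_left_mono) auto
    then show "x' s * i s \<le> - x' s / (- wu)" by (simp add: divide_inverse)
  qed
  have w: "(a (x s))\<^sup>2 + \<bar>a' (x s)\<bar> \<le> (\<kappa>1 + \<kappa>2) * (1 + M * x s) powr (- 2 - \<alpha>)" if "s \<in> {0..l}" for s
    by (rule a_abs[OF x(1)[OF that]])
  have R1: "R s \<le> C * ((\<kappa>1 + \<kappa>2) * (1 + M * x s) powr (- 2 - \<alpha>))" if s: "s \<in> {0..l}" for s
    using R(1)[OF s] mult_left_mono[OF w[OF s] C(1)] by linarith
  have R2: "- C * ((\<phi> s)\<^sup>2 + (\<kappa>1 + \<kappa>2) * (1 + M * x s) powr (- 2 - \<alpha>)) \<le> R s" if s: "s \<in> {0..l}" for s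
  proof -
    have "C * ((\<phi> s)\<^sup>2 + ((a (x s))\<^sup>2 + \<bar>a' (x s)\<bar>)) \<le> C * ((\<phi> s)\<^sup>2 + (\<kappa>1 + \<kappa>2) * (1 + M * x s) powr (- 2 - \<alpha>))"
      using w[OF s] C by (intro mult_left_mono add_left_mono) auto
    then show ?thesis using R(2)[OF s] by (simp add: add.assoc)
  qed
  note barrier = riccati_barrier[OF l pos(2) pos(1) C lower_speed(1) pos(5) x(1) x(2) x(3) \<phi> \<kappa> R1 R2 conjunct1[OF \<phi>0] large(1)]
  show ?thesis using barrier large(2) \<phi>0 pos unfolding N_def by linarith
qed

lemma a_along:
  assumes "s \<in> {0..l}" "\<And>s. s \<in> {0..l} \<Longrightarrow> 0 \<le> x s" "(x has_real_derivative x') (at s within {0..l})"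
  shows "((\<lambda>s. a (x s)) has_real_derivative x' * a' (x s)) (at s within {0..l})"
proof -
  have "(a has_real_derivative a' (x s)) (at (x s) within x ` {0..l})"
    by (rule DERIV_subset[OF a_deriv[OF assms(2)[OF assms(1)]]]) (use assms(2) in auto)
  from DERIV_image_chain[OF this assms(3)] show ?thesis by (simp add: o_def mult.commute)
qed

lemma apriori1:
  assumes l: "0 \<le> l"
    and h: "\<And>s. s \<in> {0..l} \<Longrightarrow> 0 \<le> x s \<and> z s \<in> {zl..zu} \<and> w s \<in> {wl..wu} \<and> \<bar>ze s\<bar> \<le> K \<and> \<bar>om s\<bar> \<le> K \<and> x' s < 0 \<and>
        (x has_real_derivative x' s) (at s within {0..l}) \<and>
        (z has_real_derivative x' s * (h1 (z s) (w s) * a (x s))) (at s within {0..l}) \<and>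
        (w has_real_derivative x' s * (h2 (z s) (w s) * a (x s) + om s)) (at s within {0..l}) \<and>
        (ze has_real_derivative x' s * zrate (a (x s)) (z s) (w s) (ze s) (om s)) (at s within {0..l})"
    and init: "z 0 = z0 (x 0)" "w 0 = w0 (x 0)" "ze 0 = ze_init (x 0)"
  shows "zl < z l \<and> z l < zu \<and> \<bar>ze l\<bar> < K"
proof -
  note x = h[THEN conjunct1] and bx = h[THEN conjunct2, THEN conjunct1] h[THEN conjunct2, THEN conjunct2, THEN conjunct1]
  have x': "x' s < 0" "(x has_real_derivative x' s) (at s within {0..l})" and
    zd: "(z has_real_derivative x' s * (h1 (z s) (w s) * a (x s))) (at s within {0..l})" and
    wd: "(w has_real_derivative x' s * (h2 (z s) (w s) * a (x s) + om s)) (at s within {0..l})" and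
    zed: "(ze has_real_derivative x' s * zrate (a (x s)) (z s) (w s) (ze s) (om s)) (at s within {0..l})"
    if "s \<in> {0..l}" for s using h[OF that] by auto
  have x0: "0 \<le> x 0" and lI: "l \<in> {0..l}" using x[of 0] l by auto
  have "\<bar>z l - z 0\<bar> < \<epsilon>"
    by (rule drift[OF l x x' zd]; (assumption | rule source_abs[OF bx]; assumption))
  then have zl: "zl < z l" "z l < zu" using z0_range[OF x0] init(1) by auto
  define \<phi> where "\<phi> = (\<lambda>s. Phi \<gamma> (a (x s)) (z s) (w s) (zslope (a (x s)) (z s) (w s) (ze s)))"
  have "\<bar>\<phi> l\<bar> \<le> N"
  proof (rule functional_bound[OF l x x'])
    show "(\<phi> has_real_derivative x' s * i1 (z s) (w s) * riccati \<gamma> (lambda1 \<gamma> (z s) (w s)) (a (x s)) (a' (x s)) (z s) (w s)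
        (zslope (a (x s)) (z s) (w s) (ze s))) (at s within {0..l})" if s: "s \<in> {0..l}" for s
      unfolding \<phi>_def
      by (rule Phi_along_characteristic[OF s conjI zd[OF s] wd[OF s] zed[OF s] a_along[OF s x x'(2)[OF s]]]) (rule bx; assumption)+
    show "i1 (z s) (w s) \<le> 0 \<and> \<bar>i1 (z s) (w s)\<bar> \<le> inverse (- wu)" if s: "s \<in> {0..l}" for s
      using speed_bounds(4)[OF bx[OF s]] lambda_neg(1)[OF bx[OF s]] by (simp add: i1_def)
    show "riccati \<gamma> (lambda1 \<gamma> (z s) (w s)) (a (x s)) (a' (x s)) (z s) (w s) (zslope (a (x s)) (z s) (w s) (ze s))
         \<le> C * ((a (x s))\<^sup>2 + \<bar>a' (x s)\<bar>)"
      "- C * ((\<phi> s)\<^sup>2 + (a (x s))\<^sup>2 + \<bar>a' (x s)\<bar>) \<le> riccati \<gamma> (lambda1 \<gamma> (z s) (w s)) (a (x s)) (a' (x s)) (z s) (w s)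
         (zslope (a (x s)) (z s) (w s) (ze s))" if s: "s \<in> {0..l}" for s
      using riccati_bound[of "lambda1 \<gamma> (z s) (w s)" "z s" "w s"] box_abs[OF bx[OF s]] lambda_bounds[OF bx[OF s]] lambda_neg[OF bx[OF s]]
      unfolding \<phi>_def by auto
    show "- \<delta>1 * (1 + M * x 0) powr (- 1 - \<alpha>) \<le> \<phi> 0 \<and> \<phi> 0 \<le> \<delta>2"
      using Phi0[OF x0] by (simp add: \<phi>_def init init_slopes[OF x0])
  qed
  then have "\<bar>ze l\<bar> < K" unfolding \<phi>_def by (rule ze_bound[OF bx[OF lI] a_abs(2)[OF x[OF lI]]])
  then show ?thesis using zl by simp
qed

lemma apriori2:
  assumes l: "0 \<le> l"
    and h: "\<And>s. s \<in> {0..l} \<Longrightarrow> 0 \<le> x s \<and> z s \<in> {zl..zu} \<and> w s \<in> {wl..wu} \<and> \<bar>ze s\<bar> \<le> K \<and> \<bar>om s\<bar> \<le> K \<and> x' s < 0 \<and>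
        (x has_real_derivative x' s) (at s within {0..l}) \<and>
        (z has_real_derivative x' s * (h1 (z s) (w s) * a (x s) + ze s)) (at s within {0..l}) \<and>
        (w has_real_derivative x' s * (h2 (z s) (w s) * a (x s))) (at s within {0..l}) \<and>
        (om has_real_derivative x' s * wrate (a (x s)) (z s) (w s) (ze s) (om s)) (at s within {0..l})"
    and init: "z 0 = z0 (x 0)" "w 0 = w0 (x 0)" "om 0 = om_init (x 0)"
  shows "wl < w l \<and> w l < wu \<and> \<bar>om l\<bar> < K"
proof -
  note x = h[THEN conjunct1] and bx = h[THEN conjunct2, THEN conjunct1] h[THEN conjunct2, THEN conjunct2, THEN conjunct1]
  have x': "x' s < 0" "(x has_real_derivative x' s) (at s within {0..l})" and
    zd: "(z has_real_derivative x' s * (h1 (z s) (w s) * a (x s) + ze s)) (at s within {0..l})" and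
    wd: "(w has_real_derivative x' s * (h2 (z s) (w s) * a (x s))) (at s within {0..l})" and
    omd: "(om has_real_derivative x' s * wrate (a (x s)) (z s) (w s) (ze s) (om s)) (at s within {0..l})"
    if "s \<in> {0..l}" for s using h[OF that] by auto
  have x0: "0 \<le> x 0" and lI: "l \<in> {0..l}" using x[of 0] l by auto
  have "\<bar>w l - w 0\<bar> < \<epsilon>"
    by (rule drift[OF l x x' wd]; (assumption | rule source_abs[OF bx]; assumption))
  then have wl: "wl < w l" "w l < wu" using w0_range[OF x0] init(2) by auto
  define \<phi> where "\<phi> = (\<lambda>s. Psi \<gamma> (a (x s)) (z s) (w s) (wslope (a (x s)) (z s) (w s) (om s)))"
  have "\<bar>\<phi> l\<bar> \<le> N"
  proof (rule functional_bound[OF l x x'])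
    show "(\<phi> has_real_derivative x' s * i2 (z s) (w s) * riccati \<gamma> (- lambda2 \<gamma> (z s) (w s)) (- a (x s)) (a' (x s)) (- w s) (- z s)
        (wslope (a (x s)) (z s) (w s) (om s))) (at s within {0..l})" if s: "s \<in> {0..l}" for s
      unfolding \<phi>_def
      by (rule Psi_along_characteristic[OF s conjI zd[OF s] wd[OF s] omd[OF s] a_along[OF s x x'(2)[OF s]]]) (rule bx; assumption)+
    show "i2 (z s) (w s) \<le> 0 \<and> \<bar>i2 (z s) (w s)\<bar> \<le> inverse (- wu)" if s: "s \<in> {0..l}" for s
      using speed_bounds(5)[OF bx[OF s]] lambda_neg(2)[OF bx[OF s]] by (simp add: i2_def)
    show "riccati \<gamma> (- lambda2 \<gamma> (z s) (w s)) (- a (x s)) (a' (x s)) (- w s) (- z s) (wslope (a (x s)) (z s) (w s) (om s))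
         \<le> C * ((a (x s))\<^sup>2 + \<bar>a' (x s)\<bar>)"
      "- C * ((\<phi> s)\<^sup>2 + (a (x s))\<^sup>2 + \<bar>a' (x s)\<bar>) \<le> riccati \<gamma> (- lambda2 \<gamma> (z s) (w s)) (- a (x s)) (a' (x s)) (- w s) (- z s)
         (wslope (a (x s)) (z s) (w s) (om s))" if s: "s \<in> {0..l}" for s
      using riccati_bound[of "- lambda2 \<gamma> (z s) (w s)" "- w s" "- z s" "- a (x s)"]
        box_abs[OF bx[OF s]] lambda_bounds[OF bx[OF s]] lambda_neg[OF bx[OF s]]
      unfolding \<phi>_def by (auto simp: Psi_eq_Phi)
    show "- \<delta>1 * (1 + M * x 0) powr (- 1 - \<alpha>) \<le> \<phi> 0 \<and> \<phi> 0 \<le> \<delta>2"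
      using Psi0[OF x0] by (simp add: \<phi>_def init init_slopes[OF x0])
  qed
  then have "\<bar>om l\<bar> < K" unfolding \<phi>_def by (rule om_bound[OF bx[OF lI] a_abs(2)[OF x[OF lI]]])
  then show ?thesis using wl by simp
qed

sublocale char_system i1 i2 h1 h2 i1z i1w i2z i2w h1z h1w h2z h2w a a' z0 z0' w0 w0' zl zu wl wu K
  "inverse (- zl)" "inverse (- wu)" "(\<gamma> - 1) / 2 * (wl - zu) / zl\<^sup>2" "sqrt \<kappa>1" \<kappa>2
proof (unfold_locales, goal_cases)
  case 23 then show ?case using lower_speed by simp
next
  case 24 then show ?case using \<gamma> box by simp
next
  case 25 then show ?case using speed_bounds(1-3) by simp
next
  case 30 then show ?case using data_box by simp
next
  case 31 then show ?case using data_K[of 0] by linarith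
next
  case 33 then show ?case by (rule apriori1)
next
  case 34 then show ?case by (rule apriori2)
qed (rule a_deriv a'_cont a_abs box C1_boxes lip_boxes z0_deriv w0_deriv z0'_cont w0'_cont data_K; assumption)+

end

lemma (in nozzle_problem) classical_solution: "\<exists>u v. P3_classical_solution \<gamma> a z0 w0 u v"
proof -
  obtain CH x z w X ze Y om where
    "char_picard i1 i2 h1 h2 i1z i1w i2z i2w h1z h1w h2z h2w a a' z0 z0' w0 w0' zl zu wl wu K
      (inverse (- zl)) (inverse (- wu)) ((\<gamma> - 1) / 2 * (wl - zu) / zl\<^sup>2) (sqrt \<kappa>1) \<kappa>2 CH x z w X ze Y om"
    by (rule picard_exists)
  then show ?thesis
  proof (rule char_picard.quadrant_solution, goal_cases)
    case (1 u v ux ut vx vt)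
    note c = 1(3-6) and d = 1(7,8) and bx = 1(9) and pde = 1(10,11) and init = 1(12,13)
    \<comment> \<open>Multiplying by the speed \<open>L\<close>, for which \<open>i * L = 1\<close>,
      restores the form with coefficient 1 at the time derivative.\<close>
    have gen: "L * x + (i * L) * y = (i * L) * (s * A)" if "x + i * y = s * i * A" for x y i s A L :: real
    proof -
      have "L * x + (i * L) * y = L * (x + i * y)" by (simp add: algebra_simps)
      then show ?thesis unfolding that by simp
    qed
    have "P3_classical_solution \<gamma> a z0 w0 u v"
      unfolding P3_classical_solution_def
    proof (intro conjI allI impI)
      show "C1_quadrant u" unfolding C1_quadrant_def using c(1,2) d(1) by (intro exI[of _ ux] exI[of _ ut] conjI allI impI)
      show "C1_quadrant v" unfolding C1_quadrant_def using c(3,4) d(2) by (intro exI[of _ vx] exI[of _ vt] conjI allI impI)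
      fix x t :: real assume x: "0 \<le> x"
      show "u x 0 = z0 x" "v x 0 = w0 x" by (rule init[OF x])+
      assume t: "0 \<le> t"
      note b = conjunct1[OF bx[OF x t]] conjunct2[OF bx[OF x t]]
      have "lambda1 \<gamma> (u x t) (v x t) * ux x t + (i1 (u x t) (v x t) * lambda1 \<gamma> (u x t) (v x t)) * ut x t
        = (i1 (u x t) (v x t) * lambda1 \<gamma> (u x t) (v x t)) * (src (u x t) (v x t) * a x)"
        by (rule gen[OF pde(1)[OF x t, unfolded h1_def]])
      then show "hderiv (\<lambda>s. u x s) t + lambda1 \<gamma> (u x t) (v x t) * hderiv (\<lambda>y. u y t) x
            = (\<gamma> - 1) / 8 * a x * ((v x t)\<^sup>2 - (u x t)\<^sup>2)"
        unfolding i_lambda(1)[OF b] hderiv_partials[OF d(1)[OF x t] x t] by (simp add: src_def ac_simps)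
      have "lambda2 \<gamma> (u x t) (v x t) * vx x t + (i2 (u x t) (v x t) * lambda2 \<gamma> (u x t) (v x t)) * vt x t
        = (i2 (u x t) (v x t) * lambda2 \<gamma> (u x t) (v x t)) * (- src (u x t) (v x t) * a x)"
        by (rule gen[OF pde(2)[OF x t, unfolded h2_def minus_mult_left]])
      then show "hderiv (\<lambda>s. v x s) t + lambda2 \<gamma> (u x t) (v x t) * hderiv (\<lambda>y. v y t) x
            = - ((\<gamma> - 1) / 8) * a x * ((v x t)\<^sup>2 - (u x t)\<^sup>2)"
        unfolding i_lambda(2)[OF b] hderiv_partials[OF d(2)[OF x t] x t] by (simp add: src_def ac_simps)
    qed
    then show ?case by blast
  qed
qed

section \<open>The enlarged box and the size of \<open>M0\<close>\<close>

lemma C1_halfline_deriv: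
  assumes "C1_halfline f" "0 \<le> x"
  shows "(f has_real_derivative hderiv f x) (at x within {0..})"
  using assms vector_derivative_works[of f "at x within {0..}"]
  unfolding C1_halfline_def differentiable_on_def hderiv_def has_real_derivative_iff_has_vector_derivative by auto

text \<open>For nonnegative \<open>abar\<close> the exponentials only shrink the region, so one box
  independent of x contains all of them. Should the integral not exist, its default value 0 gives
  the same conclusion.\<close>

lemma Delta_region_range:
  assumes "\<forall>y\<ge>0. 0 \<le> abar y" "L1 > 0" "L2 > 0" "U1 > 0" "U2 > 0" "(z, w) \<in> Delta_region L1 L2 U1 U2 abar x"
  shows "- L1 \<le> z" "z \<le> - U1" "- L2 \<le> w" "w \<le> - U2"
proof -
  define J where "J = integral {0..x} abar"
  have J: "0 \<le> J"
  proof (cases "abar integrable_on {0..x}")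
    case True
    then show ?thesis unfolding J_def by (rule integral_nonneg) (use assms(1) in simp)
  next
    case False
    then show ?thesis unfolding J_def by (simp add: not_integrable_integral)
  qed
  have e: "exp (- J) \<le> 1" "1 \<le> exp J" using J by auto
  have "L1 * exp (- J) \<le> L1" "L2 * exp (- J) \<le> L2" "U1 \<le> U1 * exp J" "U2 \<le> U2 * exp J"
    using mult_left_mono[OF e(1), of L1] mult_left_mono[OF e(1), of L2] mult_left_mono[OF e(2), of U1]
      mult_left_mono[OF e(2), of U2] assms(2-5) by simp_all
  moreover have "- L1 * exp (- J) \<le> z" "z \<le> - U1 * exp J" "- L2 * exp (- J) \<le> w" "w \<le> - U2 * exp J"
    using assms(6) unfolding Delta_region_def J_def by simp_all
  ultimately show "- L1 \<le> z" "z \<le> - U1" "- L2 \<le> w" "w \<le> - U2" by simp_all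
qed

theorem theorem1p3:
  fixes \<gamma> L1 L2 U1 U2 k1 k2 \<alpha> \<delta>1 \<delta>2 :: real
    and abar :: "real \<Rightarrow> real"
  assumes "1 < \<gamma>" "\<gamma> \<le> 5 / 3"
    and "L1 > 0" "L2 > 0" "U1 > 0" "U2 > 0" "k1 > 0" "k2 > 0" "\<alpha> > 0" "\<delta>1 > 0" "\<delta>2 > 0"
    and "\<delta>1 \<le> \<delta>2"
    and "C1b_halfline abar" "abar absolutely_integrable_on {0..}"
  shows "\<exists>M0>0. \<forall>M\<ge>M0. \<forall>(A :: real \<Rightarrow> real) (a :: real \<Rightarrow> real) (z0 :: real \<Rightarrow> real) (w0 :: real \<Rightarrow> real).
    C2_halfline A \<and> (\<forall>x\<ge>0. A x > 0) \<and> (\<forall>x\<ge>0. a x = hderiv A x / A x) \<and>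
    C1b_halfline a \<and>
    (\<forall>x\<ge>0. (a x)\<^sup>2 \<le> k1 * (1 + M * x) powr (- 2 - \<alpha>)) \<and>
    (\<forall>x\<ge>0. \<bar>hderiv a x\<bar> \<le> k2 * (1 + M * x) powr (- 2 - \<alpha>)) \<and>
    (\<forall>x\<ge>0. \<bar>a x\<bar> < nozzle_l \<gamma> * abar x) \<and>
    L1 \<ge> U1 * exp (2 * integral {0..} abar) \<and>
    L2 \<ge> U2 * exp (2 * integral {0..} abar) \<and>
    U1 > L2 \<and>
    L1 / (U2 * exp (2 * integral {0..} abar)) \<le> nozzle_sigma2 \<gamma> \<and>
    C1_halfline z0 \<and> C1_halfline w0 \<and>
    (\<forall>x\<ge>0. (z0 x, w0 x) \<in> Delta_region L1 L2 U1 U2 abar x) \<and>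
    (\<forall>x\<ge>0. - \<delta>1 * (1 + M * x) powr (- 1 - \<alpha>) \<le> Phi \<gamma> (a x) (z0 x) (w0 x) (hderiv z0 x) \<and>
            Phi \<gamma> (a x) (z0 x) (w0 x) (hderiv z0 x) \<le> \<delta>2) \<and>
    (\<forall>x\<ge>0. - \<delta>1 * (1 + M * x) powr (- 1 - \<alpha>) \<le> Psi \<gamma> (a x) (z0 x) (w0 x) (hderiv w0 x) \<and>
            Psi \<gamma> (a x) (z0 x) (w0 x) (hderiv w0 x) \<le> \<delta>2)
    \<longrightarrow> (\<exists>z w. P3_classical_solution \<gamma> a z0 w0 z w)"
proof (cases "U1 > L2")
  \<comment> \<open>\<open>U1 > L2\<close> is a hypothesis of the implication that does not involve
    M; if it fails, any \<open>M0\<close> will do.\<close>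
  case False
  then show ?thesis by (intro exI[of _ 1]) auto
next
  case UL: True
  \<comment> \<open>After enlarging by \<open>\<epsilon>\<close> the gap between the ranges of z and
    w is still at least half of \<open>U1 - L2\<close>, and w stays below \<open>- U2 / 2\<close>,
    so the speeds keep their sign.\<close>
  define \<epsilon> where "\<epsilon> = min ((U1 - L2) / 4) (U2 / 2)"
  have \<epsilon>: "\<epsilon> > 0" "4 * \<epsilon> \<le> U1 - L2" "2 * \<epsilon> \<le> U2" using UL assms by (auto simp: \<epsilon>_def min_def)
  define zl zu wl wu where "zl = - L1 - \<epsilon>" and "zu = - U1 + \<epsilon>" and "wl = - L2 - \<epsilon>" and "wu = - U2 + \<epsilon>"
  have y0: "wl - zu > 0" using \<epsilon> by (simp add: wl_def zu_def)
  have wu0: "- wu > 0" using \<epsilon> by (simp add: wu_def)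
  obtain C where C: "C > 0" and ric: "\<And>lam a a1 z w r. \<bar>lam\<bar> \<le> - zl \<Longrightarrow> \<bar>z\<bar> \<le> - zl \<Longrightarrow> \<bar>w\<bar> \<le> - zl \<Longrightarrow> wl - zu \<le> w - z \<Longrightarrow>
       riccati \<gamma> lam a a1 z w r \<le> C * (a\<^sup>2 + \<bar>a1\<bar>) \<and>
       - C * ((Phi \<gamma> a z w r)\<^sup>2 + a\<^sup>2 + \<bar>a1\<bar>) \<le> riccati \<gamma> lam a a1 z w r \<and>
       \<bar>r\<bar> \<le> C * (\<bar>Phi \<gamma> a z w r\<bar> + \<bar>a\<bar>)"
    by (rule riccati_bounds[OF assms(1,2) y0]) (rule that)
  define D1 D2 D3 where "D1 = C * (4 * \<delta>1\<^sup>2 + (k1 + k2)) / (- wu)" and "D2 = C * (k1 + k2) / (- wu)"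
    and "D3 = zl\<^sup>2 / (- wu) * sqrt k1"
  have D: "D1 \<ge> 0" "D2 \<ge> 0" "D3 \<ge> 0"
    unfolding D1_def D2_def D3_def using C assms
    by (intro divide_nonneg_pos[OF _ wu0] mult_nonneg_nonneg; simp)+
  define e1 e2 e3 where "e1 = 2 * \<delta>1 * (1 + \<alpha>)" and "e2 = 1 + \<alpha>" and "e3 = \<alpha> / 2 * \<epsilon>"
  have e: "e1 > 0" "e2 > 0" "e3 > 0" using assms \<epsilon> by (auto simp: e1_def e2_def e3_def)
  \<comment> \<open>Solved for M, the three inequalities of \<open>nozzle_problem\<close> read M >
    D1 / e1, M \<ge> D2 / e2 and M > D3 / e3. All these constants are fixed before M,
    \<open>a\<close> and the data.\<close>
  define M0 where "M0 = 1 + D1 / e1 + D2 / e2 + D3 / e3"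
  have De: "D1 / e1 \<ge> 0" "D2 / e2 \<ge> 0" "D3 / e3 \<ge> 0" using D e by auto
  show ?thesis
  proof (intro exI[of _ M0] conjI allI impI)
    show "M0 > 0" using De unfolding M0_def by linarith
    fix M and A a z0 w0 :: "real \<Rightarrow> real" assume M: "M0 \<le> M"
      and H: "C2_halfline A \<and> (\<forall>x\<ge>0. A x > 0) \<and> (\<forall>x\<ge>0. a x = hderiv A x / A x) \<and>
    C1b_halfline a \<and>
    (\<forall>x\<ge>0. (a x)\<^sup>2 \<le> k1 * (1 + M * x) powr (- 2 - \<alpha>)) \<and>
    (\<forall>x\<ge>0. \<bar>hderiv a x\<bar> \<le> k2 * (1 + M * x) powr (- 2 - \<alpha>)) \<and>
    (\<forall>x\<ge>0. \<bar>a x\<bar> < nozzle_l \<gamma> * abar x) \<and>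
    L1 \<ge> U1 * exp (2 * integral {0..} abar) \<and>
    L2 \<ge> U2 * exp (2 * integral {0..} abar) \<and>
    U1 > L2 \<and>
    L1 / (U2 * exp (2 * integral {0..} abar)) \<le> nozzle_sigma2 \<gamma> \<and>
    C1_halfline z0 \<and> C1_halfline w0 \<and>
    (\<forall>x\<ge>0. (z0 x, w0 x) \<in> Delta_region L1 L2 U1 U2 abar x) \<and>
    (\<forall>x\<ge>0. - \<delta>1 * (1 + M * x) powr (- 1 - \<alpha>) \<le> Phi \<gamma> (a x) (z0 x) (w0 x) (hderiv z0 x) \<and>
            Phi \<gamma> (a x) (z0 x) (w0 x) (hderiv z0 x) \<le> \<delta>2) \<and>
    (\<forall>x\<ge>0. - \<delta>1 * (1 + M * x) powr (- 1 - \<alpha>) \<le> Psi \<gamma> (a x) (z0 x) (w0 x) (hderiv w0 x) \<and>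
            Psi \<gamma> (a x) (z0 x) (w0 x) (hderiv w0 x) \<le> \<delta>2)"
    have M_gt: "0 < M" "D1 / e1 < M" "D2 / e2 \<le> M" "D3 / e3 < M" using M De unfolding M0_def by linarith+
    have a: "C1_halfline a"
      using H unfolding C1b_halfline_def by (elim conjE)
    have z0: "C1_halfline z0"
      using H by (elim conjE)
    have w0: "C1_halfline w0"
      using H by (elim conjE)
    have a_sq: "\<forall>x\<ge>0. (a x)\<^sup>2 \<le> k1 * (1 + M * x) powr (- 2 - \<alpha>)"
      using H by (elim conjE)
    have a'_bd: "\<forall>x\<ge>0. \<bar>hderiv a x\<bar> \<le> k2 * (1 + M * x) powr (- 2 - \<alpha>)"
      using H by (elim conjE)
    have a_abar: "\<forall>x\<ge>0. \<bar>a x\<bar> < nozzle_l \<gamma> * abar x"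
      using H by (elim conjE)
    have Delta: "\<forall>x\<ge>0. (z0 x, w0 x) \<in> Delta_region L1 L2 U1 U2 abar x"
      using H by (elim conjE)
    have Phi_data: "\<forall>x\<ge>0. - \<delta>1 * (1 + M * x) powr (- 1 - \<alpha>) \<le> Phi \<gamma> (a x) (z0 x) (w0 x) (hderiv z0 x) \<and>
            Phi \<gamma> (a x) (z0 x) (w0 x) (hderiv z0 x) \<le> \<delta>2"
      using H by (elim conjE)
    have Psi_data: "\<forall>x\<ge>0. - \<delta>1 * (1 + M * x) powr (- 1 - \<alpha>) \<le> Psi \<gamma> (a x) (z0 x) (w0 x) (hderiv w0 x) \<and>
            Psi \<gamma> (a x) (z0 x) (w0 x) (hderiv w0 x) \<le> \<delta>2"
      using H by (elim conjE)
    \<comment> \<open>The strict bound on \<open>\<bar>a x\<bar>\<close> forces \<open>abar\<close>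
      to be positive, as \<open>nozzle_l \<gamma>\<close> is; \<open>Delta_region_range\<close>
      relies on this sign.\<close>
    have abar0: "\<forall>x\<ge>0. 0 \<le> abar x"
    proof (intro allI impI)
      fix x :: real assume "0 \<le> x"
      have "nozzle_l \<gamma> > (3 - \<gamma>) / (\<gamma> - 1)" by (rule nozzle_l_min(1)) (use assms in auto)
      moreover have "(3 - \<gamma>) / (\<gamma> - 1) > 0" using assms by simp
      ultimately have l: "nozzle_l \<gamma> > 0" by linarith
      have "\<bar>a x\<bar> < nozzle_l \<gamma> * abar x" using a_abar \<open>0 \<le> x\<close> by simp
      then have "nozzle_l \<gamma> * abar x > 0" by linarith
      then show "0 \<le> abar x" using l by (simp add: zero_less_mult_iff)
    qed
    have rng: "- L1 \<le> z0 x" "z0 x \<le> - U1" "- L2 \<le> w0 x" "w0 x \<le> - U2" if "0 \<le> x" for x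
    proof -
      have "(z0 x, w0 x) \<in> Delta_region L1 L2 U1 U2 abar x" using Delta that by simp
      from Delta_region_range[where abar = abar, OF abar0 assms(3-6) this] show "- L1 \<le> z0 x" "z0 x \<le> - U1" "- L2 \<le> w0 x" "w0 x \<le> - U2" .
    qed
    interpret nozzle_problem \<gamma> zl zu wl wu a "hderiv a" z0 "hderiv z0" w0 "hderiv w0" \<alpha> M k1 k2 \<delta>1 \<delta>2 C \<epsilon>
    proof (unfold_locales, goal_cases)
      case 3 show ?case using rng[of 0] \<epsilon> by (simp add: zl_def zu_def)
    next
      case 4 show ?case using y0 by simp
    next
      case 5 show ?case using rng[of 0] \<epsilon> by (simp add: wl_def wu_def)
    next
      case 6 show ?case using wu0 by simp
    next
      case 14 then show ?case by (rule ric)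
    next
      case (15 x) then show ?case by (rule C1_halfline_deriv[OF a])
    next
      case 16 show ?case using a by (simp add: C1_halfline_def)
    next
      case (17 x) then show ?case by (rule a_sq[rule_format])
    next
      case (18 x) then show ?case by (rule a'_bd[rule_format])
    next
      case (19 x) then show ?case by (rule C1_halfline_deriv[OF z0])
    next
      case (20 x) then show ?case by (rule C1_halfline_deriv[OF w0])
    next
      case 21 show ?case using z0 by (simp add: C1_halfline_def)
    next
      case 22 show ?case using w0 by (simp add: C1_halfline_def)
    next
      case (23 x) then show ?case using rng[of x] by (simp add: zl_def zu_def)
    next
      case (24 x) then show ?case using rng[of x] by (simp add: wl_def wu_def)
    next
      case (25 x) then show ?case by (rule Phi_data[rule_format])
    next
      case (26 x) then show ?case by (rule Psi_data[rule_format])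
    next
      case 27 show ?case using M_gt(2) e(1) unfolding D1_def[symmetric] by (simp add: e1_def field_simps)
    next
      case 28
      have "0 < (1 + \<alpha>) * M" using M_gt(1) e(2) by (simp add: e2_def)
      moreover have "D2 \<le> (1 + \<alpha>) * M" using M_gt(3) e(2) by (simp add: e2_def pos_divide_le_eq mult.commute)
      ultimately show ?case unfolding D2_def[symmetric] by (simp only: divide_le_eq_1_pos)
    next
      case 29
      have "0 < \<alpha> / 2 * M" using M_gt(1) assms by simp
      moreover have "D3 < M * e3" using M_gt(4) pos_divide_less_eq[OF e(3)] by blast
      then have "D3 < \<epsilon> * (\<alpha> / 2 * M)" by (simp add: e3_def ac_simps)
      ultimately show ?case unfolding D3_def[symmetric] by (simp only: pos_divide_less_eq)
    qed (rule assms M_gt \<epsilon> C)+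
    show "\<exists>z w. P3_classical_solution \<gamma> a z0 w0 z w" by (rule classical_solution)
  qed
qed

end
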